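(* Let $\omega$ be a pure, split, translation invariant and $\alpha$-invariant state on $\mathcal A$ with index $\mathrm{ind}\,\omega=(0,\mathfrak q,[\upsilon])$. For each $N\in\mathbb N$ let $Q_N$ be the support projection of the density matrix of $\omega|_{\mathcal A_{[0,N-1]}}$, and assume $\sup_{N\in\mathbb N}\mathrm{rank}(Q_N)<\infty$. Then there are $m\in\mathbb N$, a faithful density matrix $D\in M_m$, a self-adjoint unitary $\vartheta\in M_m$ and matrices $\{v_\mu\}_{\mu\in\mathcal P}\subset M_m$ satisfying the following. (i) For all $x\in M_m$, $\lim_{N\to\infty}T_{\mathbf v}^N(x)=\mathrm{Tr}(Dx)\,1_{M_m}$ in norm, where $T_{\mathbf v}(x)=\sum_{\mu\in\mathcal P}v_\mu xv_\mu^*$. (ii) There is $\sigma_0\in\{0,1\}$ such that $\mathrm{Ad}_{\vartheta}(v_\mu)=(-1)^{|\mu|+\sigma_0}v_\mu$ for all $\mu\in\mathcal P$. (iii) $\mathrm{Ad}_{\vartheta}(D)=D$. (iv) For any $l\in\mathbb N\cup\{0\}$ and $\mu_0,\dots,\mu_l,\nu_0,\dots,\nu_l\in\mathcal P$, $$\omega\big(E^{(0)}_{\mu_0,\nu_0}E^{(1)}_{\mu_1,\nu_1}\cdots E^{(l)}_{\mu_l,\nu_l}\big)=(-1)^{\sum_{k=1}^l(|\mu_k|+|\nu_k|)\sum_{j=0}^{k-1}|\nu_j|}\,\mathrm{Tr}\big(Dv_{\mu_0}\cdots v_{\mu_l}v_{\nu_l}^*\cdots v_{\nu_0}^*\big).$$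 (v) There is a projective unitary/anti-unitary representation $W$ of $G$ on $\mathbb C^m$ relative to $\mathfrak p$ and, for each $g\in G$, some $c_g\in\mathbb T$ such that for all $\nu\in\mathcal P$ $$\sum_{\mu\in\mathcal P}\langle\psi_\mu,\boldsymbol\Gamma(U_g)\psi_\nu\rangle v_\mu=c_gW_gv_\nu W_g^*.$$ The second cohomology class associated to $W$ is $[\upsilon]$, and $\mathrm{Ad}_{W_g^*}(D)=D$, $\mathrm{Ad}_{W_g}(\vartheta)=(-1)^{\mathfrak q(g)}\vartheta$ for all $g\in G$.
   Context: **CAR algebra and symmetry.** Fix $d\in\mathbb N$, a finite group $G$ and a homomorphism $\mathfrak p:G\to\mathbb Z_2=\{0,1\}$ (additive). $\mathcal A$ is the CAR algebra over $l^2(\mathbb Z)\otimes\mathbb C^d$, generated by $a(f)$ (antilinear in $f$), $\{a(f_1),a(f_2)\}=0$, $\{a(f_1),a(f_2)^*\}=\langle f_1,f_2\rangle$. For $X\subset\mathbb Z$, $\mathcal A_X\subset\mathcal A$ is the CAR algebra over $l^2(X)\otimes\mathbb C^d$; $\mathcal A_R=\mathcal A_{\mathbb Z_{\ge0}}$; $\mathcal A_{[0,N-1]}$ is a full matrix algebra. For a unitary/anti-unitary $w$, $\beta_w$ is the linear/anti-linear $*$-automorphism with $\beta_w(a(f))=a(wf)$; $\Theta=\beta_{-1}$ is the parity; $\beta_{S_x}$ ($x\in\mathbb Z$) is translation by $x$, $S_x$ being the shift by $x$ on $l^2(\mathbb Z)$ tensored with $1_{\mathbb C^d}$. A projective unitary/anti-unitary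 representation of $G$ relative to $\mathfrak p$ is a family $V_g$, unitary if $\mathfrak p(g)=0$, anti-unitary if $\mathfrak p(g)=1$, with $V_gV_h=\upsilon(g,h)V_{gh}$, $\upsilon(g,h)\in U(1)$, $\upsilon(e,g)=\upsilon(g,e)=1$; then $\upsilon$ is a 2-cocycle: $\overline{\upsilon(g,h)}^{\mathfrak p(f)}\upsilon(f,gh)=\upsilon(f,g)\upsilon(fg,h)$, where $\overline z^{0}=z$, $\overline z^{1}=\overline z$. Its class modulo coboundaries $b(g)\overline{b(h)}^{\mathfrak p(g)}/b(gh)$ lies in $H^2(G,U(1)_{\mathfrak p})$. Fix such a projective representation $U$ on $\mathbb C^d$ and let $\alpha_g=\beta_{\bigoplus_{\mathbb Z}U_g}$, $g\in G$, a linear (resp. anti-linear) $*$-automorphism of $\mathcal A$ if $\mathfrak p(g)=0$ (resp. $1$). A state $\varphi$ is $\alpha$-invariant if for all $g\in G$ and all $A$: $\varphi(\alpha_g(A))=\varphi(A)$ when $\mathfrak p(g)=0$, and $\varphi(\alpha_g(A^* ))=\varphi(A)$ when $\mathfrak p(g)=1$; translation invariant if $\varphi\circ\beta_{S_x}=\varphi$ for all $x$ (then it is $\Theta$-invariant). $(\mathcal H_\varphi,\pi_\varphi,\Omega_\varphi)$ is the GNS triple; $\hat\Gamma_\varphi\pi_\varphi(A)\Omega_\varphi=\pi_\varphi(\Theta(A))\Omega_\varphi$; $\hat\alpha_\varphi$ is the extension of $\alpha|_{\mathcal A_R}$ to $\pi_\varphi(\mathcal A_R)''$. **Fock basis.**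 $\boldsymbol\Gamma(U_g)$ is the (unitary/anti-unitary) second quantization of $U_g$ on the fermionic Fock space $\mathcal F(\mathbb C^d)$. $\mathcal P$ is the power set of $\{1,\dots,d\}$ and $|\mu|=\#\mu$ mod 2. $\{\psi_\mu\}_{\mu\in\mathcal P}$ is the standard orthonormal basis of $\mathcal F(\mathbb C^d)$: $\psi_\emptyset$ is the vacuum and, for $\mu=\{\mu_1<\dots<\mu_l\}$, $\psi_\mu\propto a^*(e_{\mu_1})\cdots a^*(e_{\mu_l})\psi_\emptyset$, normalized, with $\{e_i\}$ the standard basis of $\mathbb C^d$. $E^{(0)}_{\mu,\nu}$ are the matrix units of $\mathcal A_{\{0\}}\simeq\mathcal B(\mathcal F(\mathbb C^d))$ for this basis, and $E^{(x)}_{\mu,\nu}=\beta_{S_x}(E^{(0)}_{\mu,\nu})$. $\mathrm{Ad}_Y(x)=YxY^*$. **Index.** A graded von Neumann algebra $(\mathcal M,\theta)$ is a von Neumann algebra with an involutive automorphism $\theta$; $\mathcal M^{(\sigma)}=\{x:\theta(x)=(-1)^\sigma x\}$. It is balanced if $\mathcal M^{(1)}$ contains a self-adjoint unitary, central if $Z(\mathcal M)\cap\mathcal M^{(0)}=\mathbb C1$. A graded $W^*$-$(G,\mathfrak p)$-dynamical system $(\mathcal M,\theta,\hat\alpha)$ has in addition an action $\hat\alpha$ of $G$ commuting with $\theta$, $\hat\alpha_g$ being a linear (resp. anti-linear) $*$-automorphism if $\mathfrak p(g)=0$ (resp. $1$). Two systems are equivalent if there is a $*$-isomorphism intertwining gradings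 and actions. Let $\sigma_x,\sigma_y,\sigma_z$ be the Pauli matrices, $\mathfrak C=\mathrm{span}\{1,\sigma_x\}\subset M_2$, and for a Hilbert space $\mathcal K$ let $\Gamma_{\mathcal K}=1_{\mathcal K}\otimes\sigma_z$, $\mathcal R_{0,\mathcal K}=\mathcal B(\mathcal K)\otimes M_2$, $\mathcal R_{1,\mathcal K}=\mathcal B(\mathcal K)\otimes\mathfrak C$. $\mathcal S_\kappa$ ($\kappa=0,1$) is the set of systems $(\mathcal R_{\kappa,\mathcal K},\mathrm{Ad}_{\Gamma_{\mathcal K}},\mathrm{Ad}_{V_g})$ with $V$ a projective unitary/anti-unitary representation of $G$ on $\mathcal K\otimes\mathbb C^2$ relative to $\mathfrak p$ and $\mathfrak q:G\to\mathbb Z_2$ a homomorphism with $\mathrm{Ad}_{V_g}(\Gamma_{\mathcal K})=(-1)^{\mathfrak q(g)}\Gamma_{\mathcal K}$ and, if $\kappa=1$, also $\mathrm{Ad}_{V_g}(1\otimes\sigma_x)=(-1)^{\mathfrak q(g)}1\otimes\sigma_x$. For $\kappa=1$ there is a unique projective representation $V^{(0)}$ on $\mathcal K$ with $V_g=V^{(0)}_g\otimes C^{\mathfrak p(g)}\sigma_y^{\mathfrak q(g)}$, $C$ = complex conjugation on $\mathbb C^2$. Every balanced, central, type I system is equivalent to a member of exactly one $\mathcal S_\kappa$, and $\mathrm{Ind}:=(\kappa,\mathfrak q,[\upsilon])\in\mathbb Z_2\times H^1(G,\mathbb Z_2)\times H^2(G,U(1)_{\mathfrak p})$, with $[\upsilon]$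 the class of $V$ if $\kappa=0$ and of $V^{(0)}$ if $\kappa=1$; this is well defined. A pure $\Theta$-invariant state $\varphi$ is split if $\pi_{\varphi|_{\mathcal A_R}}(\mathcal A_R)''$ is type I. For a pure, split, $\Theta$- and $\alpha$-invariant $\varphi$, $(\pi_\varphi(\mathcal A_R)'',\mathrm{Ad}_{\hat\Gamma_\varphi},\hat\alpha_\varphi)$ is a balanced, central, type I system and $\mathrm{ind}\,\varphi$ is its $\mathrm{Ind}$. *)

theory Defs
  imports
    "HOL-Analysis.Inner_Product"
    "HOL-Analysis.Product_Vector"
    "HOL-Analysis.Linear_Algebra"
    "HOL-Analysis.Infinite_Sum"
    "HOL-Library.Z2"
    "HOL-Library.Nat_Bijection"
    "HOL-Algebra.Group"
    "Jordan_Normal_Form.Matrix"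
    "Jordan_Normal_Form.Schur_Decomposition"
    "Jordan_Normal_Form.DL_Rank"
begin

section \<open>Complex Hilbert spaces and C*-algebras\<close>

class complex_vector = real_vector +
  fixes scaleC :: "complex \<Rightarrow> 'a \<Rightarrow> 'a"  (infixr \<open>*\<^sub>C\<close> 75)
  assumes scaleC_add_right: "c *\<^sub>C (x + y) = c *\<^sub>C x + c *\<^sub>C y"
    and scaleC_add_left: "(b + c) *\<^sub>C x = b *\<^sub>C x + c *\<^sub>C x"
    and scaleC_scaleC: "b *\<^sub>C c *\<^sub>C x = (b * c) *\<^sub>C x"
    and scaleC_of_real: "complex_of_real r *\<^sub>C x = r *\<^sub>R x"

text \<open>The inner product \<open>cinner\<close> is antilinear in the first argument and linear in the second.\<close>

class complex_hilbert = complex_vector + real_inner + complete_space +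
  fixes cinner :: "'a \<Rightarrow> 'a \<Rightarrow> complex"
  assumes cinner_commute: "cinner x y = cnj (cinner y x)"
    and cinner_add_right: "cinner x (y + z) = cinner x y + cinner x z"
    and cinner_scaleC_right: "cinner x (c *\<^sub>C y) = c * cinner x y"
    and Re_cinner: "Re (cinner x y) = inner x y"

class cstar_algebra = complex_vector + real_normed_algebra_1 + complete_space +
  fixes star :: "'a \<Rightarrow> 'a"
  assumes mult_scaleC_left: "(c *\<^sub>C x) * y = c *\<^sub>C (x * y)"
    and mult_scaleC_right: "x * (c *\<^sub>C y) = c *\<^sub>C (x * y)"
    and norm_scaleC: "norm (c *\<^sub>C x) = cmod c * norm x"
    and star_add: "star (x + y) = star x + star y"
    and star_scaleC: "star (c *\<^sub>C x) = cnj c *\<^sub>C star x"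
    and star_mult: "star (x * y) = star y * star x"
    and star_star: "star (star x) = x"
    and cstar_identity: "norm (star x * x) = (norm x)\<^sup>2"

instantiation prod :: (complex_vector, complex_vector) complex_vector
begin
definition scaleC_prod :: "complex \<Rightarrow> 'a \<times> 'b \<Rightarrow> 'a \<times> 'b"
  where "c *\<^sub>C z = (c *\<^sub>C fst z, c *\<^sub>C snd z)"
instance
  by standard
    (simp_all add: scaleC_prod_def scaleC_add_right scaleC_add_left scaleC_scaleC
      scaleC_of_real prod_eq_iff)
end

instantiation prod :: (complex_hilbert, complex_hilbert) complex_hilbert
begin
definition cinner_prod :: "'a \<times> 'b \<Rightarrow> 'a \<times> 'b \<Rightarrow> complex"
  where "cinner z w = cinner (fst z) (fst w) + cinner (snd z) (snd w)"
instance
proof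
  fix x y z :: "'a \<times> 'b" and c :: complex
  show "cinner x y = cnj (cinner y x)"
    unfolding cinner_prod_def complex_cnj_add
    by (metis cinner_commute)
  show "cinner x (y + z) = cinner x y + cinner x z"
    by (simp add: cinner_prod_def cinner_add_right)
  show "cinner x (c *\<^sub>C y) = c * cinner x y"
    by (simp add: cinner_prod_def scaleC_prod_def cinner_scaleC_right algebra_simps)
  show "Re (cinner x y) = inner x y"
    by (simp add: cinner_prod_def inner_prod_def Re_cinner)
qed
end


section \<open>Linear and antilinear maps; projective representations\<close>

text \<open>
  A parity \<open>s :: bit\<close> selects linear (\<open>s = 0\<close>) or antilinear (\<open>s = 1\<close>);
  \<open>cj s z\<close> is \<open>z\<close> or its conjugate, and \<open>sgn_of q\<close> is \<open>(-1)\<close> to the power \<open>q\<close>.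
\<close>

definition cj :: "bit \<Rightarrow> complex \<Rightarrow> complex"
  where "cj s z = (if s = 0 then z else cnj z)"

definition sgn_of :: "bit \<Rightarrow> complex"
  where "sgn_of q = (if q = 0 then 1 else - 1)"

definition bounded_clinear :: "('h::complex_hilbert \<Rightarrow> 'h) \<Rightarrow> bool"
  where "bounded_clinear T \<longleftrightarrow> bounded_linear T \<and> (\<forall>c x. T (c *\<^sub>C x) = c *\<^sub>C T x)"

text \<open>
  Unitaries and anti-unitaries of the complex inner product space with carrier \<open>H\<close>, scalar
  multiplication \<open>sc\<close> and inner product \<open>ip\<close>. The carrier allows the use both of whole
  Hilbert space types and of the spaces \<open>carrier_vec n\<close>.
\<close>

definition semiunitary_on ::
  "'v::plus set \<Rightarrow> (complex \<Rightarrow> 'v \<Rightarrow> 'v) \<Rightarrow> ('v \<Rightarrow> 'v \<Rightarrow> complex) \<Rightarrow> bit \<Rightarrow> ('v \<Rightarrow> 'v) \<Rightarrow> bool"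
  where "semiunitary_on H sc ip s V \<longleftrightarrow>
    V ` H = H \<and>
    (\<forall>x\<in>H. \<forall>y\<in>H. V (x + y) = V x + V y \<and> ip (V x) (V y) = cj s (ip x y)) \<and>
    (\<forall>c. \<forall>x\<in>H. V (sc c x) = sc (cj s c) (V x))"

definition Z2_hom :: "('g, 'b) monoid_scheme \<Rightarrow> ('g \<Rightarrow> bit) \<Rightarrow> bool"
  where "Z2_hom G q \<longleftrightarrow> (\<forall>g\<in>carrier G. \<forall>h\<in>carrier G. q (g \<otimes>\<^bsub>G\<^esub> h) = q g + q h)"

definition is_cocycle :: "('g, 'b) monoid_scheme \<Rightarrow> ('g \<Rightarrow> bit) \<Rightarrow> ('g \<Rightarrow> 'g \<Rightarrow> complex) \<Rightarrow> bool"
  where "is_cocycle G p \<upsilon> \<longleftrightarrow>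
    (\<forall>g\<in>carrier G. \<forall>h\<in>carrier G. cmod (\<upsilon> g h) = 1) \<and>
    (\<forall>g\<in>carrier G. \<upsilon> \<one>\<^bsub>G\<^esub> g = 1 \<and> \<upsilon> g \<one>\<^bsub>G\<^esub> = 1) \<and>
    (\<forall>f\<in>carrier G. \<forall>g\<in>carrier G. \<forall>h\<in>carrier G.
      cj (p f) (\<upsilon> g h) * \<upsilon> f (g \<otimes>\<^bsub>G\<^esub> h) = \<upsilon> f g * \<upsilon> (f \<otimes>\<^bsub>G\<^esub> g) h)"

definition cohom_class ::
  "('g, 'b) monoid_scheme \<Rightarrow> ('g \<Rightarrow> bit) \<Rightarrow> ('g \<Rightarrow> 'g \<Rightarrow> complex) \<Rightarrow> ('g \<Rightarrow> 'g \<Rightarrow> complex) set"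
  where "cohom_class G p \<upsilon> = {\<upsilon>'. is_cocycle G p \<upsilon>' \<and>
    (\<exists>b. (\<forall>g\<in>carrier G. cmod (b g) = 1) \<and>
      (\<forall>g\<in>carrier G. \<forall>h\<in>carrier G.
        \<upsilon>' g h = b g * cj (p g) (b h) / b (g \<otimes>\<^bsub>G\<^esub> h) * \<upsilon> g h))}"

definition proj_rep_on ::
  "'v::plus set \<Rightarrow> (complex \<Rightarrow> 'v \<Rightarrow> 'v) \<Rightarrow> ('v \<Rightarrow> 'v \<Rightarrow> complex) \<Rightarrow>
    ('g, 'b) monoid_scheme \<Rightarrow> ('g \<Rightarrow> bit) \<Rightarrow> ('g \<Rightarrow> 'g \<Rightarrow> complex) \<Rightarrow> ('g \<Rightarrow> 'v \<Rightarrow> 'v) \<Rightarrow> bool"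
  where "proj_rep_on H sc ip G p \<upsilon> V \<longleftrightarrow>
    (\<forall>g\<in>carrier G. semiunitary_on H sc ip (p g) (V g)) \<and>
    (\<forall>g\<in>carrier G. \<forall>h\<in>carrier G. cmod (\<upsilon> g h) = 1 \<and>
      (\<forall>x\<in>H. V g (V h x) = sc (\<upsilon> g h) (V (g \<otimes>\<^bsub>G\<^esub> h) x))) \<and>
    (\<forall>g\<in>carrier G. \<upsilon> \<one>\<^bsub>G\<^esub> g = 1 \<and> \<upsilon> g \<one>\<^bsub>G\<^esub> = 1)"

abbreviation semiunitary :: "bit \<Rightarrow> ('h::complex_hilbert \<Rightarrow> 'h) \<Rightarrow> bool"
  where "semiunitary \<equiv> semiunitary_on UNIV (*\<^sub>C) cinner"

abbreviation proj_rep ::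
  "('g, 'b) monoid_scheme \<Rightarrow> ('g \<Rightarrow> bit) \<Rightarrow> ('g \<Rightarrow> 'g \<Rightarrow> complex) \<Rightarrow>
    ('g \<Rightarrow> 'h::complex_hilbert \<Rightarrow> 'h) \<Rightarrow> bool"
  where "proj_rep \<equiv> proj_rep_on UNIV (*\<^sub>C) cinner"

text \<open>Representations on \<open>\<complex>\<close> to the power \<open>n\<close>; \<open>y \<bullet>c x\<close> is linear in \<open>y\<close> and antilinear in \<open>x\<close>.\<close>

abbreviation proj_rep_Cn ::
  "nat \<Rightarrow> ('g, 'b) monoid_scheme \<Rightarrow> ('g \<Rightarrow> bit) \<Rightarrow> ('g \<Rightarrow> 'g \<Rightarrow> complex) \<Rightarrow>
    ('g \<Rightarrow> complex Matrix.vec \<Rightarrow> complex Matrix.vec) \<Rightarrow> bool"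
  where "proj_rep_Cn n \<equiv> proj_rep_on (carrier_vec n) (\<cdot>\<^sub>v) (\<lambda>x y. y \<bullet>c x)"


section \<open>Operators and von Neumann algebras\<close>

text \<open>
  Operators on a Hilbert space type are functions, and \<open>\<circ>\<close> is their product. The library
  constant \<open>adjoint\<close> is taken with respect to \<open>inner\<close>, the real part of \<open>cinner\<close>. It is the usual
  adjoint for bounded complex-linear maps (\<open>cinner (T x) y = cinner x (adjoint T y)\<close>), and for
  bounded antilinear maps too (\<open>cinner (T x) y = cnj (cinner x (adjoint T y))\<close>).
\<close>

definition Ad :: "('h::complex_hilbert \<Rightarrow> 'h) \<Rightarrow> ('h \<Rightarrow> 'h) \<Rightarrow> 'h \<Rightarrow> 'h"
  where "Ad V T = V \<circ> T \<circ> adjoint V"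

definition commutant :: "('h::complex_hilbert \<Rightarrow> 'h) set \<Rightarrow> ('h \<Rightarrow> 'h) set"
  where "commutant M = {T. bounded_clinear T \<and> (\<forall>S\<in>M. T \<circ> S = S \<circ> T)}"

definition von_neumann_algebra :: "('h::complex_hilbert \<Rightarrow> 'h) set \<Rightarrow> bool"
  where "von_neumann_algebra M \<longleftrightarrow>
    (\<forall>T\<in>M. bounded_clinear T \<and> adjoint T \<in> M) \<and> commutant (commutant M) = M"

definition center :: "('h::complex_hilbert \<Rightarrow> 'h) set \<Rightarrow> ('h \<Rightarrow> 'h) set"
  where "center M = M \<inter> commutant M"

definition projection :: "('h::complex_hilbert \<Rightarrow> 'h) \<Rightarrow> bool"
  where "projection e \<longleftrightarrow> bounded_clinear e \<and> e \<circ> e = e \<and> adjoint e = e"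

text \<open>Type I: below every nonzero central projection there is a nonzero abelian projection.\<close>

definition abelian_projection :: "('h::complex_hilbert \<Rightarrow> 'h) set \<Rightarrow> ('h \<Rightarrow> 'h) \<Rightarrow> bool"
  where "abelian_projection M e \<longleftrightarrow> e \<in> M \<and> projection e \<and>
    (\<forall>S\<in>M. \<forall>T\<in>M. (e \<circ> S \<circ> e) \<circ> (e \<circ> T \<circ> e) = (e \<circ> T \<circ> e) \<circ> (e \<circ> S \<circ> e))"

definition type_I :: "('h::complex_hilbert \<Rightarrow> 'h) set \<Rightarrow> bool"
  where "type_I M \<longleftrightarrow> von_neumann_algebra M \<and>
    (\<forall>z\<in>center M. projection z \<and> z \<noteq> (\<lambda>_. 0) \<longrightarrow>
      (\<exists>e. abelian_projection M e \<and> e \<noteq> (\<lambda>_. 0) \<and> z \<circ> e = e))"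

definition star_iso ::
  "bit \<Rightarrow> ('h::complex_hilbert \<Rightarrow> 'h) set \<Rightarrow> ('k::complex_hilbert \<Rightarrow> 'k) set \<Rightarrow>
    (('h \<Rightarrow> 'h) \<Rightarrow> 'k \<Rightarrow> 'k) \<Rightarrow> bool"
  where "star_iso s M N \<Phi> \<longleftrightarrow> bij_betw \<Phi> M N \<and>
    (\<forall>S\<in>M. \<forall>T\<in>M. \<Phi> (\<lambda>x. S x + T x) = (\<lambda>x. \<Phi> S x + \<Phi> T x) \<and> \<Phi> (S \<circ> T) = \<Phi> S \<circ> \<Phi> T) \<and>
    (\<forall>c. \<forall>T\<in>M. \<Phi> (\<lambda>x. c *\<^sub>C T x) = (\<lambda>x. cj s c *\<^sub>C \<Phi> T x)) \<and>
    (\<forall>T\<in>M. \<Phi> (adjoint T) = adjoint (\<Phi> T))"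


section \<open>Graded W*-dynamical systems and their index\<close>

definition graded_system ::
  "('g, 'b) monoid_scheme \<Rightarrow> ('g \<Rightarrow> bit) \<Rightarrow> ('h::complex_hilbert \<Rightarrow> 'h) set \<Rightarrow>
    (('h \<Rightarrow> 'h) \<Rightarrow> 'h \<Rightarrow> 'h) \<Rightarrow> ('g \<Rightarrow> ('h \<Rightarrow> 'h) \<Rightarrow> 'h \<Rightarrow> 'h) \<Rightarrow> bool"
  where "graded_system G p M \<theta> \<alpha> \<longleftrightarrow>
    von_neumann_algebra M \<and> star_iso 0 M M \<theta> \<and> (\<forall>T\<in>M. \<theta> (\<theta> T) = T) \<and>
    (\<forall>g\<in>carrier G. star_iso (p g) M M (\<alpha> g) \<and> (\<forall>T\<in>M. \<alpha> g (\<theta> T) = \<theta> (\<alpha> g T))) \<and>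
    (\<forall>g\<in>carrier G. \<forall>h\<in>carrier G. \<forall>T\<in>M. \<alpha> g (\<alpha> h T) = \<alpha> (g \<otimes>\<^bsub>G\<^esub> h) T)"

definition balanced ::
  "('h::complex_hilbert \<Rightarrow> 'h) set \<Rightarrow> (('h \<Rightarrow> 'h) \<Rightarrow> 'h \<Rightarrow> 'h) \<Rightarrow> bool"
  where "balanced M \<theta> \<longleftrightarrow> (\<exists>u\<in>M. \<theta> u = (\<lambda>x. - u x) \<and> adjoint u = u \<and> u \<circ> u = id)"

definition central ::
  "('h::complex_hilbert \<Rightarrow> 'h) set \<Rightarrow> (('h \<Rightarrow> 'h) \<Rightarrow> 'h \<Rightarrow> 'h) \<Rightarrow> bool"
  where "central M \<theta> \<longleftrightarrow> {z \<in> center M. \<theta> z = z} = range (\<lambda>c x. c *\<^sub>C x)"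

text \<open>
  The tensor product of a Hilbert space \<open>'k\<close> with \<open>\<complex>\<close> squared is the Hilbert sum \<open>'k \<times> 'k\<close>, the pair
  \<open>(x, y)\<close> standing for \<open>x \<otimes> e\<^sub>1 + y \<otimes> e\<^sub>2\<close>. \<open>kron2 s V m\<close> is \<open>V \<otimes> C\<^sup>s m\<close>, where
  \<open>m\<close> is a matrix with entries \<open>m i j\<close>, \<open>i, j < 2\<close>, and \<open>C\<close> is complex conjugation.
\<close>

definition kron2 ::
  "bit \<Rightarrow> ('k::complex_hilbert \<Rightarrow> 'k) \<Rightarrow> (nat \<Rightarrow> nat \<Rightarrow> complex) \<Rightarrow> 'k \<times> 'k \<Rightarrow> 'k \<times> 'k"
  where "kron2 s V m = (\<lambda>(x, y).
    (cj s (m 0 0) *\<^sub>C V x + cj s (m 0 1) *\<^sub>C V y,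
     cj s (m 1 0) *\<^sub>C V x + cj s (m 1 1) *\<^sub>C V y))"

definition pauli_1 :: "nat \<Rightarrow> nat \<Rightarrow> complex"
  where "pauli_1 i j = (if i = j then 1 else 0)"

definition pauli_x :: "nat \<Rightarrow> nat \<Rightarrow> complex"
  where "pauli_x i j = (if i = j then 0 else 1)"

definition pauli_y :: "nat \<Rightarrow> nat \<Rightarrow> complex"
  where "pauli_y i j = (if i = j then 0 else if i = 0 then - \<i> else \<i>)"

definition pauli_z :: "nat \<Rightarrow> nat \<Rightarrow> complex"
  where "pauli_z i j = (if i \<noteq> j then 0 else if i = 0 then 1 else - 1)"

definition Gamma_K :: "'k::complex_hilbert \<times> 'k \<Rightarrow> 'k \<times> 'k"
  where "Gamma_K = kron2 0 id pauli_z"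

definition R_alg :: "bit \<Rightarrow> ('k::complex_hilbert \<times> 'k \<Rightarrow> 'k \<times> 'k) set"
  where "R_alg \<kappa> = (if \<kappa> = 0 then {T. bounded_clinear T}
    else {(\<lambda>z. kron2 0 A pauli_1 z + kron2 0 B pauli_x z) | A B.
            bounded_clinear A \<and> bounded_clinear B})"

text \<open>
  \<open>(R_alg \<kappa>, Ad Gamma_K, \<lambda>g. Ad (V g))\<close> is a member of \<open>\<S>\<^sub>\<kappa>\<close> with homomorphism \<open>q\<close>.
\<close>

definition S_member ::
  "('g, 'b) monoid_scheme \<Rightarrow> ('g \<Rightarrow> bit) \<Rightarrow> bit \<Rightarrow> ('g \<Rightarrow> bit) \<Rightarrow>
    ('g \<Rightarrow> 'k::complex_hilbert \<times> 'k \<Rightarrow> 'k \<times> 'k) \<Rightarrow> bool"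
  where "S_member G p \<kappa> q V \<longleftrightarrow>
    (\<exists>\<upsilon>. proj_rep G p \<upsilon> V) \<and> Z2_hom G q \<and>
    (\<forall>g\<in>carrier G. Ad (V g) Gamma_K = (\<lambda>z. sgn_of (q g) *\<^sub>C Gamma_K z)) \<and>
    (\<kappa> = 1 \<longrightarrow> (\<forall>g\<in>carrier G.
      Ad (V g) (kron2 0 id pauli_x) = (\<lambda>z. sgn_of (q g) *\<^sub>C kron2 0 id pauli_x z)))"

definition S_cocycle ::
  "('g, 'b) monoid_scheme \<Rightarrow> ('g \<Rightarrow> bit) \<Rightarrow> bit \<Rightarrow> ('g \<Rightarrow> bit) \<Rightarrow>
    ('g \<Rightarrow> 'k::complex_hilbert \<times> 'k \<Rightarrow> 'k \<times> 'k) \<Rightarrow> ('g \<Rightarrow> 'g \<Rightarrow> complex) \<Rightarrow> bool"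
  where "S_cocycle G p \<kappa> q V \<upsilon> \<longleftrightarrow> (if \<kappa> = 0 then proj_rep G p \<upsilon> V
    else (\<exists>V0. proj_rep G p \<upsilon> V0 \<and>
      (\<forall>g\<in>carrier G. V g = kron2 (p g) (V0 g) (if q g = 0 then pauli_1 else pauli_y))))"

text \<open>
  \<open>has_Ind TYPE('k) G p M \<theta> \<alpha> \<kappa> q c\<close>: the system is balanced, central and of type I, and its index
  is \<open>(\<kappa>, q, c)\<close>, as seen on a member of \<open>\<S>\<^sub>\<kappa>\<close> whose Hilbert space is \<open>'k\<close>. Quantification over
  Hilbert spaces being quantification over types, \<open>'k\<close> is a parameter; when \<open>has_Ind\<close> is
  a premise, a free \<open>'k\<close> has the force of "for some Hilbert space".
\<close>

definition has_Ind ::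
  "'k::complex_hilbert itself \<Rightarrow> ('g, 'b) monoid_scheme \<Rightarrow> ('g \<Rightarrow> bit) \<Rightarrow>
    ('h::complex_hilbert \<Rightarrow> 'h) set \<Rightarrow> (('h \<Rightarrow> 'h) \<Rightarrow> 'h \<Rightarrow> 'h) \<Rightarrow>
    ('g \<Rightarrow> ('h \<Rightarrow> 'h) \<Rightarrow> 'h \<Rightarrow> 'h) \<Rightarrow> bit \<Rightarrow> ('g \<Rightarrow> bit) \<Rightarrow> ('g \<Rightarrow> 'g \<Rightarrow> complex) set \<Rightarrow> bool"
  where "has_Ind _ G p M \<theta> \<alpha> \<kappa> q c \<longleftrightarrow>
    graded_system G p M \<theta> \<alpha> \<and> balanced M \<theta> \<and> central M \<theta> \<and> type_I M \<and>
    (\<exists>(V :: 'g \<Rightarrow> 'k \<times> 'k \<Rightarrow> 'k \<times> 'k) \<upsilon> \<Phi>.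
      S_member G p \<kappa> q V \<and> S_cocycle G p \<kappa> q V \<upsilon> \<and> c = cohom_class G p \<upsilon> \<and>
      star_iso 0 M (R_alg \<kappa>) \<Phi> \<and>
      (\<forall>T\<in>M. \<Phi> (\<theta> T) = Ad Gamma_K (\<Phi> T)) \<and>
      (\<forall>g\<in>carrier G. \<forall>T\<in>M. \<Phi> (\<alpha> g T) = Ad (V g) (\<Phi> T)))"


section \<open>The CAR algebra of the chain\<close>

text \<open>
  An element of \<open>l\<^sup>2(\<int>) \<otimes> \<complex>\<^sup>d\<close> is a square-summable map from \<open>int\<close> to \<open>carrier_vec d\<close>. The standard
  basis of \<open>\<complex>\<^sup>d\<close> is indexed by \<open>0, ..., d - 1\<close>, so \<open>\<P>\<close> is \<open>Pow {..<d}\<close>.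
\<close>

type_synonym one_particle = "int \<Rightarrow> complex Matrix.vec"

definition one_particle_space :: "nat \<Rightarrow> int set \<Rightarrow> one_particle set"
  where "one_particle_space d X = {f. (\<forall>x. f x \<in> carrier_vec d) \<and> (\<forall>x. x \<notin> X \<longrightarrow> f x = 0\<^sub>v d) \<and>
    (\<lambda>x. Re (f x \<bullet>c f x)) summable_on UNIV}"

definition one_particle_inner :: "one_particle \<Rightarrow> one_particle \<Rightarrow> complex"
  where "one_particle_inner f g = (\<Sum>\<^sub>\<infinity>x. g x \<bullet>c f x)"

inductive_set star_subalgebra :: "'a::cstar_algebra set \<Rightarrow> 'a set" for S
  where
    gen: "x \<in> S \<Longrightarrow> x \<in> star_subalgebra S"
  | unit: "1 \<in> star_subalgebra S"
  | add: "x \<in> star_subalgebra S \<Longrightarrow> y \<in> star_subalgebra S \<Longrightarrow> x + y \<in> star_subalgebra S"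
  | scale: "x \<in> star_subalgebra S \<Longrightarrow> c *\<^sub>C x \<in> star_subalgebra S"
  | mult: "x \<in> star_subalgebra S \<Longrightarrow> y \<in> star_subalgebra S \<Longrightarrow> x * y \<in> star_subalgebra S"
  | star: "x \<in> star_subalgebra S \<Longrightarrow> star x \<in> star_subalgebra S"

definition local_algebra :: "nat \<Rightarrow> (one_particle \<Rightarrow> 'a::cstar_algebra) \<Rightarrow> int set \<Rightarrow> 'a set"
  where "local_algebra d a X = closure (star_subalgebra (a ` one_particle_space d X))"

text \<open>
  The type \<open>'a\<close> with annihilation operators \<open>a\<close> is the CAR algebra. These properties determine
  \<open>('a, a)\<close> up to a unique *-isomorphism.
\<close>

definition is_CAR_algebra :: "nat \<Rightarrow> (one_particle \<Rightarrow> 'a::cstar_algebra) \<Rightarrow> bool"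
  where "is_CAR_algebra d a \<longleftrightarrow>
    (\<forall>f\<in>one_particle_space d UNIV. \<forall>g\<in>one_particle_space d UNIV.
      a (\<lambda>x. f x + g x) = a f + a g \<and>
      a f * a g + a g * a f = 0 \<and>
      a f * star (a g) + star (a g) * a f = one_particle_inner f g *\<^sub>C 1) \<and>
    (\<forall>c. \<forall>f\<in>one_particle_space d UNIV. a (\<lambda>x. c \<cdot>\<^sub>v f x) = cnj c *\<^sub>C a f) \<and>
    local_algebra d a UNIV = UNIV"

text \<open>
  \<open>\<beta>\<close> is the (anti-)linear *-automorphism \<open>\<beta>\<^sub>w\<close>; it is determined by its values on the generators.
\<close>

definition is_bogoliubov ::
  "nat \<Rightarrow> (one_particle \<Rightarrow> 'a::cstar_algebra) \<Rightarrow> bit \<Rightarrow> (one_particle \<Rightarrow> one_particle) \<Rightarrow>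
    ('a \<Rightarrow> 'a) \<Rightarrow> bool"
  where "is_bogoliubov d a s w \<beta> \<longleftrightarrow> bij \<beta> \<and>
    (\<forall>x y. \<beta> (x + y) = \<beta> x + \<beta> y \<and> \<beta> (x * y) = \<beta> x * \<beta> y) \<and>
    (\<forall>c x. \<beta> (c *\<^sub>C x) = cj s c *\<^sub>C \<beta> x) \<and> (\<forall>x. \<beta> (star x) = star (\<beta> x)) \<and>
    (\<forall>f\<in>one_particle_space d UNIV. \<beta> (a f) = a (w f))"

definition shift :: "int \<Rightarrow> one_particle \<Rightarrow> one_particle"
  where "shift x f = (\<lambda>y. f (y - x))"

definition onsite :: "(complex Matrix.vec \<Rightarrow> complex Matrix.vec) \<Rightarrow> one_particle \<Rightarrow> one_particle"
  where "onsite w f = (\<lambda>x. w (f x))"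

definition flip_sign :: "one_particle \<Rightarrow> one_particle"
  where "flip_sign f = (\<lambda>x. - f x)"


section \<open>States\<close>

definition is_state :: "('a::cstar_algebra \<Rightarrow> complex) \<Rightarrow> bool"
  where "is_state \<phi> \<longleftrightarrow> (\<forall>x y. \<phi> (x + y) = \<phi> x + \<phi> y) \<and> (\<forall>c x. \<phi> (c *\<^sub>C x) = c * \<phi> x) \<and>
    (\<forall>x. 0 \<le> \<phi> (star x * x)) \<and> \<phi> 1 = 1"

definition is_pure :: "('a::cstar_algebra \<Rightarrow> complex) \<Rightarrow> bool"
  where "is_pure \<phi> \<longleftrightarrow> is_state \<phi> \<and>
    (\<forall>\<psi> \<chi> t. is_state \<psi> \<and> is_state \<chi> \<and> 0 < t \<and> t < (1::real) \<and>
      (\<forall>x. \<phi> x = of_real t * \<psi> x + of_real (1 - t) * \<chi> x) \<longrightarrow> \<psi> = \<phi> \<and> \<chi> = \<phi>)"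

definition translation_invariant :: "(int \<Rightarrow> 'a \<Rightarrow> 'a) \<Rightarrow> ('a::cstar_algebra \<Rightarrow> complex) \<Rightarrow> bool"
  where "translation_invariant \<tau> \<phi> \<longleftrightarrow> (\<forall>x A. \<phi> (\<tau> x A) = \<phi> A)"

definition symmetry_invariant ::
  "('g, 'b) monoid_scheme \<Rightarrow> ('g \<Rightarrow> bit) \<Rightarrow> ('g \<Rightarrow> 'a \<Rightarrow> 'a) \<Rightarrow> ('a::cstar_algebra \<Rightarrow> complex) \<Rightarrow> bool"
  where "symmetry_invariant G p \<alpha> \<phi> \<longleftrightarrow> (\<forall>g\<in>carrier G. \<forall>A.
    (p g = 0 \<longrightarrow> \<phi> (\<alpha> g A) = \<phi> A) \<and> (p g = 1 \<longrightarrow> \<phi> (\<alpha> g (star A)) = \<phi> A))"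

text \<open>\<open>('h, \<pi>, \<Omega>)\<close> is a GNS triple of the restriction of \<open>\<phi>\<close> to the C*-subalgebra \<open>B\<close>.\<close>

definition is_GNS ::
  "'a::cstar_algebra set \<Rightarrow> ('a \<Rightarrow> complex) \<Rightarrow> ('a \<Rightarrow> 'h::complex_hilbert \<Rightarrow> 'h) \<Rightarrow> 'h \<Rightarrow> bool"
  where "is_GNS B \<phi> \<pi> \<Omega> \<longleftrightarrow>
    (\<forall>A\<in>B. bounded_clinear (\<pi> A) \<and> \<pi> (star A) = adjoint (\<pi> A) \<and> \<phi> A = cinner \<Omega> (\<pi> A \<Omega>)) \<and>
    (\<forall>A\<in>B. \<forall>A'\<in>B. \<pi> (A + A') = (\<lambda>x. \<pi> A x + \<pi> A' x) \<and> \<pi> (A * A') = \<pi> A \<circ> \<pi> A') \<and>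
    (\<forall>c. \<forall>A\<in>B. \<pi> (c *\<^sub>C A) = (\<lambda>x. c *\<^sub>C \<pi> A x)) \<and>
    \<pi> 1 = id \<and> closure ((\<lambda>A. \<pi> A \<Omega>) ` B) = UNIV"

abbreviation right_algebra :: "nat \<Rightarrow> (one_particle \<Rightarrow> 'a::cstar_algebra) \<Rightarrow> 'a set"
  where "right_algebra d a \<equiv> local_algebra d a {0..}"

text \<open>
  As for \<open>has_Ind\<close>, the GNS space is a type parameter. GNS triples are unique up to unitary
  equivalence, so the choice of the triple does not matter.
\<close>

definition is_split ::
  "'h::complex_hilbert itself \<Rightarrow> nat \<Rightarrow> (one_particle \<Rightarrow> 'a::cstar_algebra) \<Rightarrow>
    ('a \<Rightarrow> complex) \<Rightarrow> bool"
  where "is_split _ d a \<phi> \<longleftrightarrow> (\<exists>\<pi> (\<Omega> :: 'h). is_GNS (right_algebra d a) \<phi> \<pi> \<Omega> \<and>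
    type_I (commutant (commutant (\<pi> ` right_algebra d a))))"

text \<open>
  \<open>has_index ... \<phi> \<kappa> q c\<close>: \<open>ind \<phi> = (\<kappa>, q, c)\<close>. The extension \<open>\<alpha>h\<close> of \<open>\<alpha>\<close> is determined on the
  bicommutant, since (anti-)linear *-automorphisms of von Neumann algebras are normal.
\<close>

definition has_index ::
  "'h::complex_hilbert itself \<Rightarrow> 'k::complex_hilbert itself \<Rightarrow> nat \<Rightarrow>
    (one_particle \<Rightarrow> 'a::cstar_algebra) \<Rightarrow> ('g, 'b) monoid_scheme \<Rightarrow> ('g \<Rightarrow> bit) \<Rightarrow>
    ('a \<Rightarrow> 'a) \<Rightarrow> ('g \<Rightarrow> 'a \<Rightarrow> 'a) \<Rightarrow> ('a \<Rightarrow> complex) \<Rightarrow>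
    bit \<Rightarrow> ('g \<Rightarrow> bit) \<Rightarrow> ('g \<Rightarrow> 'g \<Rightarrow> complex) set \<Rightarrow> bool"
  where "has_index _ tk d a G p \<Theta> \<alpha> \<phi> \<kappa> q c \<longleftrightarrow>
    (\<exists>\<pi> (\<Omega> :: 'h) \<Gamma>h \<alpha>h M.
      is_GNS UNIV \<phi> \<pi> \<Omega> \<and>
      semiunitary 0 \<Gamma>h \<and> (\<forall>A. \<Gamma>h (\<pi> A \<Omega>) = \<pi> (\<Theta> A) \<Omega>) \<and>
      M = commutant (commutant (\<pi> ` right_algebra d a)) \<and>
      (\<forall>g\<in>carrier G. star_iso (p g) M M (\<alpha>h g) \<and>
        (\<forall>A\<in>right_algebra d a. \<alpha>h g (\<pi> A) = \<pi> (\<alpha> g A))) \<and>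
      has_Ind tk G p M (Ad \<Gamma>h) \<alpha>h \<kappa> q c)"


section \<open>Matrix units and local density matrices\<close>

text \<open>
  The modes of \<open>[0, N - 1]\<close> are numbered site by site: mode \<open>k < d * N\<close> is the basis vector
  \<open>k mod d\<close> at site \<open>k div d\<close>. In the Fock representation of the algebra of \<open>[0, N - 1]\<close> the
  element \<open>vacuum_proj d a N\<close>, the product of all \<open>a\<^sub>k a\<^sub>k\<^sup>*\<close>, is the projection onto the vacuum, and for a
  set \<open>S\<close> of modes \<open>creation_word d a S\<close> maps the vacuum to the basis vector \<open>\<psi>\<^sub>S\<close>. Hence
  \<open>fock_unit d a N S T\<close> is the matrix unit \<open>|\<psi>\<^sub>S\<rangle>\<langle>\<psi>\<^sub>T|\<close>. For \<open>N = 1\<close> the sets of modes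
  are the elements of \<open>Pow {..<d}\<close>.
\<close>

definition mode_annihilator :: "nat \<Rightarrow> (one_particle \<Rightarrow> 'a::cstar_algebra) \<Rightarrow> nat \<Rightarrow> 'a"
  where "mode_annihilator d a k =
    a (\<lambda>x. if x = int (k div d) then unit_vec d (k mod d) else 0\<^sub>v d)"

definition creation_word :: "nat \<Rightarrow> (one_particle \<Rightarrow> 'a::cstar_algebra) \<Rightarrow> nat set \<Rightarrow> 'a"
  where "creation_word d a S =
    prod_list (map (\<lambda>k. star (mode_annihilator d a k)) (sorted_list_of_set S))"

definition vacuum_proj :: "nat \<Rightarrow> (one_particle \<Rightarrow> 'a::cstar_algebra) \<Rightarrow> nat \<Rightarrow> 'a"
  where "vacuum_proj d a N =
    prod_list (map (\<lambda>k. mode_annihilator d a k * star (mode_annihilator d a k)) [0..<d * N])"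

definition fock_unit ::
  "nat \<Rightarrow> (one_particle \<Rightarrow> 'a::cstar_algebra) \<Rightarrow> nat \<Rightarrow> nat set \<Rightarrow> nat set \<Rightarrow> 'a"
  where "fock_unit d a N S T =
    creation_word d a S * vacuum_proj d a N * star (creation_word d a T)"

definition site_unit ::
  "nat \<Rightarrow> (one_particle \<Rightarrow> 'a::cstar_algebra) \<Rightarrow> (int \<Rightarrow> 'a \<Rightarrow> 'a) \<Rightarrow> int \<Rightarrow> nat set \<Rightarrow> nat set \<Rightarrow> 'a"
  where "site_unit d a \<tau> x \<mu> \<nu> = \<tau> x (fock_unit d a 1 \<mu> \<nu>)"

text \<open>
  The density matrix of the restriction of \<open>\<phi>\<close> to the algebra of \<open>[0, N - 1]\<close>, in the basis \<open>\<psi>\<^sub>S\<close>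
  with \<open>S\<close> enumerated by binary expansion: \<open>\<phi> (E\<^sub>S\<^sub>T) = Tr (\<rho> E\<^sub>S\<^sub>T) = \<rho>\<^sub>T\<^sub>S\<close>.
\<close>

definition local_density ::
  "nat \<Rightarrow> (one_particle \<Rightarrow> 'a::cstar_algebra) \<Rightarrow> ('a \<Rightarrow> complex) \<Rightarrow> nat \<Rightarrow> complex Matrix.mat"
  where "local_density d a \<phi> N = Matrix.mat (2 ^ (d * N)) (2 ^ (d * N))
    (\<lambda>(i, j). \<phi> (fock_unit d a N (set_decode j) (set_decode i)))"

definition is_proj_mat :: "nat \<Rightarrow> complex Matrix.mat \<Rightarrow> bool"
  where "is_proj_mat n Q \<longleftrightarrow> Q \<in> carrier_mat n n \<and> Q * Q = Q \<and> mat_adjoint Q = Q"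

text \<open>The support projection of a positive matrix is the least projection \<open>Q\<close> with \<open>Q * \<rho> = \<rho>\<close>.\<close>

definition is_support_proj :: "nat \<Rightarrow> complex Matrix.mat \<Rightarrow> complex Matrix.mat \<Rightarrow> bool"
  where "is_support_proj n \<rho> Q \<longleftrightarrow> is_proj_mat n Q \<and> Q * \<rho> = \<rho> \<and>
    (\<forall>R. is_proj_mat n R \<and> R * \<rho> = \<rho> \<longrightarrow> R * Q = Q)"


section \<open>Finite-dimensional Fock space\<close>

text \<open>
  \<open>\<F>(\<complex>\<^sup>d)\<close> consists of the functions on \<open>Pow {..<d}\<close>, and \<open>\<psi>\<^sub>\<mu>\<close> is the indicator function of \<open>\<mu>\<close>. The
  sign in \<open>fock_create\<close> is such that \<open>a\<^sup>*(e\<^bsub>\<mu>\<^sub>1\<^esub>) \<dots> a\<^sup>*(e\<^bsub>\<mu>\<^sub>l\<^esub>) \<psi>\<^bsub>{}\<^esub> = \<psi>\<^sub>\<mu>\<close> for \<open>\<mu>\<^sub>1 < \<dots> < \<mu>\<^sub>l\<close>.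
  Accordingly the second quantization \<open>\<Gamma>(w)\<close> sends \<open>\<psi>\<^sub>\<nu>\<close> to \<open>a\<^sup>*(w e\<^bsub>\<nu>\<^sub>1\<^esub>) \<dots> a\<^sup>*(w e\<^bsub>\<nu>\<^sub>l\<^esub>) \<psi>\<^bsub>{}\<^esub>\<close>.
\<close>

definition fock_basis :: "nat set \<Rightarrow> nat set \<Rightarrow> complex"
  where "fock_basis \<mu> = (\<lambda>\<rho>. if \<rho> = \<mu> then 1 else 0)"

definition fock_create :: "complex Matrix.vec \<Rightarrow> (nat set \<Rightarrow> complex) \<Rightarrow> nat set \<Rightarrow> complex"
  where "fock_create f \<phi> = (\<lambda>\<rho>. \<Sum>i\<in>\<rho>. (- 1) ^ card {j\<in>\<rho>. j < i} * vec_index f i * \<phi> (\<rho> - {i}))"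

definition fock_inner :: "nat \<Rightarrow> (nat set \<Rightarrow> complex) \<Rightarrow> (nat set \<Rightarrow> complex) \<Rightarrow> complex"
  where "fock_inner d \<phi> \<chi> = (\<Sum>\<rho>\<in>Pow {..<d}. cnj (\<phi> \<rho>) * \<chi> \<rho>)"

definition second_quant ::
  "nat \<Rightarrow> bit \<Rightarrow> (complex Matrix.vec \<Rightarrow> complex Matrix.vec) \<Rightarrow>
    (nat set \<Rightarrow> complex) \<Rightarrow> nat set \<Rightarrow> complex"
  where "second_quant d s w \<phi> = (\<lambda>\<rho>. \<Sum>\<nu>\<in>Pow {..<d}. cj s (\<phi> \<nu>) *
    foldr (\<lambda>i. fock_create (w (unit_vec d i))) (sorted_list_of_set \<nu>) (fock_basis {}) \<rho>)"


section \<open>Matrices \<close>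

definition mat_trace :: "complex Matrix.mat \<Rightarrow> complex"
  where "mat_trace A = (\<Sum>i<dim_row A. index_mat A (i, i))"

definition vec_l2norm :: "complex Matrix.vec \<Rightarrow> real"
  where "vec_l2norm x = sqrt (Re (x \<bullet>c x))"

definition mat_opnorm :: "complex Matrix.mat \<Rightarrow> real"
  where "mat_opnorm A = Sup {vec_l2norm (A *\<^sub>v x) | x. x \<in> carrier_vec (dim_col A) \<and> vec_l2norm x \<le> 1}"

definition mat_sum :: "nat \<Rightarrow> 'i set \<Rightarrow> ('i \<Rightarrow> complex Matrix.mat) \<Rightarrow> complex Matrix.mat"
  where "mat_sum m I A = Matrix.mat m m (\<lambda>(i, j). \<Sum>\<mu>\<in>I. index_mat (A \<mu>) (i, j))"

definition mat_prod :: "nat \<Rightarrow> complex Matrix.mat list \<Rightarrow> complex Matrix.mat"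
  where "mat_prod m As = foldr (*) As (1\<^sub>m m)"

definition density_matrix :: "nat \<Rightarrow> complex Matrix.mat \<Rightarrow> bool"
  where "density_matrix m D \<longleftrightarrow> D \<in> carrier_mat m m \<and> mat_adjoint D = D \<and>
    (\<forall>x\<in>carrier_vec m. 0 \<le> (D *\<^sub>v x) \<bullet>c x) \<and> mat_trace D = 1"

definition faithful_matrix :: "nat \<Rightarrow> complex Matrix.mat \<Rightarrow> bool"
  where "faithful_matrix m D \<longleftrightarrow>
    (\<forall>x\<in>carrier_mat m m. mat_trace (D * (mat_adjoint x * x)) = 0 \<longrightarrow> x = 0\<^sub>m m m)"

definition self_adjoint_unitary :: "nat \<Rightarrow> complex Matrix.mat \<Rightarrow> bool"
  where "self_adjoint_unitary m \<theta> \<longleftrightarrow> \<theta> \<in> carrier_mat m m \<and> mat_adjoint \<theta> = \<theta> \<and> \<theta> * \<theta> = 1\<^sub>m m"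

definition Ad_mat :: "complex Matrix.mat \<Rightarrow> complex Matrix.mat \<Rightarrow> complex Matrix.mat"
  where "Ad_mat Y x = Y * x * mat_adjoint Y"

definition transfer_map ::
  "nat \<Rightarrow> nat \<Rightarrow> (nat set \<Rightarrow> complex Matrix.mat) \<Rightarrow> complex Matrix.mat \<Rightarrow> complex Matrix.mat"
  where "transfer_map m d v x = mat_sum m (Pow {..<d}) (\<lambda>\<mu>. v \<mu> * x * mat_adjoint (v \<mu>))"

text \<open>
  For a (anti-)unitary \<open>W\<close> on \<open>\<complex>\<^sup>m\<close>, given as a map, \<open>W\<^sup>* = W\<^sup>-\<^sup>1\<close>, and \<open>Ad_semi m W x\<close> is the matrix
  of the operator \<open>W x W\<^sup>*\<close>, which is complex-linear in both cases.
\<close>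

definition semi_adjoint ::
  "nat \<Rightarrow> (complex Matrix.vec \<Rightarrow> complex Matrix.vec) \<Rightarrow> complex Matrix.vec \<Rightarrow> complex Matrix.vec"
  where "semi_adjoint m W = inv_into (carrier_vec m) W"

definition Ad_semi ::
  "nat \<Rightarrow> (complex Matrix.vec \<Rightarrow> complex Matrix.vec) \<Rightarrow> complex Matrix.mat \<Rightarrow> complex Matrix.mat"
  where "Ad_semi m W x =
    Matrix.mat m m (\<lambda>(i, j). vec_index (W (x *\<^sub>v semi_adjoint m W (unit_vec m j))) i)"

definition par :: "nat set \<Rightarrow> nat"
  where "par \<mu> = card \<mu> mod 2"

end

theory Submission
  imports Defs "HOL-Analysis.Elementary_Metric_Spaces" "HOL-Analysis.Function_Topology"
begin

text \<open>
  Let \<open>M\<close> be the weak closure of the right half-chain algebra in the GNS representation of \<open>\<omega>\<close>. The index provides an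
  isomorphism \<open>\<Phi>\<close> from \<open>M\<close> onto some \<open>\<B>(\<K>)\<close> under which parity and symmetry become conjugation by \<open>\<Gamma>\<close> and by
  (anti-)unitaries \<open>V\<^sub>g\<close>. Translation by one site is a *-endomorphism \<open>\<gamma>\<close> of \<open>\<B>(\<K>)\<close>. Its image and the Fock matrix units
  \<open>E\<^sub>\<mu>\<^sub>\<nu>\<close> of the site \<open>0\<close> graded-commute and together exhaust \<open>\<B>(\<K>)\<close>, so \<open>E\<^sub>\<emptyset>\<^sub>\<emptyset> \<gamma>\<close> is implemented by
  an isometry \<open>B\<^sub>0\<close>. Put \<open>B\<^sub>\<mu> = E\<^sub>\<mu>\<^sub>\<emptyset> B\<^sub>0\<close>. Then \<open>x \<mapsto> B\<^sub>\<mu> x B\<^sub>\<nu>\<^sup>*\<close> is \<open>E\<^sub>\<mu>\<^sub>\<emptyset> \<gamma>(x) E\<^sub>\<emptyset>\<^sub>\<nu>\<close>, which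
  turns correlation functions into matrix products up to the signs of the graded commutation.

  Let \<open>P\<close> be the support projection of \<open>\<omega>\<close> in \<open>M\<close>. A pure translation invariant state clusters: for even local observables
  because a cluster point of the translates dominated by \<open>\<omega>\<close> is a multiple of \<open>\<omega>\<close>, for odd ones by a Bessel inequality from
  the anticommutation relations. Hence \<open>\<langle>\<eta>, \<gamma>\<^sup>N(x) \<zeta>\<rangle> \<longlonglongrightarrow> \<langle>\<eta>, \<zeta>\<rangle> \<omega>(x)\<close> for \<open>\<zeta>\<close> in the range of \<open>P\<close>. For an even
  minimal projection \<open>x\<close> and orthonormal vectors \<open>\<xi>\<^sub>1, \<dots>, \<xi>\<^sub>r\<close> in this range the Gram matrices
  \<open>\<langle>\<xi>\<^sub>i, \<gamma>\<^sup>N(x) \<xi>\<^sub>j\<rangle>\<close> are therefore eventually invertible; but they factor through the local density matrix of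
  \<open>[0, N - 1]\<close>, so \<open>r\<close> is at most its rank. Thus \<open>P\<close> has finite rank \<open>m\<close>, and the matrices \<open>v\<^sub>\<mu> = P B\<^sub>\<mu> P\<close>, the
  compression of \<open>\<Gamma>\<close>, the density matrix \<open>D\<close> of \<open>\<omega>\<close> on the range of \<open>P\<close> and \<open>W\<^sub>g = P V\<^sub>g P\<close> have the required properties;
  the intertwining relation holds since \<open>V\<^sub>g B\<^sub>0 V\<^sub>g\<^sup>*\<close> implements the same map as \<open>B\<^sub>0\<close> and hence is a multiple of \<open>B\<^sub>0\<close>.
\<close>

section \<open>Hilbert spaces\<close>

text \<open>Two obstacles shape the argument. The algebra \<open>M\<close> is a weak closure, yet no
  weak topology appears: facts about \<open>M\<close> are deduced from commutation with
  \<open>M'\<close>, which is tested on generators. Normality of \<open>\<gamma>\<close> is avoided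
  because the identity for \<open>B\<close> is applied to finite rank operators only. Passing to
  them by \<open>P\<close> loses nothing: translation maps the half chain into itself, hence
  \<open>\<gamma>(P) \<ge> P\<close>, and \<open>P \<gamma>(x) P\<close> depends on
  \<open>P x P\<close> alone.

  The second obstacle is Fermi statistics: odd matrix units of a site do not commute with the
  translated algebra. Since the index starts with 0, the parity is implemented by a unitary inside
  \<open>M\<close>, and its translate repairs the commutation. What remains is a sign, as the
  isometry \<open>B\<^sub>0\<close> may be even or odd. Consequently the transfer map is
  \<open>\<gamma>\<close> only on even operators; on odd \<open>x\<close> its powers are, up to
  sign, \<open>\<Gamma> \<gamma>^N(\<Gamma> x)\<close>, which tends to 0 on the range of
  \<open>P\<close> because \<open>\<Gamma> x\<close> is odd as well. Convergence in norm is then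
  automatic in dimension \<open>m\<close>. Finally each \<open>V\<^sub>g\<close> commutes with
  \<open>P\<close>, so \<open>W\<close> keeps the cocycle of \<open>V\<close> itself, not only its
  class.\<close>

lemma cinner_add_left: "cinner (x + y) z = cinner x z + cinner y z"
  by (metis cinner_add_right cinner_commute complex_cnj_add)

lemma cinner_scaleC_left: "cinner (c *\<^sub>C x) y = cnj c * cinner x y"
  by (metis cinner_commute cinner_scaleC_right complex_cnj_mult)

lemma scaleC_zero_left [simp]: "0 *\<^sub>C x = 0"
  using scaleC_of_real[of 0 x] by simp

lemma scaleC_one [simp]: "1 *\<^sub>C x = x"
  using scaleC_of_real[of 1 x] by simp

lemma scaleC_zero_right [simp]: "c *\<^sub>C 0 = 0"
  using scaleC_add_right[of c 0 0] by simp

lemma scaleC_minus_left: "(- c) *\<^sub>C x = - (c *\<^sub>C x)"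
  using scaleC_add_left[of c "- c" x] by (metis add.right_inverse minus_unique scaleC_zero_left)

lemma scaleC_minus_right: "c *\<^sub>C (- x) = - (c *\<^sub>C x)"
  using scaleC_add_right[of c x "- x"] by (metis add.right_inverse minus_unique scaleC_zero_right)

lemma scaleC_diff_right: "c *\<^sub>C (x - y) = c *\<^sub>C x - c *\<^sub>C y"
  by (metis add_uminus_conv_diff scaleC_add_right scaleC_minus_right)

lemma scaleC_diff_left: "(b - c) *\<^sub>C x = b *\<^sub>C x - c *\<^sub>C x"
  by (metis add_uminus_conv_diff scaleC_add_left scaleC_minus_left)

lemma scaleC_neg_one [simp]: "(- 1) *\<^sub>C x = - x"
  by (simp add: scaleC_minus_left)

lemma scaleC_sum_right: "c *\<^sub>C (\<Sum>i\<in>I. f i) = (\<Sum>i\<in>I. c *\<^sub>C f i)"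
  by (induction I rule: infinite_finite_induct) (simp_all add: scaleC_add_right)

lemma scaleC_sum_left: "(\<Sum>i\<in>I. f i) *\<^sub>C x = (\<Sum>i\<in>I. f i *\<^sub>C x)"
  by (induction I rule: infinite_finite_induct) (simp_all add: scaleC_add_left)

lemma scaleC_eq_0_iff [simp]: "c *\<^sub>C x = 0 \<longleftrightarrow> c = 0 \<or> x = 0"
proof (cases "c = 0")
  case False
  then have "inverse c *\<^sub>C c *\<^sub>C x = x"
    by (simp add: scaleC_scaleC)
  then show ?thesis using False by (metis scaleC_zero_right)
qed simp

lemma cinner_zero_left [simp]: "cinner 0 x = 0"
  using cinner_scaleC_left[of 0 x x] by simp

lemma cinner_zero_right [simp]: "cinner x 0 = 0"
  using cinner_scaleC_right[of x 0 x] by simp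

lemma cinner_minus_left: "cinner (- x) y = - cinner x y"
  using cinner_scaleC_left[of "- 1" x y] by simp

lemma cinner_minus_right: "cinner x (- y) = - cinner x y"
  using cinner_scaleC_right[of x "- 1" y] by simp

lemma cinner_diff_left: "cinner (x - y) z = cinner x z - cinner y z"
  using cinner_add_left[of x "- y" z] by (simp add: cinner_minus_left)

lemma cinner_diff_right: "cinner x (y - z) = cinner x y - cinner x z"
  using cinner_add_right[of x y "- z"] by (simp add: cinner_minus_right)

lemma cinner_sum_left: "cinner (\<Sum>i\<in>I. f i) y = (\<Sum>i\<in>I. cinner (f i) y)"
  by (induction I rule: infinite_finite_induct) (simp_all add: cinner_add_left)

lemma cinner_sum_right: "cinner y (\<Sum>i\<in>I. f i) = (\<Sum>i\<in>I. cinner y (f i))"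
  by (induction I rule: infinite_finite_induct) (simp_all add: cinner_add_right)

lemma cinner_self: "cinner x x = complex_of_real ((norm x)\<^sup>2)"
  using cinner_commute[of x x] Re_cinner[of x x]
  by (auto simp: complex_eq_iff power2_norm_eq_inner)

lemma cinner_self_eq_0 [simp]: "cinner x x = 0 \<longleftrightarrow> x = 0"
  by (simp add: cinner_self)

lemma cinner_eq_inner: "cinner x y = Complex (inner x y) (- inner x (\<i> *\<^sub>C y))"
proof -
  have "Re (cinner x (\<i> *\<^sub>C y)) = inner x (\<i> *\<^sub>C y)"
    by (rule Re_cinner)
  then have "Im (cinner x y) = - inner x (\<i> *\<^sub>C y)"
    by (simp add: cinner_scaleC_right)
  then show ?thesis
    by (simp add: complex_eq_iff Re_cinner)
qed

lemma norm_scaleC_hilbert: "norm (c *\<^sub>C (x::'h::complex_hilbert)) = cmod c * norm x"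
proof -
  have "complex_of_real ((norm (c *\<^sub>C x))\<^sup>2) = complex_of_real ((cmod c * norm x)\<^sup>2)"
    using complex_norm_square[of c]
    by (simp only: cinner_self[symmetric] power_mult_distrib of_real_mult)
      (simp add: cinner_scaleC_left cinner_scaleC_right)
  then have "(norm (c *\<^sub>C x))\<^sup>2 = (cmod c * norm x)\<^sup>2"
    using of_real_eq_iff by blast
  then show ?thesis
    by (rule power2_eq_imp_eq) simp_all
qed

lemma cinner_Cauchy_Schwarz: "cmod (cinner x y) \<le> norm x * norm y"
proof (cases "cinner x y = 0")
  case False
  define c where "c = cnj (cinner x y) / cmod (cinner x y)"
  have c: "cmod c = 1" using False by (simp add: c_def norm_divide)
  have "cinner x (c *\<^sub>C y) = complex_of_real (cmod (cinner x y))"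
    using False complex_norm_square[of "cinner x y"]
    by (simp add: c_def cinner_scaleC_right mult.commute[of "cnj _"] power2_eq_square field_simps)
  then have "cmod (cinner x y) = inner x (c *\<^sub>C y)"
    by (metis Re_cinner Re_complex_of_real)
  also have "\<dots> \<le> norm x * norm (c *\<^sub>C y)"
    by (rule norm_cauchy_schwarz)
  finally show ?thesis by (simp add: norm_scaleC_hilbert c)
qed simp

lemma bounded_bilinear_cinner: "bounded_bilinear (cinner :: 'h::complex_hilbert \<Rightarrow> 'h \<Rightarrow> complex)"
proof
  fix x y z :: 'h and r :: real
  show "cinner (r *\<^sub>R x) y = r *\<^sub>R cinner x y" "cinner x (r *\<^sub>R y) = r *\<^sub>R cinner x y"
    by (simp_all add: scaleC_of_real[symmetric] cinner_scaleC_left cinner_scaleC_right scaleR_conv_of_real)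
  show "\<exists>K. \<forall>(x::'h) y. norm (cinner x y) \<le> norm x * norm y * K"
    using cinner_Cauchy_Schwarz by (metis mult.right_neutral)
qed (simp_all add: cinner_add_left cinner_add_right)

lemmas tendsto_cinner = bounded_bilinear.tendsto[OF bounded_bilinear_cinner]
lemmas continuous_on_cinner = bounded_bilinear.continuous_on[OF bounded_bilinear_cinner]

lemma cinner_eqI: "(\<And>x. cinner x y = cinner x z) \<Longrightarrow> y = z"
  using cinner_self_eq_0[of "y - z"] by (simp add: cinner_diff_right)

lemma eq_of_cinner_dense:
  assumes "closure S = UNIV" and "\<And>x. x \<in> S \<Longrightarrow> cinner x y = cinner x z"
  shows "y = z"
proof (rule cinner_eqI)
  fix x
  have "closed {x. cinner x y = cinner x z}"
    by (intro closed_Collect_eq continuous_on_cinner continuous_intros)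
  moreover have "S \<subseteq> {x. cinner x y = cinner x z}" using assms(2) by auto
  ultimately have "closure S \<subseteq> {x. cinner x y = cinner x z}" by (rule closure_minimal[rotated])
  then show "cinner x y = cinner x z" using assms(1) by auto
qed

section \<open>Orthogonal projection, Riesz representation and adjoints\<close>

lemma orthogonal_projection_exists:
  fixes S :: "'h::complex_hilbert set"
  assumes S: "real_vector.subspace S" "closed S"
  shows "\<exists>y\<in>S. \<forall>z\<in>S. inner (x - y) z = 0"
proof -
  have S0: "S \<noteq> {}" using S(1) real_vector.subspace_0 by blast
  define d where "d = infdist x S"
  have d_le: "d \<le> norm (x - z)" if "z \<in> S" for z
    using infdist_le[OF that, of x] by (simp add: d_def dist_norm)
  have d0: "d \<ge> 0" by (simp add: d_def infdist_nonneg)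
  have "\<exists>z\<in>S. norm (x - z) < d + 1 / Suc n" for n
  proof (rule ccontr)
    assume "\<not> ?thesis"
    then have "d + 1 / Suc n \<le> dist x z" if "z \<in> S" for z
      using that by (force simp: dist_norm)
    then have "d + 1 / Suc n \<le> infdist x S"
      using S0 by (auto simp: infdist_def intro!: cINF_greatest)
    then show False by (simp add: d_def)
  qed
  then obtain y where yS: "\<And>n. y n \<in> S" and y: "\<And>n. norm (x - y n) < d + 1 / Suc n" by metis
  have para: "(norm (y m - y n))\<^sup>2 \<le> 2 * (norm (x - y m))\<^sup>2 + 2 * (norm (x - y n))\<^sup>2 - 4 * d\<^sup>2" for m n
  proof -
    have "(1/2) *\<^sub>R (y m + y n) \<in> S"
      using S(1) yS by (simp add: real_vector.subspace_scale real_vector.subspace_add)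
    then have "d\<^sup>2 \<le> (norm (x - (1/2) *\<^sub>R (y m + y n)))\<^sup>2"
      using d_le d0 by (simp add: power_mono)
    moreover have "(norm (y m - y n))\<^sup>2 = 2 * (norm (x - y m))\<^sup>2 + 2 * (norm (x - y n))\<^sup>2
        - 4 * (norm (x - (1/2) *\<^sub>R (y m + y n)))\<^sup>2"
      by (simp add: power2_norm_eq_inner algebra_simps inner_commute)
    ultimately show ?thesis by linarith
  qed
  have lim: "(\<lambda>n. norm (x - y n)) \<longlonglongrightarrow> d"
  proof (rule tendsto_sandwich)
    show "\<forall>\<^sub>F n in sequentially. d \<le> norm (x - y n)" using d_le yS by simp
    show "\<forall>\<^sub>F n in sequentially. norm (x - y n) \<le> d + 1 / Suc n" using y less_imp_le by (intro always_eventually) blast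
    show "(\<lambda>n. d + 1 / real (Suc n)) \<longlonglongrightarrow> d"
      using tendsto_add[OF tendsto_const[of d] LIMSEQ_inverse_real_of_nat] by (simp add: field_simps inverse_eq_divide)
  qed simp
  have "Cauchy y"
  proof (rule metric_CauchyI)
    fix e :: real assume e: "e > 0"
    have "(\<lambda>n. (norm (x - y n))\<^sup>2) \<longlonglongrightarrow> d\<^sup>2" by (intro tendsto_intros lim)
    then have "\<forall>\<^sub>F n in sequentially. (norm (x - y n))\<^sup>2 < d\<^sup>2 + e\<^sup>2 / 4"
      using e by (intro order_tendstoD(2)) auto
    then obtain N where N: "\<And>n. n \<ge> N \<Longrightarrow> (norm (x - y n))\<^sup>2 < d\<^sup>2 + e\<^sup>2 / 4"
      by (auto simp: eventually_sequentially)
    show "\<exists>N. \<forall>m\<ge>N. \<forall>n\<ge>N. dist (y m) (y n) < e"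
    proof (intro exI allI impI)
      fix m n assume "m \<ge> N" "n \<ge> N"
      then have "(norm (y m - y n))\<^sup>2 < e\<^sup>2" using para[of m n] N[of m] N[of n] by linarith
      then show "dist (y m) (y n) < e" using e by (simp add: dist_norm power_less_imp_less_base)
    qed
  qed
  then obtain l where l: "y \<longlonglongrightarrow> l" using Cauchy_convergent_iff convergent_def by blast
  have lS: "l \<in> S" using S(2) yS l closed_sequentially by blast
  have nl: "norm (x - l) = d"
    using tendsto_norm[OF tendsto_diff[OF tendsto_const[of x] l]] lim LIMSEQ_unique by blast
  show ?thesis
  proof (intro bexI[OF _ lS] ballI)
    fix z assume z: "z \<in> S"
    show "inner (x - l) z = 0"
    proof (cases "z = 0")
      case False
      \<comment> \<open>The minimiser over \<open>t\<close> of the norm of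
        \<open>x - (l + t z)\<close>; a nonzero inner product would bring it below the distance
        \<open>d\<close>.\<close>
      define t where "t = inner (x - l) z / inner z z"
      have zz: "inner z z > 0" using False by simp
      have "l + t *\<^sub>R z \<in> S" using lS z S(1) by (simp add: real_vector.subspace_add real_vector.subspace_scale)
      then have "d\<^sup>2 \<le> (norm (x - (l + t *\<^sub>R z)))\<^sup>2" using d_le d0 by (simp add: power_mono)
      also have "\<dots> = (norm (x - l))\<^sup>2 - 2 * t * inner (x - l) z + t\<^sup>2 * inner z z"
        by (simp only: power2_norm_eq_inner) (simp add: algebra_simps inner_commute power2_eq_square)
      finally have "2 * t * inner (x - l) z \<le> t\<^sup>2 * inner z z" by (simp add: nl)
      then have "(inner (x - l) z)\<^sup>2 \<le> 0"
        using zz by (simp add: t_def power2_eq_square field_simps)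
      then show ?thesis by simp
    qed simp
  qed
qed

lemma riesz_representation:
  fixes f :: "'h::complex_hilbert \<Rightarrow> real"
  assumes f: "bounded_linear f"
  shows "\<exists>y. \<forall>x. f x = inner x y"
proof (cases "\<forall>x. f x = 0")
  case True
  then show ?thesis by (intro exI[of _ 0]) simp
next
  case False
  then obtain x where x: "f x \<noteq> 0" by auto
  interpret f: bounded_linear f by (rule f)
  have "real_vector.subspace {x. f x = 0}" by (auto simp: real_vector.subspace_def f.add f.scaleR f.zero)
  moreover have "closed {x. f x = 0}"
    by (intro closed_Collect_eq continuous_intros f.continuous_on)
  ultimately obtain y where y: "f y = 0" "\<And>z. f z = 0 \<Longrightarrow> inner (x - y) z = 0"
    using orthogonal_projection_exists[of "{x. f x = 0}" x] by auto
  \<comment> \<open>\<open>n\<close> is orthogonal to the kernel of \<open>f\<close>; a multiple of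
    it represents \<open>f\<close>.\<close>
  define n where "n = x - y"
  have fn: "f n \<noteq> 0" using x y(1) by (simp add: n_def f.diff)
  then have nn: "inner n n \<noteq> 0" using f.zero by auto
  show ?thesis
  proof (intro exI[of _ "(f n / inner n n) *\<^sub>R n"] allI)
    fix z
    have "f (z - (f z / f n) *\<^sub>R n) = 0" using fn by (simp add: f.diff f.scaleR)
    then have "inner n (z - (f z / f n) *\<^sub>R n) = 0" using y(2) n_def by blast
    then have "inner n z = (f z / f n) * inner n n" by (simp add: inner_diff_right)
    then show "f z = inner z ((f n / inner n n) *\<^sub>R n)"
      using fn nn by (simp add: inner_commute)
  qed
qed

text \<open>\<open>adjoint\<close> is a choice of a map with this property, so only existence has to
  be shown; the Riesz theorem gives it vector by vector.\<close>

lemma adjoint_inner: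
  fixes T :: "'h::complex_hilbert \<Rightarrow> 'h"
  assumes T: "bounded_linear T"
  shows "inner (T x) y = inner x (adjoint T y)"
proof -
  interpret T: bounded_linear T by (rule T)
  have "\<exists>z. \<forall>x. inner (T x) y = inner x z" for y
    by (rule riesz_representation) (rule bounded_linear_compose[OF bounded_linear_inner_left T])
  then obtain T' where "\<And>x y. inner (T x) y = inner x (T' y)" by metis
  then have "\<exists>f'. \<forall>x y. inner (T x) y = inner x (f' y)" by blast
  then show ?thesis unfolding adjoint_def by (rule someI2_ex) blast
qed

lemma adjoint_bounded_linear:
  fixes T :: "'h::complex_hilbert \<Rightarrow> 'h"
  assumes T: "bounded_linear T"
  shows "bounded_linear (adjoint T)"
proof -
  note adj = adjoint_inner[OF T]
  obtain K where K: "\<And>x. norm (T x) \<le> norm x * K" "K > 0"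
    using bounded_linear.pos_bounded[OF T] by blast
  show ?thesis
  proof (rule bounded_linear_intro[where K = K])
    fix x y
    show "adjoint T (x + y) = adjoint T x + adjoint T y"
      by (rule vector_eq_rdot[THEN iffD1]) (metis adj inner_add_right inner_commute)
    show "adjoint T (r *\<^sub>R x) = r *\<^sub>R adjoint T x" for r
      by (rule vector_eq_rdot[THEN iffD1]) (metis adj inner_scaleR_right inner_commute)
    have "norm (adjoint T x) * norm (adjoint T x) = inner (T (adjoint T x)) x"
      by (simp add: adj power2_norm_eq_inner[symmetric] power2_eq_square)
    also have "\<dots> \<le> norm (adjoint T x) * K * norm x"
      by (rule order.trans[OF norm_cauchy_schwarz]) (simp add: K mult_right_mono)
    finally show "norm (adjoint T x) \<le> norm x * K"
      by (cases "adjoint T x = 0") (use K(2) in \<open>simp_all add: mult_ac\<close>)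
  qed
qed

lemma adjoint_cinner:
  assumes "bounded_clinear T"
  shows "cinner (T x) y = cinner x (adjoint T y)"
proof -
  have T: "bounded_linear T" "\<And>c x. T (c *\<^sub>C x) = c *\<^sub>C T x"
    using assms by (auto simp: bounded_clinear_def)
  \<comment> \<open>Multiplication by \<open>\<i>\<close> is skew for the real inner product; this
    carries the real adjoint relation over to the imaginary part of \<open>cinner\<close>.\<close>
  have i: "inner z (\<i> *\<^sub>C w) = - inner (\<i> *\<^sub>C z) w" for z w :: 'a
    unfolding Re_cinner[symmetric] by (simp add: cinner_scaleC_left cinner_scaleC_right)
  have "inner (T x) (\<i> *\<^sub>C y) = inner x (\<i> *\<^sub>C adjoint T y)"
    unfolding i by (simp only: T(2)[symmetric] adjoint_inner[OF T(1)])
  then show ?thesis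
    by (simp add: cinner_eq_inner adjoint_inner[OF T(1)])
qed

lemma adjoint_bounded_clinear:
  assumes "bounded_clinear T"
  shows "bounded_clinear (adjoint T)"
  unfolding bounded_clinear_def
proof (intro conjI allI)
  show "bounded_linear (adjoint T)"
    using assms by (simp add: bounded_clinear_def adjoint_bounded_linear)
  show "adjoint T (c *\<^sub>C x) = c *\<^sub>C adjoint T x" for c x
    by (rule cinner_eqI)
      (metis adjoint_cinner[OF assms] cinner_scaleC_right)
qed

lemma cinner_normalized: "x \<noteq> 0 \<Longrightarrow>
    cinner ((1 / complex_of_real (norm x)) *\<^sub>C x) ((1 / complex_of_real (norm x)) *\<^sub>C x) = 1"
  by (simp add: cinner_scaleC_left cinner_scaleC_right cinner_self[of x] power2_eq_square)

section \<open>Bounded operators\<close>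

lemma bounded_clinear_intro:
  assumes "\<And>x y. T (x + y) = T x + T y" and "\<And>c x. T (c *\<^sub>C x) = c *\<^sub>C T x"
    and "\<And>x. norm (T x) \<le> norm x * K"
  shows "bounded_clinear (T :: 'h::complex_hilbert \<Rightarrow> 'h)"
proof -
  have "T (r *\<^sub>R x) = r *\<^sub>R T x" for r x
    using assms(2)[of "of_real r" x] by (simp add: scaleC_of_real)
  then show ?thesis
    unfolding bounded_clinear_def using assms by (auto intro!: bounded_linear_intro[where K = K])
qed

text \<open>Functions only compose by \<open>\<circ>\<close>; as a type of their own the bounded
  operators form a ring and a complex vector space, and ordinary algebra applies to them.
  \<open>ap\<close> and \<open>Bop\<close> translate to and from the functions of the
  statement.\<close>

typedef (overloaded) 'h bop = "{T :: 'h::complex_hilbert \<Rightarrow> 'h. bounded_clinear T}"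
  morphisms ap Bop
proof
  show "(\<lambda>x. x) \<in> {T :: 'h \<Rightarrow> 'h. bounded_clinear T}"
    by (simp add: bounded_clinear_def)
qed

lemma bounded_clinear_ap: "bounded_clinear (ap T)"
  using ap by blast

lemma bounded_linear_ap: "bounded_linear (ap T)"
  using bounded_clinear_ap by (auto simp: bounded_clinear_def)

lemma ap_Bop: "bounded_clinear T \<Longrightarrow> ap (Bop T) = T"
  by (simp add: Bop_inverse)

lemma bop_eqI: "(\<And>x. ap S x = ap T x) \<Longrightarrow> S = T"
  by (metis ap_inject ext)

lemma ap_linear:
  "ap T (x + y) = ap T x + ap T y" "ap T (x - y) = ap T x - ap T y"
  "ap T 0 = 0" "ap T (- x) = - ap T x" "ap T (c *\<^sub>C x) = c *\<^sub>C ap T x"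
proof -
  interpret bounded_linear "ap T" by (rule bounded_linear_ap)
  show "ap T (x + y) = ap T x + ap T y" "ap T (x - y) = ap T x - ap T y" "ap T 0 = 0"
    "ap T (- x) = - ap T x" by (simp_all add: add diff zero neg)
  show "ap T (c *\<^sub>C x) = c *\<^sub>C ap T x"
    using bounded_clinear_ap by (auto simp: bounded_clinear_def)
qed

lemma ap_sum: "ap T (\<Sum>i\<in>I. f i) = (\<Sum>i\<in>I. ap T (f i))"
  by (induction I rule: infinite_finite_induct) (simp_all add: ap_linear)

lemma ap_bounded: "\<exists>K>0. \<forall>x. norm (ap T x) \<le> norm x * K"
  using bounded_linear.pos_bounded[OF bounded_linear_ap] by blast

lemma continuous_on_ap: "continuous_on S f \<Longrightarrow> continuous_on S (\<lambda>x. ap T (f x))"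
  using bounded_linear_ap by (rule bounded_linear.continuous_on)

instantiation bop :: (complex_hilbert) "{complex_vector, ring, monoid_mult}"
begin

definition "0 = Bop (\<lambda>_. 0)"
definition "1 = Bop (\<lambda>x. x)"
definition "S + T = Bop (\<lambda>x. ap S x + ap T x)"
definition "S - T = Bop (\<lambda>x. ap S x - ap T x)"
definition "- T = Bop (\<lambda>x. - ap T x)"
definition "S * T = Bop (ap S \<circ> ap T)"
definition "r *\<^sub>R T = Bop (\<lambda>x. r *\<^sub>R ap T x)"
definition "c *\<^sub>C T = Bop (\<lambda>x. c *\<^sub>C ap T x)"

lemma ap_zero [simp]: "ap 0 x = 0"
  unfolding zero_bop_def by (subst ap_Bop) (auto intro!: bounded_clinear_intro[where K = 0])

lemma ap_one [simp]: "ap 1 x = x"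
  unfolding one_bop_def by (subst ap_Bop) (auto intro!: bounded_clinear_intro[where K = 1])

lemma ap_add: "ap (S + T) x = ap S x + ap T x"
proof -
  have "bounded_clinear (\<lambda>x. ap S x + ap T x)"
    unfolding bounded_clinear_def
    by (simp add: ap_linear scaleC_add_right bounded_linear_add bounded_linear_ap)
  then show ?thesis by (simp add: plus_bop_def ap_Bop)
qed

lemma ap_diff: "ap (S - T) x = ap S x - ap T x"
proof -
  have "bounded_clinear (\<lambda>x. ap S x - ap T x)"
    unfolding bounded_clinear_def
    by (simp add: ap_linear scaleC_diff_right bounded_linear_sub bounded_linear_ap)
  then show ?thesis by (simp add: minus_bop_def ap_Bop)
qed

lemma ap_minus: "ap (- T) x = - ap T x"
proof -
  have "bounded_clinear (\<lambda>x. - ap T x)"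
    unfolding bounded_clinear_def
    by (simp add: ap_linear scaleC_minus_right bounded_linear_minus bounded_linear_ap)
  then show ?thesis by (simp add: uminus_bop_def ap_Bop)
qed

lemma ap_mult: "ap (S * T) x = ap S (ap T x)"
proof -
  have "bounded_clinear (ap S \<circ> ap T)"
    unfolding bounded_clinear_def comp_def
    by (simp add: ap_linear bounded_linear_compose bounded_linear_ap)
  then show ?thesis by (simp add: times_bop_def ap_Bop)
qed

lemma ap_scaleC: "ap (c *\<^sub>C T) x = c *\<^sub>C ap T x"
proof -
  obtain K where K: "\<And>x. norm (ap T x) \<le> norm x * K" using ap_bounded by blast
  have "norm (c *\<^sub>C ap T x) \<le> norm x * (cmod c * K)" for x
    using mult_left_mono[OF K[of x], of "cmod c"] by (simp add: norm_scaleC_hilbert mult_ac)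
  then have "bounded_clinear (\<lambda>x. c *\<^sub>C ap T x)"
    by (intro bounded_clinear_intro[where K = "cmod c * K"])
      (simp_all add: ap_linear scaleC_add_right scaleC_scaleC mult.commute)
  then show ?thesis by (simp add: scaleC_bop_def ap_Bop)
qed

lemma scaleR_bop_scaleC: "r *\<^sub>R T = complex_of_real r *\<^sub>C (T :: 'a bop)"
  by (simp add: scaleR_bop_def scaleC_bop_def scaleC_of_real)

instance
proof
  fix S T R :: "'a bop" and b c :: complex and r s :: real
  note simps = ap_add ap_diff ap_minus ap_mult ap_scaleC scaleR_bop_scaleC ap_linear
    scaleC_add_right scaleC_add_left scaleC_scaleC algebra_simps
  show "S + T + R = S + (T + R)" "S + T = T + S" "0 + S = S" "- S + S = 0" "S - T = S + - T"
    "S * T * R = S * (T * R)" "(S + T) * R = S * R + T * R" "S * (T + R) = S * T + S * R"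
    "1 * S = S" "S * 1 = S"
    "c *\<^sub>C (S + T) = c *\<^sub>C S + c *\<^sub>C T" "(b + c) *\<^sub>C S = b *\<^sub>C S + c *\<^sub>C S"
    "b *\<^sub>C c *\<^sub>C S = (b * c) *\<^sub>C S" "complex_of_real r *\<^sub>C S = r *\<^sub>R S"
    "r *\<^sub>R (S + T) = r *\<^sub>R S + r *\<^sub>R T" "(r + s) *\<^sub>R S = r *\<^sub>R S + s *\<^sub>R S"
    "r *\<^sub>R s *\<^sub>R S = (r * s) *\<^sub>R S" "1 *\<^sub>R S = S"
    by (rule bop_eqI; simp add: simps)+
qed

end

lemma ap_bop_sum: "ap (\<Sum>i\<in>I. T i) x = (\<Sum>i\<in>I. ap (T i) x)"
  by (induction I rule: infinite_finite_induct) (simp_all add: ap_add)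

lemmas ap_simps = ap_add ap_diff ap_minus ap_mult ap_scaleC ap_bop_sum

lemma bop_scaleC_mult [simp]:
  "(c *\<^sub>C S) * T = c *\<^sub>C (S * T)" "S * (c *\<^sub>C T) = c *\<^sub>C (S * (T :: 'h::complex_hilbert bop))"
  by (rule bop_eqI; simp add: ap_simps ap_linear)+

definition adj :: "'h::complex_hilbert bop \<Rightarrow> 'h bop"
  where "adj T = Bop (adjoint (ap T))"

lemma ap_adj: "ap (adj T) = adjoint (ap T)"
  unfolding adj_def by (rule ap_Bop) (rule adjoint_bounded_clinear[OF bounded_clinear_ap])

lemma cinner_adj: "cinner (ap T x) y = cinner x (ap (adj T) y)"
  unfolding ap_adj by (rule adjoint_cinner[OF bounded_clinear_ap])

lemma cinner_adj': "cinner (ap (adj T) x) y = cinner x (ap T y)"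
  by (metis cinner_adj cinner_commute)

lemma adj_eqI: "(\<And>x y. cinner (ap T x) y = cinner x (ap S y)) \<Longrightarrow> adj T = S"
  by (rule bop_eqI) (metis cinner_adj cinner_eqI)

lemma adj_simps [simp]:
  "adj (adj T) = T" "adj (S * T) = adj T * adj S" "adj (S + T) = adj S + adj T"
  "adj (S - T) = adj S - adj T" "adj (- T) = - adj T" "adj 0 = 0" "adj 1 = 1"
  "adj (c *\<^sub>C T) = cnj c *\<^sub>C adj T"
  by (rule adj_eqI; simp add: ap_simps cinner_adj' cinner_adj[of T] cinner_adj[of S] cinner_add_left
      cinner_add_right cinner_diff_left cinner_diff_right cinner_minus_left cinner_minus_right
      cinner_scaleC_left cinner_scaleC_right)+

lemma adj_sum: "adj (\<Sum>i\<in>I. f i) = (\<Sum>i\<in>I. adj (f i))"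
  by (induction I rule: infinite_finite_induct) simp_all

section \<open>Rank-one operators\<close>

definition rank1 :: "'h::complex_hilbert \<Rightarrow> 'h \<Rightarrow> 'h bop"
  where "rank1 x y = Bop (\<lambda>z. cinner y z *\<^sub>C x)"

lemma ap_rank1: "ap (rank1 x y) z = cinner y z *\<^sub>C x"
proof -
  have "bounded_clinear (\<lambda>z. cinner y z *\<^sub>C x)"
    by (rule bounded_clinear_intro[where K = "norm y * norm x"])
      (simp_all add: cinner_add_right scaleC_add_left cinner_scaleC_right scaleC_scaleC
        norm_scaleC_hilbert mult_right_mono cinner_Cauchy_Schwarz mult.assoc[symmetric] mult.commute[of "norm _" "norm y"])
  then show ?thesis by (simp add: rank1_def ap_Bop)
qed

lemma rank1_mult:
  "T * rank1 x y = rank1 (ap T x) y" "rank1 x y * T = rank1 x (ap (adj T) y)"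
  by (rule bop_eqI; simp add: ap_simps ap_rank1 ap_linear cinner_adj')+

lemma adj_rank1 [simp]: "adj (rank1 x y) = rank1 y x"
  by (rule adj_eqI)
    (simp add: ap_rank1 cinner_scaleC_left cinner_scaleC_right cinner_commute[symmetric] mult.commute)

lemma rank1_linear:
  "rank1 (x + z) y = rank1 x y + rank1 z y" "rank1 (c *\<^sub>C x) y = c *\<^sub>C rank1 x y"
  "rank1 x (y + z) = rank1 x y + rank1 x z" "rank1 x (c *\<^sub>C y) = cnj c *\<^sub>C rank1 x y"
  "rank1 0 y = 0" "rank1 x 0 = 0"
  by (rule bop_eqI; simp add: ap_rank1 ap_simps scaleC_add_right scaleC_add_left scaleC_scaleC
      cinner_add_left cinner_scaleC_left mult.commute)+

lemma rank1_sum_left: "rank1 (\<Sum>i\<in>I. f i) y = (\<Sum>i\<in>I. rank1 (f i) y)"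
  by (induction I rule: infinite_finite_induct) (simp_all add: rank1_linear)

lemma rank1_sum_right: "rank1 x (\<Sum>i\<in>I. f i) = (\<Sum>i\<in>I. rank1 x (f i))"
  by (induction I rule: infinite_finite_induct) (simp_all add: rank1_linear)

lemma rank1_rank1: "rank1 x y * rank1 z w = cinner y z *\<^sub>C rank1 x w"
  by (simp add: rank1_mult ap_rank1 rank1_linear)

lemma commutes_with_rank1_scalar:
  assumes "\<And>x y. T * rank1 x y = rank1 x y * T"
  shows "\<exists>c. T = c *\<^sub>C 1"
proof (cases "\<exists>y :: 'a. y \<noteq> 0")
  case True
  then obtain y :: 'a where y: "y \<noteq> 0" by blast
  have "T = (cinner y (ap T y) / cinner y y) *\<^sub>C 1"
  proof (rule bop_eqI)
    fix x
    \<comment> \<open>Evaluated at \<open>y\<close> itself, the commutation relation exhibits the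
      scalar.\<close>
    have "ap (T * rank1 x y) y = ap (rank1 x y * T) y" by (simp add: assms)
    then have eq: "cinner y y *\<^sub>C ap T x = cinner y (ap T y) *\<^sub>C x"
      by (simp add: ap_simps ap_rank1 ap_linear)
    have "ap T x = (1 / cinner y y) *\<^sub>C cinner y y *\<^sub>C ap T x"
      using y by (simp add: scaleC_scaleC)
    also have "\<dots> = (cinner y (ap T y) / cinner y y) *\<^sub>C x"
      unfolding eq by (simp add: scaleC_scaleC)
    finally show "ap T x = ap ((cinner y (ap T y) / cinner y y) *\<^sub>C 1) x"
      by (simp add: ap_simps)
  qed
  then show ?thesis by blast
next
  case False
  \<comment> \<open>The zero space is a Hilbert space here; on it all operators coincide.\<close>
  then show ?thesis by (metis bop_eqI)
qed

section \<open>Algebraic star homomorphisms and their intertwiners\<close>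

definition star_hom :: "('h::complex_hilbert bop \<Rightarrow> 'k::complex_hilbert bop) \<Rightarrow> bool"
  where "star_hom \<sigma> \<longleftrightarrow> (\<forall>S T. \<sigma> (S + T) = \<sigma> S + \<sigma> T \<and> \<sigma> (S * T) = \<sigma> S * \<sigma> T) \<and>
    (\<forall>c T. \<sigma> (c *\<^sub>C T) = c *\<^sub>C \<sigma> T) \<and> (\<forall>T. \<sigma> (adj T) = adj (\<sigma> T)) \<and> \<sigma> 1 = 1"

lemma star_homD:
  assumes "star_hom \<sigma>"
  shows "\<sigma> (S + T) = \<sigma> S + \<sigma> T" "\<sigma> (S * T) = \<sigma> S * \<sigma> T" "\<sigma> (c *\<^sub>C T) = c *\<^sub>C \<sigma> T"
    "\<sigma> (adj T) = adj (\<sigma> T)" "\<sigma> 1 = 1" "\<sigma> 0 = 0" "\<sigma> (- T) = - \<sigma> T" "\<sigma> (S - T) = \<sigma> S - \<sigma> T"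
proof -
  show *: "\<sigma> (S + T) = \<sigma> S + \<sigma> T" "\<sigma> (S * T) = \<sigma> S * \<sigma> T" "\<sigma> (c *\<^sub>C T) = c *\<^sub>C \<sigma> T"
    "\<sigma> (adj T) = adj (\<sigma> T)" "\<sigma> 1 = 1" for S T c
    using assms by (auto simp: star_hom_def)
  show "\<sigma> 0 = 0" using *(3)[of 0 0] by simp
  show m: "\<sigma> (- T) = - \<sigma> T" for T using *(3)[of "- 1" T] by simp
  show "\<sigma> (S - T) = \<sigma> S - \<sigma> T" using *(1)[of S "- T"] m[of T] by simp
qed

lemma star_hom_sum: "star_hom \<sigma> \<Longrightarrow> \<sigma> (\<Sum>i\<in>I. f i) = (\<Sum>i\<in>I. \<sigma> (f i))"
  by (induction I rule: infinite_finite_induct) (simp_all add: star_homD)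

text \<open>
  The intertwiner by which one proves that automorphisms of \<open>\<B>(\<K>)\<close> are inner. For an endomorphism
  it depends on the vector \<open>\<zeta>\<close> in the range of the image of a minimal projection.
\<close>

lemma star_hom_intertwiner:
  fixes \<sigma> :: "'k::complex_hilbert bop \<Rightarrow> 'k bop"
  assumes \<sigma>: "star_hom \<sigma>" and \<xi>: "cinner \<xi> \<xi> = 1" and \<zeta>: "cinner \<zeta> \<zeta> = 1" "ap (\<sigma> (rank1 \<xi> \<xi>)) \<zeta> = \<zeta>"
  obtains t where "\<And>\<eta>. ap t \<eta> = ap (\<sigma> (rank1 \<eta> \<xi>)) \<zeta>" "adj t * t = 1" "\<And>x. \<sigma> x * t = t * x"
proof -
  let ?f = "\<lambda>\<eta>. ap (\<sigma> (rank1 \<eta> \<xi>)) \<zeta>"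
  note \<sigma>s = star_homD[OF \<sigma>]
  have iso: "cinner (?f x) (?f y) = cinner x y" for x y
  proof -
    have "cinner (?f x) (?f y) = cinner \<zeta> (ap (\<sigma> (rank1 \<xi> x * rank1 y \<xi>)) \<zeta>)"
      by (simp add: cinner_adj \<sigma>s(2,4)[symmetric] ap_mult[symmetric])
    then show ?thesis by (simp add: rank1_rank1 \<sigma>s ap_simps \<zeta> cinner_scaleC_right)
  qed
  have nrm: "norm (?f x) = norm x" for x
    using iso[of x x] by (simp add: cinner_self flip: of_real_power)
  have bc: "bounded_clinear ?f"
    by (rule bounded_clinear_intro[where K = 1]) (simp_all add: rank1_linear \<sigma>s ap_simps nrm)
  define t where "t = Bop ?f"
  have t: "ap t \<eta> = ?f \<eta>" for \<eta> by (simp add: t_def ap_Bop[OF bc])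
  have "adj t * t = 1"
    by (rule bop_eqI, rule cinner_eqI) (simp add: ap_simps cinner_adj[symmetric] t iso)
  moreover have "\<sigma> x * t = t * x" for x
    by (rule bop_eqI) (simp add: ap_mult t \<sigma>s(2) flip: rank1_mult(1))
  ultimately show thesis using that t by blast
qed

text \<open>The intertwiner \<open>t\<close> with \<open>\<sigma> x * t = t * x\<close> commutes
  with the elements of \<open>S\<close>, because \<open>\<sigma>\<close> fixes them, so it is a
  scalar by irreducibility; an isometry on a nonzero space is not 0, and the scalar cancels.
  Injectivity makes the image of a minimal projection nonzero, which supplies the vector
  \<open>\<zeta>\<close> needed to build \<open>t\<close>.\<close>

lemma star_automorphism_trivial:
  fixes \<sigma> :: "'k::complex_hilbert bop \<Rightarrow> 'k bop"
  assumes \<sigma>: "star_hom \<sigma>" "inj \<sigma>"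
    and irr: "\<And>t. (\<And>x. x \<in> S \<Longrightarrow> t * x = x * t) \<Longrightarrow> \<exists>c. t = c *\<^sub>C 1"
    and fixed: "\<And>x. x \<in> S \<Longrightarrow> \<sigma> x = x"
  shows "\<sigma> x = x"
proof (cases "\<exists>y :: 'k. y \<noteq> 0")
  case True
  then obtain y :: 'k where y: "y \<noteq> 0" by blast
  define \<xi> where "\<xi> = (1 / complex_of_real (norm y)) *\<^sub>C y"
  have \<xi>: "cinner \<xi> \<xi> = 1" unfolding \<xi>_def by (rule cinner_normalized[OF y])
  note \<sigma>s = star_homD[OF \<sigma>(1)]
  let ?e = "rank1 \<xi> \<xi>"
  have "ap ?e \<xi> = \<xi>" by (simp add: ap_rank1 \<xi>)
  then have "?e \<noteq> 0" using \<xi> by auto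
  then have "\<sigma> ?e \<noteq> 0" using \<sigma>(2) \<sigma>s(6) by (metis injD)
  then obtain z where z: "ap (\<sigma> ?e) z \<noteq> 0" by (metis ap_zero bop_eqI)
  define \<zeta> where "\<zeta> = (1 / complex_of_real (norm (ap (\<sigma> ?e) z))) *\<^sub>C ap (\<sigma> ?e) z"
  have \<zeta>1: "cinner \<zeta> \<zeta> = 1" unfolding \<zeta>_def by (rule cinner_normalized[OF z])
  have "?e * ?e = ?e" by (simp add: rank1_rank1 \<xi>)
  then have \<zeta>2: "ap (\<sigma> ?e) \<zeta> = \<zeta>"
    unfolding \<zeta>_def ap_linear by (metis \<sigma>s(2) ap_mult)
  obtain t where t: "adj t * t = 1" "\<And>x. \<sigma> x * t = t * x"
    using star_hom_intertwiner[OF \<sigma>(1) \<xi> \<zeta>1 \<zeta>2] by metis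
  have "t * x = x * t" if "x \<in> S" for x using t(2)[of x] fixed[OF that] by simp
  then obtain c where c: "t = c *\<^sub>C 1" using irr by blast
  have "c \<noteq> 0"
  proof
    assume "c = 0"
    then have "(1 :: 'k bop) = 0" using t(1) c by simp
    then show False using y by (metis ap_one ap_zero)
  qed
  then show ?thesis using t(2)[of x] unfolding c
    by simp (metis (no_types) scaleC_scaleC right_inverse scaleC_one mult.commute)
next
  case False
  then show ?thesis by (metis bop_eqI)
qed

section \<open>Conjugation by unitaries and anti-unitaries\<close>

lemma cj_simps [simp]: "cj s (cj s c) = c" "cj s 1 = 1" "cj s 0 = 0" "cj s (x + y) = cj s x + cj s y"
  "cj s (x * y) = cj s x * cj s y" "cmod (cj s x) = cmod x" "cj s (cnj x) = cnj (cj s x)" "cj s (- x) = - cj s x"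
  "cj 0 x = x" "cj s (of_real r) = of_real r"
  by (simp_all add: cj_def)

locale semiunitary_map =
  fixes s :: bit and V :: "'h::complex_hilbert \<Rightarrow> 'h"
  assumes semiunitary: "semiunitary s V"
begin

lemma surj: "surj V" and add: "V (x + y) = V x + V y" and scaleC: "V (c *\<^sub>C x) = cj s c *\<^sub>C V x"
  and cinner: "cinner (V x) (V y) = cj s (cinner x y)"
  using semiunitary by (auto simp: semiunitary_on_def)

lemma norm: "norm (V x) = norm x"
  using cinner[of x x] by (simp add: cinner_self flip: of_real_power)

lemma zero: "V 0 = 0" using scaleC[of 0 0] by simp

lemma minus: "V (- x) = - V x" using scaleC[of "- 1" x] by simp

lemma diff: "V (x - y) = V x - V y" using add[of x "- y"] minus by simp

lemma inj: "inj V"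
proof (rule injI)
  fix x y assume "V x = V y"
  then show "x = y" using norm[of "x - y"] by (simp add: diff)
qed

lemma inv_right: "V (inv_into UNIV V x) = x" using surj by (simp add: surj_f_inv_f)
lemma inv_left: "inv_into UNIV V (V x) = x" using inj by simp

lemma inv_semiunitary: "semiunitary s (inv_into UNIV V)"
proof -
  have 1: "inv_into UNIV V (x + y) = inv_into UNIV V x + inv_into UNIV V y" for x y
    by (rule injD[OF inj]) (simp add: add inv_right)
  have 2: "inv_into UNIV V (c *\<^sub>C x) = cj s c *\<^sub>C inv_into UNIV V x" for c x
    by (rule injD[OF inj]) (simp add: scaleC inv_right)
  have 3: "cinner (inv_into UNIV V x) (inv_into UNIV V y) = cj s (cinner x y)" for x y
    using cinner[of "inv_into UNIV V x" "inv_into UNIV V y"] by (simp add: inv_right)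
  have "inv_into UNIV V ` UNIV = UNIV" using inj by (simp add: inj_imp_surj_inv)
  then show ?thesis using 1 2 3 by (simp add: semiunitary_on_def)
qed

lemma inner: "inner (V x) (V y) = inner x y"
  using cinner[of x y] by (simp add: cj_def Re_cinner[symmetric] split: if_splits)

text \<open>\<open>adjoint\<close> refers to the real inner product, which anti-unitaries preserve
  as well as unitaries.\<close>

lemma adjoint_eq: "adjoint V = inv_into UNIV V"
  by (rule adjoint_unique) (metis inner inv_right)

text \<open>The conjugate of a linear operator is linear even for anti-unitary \<open>V\<close>;
  anti-linearity shows only in its dependence on \<open>T\<close>, through
  \<open>cj s\<close>.\<close>

definition conj_by :: "'h bop \<Rightarrow> 'h bop"
  where "conj_by T = Bop (V \<circ> ap T \<circ> inv_into UNIV V)"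

lemma ap_conj_by: "ap (conj_by T) x = V (ap T (inv_into UNIV V x))"
proof -
  interpret i: semiunitary_map s "inv_into UNIV V" by standard (rule inv_semiunitary)
  obtain K where "\<And>x. norm (ap T x) \<le> norm x * K" using ap_bounded by blast
  then have "bounded_clinear (V \<circ> ap T \<circ> inv_into UNIV V)"
    by (intro bounded_clinear_intro[where K = K])
      (simp_all add: add scaleC i.add i.scaleC norm ap_linear, metis i.norm)
  then show ?thesis by (simp add: conj_by_def ap_Bop)
qed

lemma ap_conj_by_V: "ap (conj_by T) (V x) = V (ap T x)"
  by (simp add: ap_conj_by inv_left)

lemma Ad_eq: "Ad V (ap T) = ap (conj_by T)"
  by (rule ext) (simp add: Ad_def adjoint_eq ap_conj_by)

lemma conj_by_simps:
  "conj_by (S + T) = conj_by S + conj_by T" "conj_by (S * T) = conj_by S * conj_by T"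
  "conj_by (c *\<^sub>C T) = cj s c *\<^sub>C conj_by T" "conj_by (adj T) = adj (conj_by T)" "conj_by 1 = 1"
  "conj_by (rank1 x y) = rank1 (V x) (V y)" "conj_by 0 = 0" "conj_by (- T) = - conj_by T"
  "conj_by (S - T) = conj_by S - conj_by T"
proof -
  show "conj_by (S + T) = conj_by S + conj_by T" "conj_by (S * T) = conj_by S * conj_by T"
    "conj_by (c *\<^sub>C T) = cj s c *\<^sub>C conj_by T" "conj_by 1 = 1" "conj_by 0 = 0" "conj_by (- T) = - conj_by T"
    "conj_by (S - T) = conj_by S - conj_by T"
    by (rule bop_eqI; simp add: ap_conj_by ap_simps add scaleC inv_left inv_right zero minus diff)+
  show "conj_by (adj T) = adj (conj_by T)"
  proof (rule adj_eqI[symmetric])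
    fix x y
    show "cinner (ap (conj_by T) x) y = cinner x (ap (conj_by (adj T)) y)"
      using cinner[of "ap T (inv_into UNIV V x)" "inv_into UNIV V y"] cinner[of "inv_into UNIV V x" "ap (adj T) (inv_into UNIV V y)"]
      by (simp add: ap_conj_by inv_right cinner_adj)
  qed
  show "conj_by (rank1 x y) = rank1 (V x) (V y)"
  proof (rule bop_eqI)
    fix z
    have "cj s (cinner y (inv_into UNIV V z)) = cinner (V y) z" using cinner[of y "inv_into UNIV V z"] by (simp add: inv_right)
    then show "ap (conj_by (rank1 x y)) z = ap (rank1 (V x) (V y)) z"
      by (simp add: ap_conj_by ap_rank1 scaleC)
  qed
qed

lemma conj_by_inj: "conj_by S = conj_by T \<longleftrightarrow> S = T"
proof
  assume eq: "conj_by S = conj_by T"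
  show "S = T"
  proof (rule bop_eqI)
    fix x
    have "V (ap S x) = V (ap T x)" using eq by (metis ap_conj_by_V)
    then show "ap S x = ap T x" using inj by (simp add: inj_eq)
  qed
qed simp

end

section \<open>C*-algebras and GNS representations\<close>

instance cstar_algebra \<subseteq> banach ..

lemma star_one [simp]: "star (1 :: 'a::cstar_algebra) = 1"
  by (metis mult_1_left mult_1_right star_mult star_star)

lemma star_scaleR: "star (r *\<^sub>R x) = r *\<^sub>R star (x :: 'a::cstar_algebra)"
  using star_scaleC[of "of_real r" x] by (simp add: scaleC_of_real)

lemma star_zero [simp]: "star (0 :: 'a::cstar_algebra) = 0"
  using star_scaleC[of 0 "0 :: 'a"] by simp

lemma star_minus: "star (- x) = - star (x :: 'a::cstar_algebra)"
  using star_scaleC[of "- 1" x] by simp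

lemma star_sum: "star (\<Sum>i\<in>I. f i) = (\<Sum>i\<in>I. star (f i :: 'a::cstar_algebra))"
  by (induction I rule: infinite_finite_induct) (simp_all add: star_add)

lemma star_power: "star (x ^ n) = star (x :: 'a::cstar_algebra) ^ n"
  by (induction n) (simp_all add: star_mult power_commutes)

lemma norm_star: "norm (star x) = norm (x :: 'a::cstar_algebra)"
proof -
  have "norm y \<le> norm (star y)" for y :: 'a
  proof (cases "y = 0")
    case False
    have "norm y * norm y \<le> norm (star y) * norm y"
      using cstar_identity[of y] norm_mult_ineq[of "star y" y] by (simp add: power2_eq_square)
    then show ?thesis using False by simp
  qed simp
  from this[of x] this[of "star x"] show ?thesis by (simp add: star_star)
qed

lemma bounded_linear_star: "bounded_linear (star :: 'a::cstar_algebra \<Rightarrow> 'a)"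
  by (rule bounded_linear_intro[where K = 1]) (simp_all add: star_add star_scaleR norm_star)

text \<open>Coefficients of the binomial series of the square root; the bound gives convergence for
  norm below 1.\<close>

lemma abs_gbinomial_half_le: "\<bar>(1/2 :: real) gchoose n\<bar> \<le> 1"
proof (induction n)
  case (Suc n)
  have "((1/2 :: real) gchoose Suc n) = (1/2 gchoose n) * ((1/2 - real n) / (real n + 1))"
    using gbinomial_mult_1[of "1/2 :: real" n] by (simp add: field_simps)
  moreover have q: "\<bar>(1/2 - real n) / (real n + 1)\<bar> \<le> 1" by (simp add: divide_simps)
  ultimately show ?case using mult_mono[OF Suc q] by (simp add: abs_mult)
qed simp

text \<open>The binomial series with exponent 1/2. It takes the place of spectral theory in the
  proof that representations are contractive.\<close>

lemma sqrt_one_minus: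
  fixes h :: "'a::cstar_algebra"
  assumes h: "norm h < 1" "star h = h"
  obtains y where "star y = y" "y * y = 1 - h"
proof -
  define b where "b n = ((1/2 :: real) gchoose n) * (- 1) ^ n" for n
  define f where "f n = b n *\<^sub>R h ^ n" for n
  have b: "\<bar>b n\<bar> \<le> 1" for n using abs_gbinomial_half_le by (simp add: b_def abs_mult)
  have "norm (norm (f n)) \<le> norm h ^ n" for n
    using mult_mono[OF b[of n] norm_power_ineq[of h n]] by (simp add: f_def)
  then have sn: "summable (\<lambda>n. norm (f n))"
    using h(1) by (intro summable_comparison_test'[OF summable_geometric, of "norm h" 0]) auto
  define y where "y = suminf f"
  have sf: "summable f" using sn by (rule summable_norm_cancel)
  have "star y = (\<Sum>n. star (f n))"
    unfolding y_def by (rule bounded_linear.suminf[OF bounded_linear_star sf])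
  then have "star y = y" by (simp add: star_scaleR star_power h(2) y_def f_def[abs_def])
  moreover have "y * y = 1 - h"
  proof -
    \<comment> \<open>Vandermonde convolution with 1/2 + 1/2 = 1: the square of the series is the
      binomial series of exponent 1, which is \<open>1 - h\<close>.\<close>
    have coef: "(\<Sum>i\<le>n. b i * b (n - i)) = (if n = 0 then 1 else if n = 1 then - 1 else 0)" for n
    proof -
      have "(\<Sum>i\<le>n. b i * b (n - i)) = (\<Sum>i\<le>n. (1/2 gchoose i) * (1/2 gchoose (n - i)) * (- 1) ^ n)"
        by (intro sum.cong refl) (simp add: b_def mult_ac flip: power_add)
      also have "\<dots> = (1 gchoose n) * (- 1) ^ n"
        using gbinomial_Vandermonde[of "1/2 :: real" "1/2" n]
        by (simp add: sum_distrib_right[symmetric] atLeast0AtMost)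
      also have "(1 :: real) gchoose n = of_nat (1 choose n)"
        by (simp add: binomial_gbinomial)
      finally show ?thesis by (auto simp: binomial_eq_0 less_Suc_eq not_less)
    qed
    have "y * y = (\<Sum>n. \<Sum>i\<le>n. f i * f (n - i))"
      unfolding y_def by (rule Cauchy_product[OF sn sn])
    also have "(\<lambda>n. \<Sum>i\<le>n. f i * f (n - i)) = (\<lambda>n. (\<Sum>i\<le>n. b i * b (n - i)) *\<^sub>R h ^ n)"
      by (rule ext) (simp add: f_def scaleR_sum_left mult.commute flip: power_add)
    also have "(\<Sum>n. (\<Sum>i\<le>n. b i * b (n - i)) *\<^sub>R h ^ n) = (\<Sum>n\<in>{0,1}. (\<Sum>i\<le>n. b i * b (n - i)) *\<^sub>R h ^ n)"
      by (rule suminf_finite) (auto simp: coef)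
    also have "\<dots> = 1 - h" using coef[of 0] coef[of 1] by simp
    finally show ?thesis .
  qed
  ultimately show thesis by (rule that)
qed

text \<open>\<open>F\<close> and \<open>G\<close> are indexed by the same space and have matching
  inner products, so \<open>F x \<mapsto> G x\<close> is well defined and isometric and extends
  along approximating sequences. Density of the range of \<open>F\<close> gives the domain, density
  of the range of \<open>G\<close> surjectivity.\<close>

lemma semiunitary_extension:
  fixes F G :: "'a::complex_vector \<Rightarrow> 'h::complex_hilbert"
  assumes F: "closure (range F) = UNIV" "\<And>x y. F (x + y) = F x + F y" "\<And>c x. F (c *\<^sub>C x) = c *\<^sub>C F x"
    and G: "closure (range G) = UNIV" "\<And>x y. G (x + y) = G x + G y" "\<And>c x. G (c *\<^sub>C x) = cj s c *\<^sub>C G x"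
    and FG: "\<And>x y. cinner (G x) (G y) = cj s (cinner (F x) (F y))"
  obtains V where "semiunitary s V" "\<And>x. V (F x) = G x"
proof -
  have Fd: "F (x - y) = F x - F y" for x y
    using F(2)[of x "(-1) *\<^sub>C y"] F(3)[of "-1" y] by simp
  have Gd: "G (x - y) = G x - G y" for x y
    using G(2)[of x "(-1) *\<^sub>C y"] G(3)[of "-1" y] by simp
  have nrm: "norm (G x) = norm (F x)" for x
    using FG[of x x] by (simp add: cinner_self flip: of_real_power)
  then have nd: "norm (G x - G y) = norm (F x - F y)" for x y by (metis Fd Gd)
  have appr: "\<exists>b. (\<lambda>n. F (b n)) \<longlonglongrightarrow> x" for x
  proof -
    have "x \<in> closure (range F)" using F(1) by simp
    then obtain z where z: "\<And>n. z n \<in> range F" "z \<longlonglongrightarrow> x" unfolding closure_sequential by blast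
    from z(1) have "\<forall>n. \<exists>b. z n = F b" by blast
    then obtain b where "\<And>n. z n = F (b n)" by metis
    then have "z = (\<lambda>n. F (b n))" by (rule ext)
    then show ?thesis using z(2) by blast
  qed
  have "\<exists>v. \<forall>b. (\<lambda>n. F (b n)) \<longlonglongrightarrow> x \<longrightarrow> (\<lambda>n. G (b n)) \<longlonglongrightarrow> v" for x
  proof -
    obtain b where b: "(\<lambda>n. F (b n)) \<longlonglongrightarrow> x" using appr by blast
    have "Cauchy (\<lambda>n. G (b n))"
      using LIMSEQ_imp_Cauchy[OF b] by (simp add: Cauchy_def dist_norm nd)
    then obtain v where v: "(\<lambda>n. G (b n)) \<longlonglongrightarrow> v" using Cauchy_convergent_iff convergent_def by blast
    show ?thesis
    proof (intro exI allI impI)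
      fix b' assume b': "(\<lambda>n. F (b' n)) \<longlonglongrightarrow> x"
      have "(\<lambda>n. F (b' n) - F (b n)) \<longlonglongrightarrow> 0" using tendsto_diff[OF b' b] by simp
      then have "(\<lambda>n. G (b' n) - G (b n)) \<longlonglongrightarrow> 0"
        by (simp only: tendsto_norm_zero_iff[symmetric, of "\<lambda>n. G (b' n) - G (b n)"] nd)
          (rule tendsto_norm_zero)
      from tendsto_add[OF this v] show "(\<lambda>n. G (b' n)) \<longlonglongrightarrow> v" by simp
    qed
  qed
  then obtain V where V: "\<And>x b. (\<lambda>n. F (b n)) \<longlonglongrightarrow> x \<Longrightarrow> (\<lambda>n. G (b n)) \<longlonglongrightarrow> V x" by metis
  have VF: "V (F x) = G x" for x
    using V[of "\<lambda>_. x" "F x"] LIMSEQ_unique[OF tendsto_const] by (metis tendsto_const)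
  have cs: "bounded_linear (\<lambda>x::'h. c *\<^sub>C x)" for c
    using bounded_linear_ap[of "c *\<^sub>C 1"] by (simp add: ap_simps[abs_def])
  have "semiunitary s V" unfolding semiunitary_on_def
  proof (intro conjI ballI allI)
    fix x y c
    obtain b b' where b: "(\<lambda>n. F (b n)) \<longlonglongrightarrow> x" and b': "(\<lambda>n. F (b' n)) \<longlonglongrightarrow> y" using appr by metis
    have "(\<lambda>n. F (b n + b' n)) \<longlonglongrightarrow> x + y" using tendsto_add[OF b b'] by (simp add: F)
    from V[OF this] have "(\<lambda>n. G (b n) + G (b' n)) \<longlonglongrightarrow> V (x + y)" by (simp add: G)
    then show "V (x + y) = V x + V y" using LIMSEQ_unique tendsto_add[OF V[OF b] V[OF b']] by blast
    have "(\<lambda>n. F (c *\<^sub>C b n)) \<longlonglongrightarrow> c *\<^sub>C x" using bounded_linear.tendsto[OF cs b] by (simp add: F)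
    from V[OF this] have "(\<lambda>n. cj s c *\<^sub>C G (b n)) \<longlonglongrightarrow> V (c *\<^sub>C x)" by (simp add: G)
    then show "V (c *\<^sub>C x) = cj s c *\<^sub>C V x" using LIMSEQ_unique bounded_linear.tendsto[OF cs V[OF b]] by blast
    have "(\<lambda>n. cinner (G (b n)) (G (b' n))) \<longlonglongrightarrow> cj s (cinner x y)"
      unfolding FG using tendsto_cinner[OF b b'] by (auto simp: cj_def intro: tendsto_cnj)
    then show "cinner (V x) (V y) = cj s (cinner x y)"
      using LIMSEQ_unique tendsto_cinner[OF V[OF b] V[OF b']] by blast
  next
    show "V ` UNIV = UNIV"
    proof (intro subset_antisym subsetI)
      fix y
      have "y \<in> closure (range G)" using G(1) by simp
      then obtain z where z0: "\<And>n. z n \<in> range G" and z: "z \<longlonglongrightarrow> y" unfolding closure_sequential by blast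
      from z0 have "\<forall>n. \<exists>b. z n = G b" by blast
      then obtain b where "\<And>n. z n = G (b n)" by metis
      then have b: "z = (\<lambda>n. G (b n))" by (rule ext)
      have "Cauchy (\<lambda>n. F (b n))"
        using LIMSEQ_imp_Cauchy[OF z] by (simp add: b Cauchy_def dist_norm nd)
      then obtain x where "(\<lambda>n. F (b n)) \<longlonglongrightarrow> x" using Cauchy_convergent_iff convergent_def by blast
      then have "V x = y" using V z b LIMSEQ_unique by blast
      then show "y \<in> V ` UNIV" by blast
    qed simp
  qed
  then show thesis using VF that by blast
qed

section \<open>GNS representations: contractivity and implementation of symmetries\<close>

locale gns =
  fixes \<omega> :: "'a::cstar_algebra \<Rightarrow> complex" and \<pi>0 :: "'a \<Rightarrow> 'h::complex_hilbert \<Rightarrow> 'h" and \<Omega> :: 'h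
  assumes is_GNS: "is_GNS UNIV \<omega> \<pi>0 \<Omega>"
begin

definition rep :: "'a \<Rightarrow> 'h bop" ("\<pi>")
  where "\<pi> A = Bop (\<pi>0 A)"

lemma ap_rep: "ap (\<pi> A) = \<pi>0 A"
  unfolding rep_def by (rule ap_Bop) (use is_GNS in \<open>auto simp: is_GNS_def\<close>)

lemma rep_simps: "\<pi> (A + B) = \<pi> A + \<pi> B" "\<pi> (A * B) = \<pi> A * \<pi> B" "\<pi> (c *\<^sub>C A) = c *\<^sub>C \<pi> A"
  "\<pi> (star A) = adj (\<pi> A)" "\<pi> 1 = 1" "\<pi> 0 = 0" "\<pi> (- A) = - \<pi> A" "\<pi> (A - B) = \<pi> A - \<pi> B"
proof -
  show *: "\<pi> (A + B) = \<pi> A + \<pi> B" "\<pi> (c *\<^sub>C A) = c *\<^sub>C \<pi> A" for A B c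
    using is_GNS by (auto intro!: bop_eqI simp: ap_simps ap_rep is_GNS_def)
  show "\<pi> (A * B) = \<pi> A * \<pi> B" "\<pi> 1 = 1"
    using is_GNS by (auto intro!: bop_eqI simp: ap_simps ap_rep is_GNS_def)
  show "\<pi> (star A) = adj (\<pi> A)"
    unfolding adj_def ap_rep using is_GNS by (simp add: is_GNS_def rep_def)
  show "\<pi> 0 = 0" using *(2)[of 0 0] by simp
  show m: "\<pi> (- A) = - \<pi> A" for A using *(2)[of "- 1" A] by simp
  show "\<pi> (A - B) = \<pi> A - \<pi> B" using *(1)[of A "- B"] m by simp
qed

lemma rep_sum: "\<pi> (\<Sum>i\<in>I. f i) = (\<Sum>i\<in>I. \<pi> (f i))"
  by (induction I rule: infinite_finite_induct) (simp_all add: rep_simps)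

lemma state_eq: "\<omega> A = cinner \<Omega> (ap (\<pi> A) \<Omega>)"
  using is_GNS by (auto simp: is_GNS_def ap_rep)

lemma cyclic: "closure (range (\<lambda>A. ap (\<pi> A) \<Omega>)) = UNIV"
  using is_GNS by (auto simp: is_GNS_def ap_rep)

lemma state_linear: "\<omega> (A + B) = \<omega> A + \<omega> B" "\<omega> (c *\<^sub>C A) = c * \<omega> A" "\<omega> (- A) = - \<omega> A" "\<omega> (A - B) = \<omega> A - \<omega> B"
  by (simp_all add: state_eq rep_simps ap_simps cinner_add_right cinner_scaleC_right cinner_minus_right cinner_diff_right)

lemma cinner_rep: "cinner (ap (\<pi> A) \<Omega>) (ap (\<pi> B) \<Omega>) = \<omega> (star A * B)"
  by (simp add: state_eq rep_simps ap_simps cinner_adj)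

lemma state_star: "\<omega> (star A) = cnj (\<omega> A)"
  unfolding state_eq rep_simps by (metis cinner_adj cinner_commute)

text \<open>If \<open>norm B < 1\<close>, then \<open>1 - star B * B\<close> is the square of a
  self-adjoint \<open>y\<close>, hence nonnegative in the representation; the general case follows
  by scaling. A GNS triple only comes with boundedness of each single \<open>\<pi> A\<close>; this
  uniform bound makes \<open>\<pi>\<close> continuous.\<close>

lemma norm_rep_le: "norm (ap (\<pi> A) x) \<le> norm A * norm x"
proof (cases "x = 0")
  case False
  have contr: "norm (ap (\<pi> B) x) \<le> norm x" if B: "norm B < 1" for B
  proof -
    have "norm (star B * B) < 1" using B by (simp add: cstar_identity power_less_one_iff)
    moreover have "star (star B * B) = star B * B" by (simp add: star_mult star_star)
    ultimately obtain y where y: "star y = y" "y * y = 1 - star B * B" using sqrt_one_minus by blast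
    have "adj (\<pi> y) * \<pi> y = 1 - adj (\<pi> B) * \<pi> B"
      by (metis rep_simps(2,4,5,8) y)
    then have "cinner x (ap (adj (\<pi> y) * \<pi> y) x) = cinner x x - cinner x (ap (adj (\<pi> B) * \<pi> B) x)"
      by (simp add: ap_simps cinner_diff_right)
    then have "(norm (ap (\<pi> y) x))\<^sup>2 = (norm x)\<^sup>2 - (norm (ap (\<pi> B) x))\<^sup>2"
      by (simp add: ap_simps cinner_adj[symmetric] cinner_self flip: of_real_power of_real_diff)
    then have "(norm (ap (\<pi> B) x))\<^sup>2 \<le> (norm x)\<^sup>2" by (metis diff_ge_0_iff_ge zero_le_power2)
    then show ?thesis by (rule power2_le_imp_le) simp
  qed
  have "norm (ap (\<pi> A) x) / norm x \<le> c" if c: "norm A < c" for c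
  proof -
    have c0: "c > 0" using c norm_ge_zero[of A] by linarith
    have "norm (ap (\<pi> ((1 / of_real c) *\<^sub>C A)) x) \<le> norm x"
      by (rule contr) (use c c0 in \<open>simp add: norm_scaleC norm_divide\<close>)
    then show ?thesis using c0 False
      by (simp add: rep_simps ap_simps norm_scaleC_hilbert norm_divide field_simps)
  qed
  then have "norm (ap (\<pi> A) x) / norm x \<le> norm A" by (rule dense_ge)
  then show ?thesis using False by (simp add: field_simps)
qed (simp add: ap_linear)

lemma bounded_linear_rep: "bounded_linear (\<lambda>A. ap (\<pi> A) x)"
  by (rule bounded_linear_intro[where K = "norm x"])
    (use norm_rep_le in \<open>auto simp: rep_simps ap_simps scaleC_of_real[symmetric] mult_ac\<close>)

text \<open>On vectors \<open>\<pi> A \<Omega>\<close> the operator \<open>V\<close> is given by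
  \<open>\<beta>\<close>, isometric by invariance of the state. The commutation with
  \<open>\<pi>\<close> on arbitrary vectors is obtained by comparing the adjoints of
  \<open>V \<pi> A V^-1\<close> and \<open>\<pi> (\<beta> A)\<close> on the dense set of these
  vectors.\<close>

lemma implementer:
  assumes \<beta>: "is_bogoliubov d a s w \<beta>" and inv: "\<And>A. \<omega> (\<beta> A) = cj s (\<omega> A)"
  obtains V where "semiunitary s V" "\<And>A. V (ap (\<pi> A) \<Omega>) = ap (\<pi> (\<beta> A)) \<Omega>"
    "\<And>A x. V (ap (\<pi> A) x) = ap (\<pi> (\<beta> A)) (V x)"
proof -
  have b: "surj \<beta>" "\<And>x y. \<beta> (x + y) = \<beta> x + \<beta> y" "\<And>x y. \<beta> (x * y) = \<beta> x * \<beta> y"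
    "\<And>c x. \<beta> (c *\<^sub>C x) = cj s c *\<^sub>C \<beta> x" "\<And>x. \<beta> (star x) = star (\<beta> x)"
    using \<beta> by (auto simp: is_bogoliubov_def bij_def)
  have r: "range (\<lambda>A. ap (\<pi> (\<beta> A)) \<Omega>) = range (\<lambda>A. ap (\<pi> A) \<Omega>)"
    unfolding image_image[of "\<lambda>A. ap (\<pi> A) \<Omega>" \<beta> UNIV, symmetric] b(1) ..
  obtain V where V: "semiunitary s V" "\<And>A. V (ap (\<pi> A) \<Omega>) = ap (\<pi> (\<beta> A)) \<Omega>"
  proof (rule semiunitary_extension[of "\<lambda>A. ap (\<pi> A) \<Omega>" "\<lambda>A. ap (\<pi> (\<beta> A)) \<Omega>" s])
    show "cinner (ap (\<pi> (\<beta> x)) \<Omega>) (ap (\<pi> (\<beta> y)) \<Omega>) = cj s (cinner (ap (\<pi> x) \<Omega>) (ap (\<pi> y) \<Omega>))" for x y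
      unfolding cinner_rep by (simp flip: b inv)
  qed (simp_all add: cyclic r b rep_simps ap_simps)
  interpret V: semiunitary_map s V by standard (rule V(1))
  have "V (ap (\<pi> A) x) = ap (\<pi> (\<beta> A)) (V x)" for A x
  proof -
    have "ap (V.conj_by (\<pi> A)) y = ap (\<pi> (\<beta> A)) y" for y
    proof -
      have "ap (adj (V.conj_by (\<pi> A))) (ap (\<pi> B) \<Omega>) = ap (adj (\<pi> (\<beta> A))) (ap (\<pi> B) \<Omega>)" for B
      proof -
        obtain B' where B: "B = \<beta> B'" using b(1) by blast
        have "ap (adj (V.conj_by (\<pi> A))) (V (ap (\<pi> B') \<Omega>)) = V (ap (\<pi> (star A * B')) \<Omega>)"
          by (simp add: V.ap_conj_by_V rep_simps ap_simps flip: V.conj_by_simps(4))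
        then show ?thesis unfolding B V(2) by (simp add: b rep_simps ap_simps)
      qed
      then have "cinner (ap (\<pi> B) \<Omega>) (ap (V.conj_by (\<pi> A)) y) = cinner (ap (\<pi> B) \<Omega>) (ap (\<pi> (\<beta> A)) y)" for B
        by (metis cinner_adj')
      then show ?thesis using eq_of_cinner_dense[OF cyclic] by blast
    qed
    then show ?thesis by (metis V.ap_conj_by_V)
  qed
  with V show thesis by (rule that)
qed

end

section \<open>Matrix units from the canonical anticommutation relations\<close>

text \<open>The matrix units are obtained from the relations alone, for any family of modes, without
  passing through a Fock representation.\<close>

locale car_modes =
  fixes c :: "nat \<Rightarrow> 'a::cstar_algebra"
  assumes cc: "c j * c k + c k * c j = 0"
    and cs: "c j * star (c k) + star (c k) * c j = (if j = k then 1 else 0)"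
begin

lemma cc': "c j * c k = - (c k * c j)" using cc[of j k] by (simp add: eq_neg_iff_add_eq_0)

lemma cs': "c j * star (c k) = (if j = k then 1 else 0) - star (c k) * c j"
  using cs[of j k] by (simp add: eq_diff_eq)

lemma ss': "star (c j) * star (c k) = - (star (c k) * star (c j))"
  by (metis cc' star_minus star_mult)

lemma cc_self [simp]: "c k * c k = 0"
proof -
  have "2 *\<^sub>R (c k * c k) = 0" using cc[of k k] by (simp add: scaleR_2)
  then show ?thesis by simp
qed

lemma ss_self [simp]: "star (c k) * star (c k) = 0"
  by (metis cc_self star_mult star_zero)

definition word :: "nat list \<Rightarrow> 'a"
  where "word xs = prod_list (map (\<lambda>k. star (c k)) xs)"

definition num :: "nat \<Rightarrow> 'a"
  where "num k = c k * star (c k)"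

definition vac :: "nat \<Rightarrow> 'a"
  where "vac n = prod_list (map num [0..<n])"

lemma word_simps [simp]: "word [] = 1" "word (x # xs) = star (c x) * word xs" "word (xs @ ys) = word xs * word ys"
  by (simp_all add: word_def)

lemma vac_0 [simp]: "vac 0 = 1" by (simp add: vac_def)
lemma vac_Suc: "vac (Suc n) = vac n * num n" by (simp add: vac_def)

lemma star_num: "star (num k) = num k" by (simp add: num_def star_mult star_star)

lemma c_num: "c k * num k = 0" by (simp add: num_def flip: mult.assoc)

lemma num_c_comm: "j \<noteq> k \<Longrightarrow> num k * c j = c j * num k"
proof -
  assume "j \<noteq> k"
  then have "star (c k) * c j = - (c j * star (c k))" using cs'[of j k] by simp
  then show ?thesis by (simp add: num_def mult.assoc cc'[of j k] flip: mult.assoc[of "c j"])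
qed

lemma num_s_comm: "j \<noteq> k \<Longrightarrow> num k * star (c j) = star (c j) * num k"
  using num_c_comm[of j k] by (metis star_mult star_num star_star)

lemma num_num: "num k * num k = num k"
proof -
  have "num k * num k = c k * (star (c k) * c k) * star (c k)" by (simp add: num_def mult.assoc)
  also have "star (c k) * c k = 1 - c k * star (c k)" using cs'[of k k] by simp
  also have "c k * (1 - c k * star (c k)) * star (c k) = num k"
    by (simp add: num_def algebra_simps mult.assoc[symmetric])
  finally show ?thesis .
qed

lemma num_comm: "num j * num k = num k * num j"
proof (cases "j = k")
  case False
  have "num j * num k = num j * c k * star (c k)" by (simp add: num_def mult.assoc)
  also have "\<dots> = c k * (num j * star (c k))" using False by (simp add: num_c_comm mult.assoc)
  also have "\<dots> = num k * num j" using False by (simp add: num_s_comm num_def[of k] mult.assoc)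
  finally show ?thesis .
qed simp

lemma vac_num_comm: "vac n * num k = num k * vac n"
proof (induction n)
  case (Suc n)
  then show ?case by (metis mult.assoc num_comm vac_Suc)
qed simp

lemma vac_s_comm: "n \<le> k \<Longrightarrow> vac n * star (c k) = star (c k) * vac n"
proof (induction n)
  case (Suc n)
  then show ?case by (simp add: vac_Suc mult.assoc num_s_comm) (simp flip: mult.assoc)
qed simp

lemma star_vac: "star (vac n) = vac n"
  by (induction n) (simp_all add: vac_Suc star_mult star_num vac_num_comm)

lemma vac_vac: "vac n * vac n = vac n"
proof (induction n)
  case (Suc n)
  have "vac (Suc n) * vac (Suc n) = vac n * (num n * vac n) * num n" by (simp add: vac_Suc mult.assoc)
  also have "\<dots> = (vac n * vac n) * (num n * num n)"
    by (simp only: vac_num_comm[symmetric]) (simp add: mult.assoc)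
  finally show ?case by (simp add: Suc num_num vac_Suc)
qed simp

lemma c_vac: "k < n \<Longrightarrow> c k * vac n = 0"
proof (induction n)
  case (Suc n)
  show ?case
  proof (cases "k = n")
    case True
    have "c k * vac (Suc n) = c k * num n * vac n" by (simp add: vac_Suc vac_num_comm mult.assoc)
    then show ?thesis using True c_num by simp
  next
    case False
    then have "c k * vac n = 0" using Suc by simp
    then show ?thesis by (simp add: vac_Suc flip: mult.assoc)
  qed
qed simp

lemma s_word: "k \<in> set xs \<Longrightarrow> star (c k) * word xs = 0"
proof (induction xs)
  case (Cons x xs)
  show ?case
  proof (cases "k = x")
    case True
    then show ?thesis by (simp flip: mult.assoc)
  next
    case False
    then have "star (c k) * word (x # xs) = - (star (c x) * (star (c k) * word xs))"
      by (simp add: ss'[of k x] flip: mult.assoc)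
    then show ?thesis using Cons False by simp
  qed
qed simp

lemma s_word_insort:
  "sorted xs \<Longrightarrow> k \<notin> set xs \<Longrightarrow> star (c k) * word xs = (- 1) ^ length (filter (\<lambda>j. j < k) xs) *\<^sub>C word (insort k xs)"
proof (induction xs)
  case (Cons x xs)
  show ?case
  proof (cases "k \<le> x")
    case True
    then have "filter (\<lambda>j. j < k) (x # xs) = []" using Cons(2) by (auto simp: filter_empty_conv)
    then show ?thesis using True by simp
  next
    case False
    have "star (c k) * word (x # xs) = - (star (c x) * (star (c k) * word xs))"
      by (simp add: ss'[of k x] flip: mult.assoc)
    also have "\<dots> = (- 1) ^ length (filter (\<lambda>j. j < k) (x # xs)) *\<^sub>C (star (c x) * word (insort k xs))"
      using Cons False by (simp add: mult_scaleC_right scaleC_minus_left)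
    finally show ?thesis using False by simp
  qed
qed simp

lemma c_word_vac: "k < n \<Longrightarrow> k \<notin> set xs \<Longrightarrow> c k * (word xs * vac n) = 0"
proof (induction xs)
  case Nil
  then show ?case by (simp add: c_vac)
next
  case (Cons x xs)
  then have "c k * star (c x) = - (star (c x) * c k)" using cs'[of k x] by auto
  then have "c k * (word (x # xs) * vac n) = - (star (c x) * (c k * (word xs * vac n)))"
    by (simp add: mult.assoc[symmetric])
  then show ?case using Cons by simp
qed

lemma star_word_eq_0:
  "k \<in> set xs \<Longrightarrow> c k * z = 0 \<Longrightarrow> star (word xs) * z = 0"
proof (induction xs arbitrary: z)
  case (Cons x xs)
  have "c k * (c x * z) = - (c x * (c k * z))" by (simp add: cc'[of k x] flip: mult.assoc)
  then have 1: "c k * (c x * z) = 0" using Cons by simp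
  have "star (word (x # xs)) * z = star (word xs) * (c x * z)"
    by (simp add: star_mult star_star mult.assoc)
  then show ?case using Cons 1 by (cases "k = x") auto
qed simp

lemma star_word_word:
  "distinct xs \<Longrightarrow> set xs \<subseteq> {..<n} \<Longrightarrow> star (word xs) * (word xs * vac n) = vac n"
proof (induction xs)
  case (Cons x xs)
  have "star (word (x # xs)) * (word (x # xs) * vac n) =
      star (word xs) * (c x * star (c x) * (word xs * vac n))"
    by (simp add: star_mult star_star mult.assoc)
  also have "c x * star (c x) * (word xs * vac n) = word xs * vac n - star (c x) * (c x * (word xs * vac n))"
    by (simp add: cs'[of x x] algebra_simps)
  finally show ?case using Cons c_word_vac[of x n xs] by simp
qed simp

abbreviation wordset :: "nat set \<Rightarrow> 'a"
  where "wordset S \<equiv> word (sorted_list_of_set S)"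

definition unit :: "nat \<Rightarrow> nat set \<Rightarrow> nat set \<Rightarrow> 'a"
  where "unit n S T = wordset S * vac n * star (wordset T)"

lemma star_unit: "star (unit n S T) = unit n T S"
  by (simp add: unit_def star_mult star_star star_vac mult.assoc)

text \<open>The annihilator of a mode in \<open>T\<close> but not in \<open>S\<close> can be moved
  through the word of \<open>S\<close> to the vacuum projection, which it kills; if the extra mode
  lies in \<open>S\<close>, take adjoints. For \<open>S = T\<close> the two words cancel mode by
  mode.\<close>

lemma vac_word_word_vac:
  assumes S: "S \<subseteq> {..<n}" and T: "T \<subseteq> {..<n}"
  shows "vac n * (star (wordset T) * (wordset S * vac n)) = (if S = T then vac n else 0)"
proof -
  have fin: "finite S" "finite T" using S T finite_subset by blast+
  have diff: "star (wordset A) * (wordset B * vac n) = 0"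
    if "k \<in> A" "k \<notin> B" "finite A" "finite B" "A \<subseteq> {..<n}" for A B k
    by (rule star_word_eq_0[of k]) (use that c_word_vac in auto)
  show ?thesis
  proof (cases "S = T")
    case True
    then show ?thesis using star_word_word[of "sorted_list_of_set S" n] fin S by (simp add: vac_vac)
  next
    case False
    then consider k where "k \<in> T" "k \<notin> S" | k where "k \<in> S" "k \<notin> T" by blast
    then show ?thesis
    proof cases
      case 1
      then show ?thesis using diff[of k T S] fin T False by simp
    next
      case 2
      then have "star (star (wordset S) * (wordset T * vac n)) = 0" using diff[of k S T] fin S by simp
      then have "vac n * star (wordset T) * wordset S = 0" by (simp add: star_mult star_star star_vac)
      then show ?thesis using False by (simp flip: mult.assoc)
    qed
  qed
qed

lemma unit_mult:
  assumes "S \<subseteq> {..<n}" "T \<subseteq> {..<n}"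
  shows "unit n R T * unit n S Q = (if S = T then unit n R Q else 0)"
proof -
  have "unit n R T * unit n S Q = wordset R * (vac n * vac n * (star (wordset T) * (wordset S * vac n))) * star (wordset Q)"
    by (simp only: vac_vac) (simp add: unit_def mult.assoc)
  also have "\<dots> = wordset R * (vac n * (vac n * (star (wordset T) * (wordset S * vac n)))) * star (wordset Q)"
    by (simp add: mult.assoc)
  also have "\<dots> = (if S = T then unit n R Q else 0)"
    unfolding vac_word_word_vac[OF assms] by (simp add: vac_vac unit_def)
  finally show ?thesis .
qed

text \<open>Induction on the number of modes: each diagonal unit is the sum of its versions with the
  new mode empty, carrying \<open>num n\<close>, and filled, carrying
  \<open>1 - num n\<close>.\<close>

lemma sum_unit: "(\<Sum>S\<in>Pow {..<n}. unit n S S) = 1"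
proof (induction n)
  case 0
  then show ?case by (simp add: unit_def)
next
  case (Suc n)
  \<comment> \<open>\<open>n\<close> is larger than all modes in \<open>S\<close>, so it is appended
    at the end of the word and no sign arises.\<close>
  have ins: "wordset (insert n S) = wordset S * star (c n)" if "S \<in> Pow {..<n}" for S
  proof -
    have fin: "finite S" using that finite_subset by blast
    then have "sorted_list_of_set (insert n S) = insort n (sorted_list_of_set S)"
      using that by (subst sorted_list_of_set_insert) auto
    also have "\<dots> = sorted_list_of_set S @ [n]"
      using that fin by (intro sorted_insort_is_snoc) auto
    finally show ?thesis by simp
  qed
  have eq: "unit (Suc n) S S + unit (Suc n) (insert n S) (insert n S) = unit n S S"
    if S: "S \<in> Pow {..<n}" for S
  proof -
    have scs: "star (c n) * num n * c n = 1 - num n"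
    proof -
      have 1: "star (c n) * c n = 1 - num n" using cs'[of n n] by (simp add: num_def)
      have "star (c n) * num n * c n = (star (c n) * c n) * (star (c n) * c n)" by (simp add: num_def mult.assoc)
      then show ?thesis by (simp add: 1 algebra_simps num_num)
    qed
    have "unit (Suc n) (insert n S) (insert n S) = wordset S * (star (c n) * vac n * num n * c n) * star (wordset S)"
      by (simp add: unit_def ins[OF S] vac_Suc star_mult star_star mult.assoc)
    also have "star (c n) * vac n * num n * c n = vac n * (1 - num n)"
      using scs by (simp add: vac_s_comm[symmetric] mult.assoc)
    finally show ?thesis by (simp add: unit_def vac_Suc algebra_simps)
  qed
  have inj: "inj_on (insert n) (Pow {..<n})" by (auto simp: inj_on_def)
  have "Pow {..<Suc n} = Pow {..<n} \<union> insert n ` Pow {..<n}" by (simp add: lessThan_Suc Pow_insert)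
  then have "(\<Sum>S\<in>Pow {..<Suc n}. unit (Suc n) S S) =
      (\<Sum>S\<in>Pow {..<n}. unit (Suc n) S S) + (\<Sum>S\<in>insert n ` Pow {..<n}. unit (Suc n) S S)"
    by (simp only:) (rule sum.union_disjoint, auto)
  also have "\<dots> = (\<Sum>S\<in>Pow {..<n}. unit n S S)"
    unfolding sum.reindex[OF inj] sum.distrib[symmetric] by (rule sum.cong) (simp_all add: eq)
  finally show ?case using Suc by simp
qed

lemma s_wordset:
  assumes "finite S"
  shows "star (c k) * wordset S =
    (if k \<in> S then 0 else (- 1) ^ card {j\<in>S. j < k} *\<^sub>C wordset (insert k S))"
proof (cases "k \<in> S")
  case True
  then show ?thesis using s_word assms by simp
next
  case False
  have "length (filter (\<lambda>j. j < k) (sorted_list_of_set S)) = card {j\<in>S. j < k}"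
    using assms by (subst distinct_card[symmetric]) simp_all
  then show ?thesis
    using s_word_insort[of "sorted_list_of_set S" k] False assms by (simp add: sorted_list_of_set_insert)
qed

lemma s_unit:
  assumes "finite S"
  shows "star (c k) * unit n S T =
    (if k \<in> S then 0 else (- 1) ^ card {j\<in>S. j < k} *\<^sub>C unit n (insert k S) T)"
  using s_wordset[OF assms, of k] by (auto simp: unit_def mult_scaleC_left mult.assoc[symmetric])

text \<open>The resolution of the identity multiplied by \<open>star (c k)\<close>. Commutation with
  all matrix units is thereby passed on to creators and annihilators.\<close>

lemma s_as_units:
  assumes "k < n"
  shows "star (c k) = (\<Sum>S | S \<subseteq> {..<n} \<and> k \<notin> S. (- 1) ^ card {j\<in>S. j < k} *\<^sub>C unit n (insert k S) S)"
proof -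
  have "star (c k) = (\<Sum>S\<in>Pow {..<n}. star (c k) * unit n S S)"
    using sum_unit[of n] by (simp flip: sum_distrib_left)
  also have "\<dots> = (\<Sum>S\<in>Pow {..<n}. if k \<notin> S then (- 1) ^ card {j\<in>S. j < k} *\<^sub>C unit n (insert k S) S else 0)"
    by (rule sum.cong[OF refl], subst s_unit) (auto intro: finite_subset)
  finally show ?thesis by (simp add: sum.inter_filter[symmetric])
qed

end

section \<open>The CAR algebra of the chain\<close>

abbreviation ops :: "nat \<Rightarrow> int set \<Rightarrow> one_particle set"
  where "ops \<equiv> one_particle_space"

lemma conj_square_real:
  assumes "v \<in> carrier_vec d"
  shows "v \<bullet>c v = complex_of_real (Re (v \<bullet>c v))" "0 \<le> Re (v \<bullet>c v)"
  using conjugate_square_ge_0_vec[of v] by (auto simp: less_eq_complex_def complex_eq_iff)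

lemma conjugate_unit_vec: "conjugate (unit_vec n i) = (unit_vec n i :: complex Matrix.vec)"
  by (rule eq_vecI) (auto simp: unit_vec_def)

lemma ops_carrier: "f \<in> ops d X \<Longrightarrow> f x \<in> carrier_vec d"
  by (simp add: one_particle_space_def)

lemma ops_outside: "f \<in> ops d X \<Longrightarrow> x \<notin> X \<Longrightarrow> f x = 0\<^sub>v d"
  by (simp add: one_particle_space_def)

lemma ops_mono: "X \<subseteq> Y \<Longrightarrow> ops d X \<subseteq> ops d Y"
  by (auto simp: one_particle_space_def)

lemma ops_finite:
  assumes "\<And>x. f x \<in> carrier_vec d" "\<And>x. x \<notin> X \<Longrightarrow> f x = 0\<^sub>v d" "finite X"
  shows "f \<in> ops d X"
proof -
  have "(\<lambda>x. Re (f x \<bullet>c f x)) summable_on UNIV \<longleftrightarrow> (\<lambda>x. Re (f x \<bullet>c f x)) summable_on X"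
    by (rule summable_on_cong_neutral) (use assms in auto)
  then show ?thesis using assms by (simp add: one_particle_space_def)
qed

definition restr :: "nat \<Rightarrow> int set \<Rightarrow> one_particle \<Rightarrow> one_particle"
  where "restr d F f = (\<lambda>x. if x \<in> F then f x else 0\<^sub>v d)"

lemma ops_restr:
  assumes "f \<in> ops d X"
  shows "restr d F f \<in> ops d (X \<inter> F)"
proof -
  have f: "\<And>x. f x \<in> carrier_vec d" "(\<lambda>x. Re (f x \<bullet>c f x)) summable_on UNIV"
    using assms by (simp_all add: one_particle_space_def)
  have "(\<lambda>x. Re (restr d F f x \<bullet>c restr d F f x)) summable_on UNIV \<longleftrightarrow> (\<lambda>x. Re (f x \<bullet>c f x)) summable_on F"
    by (rule summable_on_cong_neutral) (auto simp: restr_def)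
  then show ?thesis
    using f summable_on_subset_banach[OF f(2), of F] assms
    by (auto simp: one_particle_space_def restr_def)
qed

lemma ops_shift:
  assumes "f \<in> ops d X"
  shows "shift N f \<in> ops d ((+) N ` X)"
proof -
  have "bij_betw (\<lambda>y. y - N) UNIV (UNIV :: int set)"
    by (rule bij_betwI[where g = "\<lambda>y. y + N"]) auto
  from summable_on_reindex_bij_betw[OF this, of "\<lambda>x. Re (f x \<bullet>c f x)"]
  have "(\<lambda>y. Re (f (y - N) \<bullet>c f (y - N))) summable_on UNIV"
    using assms by (simp add: one_particle_space_def)
  moreover have "f (x - N) = 0\<^sub>v d" if "x \<notin> (+) N ` X" for x
  proof -
    have "x - N \<notin> X" using that by (metis add_diff_cancel_left' add.commute diff_add_cancel image_eqI)
    then show ?thesis using assms by (simp add: one_particle_space_def)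
  qed
  ultimately show ?thesis using assms by (simp add: one_particle_space_def shift_def)
qed

lemma star_subalgebra_mono: "S \<subseteq> T \<Longrightarrow> star_subalgebra S \<subseteq> star_subalgebra T"
proof
  fix x assume "S \<subseteq> T" "x \<in> star_subalgebra S"
  from this(2,1) show "x \<in> star_subalgebra T"
    by (induction rule: star_subalgebra.induct) (auto intro: star_subalgebra.intros)
qed

lemma star_subalgebra_diff:
  "x \<in> star_subalgebra S \<Longrightarrow> y \<in> star_subalgebra S \<Longrightarrow> x - y \<in> star_subalgebra S"
  using star_subalgebra.add[OF _ star_subalgebra.scale[of y S "- 1"]] by simp

definition lmode :: "nat \<Rightarrow> nat \<Rightarrow> one_particle"
  where "lmode d k = (\<lambda>x. if x = int (k div d) then unit_vec d (k mod d) else 0\<^sub>v d)"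

locale car =
  fixes d :: nat and a :: "one_particle \<Rightarrow> 'a::cstar_algebra"
  assumes d_pos: "d \<ge> 1" and car: "is_CAR_algebra d a"
begin

lemma a_add: "f \<in> ops d UNIV \<Longrightarrow> g \<in> ops d UNIV \<Longrightarrow> a (\<lambda>x. f x + g x) = a f + a g"
  and a_scale: "f \<in> ops d UNIV \<Longrightarrow> a (\<lambda>x. z \<cdot>\<^sub>v f x) = cnj z *\<^sub>C a f"
  and aa: "f \<in> ops d UNIV \<Longrightarrow> g \<in> ops d UNIV \<Longrightarrow> a f * a g + a g * a f = 0"
  and as: "f \<in> ops d UNIV \<Longrightarrow> g \<in> ops d UNIV \<Longrightarrow>
    a f * star (a g) + star (a g) * a f = one_particle_inner f g *\<^sub>C 1"
  and total: "closure (star_subalgebra (a ` ops d UNIV)) = UNIV"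
  using car by (auto simp: is_CAR_algebra_def local_algebra_def)

lemma ops_UNIV: "f \<in> ops d X \<Longrightarrow> f \<in> ops d UNIV"
  using ops_mono[of X UNIV] by auto

lemma one_particle_inner_disjoint:
  assumes "f \<in> ops d X" "g \<in> ops d Y" "X \<inter> Y = {}"
  shows "one_particle_inner f g = 0"
  unfolding one_particle_inner_def
proof (rule infsum_0)
  fix x
  have "x \<notin> X \<or> x \<notin> Y" using assms(3) by auto
  then show "g x \<bullet>c f x = 0"
    using ops_outside[OF assms(1), of x] ops_outside[OF assms(2), of x]
      ops_carrier[OF assms(1), of x] ops_carrier[OF assms(2), of x] by auto
qed

lemma a_zero: "a (\<lambda>_. 0\<^sub>v d) = 0"
proof -
  have z: "(\<lambda>_. 0\<^sub>v d) \<in> ops d UNIV" using ops_finite[of "\<lambda>_. 0\<^sub>v d" d "{}"] ops_UNIV by auto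
  have "0 \<cdot>\<^sub>v 0\<^sub>v d = (0\<^sub>v d :: complex Matrix.vec)" by (rule eq_vecI) auto
  then show ?thesis using a_scale[OF z, of 0] by simp
qed

lemma lmode_ops: "lmode d k \<in> ops d {int (k div d)}"
  by (rule ops_finite) (auto simp: lmode_def)

lemma lmode_ops': "k < d * N \<Longrightarrow> lmode d k \<in> ops d {0..<int N}"
proof -
  assume "k < d * N"
  then have "k div d < N" using d_pos by (simp add: less_mult_imp_div_less mult.commute)
  then show ?thesis using lmode_ops[of k] ops_mono[of "{int (k div d)}" "{0..<int N}" d] by auto
qed

lemma mode_annihilator_eq: "mode_annihilator d a k = a (lmode d k)"
  by (simp add: mode_annihilator_def lmode_def)

lemma inner_lmode: "one_particle_inner (lmode d j) (lmode d k) = (if j = k then 1 else 0)"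
proof -
  have m: "i mod d < d" for i using d_pos by simp
  have "one_particle_inner (lmode d j) (lmode d k) =
      (\<Sum>\<^sub>\<infinity>x\<in>{int (j div d)}. lmode d k x \<bullet>c lmode d j x)"
    unfolding one_particle_inner_def by (rule infsum_cong_neutral) (auto simp: lmode_def)
  also have "\<dots> = (if j div d = k div d \<and> j mod d = k mod d then 1 else 0)"
    using m by (auto simp: lmode_def conjugate_unit_vec)
  also have "(j div d = k div d \<and> j mod d = k mod d) = (j = k)"
    by (metis div_mult_mod_eq)
  finally show ?thesis .
qed

sublocale modes: car_modes "mode_annihilator d a"
proof
  fix j k
  note [simp] = mode_annihilator_eq
  show "mode_annihilator d a j * mode_annihilator d a k + mode_annihilator d a k * mode_annihilator d a j = 0"
    using aa[OF ops_UNIV[OF lmode_ops] ops_UNIV[OF lmode_ops]] by simp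
  show "mode_annihilator d a j * star (mode_annihilator d a k) + star (mode_annihilator d a k) * mode_annihilator d a j
      = (if j = k then 1 else 0)"
    using as[OF ops_UNIV[OF lmode_ops[of j]] ops_UNIV[OF lmode_ops[of k]]] by (simp add: inner_lmode)
qed

lemma fock_unit_eq: "fock_unit d a N S T = modes.unit (d * N) S T"
  by (simp add: fock_unit_def modes.unit_def creation_word_def vacuum_proj_def
      modes.word_def modes.vac_def modes.num_def[abs_def])

text \<open>The part of \<open>f\<close> in the first \<open>n\<close> modes, counted site by site
  from site 0. Growing by one mode at a time it can be treated by induction; for
  \<open>n = d * N\<close> it is the restriction to \<open>[0, N - 1]\<close>.\<close>

definition mode_part :: "nat \<Rightarrow> one_particle \<Rightarrow> one_particle"
  where "mode_part n f = (\<lambda>x. Matrix.vec d (\<lambda>i. if 0 \<le> x \<and> nat x * d + i < n then vec_index (f x) i else 0))"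

lemma mode_part_ops: "mode_part n f \<in> ops d {0..int n}"
proof (rule ops_finite)
  fix x assume x: "x \<notin> {0..int n}"
  have "n \<le> nat x * d" if "x > int n"
  proof -
    have "n * 1 \<le> nat x * d" by (rule mult_le_mono) (use that d_pos in auto)
    then show ?thesis by simp
  qed
  then show "mode_part n f x = 0\<^sub>v d" using x by (auto simp: mode_part_def intro!: eq_vecI)
qed (auto simp: mode_part_def)

lemma a_mode_part:
  "a (mode_part n f) = (\<Sum>k<n. cnj (vec_index (f (int (k div d))) (k mod d)) *\<^sub>C mode_annihilator d a k)"
proof (induction n)
  case 0
  have "mode_part 0 f = (\<lambda>_. 0\<^sub>v d)" by (rule ext) (auto simp: mode_part_def)
  then show ?case by (simp add: a_zero)
next
  case (Suc n)
  have nd: "nat x * d + i = n \<longleftrightarrow> x = int (n div d) \<and> i = n mod d" if "0 \<le> x" "i < d" for x i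
    using that by (auto simp: div_mult_mod_eq)
  have "mode_part (Suc n) f = (\<lambda>x. mode_part n f x + vec_index (f (int (n div d))) (n mod d) \<cdot>\<^sub>v lmode d n x)"
  proof (rule ext, rule eq_vecI)
    fix x i assume "i < dim_vec (mode_part n f x + vec_index (f (int (n div d))) (n mod d) \<cdot>\<^sub>v lmode d n x)"
    then have i: "i < d" by (simp add: lmode_def split: if_splits)
    show "vec_index (mode_part (Suc n) f x) i =
        vec_index (mode_part n f x + vec_index (f (int (n div d))) (n mod d) \<cdot>\<^sub>v lmode d n x) i"
    proof (cases "0 \<le> x")
      case True
      then show ?thesis using i nd[OF True i] by (auto simp: mode_part_def lmode_def less_Suc_eq)
    next
      case False
      then have "x \<noteq> int (n div d)" using of_nat_0_le_iff by blast
      then show ?thesis using i False by (simp add: mode_part_def lmode_def)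
    qed
  qed (auto simp: mode_part_def lmode_def)
  moreover have "(\<lambda>x. vec_index (f (int (n div d))) (n mod d) \<cdot>\<^sub>v lmode d n x) \<in> ops d {int (n div d)}"
    by (rule ops_finite) (auto simp: lmode_def)
  ultimately show ?case
    using a_add[OF ops_UNIV[OF mode_part_ops[of n f]] ops_UNIV]
      a_scale[OF ops_UNIV[OF lmode_ops[of n]], of "vec_index (f (int (n div d))) (n mod d)"] Suc
    by (simp add: mode_annihilator_eq)
qed

text \<open>Cutting at site \<open>N\<close>: every generator of the half chain is a combination of
  block modes plus a translate of a generator.\<close>

lemma ops_split:
  assumes f: "f \<in> ops d {0..}"
  obtains g where "g \<in> ops d {0..}" "a f = a (mode_part (d * N) f) + a (shift (int N) g)"
proof -
  define g where "g = shift (- int N) (restr d {int N..} f)"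
  have "restr d {int N..} f \<in> ops d {int N..}"
    using ops_restr[OF f, of "{int N..}"] ops_mono[of "{0..} \<inter> {int N..}" "{int N..}" d] by auto
  from ops_shift[OF this, of "- int N"] have "g \<in> ops d ((+) (- int N) ` {int N..})" by (simp add: g_def)
  moreover have "(+) (- int N) ` {int N..} \<subseteq> {0..}" by auto
  ultimately have g: "g \<in> ops d {0..}" using ops_mono by blast
  have sg: "shift (int N) g = restr d {int N..} f" by (rule ext) (simp add: g_def shift_def)
  have "f x = mode_part (d * N) f x + shift (int N) g x" for x
  proof (rule eq_vecI)
    have fx: "f x \<in> carrier_vec d" by (rule ops_carrier[OF f])
    then show "dim_vec (f x) = dim_vec (mode_part (d * N) f x + shift (int N) g x)"
      by (auto simp: sg restr_def)
    fix i assume "i < dim_vec (mode_part (d * N) f x + shift (int N) g x)"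
    then have i: "i < d" using fx by (auto simp: sg restr_def split: if_splits)
    consider "x < 0" | "0 \<le> x" "x < int N" | "int N \<le> x" by linarith
    then show "vec_index (f x) i = vec_index (mode_part (d * N) f x + shift (int N) g x) i"
    proof cases
      case 1
      then show ?thesis using i ops_outside[OF f, of x] by (simp add: mode_part_def sg restr_def)
    next
      case 2
      then have "Suc (nat x) * d \<le> N * d" by (intro mult_le_mono1) auto
      then have "nat x * d + i < d * N" using i by (simp add: mult.commute)
      then show ?thesis using 2 i by (simp add: mode_part_def sg restr_def)
    next
      case 3
      then have "d * N \<le> d * nat x" by (intro mult_le_mono2) auto
      then have "\<not> nat x * d + i < d * N" unfolding mult.commute[of "nat x" d] by linarith
      then show ?thesis using 3 i fx by (simp add: mode_part_def sg restr_def)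
    qed
  qed
  then have "f = (\<lambda>x. mode_part (d * N) f x + shift (int N) g x)" by blast
  then have "a f = a (mode_part (d * N) f) + a (shift (int N) g)"
    using a_add[OF ops_UNIV[OF mode_part_ops] ops_UNIV[OF ops_shift[OF g]]] by metis
  with g show thesis by (rule that)
qed

text \<open>The relations give \<open>h * h = ?r *\<^sub>C h\<close> for
  \<open>h = star (a f) * a f\<close>, so the identity for the norm of \<open>star h * h\<close>
  bounds \<open>norm h\<close>. The estimate yields continuity of \<open>a\<close> and with it
  density of the local elements.\<close>

lemma norm_a_le:
  assumes f: "f \<in> ops d UNIV"
  shows "(norm (a f))\<^sup>2 \<le> cmod (one_particle_inner f f)"
proof -
  let ?A = "a f" and ?r = "one_particle_inner f f"
  have "2 *\<^sub>R (?A * ?A) = 0" using aa[OF f f] by (simp add: scaleR_2)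
  then have AA: "?A * ?A = 0" by simp
  define h where "h = star ?A * ?A"
  have hs: "star h = h" by (simp add: h_def star_mult star_star)
  have "h * h = star ?A * (?A * star ?A) * ?A" by (simp add: h_def mult.assoc)
  also have "?A * star ?A = ?r *\<^sub>C 1 - star ?A * ?A" using as[OF f f] by (simp add: eq_diff_eq)
  also have "star ?A * (?r *\<^sub>C 1 - star ?A * ?A) * ?A = ?r *\<^sub>C h"
    by (simp add: h_def algebra_simps mult_scaleC_left mult_scaleC_right AA)
  finally have "norm (star h * h) = cmod ?r * norm h" by (simp add: hs norm_scaleC)
  then have "norm h * norm h = cmod ?r * norm h" by (simp add: cstar_identity power2_eq_square)
  then have "norm h \<le> cmod ?r" by (cases "norm h = 0") auto
  then show ?thesis by (simp add: h_def cstar_identity)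
qed

lemma a_approx_finite:
  assumes f: "f \<in> ops d UNIV" and e: "e > 0"
  obtains F where "finite F" "norm (a f - a (restr d F f)) < e"
proof -
  define h where "h x = Re (f x \<bullet>c f x)" for x
  have fc: "f x \<in> carrier_vec d" for x by (rule ops_carrier[OF f])
  have hs: "h summable_on UNIV" using f by (simp add: one_particle_space_def h_def[abs_def])
  then have "(h has_sum infsum h UNIV) UNIV" by simp
  then have "((\<lambda>F. sum h F) \<longlongrightarrow> infsum h UNIV) (finite_subsets_at_top UNIV)" by (simp add: has_sum_def)
  then have "\<forall>\<^sub>F F in finite_subsets_at_top UNIV. dist (sum h F) (infsum h UNIV) < e\<^sup>2"
    using e by (intro tendstoD) auto
  then obtain F where F: "finite F" "dist (sum h F) (infsum h UNIV) < e\<^sup>2"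
    unfolding eventually_finite_subsets_at_top by blast
  let ?g = "restr d (- F) f"
  have g: "?g \<in> ops d UNIV" using ops_restr[OF f, of "- F"] ops_UNIV by blast
  have "(h has_sum (infsum h UNIV - sum h F)) (UNIV - F)"
    by (rule has_sum_Diff) (use hs F in auto)
  from has_sum_bounded_linear[OF bounded_linear_of_real this]
  have "((\<lambda>x. complex_of_real (h x)) has_sum complex_of_real (infsum h UNIV - sum h F)) (- F)"
    by (simp add: o_def Compl_eq_Diff_UNIV)
  moreover have "one_particle_inner ?g ?g = infsum (\<lambda>x. complex_of_real (h x)) (- F)"
    unfolding one_particle_inner_def
    by (rule infsum_cong_neutral) (auto simp: restr_def h_def conj_square_real(1)[OF fc, symmetric])
  ultimately have "one_particle_inner ?g ?g = complex_of_real (infsum h UNIV - sum h F)"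
    by (simp add: infsumI)
  then have "(norm (a ?g))\<^sup>2 \<le> \<bar>infsum h UNIV - sum h F\<bar>"
    using norm_a_le[OF g] by (metis norm_of_real)
  also have "\<dots> < e\<^sup>2" using F(2) by (simp add: dist_real_def abs_minus_commute)
  finally have ng: "norm (a ?g) < e" using e by (simp add: power_less_imp_less_base)
  have "f = (\<lambda>x. restr d F f x + ?g x)"
    by (rule ext) (use fc in \<open>auto simp: restr_def\<close>)
  then have "a f = a (restr d F f) + a ?g"
    using a_add[OF _ g, of "restr d F f"] ops_restr[OF f, of F] ops_UNIV by metis
  with F(1) ng show thesis by (intro that[of F]) auto
qed

text \<open>The local algebra before closure, so that statements about it follow by induction over
  generators.\<close>

definition Loc :: "int set \<Rightarrow> 'a set"
  where "Loc X = star_subalgebra (a ` ops d X)"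

lemma Loc_mono: "X \<subseteq> Y \<Longrightarrow> Loc X \<subseteq> Loc Y"
  unfolding Loc_def by (intro star_subalgebra_mono image_mono ops_mono)

definition locals :: "'a set"
  where "locals = (\<Union>X\<in>{X. finite X}. Loc X)"

lemma locals_dense: "closure locals = UNIV"
proof -
  have comb: "\<exists>X. finite X \<and> x \<in> Loc X \<and> y \<in> Loc X" if xy: "x \<in> locals" "y \<in> locals" for x y
  proof -
    obtain X where "finite X" "x \<in> Loc X" using xy(1) by (auto simp: locals_def)
    moreover obtain Y where "finite Y" "y \<in> Loc Y" using xy(2) by (auto simp: locals_def)
    moreover have "Loc X \<subseteq> Loc (X \<union> Y)" "Loc Y \<subseteq> Loc (X \<union> Y)" by (simp_all add: Loc_mono)
    ultimately show ?thesis by (intro exI[of _ "X \<union> Y"]) blast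
  qed
  have localsI: "x \<in> locals" if "finite X" "x \<in> Loc X" for x X
    using that by (auto simp: locals_def)
  have ladd: "x + y \<in> locals" and lmult: "x * y \<in> locals" if xy: "x \<in> locals" "y \<in> locals" for x y
  proof -
    obtain X where X: "finite X" "x \<in> Loc X" "y \<in> Loc X" using comb[OF xy] by blast
    have "x + y \<in> Loc X" "x * y \<in> Loc X"
      using X(2,3) unfolding Loc_def by (rule star_subalgebra.add, rule star_subalgebra.mult)
    then show "x + y \<in> locals" "x * y \<in> locals" using localsI[OF X(1)] by auto
  qed
  have lscale: "c *\<^sub>C x \<in> locals" and lstar: "star x \<in> locals" if x: "x \<in> locals" for x c
  proof -
    obtain X where X: "finite X" "x \<in> Loc X" using comb[OF x x] by blast
    have "c *\<^sub>C x \<in> Loc X" "star x \<in> Loc X"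
      using X(2) unfolding Loc_def by (rule star_subalgebra.scale, rule star_subalgebra.star)
    then show "c *\<^sub>C x \<in> locals" "star x \<in> locals" using localsI[OF X(1)] by auto
  qed
  have "star_subalgebra (a ` ops d UNIV) \<subseteq> closure locals"
  proof
    fix x assume "x \<in> star_subalgebra (a ` ops d UNIV)"
    then show "x \<in> closure locals"
    proof induction
      case (gen x)
      then obtain f where f: "f \<in> ops d UNIV" "x = a f" by blast
      have "\<exists>y\<in>locals. dist y x < e" if e: "e > 0" for e
      proof -
        obtain F where F: "finite F" "norm (a f - a (restr d F f)) < e" using a_approx_finite[OF f(1) e] .
        have "a (restr d F f) \<in> Loc F"
          unfolding Loc_def using ops_restr[OF f(1), of F] by (auto intro: star_subalgebra.gen)
        then show ?thesis using F f(2)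
          by (intro bexI[of _ "a (restr d F f)"]) (auto simp: locals_def dist_norm norm_minus_commute)
      qed
      then show ?case by (simp add: closure_approachable)
    next
      case unit
      have "1 \<in> Loc {}" unfolding Loc_def by (rule star_subalgebra.unit)
      then show ?case using closure_subset[of locals] by (auto simp: locals_def)
    next
      case (add x y)
      obtain f g where "\<And>n. f n \<in> locals" "f \<longlonglongrightarrow> x" "\<And>n. g n \<in> locals" "g \<longlonglongrightarrow> y"
        using add.IH unfolding closure_sequential by blast
      then show ?case unfolding closure_sequential
        by (intro exI[of _ "\<lambda>n. f n + g n"]) (simp add: tendsto_add ladd)
    next
      case (scale x c)
      obtain f where "\<And>n. f n \<in> locals" "f \<longlonglongrightarrow> x"
        using scale.IH unfolding closure_sequential by blast
      moreover have bl: "bounded_linear (\<lambda>x :: 'a. c *\<^sub>C x)"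
        by (rule bounded_linear_intro[where K = "cmod c"])
          (simp_all add: scaleC_add_right norm_scaleC scaleC_scaleC mult.commute flip: scaleC_of_real)
      ultimately show ?case unfolding closure_sequential
        by (intro exI[of _ "\<lambda>n. c *\<^sub>C f n"] conjI allI lscale bounded_linear.tendsto[OF bl])
    next
      case (mult x y)
      obtain f g where "\<And>n. f n \<in> locals" "f \<longlonglongrightarrow> x" "\<And>n. g n \<in> locals" "g \<longlonglongrightarrow> y"
        using mult.IH unfolding closure_sequential by blast
      then show ?case unfolding closure_sequential
        by (intro exI[of _ "\<lambda>n. f n * g n"]) (simp add: tendsto_mult lmult)
    next
      case (star x)
      obtain f where "\<And>n. f n \<in> locals" "f \<longlonglongrightarrow> x"
        using star.IH unfolding closure_sequential by blast
      then show ?case unfolding closure_sequential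
        by (intro exI[of _ "\<lambda>n. star (f n)"]) (simp add: bounded_linear.tendsto[OF bounded_linear_star] lstar)
    qed
  qed
  then have "closure (star_subalgebra (a ` ops d UNIV)) \<subseteq> closure locals"
    by (rule closure_minimal) simp
  then show ?thesis using total by auto
qed

lemma a_flip: "f \<in> ops d UNIV \<Longrightarrow> a (flip_sign f) = - a f"
proof -
  assume f: "f \<in> ops d UNIV"
  have "flip_sign f = (\<lambda>x. (- 1) \<cdot>\<^sub>v f x)"
    using ops_carrier[OF f] by (intro ext eq_vecI) (auto simp: flip_sign_def)
  then show ?thesis using a_scale[OF f, of "- 1"] by simp
qed

end

locale car_parity = car d a for d and a :: "one_particle \<Rightarrow> 'a::cstar_algebra" +
  fixes \<Theta> :: "'a \<Rightarrow> 'a"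
  assumes parity: "is_bogoliubov d a 0 flip_sign \<Theta>"
begin

lemma \<Theta>_simps: "\<Theta> (x + y) = \<Theta> x + \<Theta> y" "\<Theta> (x * y) = \<Theta> x * \<Theta> y" "\<Theta> (c *\<^sub>C x) = c *\<^sub>C \<Theta> x"
  "\<Theta> (star x) = star (\<Theta> x)" "f \<in> ops d X \<Longrightarrow> \<Theta> (a f) = - a f" "\<Theta> 1 = 1" "\<Theta> 0 = 0" "\<Theta> (- x) = - \<Theta> x" "\<Theta> (x - y) = \<Theta> x - \<Theta> y"
proof -
  have b: "surj \<Theta>" using parity by (simp add: is_bogoliubov_def bij_def)
  show *: "\<Theta> (x + y) = \<Theta> x + \<Theta> y" "\<Theta> (x * y) = \<Theta> x * \<Theta> y" "\<Theta> (c *\<^sub>C x) = c *\<^sub>C \<Theta> x"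
    "\<Theta> (star x) = star (\<Theta> x)" for x y c
    using parity by (auto simp: is_bogoliubov_def)
  show "f \<in> ops d X \<Longrightarrow> \<Theta> (a f) = - a f"
    using parity ops_UNIV[of f X] by (auto simp: is_bogoliubov_def a_flip)
  obtain z where z: "\<Theta> z = 1" using b by (metis surjD)
  show "\<Theta> 1 = 1" using *(2)[of 1 z] z by simp
  show "\<Theta> 0 = 0" using *(3)[of 0 0] by simp
  show m: "\<Theta> (- x) = - \<Theta> x" for x using *(3)[of "- 1" x] by simp
  show "\<Theta> (x - y) = \<Theta> x - \<Theta> y" using *(1)[of x "- y"] m by simp
qed

lemma \<Theta>_Loc:
  assumes "x \<in> Loc X"
  shows "\<Theta> x \<in> Loc X" "\<Theta> (\<Theta> x) = x"
proof -
  have "\<Theta> x \<in> Loc X \<and> \<Theta> (\<Theta> x) = x" using assms unfolding Loc_def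
  proof induction
    case (gen x)
    then obtain f where f: "f \<in> ops d X" "x = a f" by blast
    moreover have "(- 1) *\<^sub>C x \<in> star_subalgebra (a ` ops d X)"
      using gen by (intro star_subalgebra.scale star_subalgebra.gen)
    ultimately show ?case by (simp add: \<Theta>_simps)
  next
    case unit
    show ?case by (simp add: \<Theta>_simps star_subalgebra.unit)
  next
    case (add x y)
    then show ?case by (simp add: \<Theta>_simps star_subalgebra.add)
  next
    case (scale x c)
    then show ?case by (simp add: \<Theta>_simps star_subalgebra.scale)
  next
    case (mult x y)
    then show ?case by (simp add: \<Theta>_simps star_subalgebra.mult)
  next
    case (star x)
    then show ?case by (simp add: \<Theta>_simps star_subalgebra.star)
  qed
  then show "\<Theta> x \<in> Loc X" "\<Theta> (\<Theta> x) = x" by auto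
qed

text \<open>The property that moving \<open>x\<close> past \<open>a g\<close> or its adjoint applies
  the parity is stable under products, so it reduces to generators. The induction carries
  \<open>star x\<close> along, since adjoints are among the generating operations.\<close>

lemma Loc_a_commute:
  assumes "x \<in> Loc X" and g: "g \<in> ops d Y" and XY: "X \<inter> Y = {}"
  shows "x * a g = a g * \<Theta> x" "x * star (a g) = star (a g) * \<Theta> x"
proof -
  have gU: "g \<in> ops d UNIV" using g ops_UNIV by blast
  define Q where "Q x \<longleftrightarrow> x * a g = a g * \<Theta> x \<and> x * star (a g) = star (a g) * \<Theta> x" for x
  have Qm: "Q (x * y)" if "Q x" "Q y" for x y
  proof -
    have *: "x * y * z = z * (\<Theta> x * \<Theta> y)" if "x * z = z * \<Theta> x" "y * z = z * \<Theta> y" for z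
    proof -
      have "x * y * z = (x * z) * \<Theta> y" unfolding mult.assoc that(2) ..
      then show ?thesis unfolding that(1) mult.assoc .
    qed
    show ?thesis using *[of "a g"] *[of "star (a g)"] that unfolding Q_def \<Theta>_simps(2) by blast
  qed
  have Qa: "Q (x + y)" if "Q x" "Q y" for x y
    using that unfolding Q_def by (simp add: \<Theta>_simps(1) distrib_left distrib_right)
  have Qs: "Q (c *\<^sub>C x)" if "Q x" for x c
    using that unfolding Q_def by (simp add: \<Theta>_simps(3) mult_scaleC_left mult_scaleC_right)
  have "Q x \<and> Q (star x)"
    using assms(1) unfolding Loc_def
  proof induction
    case (gen x)
    then obtain f where f: "f \<in> ops d X" "x = a f" by blast
    have fU: "f \<in> ops d UNIV" using f ops_UNIV by blast
    have 1: "a f * a g = - (a g * a f)" using aa[OF fU gU] by (simp add: eq_neg_iff_add_eq_0)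
    have 2: "a f * star (a g) = - (star (a g) * a f)"
      using as[OF fU gU] one_particle_inner_disjoint[OF f(1) g XY] by (simp add: eq_neg_iff_add_eq_0)
    have 3: "star (a f) * a g = - (a g * star (a f))"
      using arg_cong[OF 2, of star] by (simp add: star_mult star_star star_minus)
    have 4: "star (a f) * star (a g) = - (star (a g) * star (a f))"
      using arg_cong[OF 1, of star] by (simp add: star_mult star_minus)
    show ?case unfolding Q_def f(2) \<Theta>_simps(4) \<Theta>_simps(5)[OF f(1)] 1 2 3 4 by (simp add: star_minus)
  next
    case unit
    then show ?case by (simp add: Q_def \<Theta>_simps)
  next
    case (add x y)
    then show ?case unfolding star_add using Qa by blast
  next
    case (scale x c)
    then show ?case unfolding star_scaleC using Qs by blast
  next
    case (mult x y)
    then show ?case unfolding star_mult using Qm by blast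
  next
    case (star x)
    then show ?case unfolding star_star by blast
  qed
  then show "x * a g = a g * \<Theta> x" "x * star (a g) = star (a g) * \<Theta> x" by (auto simp: Q_def)
qed

text \<open>Graded commutation for elements without definite parity: the even part of
  \<open>y\<close> passes \<open>x\<close>, the odd part turns \<open>x\<close> into
  \<open>\<Theta> x\<close>. Both parts are doubled to avoid halves.\<close>

lemma Loc_graded_commute:
  assumes "y \<in> Loc Y" and x: "x \<in> Loc X" and XY: "X \<inter> Y = {}"
  shows "2 *\<^sub>R (x * y) = (y + \<Theta> y) * x + (y - \<Theta> y) * \<Theta> x"
proof -
  let ?P = "\<lambda>y. \<forall>x\<in>Loc X. 2 *\<^sub>R (x * y) = (y + \<Theta> y) * x + (y - \<Theta> y) * \<Theta> x"
  have "?P y \<and> ?P (star y)"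
    using assms(1) unfolding Loc_def[of Y]
  proof induction
    case (gen y)
    then obtain g where "g \<in> ops d Y" "y = a g" by blast
    moreover have "2 *\<^sub>R (x * z) = (z - z) * x + (z - - z) * \<Theta> x" if "x * z = z * \<Theta> x" for x z
      using that by (simp add: scaleR_2 distrib_right)
    ultimately show ?case using Loc_a_commute[OF _ _ XY] by (simp add: \<Theta>_simps star_minus)
  next
    case (mult y z)
    have *: "?P (y * z)" if P: "?P y" "?P z" for y z
    proof
      fix x assume x: "x \<in> Loc X"
      note \<Theta>x = \<Theta>_Loc[OF x]
      have "2 *\<^sub>R 2 *\<^sub>R (x * (y * z)) = 2 *\<^sub>R ((2 *\<^sub>R (x * y)) * z)" by (simp add: mult.assoc)
      also have "2 *\<^sub>R (x * y) = (y + \<Theta> y) * x + (y - \<Theta> y) * \<Theta> x" using P x by blast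
      also have "2 *\<^sub>R (((y + \<Theta> y) * x + (y - \<Theta> y) * \<Theta> x) * z) =
          (y + \<Theta> y) * (2 *\<^sub>R (x * z)) + (y - \<Theta> y) * (2 *\<^sub>R (\<Theta> x * z))"
        by (simp add: algebra_simps scaleR_add_right)
      also have "2 *\<^sub>R (x * z) = (z + \<Theta> z) * x + (z - \<Theta> z) * \<Theta> x" using P x by blast
      also have "2 *\<^sub>R (\<Theta> x * z) = (z + \<Theta> z) * \<Theta> x + (z - \<Theta> z) * x" using P \<Theta>x by metis
      also have "(y + \<Theta> y) * ((z + \<Theta> z) * x + (z - \<Theta> z) * \<Theta> x) +
            (y - \<Theta> y) * ((z + \<Theta> z) * \<Theta> x + (z - \<Theta> z) * x) =
          2 *\<^sub>R ((y * z + \<Theta> (y * z)) * x + (y * z - \<Theta> (y * z)) * \<Theta> x)"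
        by (simp add: \<Theta>_simps scaleR_2 algebra_simps)
      finally show "2 *\<^sub>R (x * (y * z)) = (y * z + \<Theta> (y * z)) * x + (y * z - \<Theta> (y * z)) * \<Theta> x"
        by (metis real_vector.scale_cancel_left zero_neq_numeral)
    qed
    show ?case using mult.IH * by (simp add: star_mult)
  next
    case (scale y c)
    have *: "?P (c *\<^sub>C y)" if "?P y" for y c
    proof
      fix x assume "x \<in> Loc X"
      then have "c *\<^sub>C (2 *\<^sub>R (x * y)) = c *\<^sub>C ((y + \<Theta> y) * x + (y - \<Theta> y) * \<Theta> x)" using that by metis
      then show "2 *\<^sub>R (x * c *\<^sub>C y) = (c *\<^sub>C y + \<Theta> (c *\<^sub>C y)) * x + (c *\<^sub>C y - \<Theta> (c *\<^sub>C y)) * \<Theta> x"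
        by (simp add: \<Theta>_simps mult_scaleC_left mult_scaleC_right scaleR_2 scaleC_add_right scaleC_diff_right algebra_simps)
    qed
    show ?case using scale.IH * by (simp add: star_scaleC)
  next
    case (add y z)
    have *: "?P (y + z)" if "?P y" "?P z" for y z
      using that by (simp add: \<Theta>_simps scaleR_add_right algebra_simps)
    show ?case using add.IH * by (simp add: star_add)
  next
    case unit
    show ?case by (simp add: \<Theta>_simps scaleR_2 mult_2)
  next
    case (star y)
    then show ?case by (simp add: star_star)
  qed
  then show ?thesis using x by blast
qed

lemma Loc_even_commute:
  assumes "x \<in> Loc X" "y \<in> Loc Y" "X \<inter> Y = {}" "\<Theta> y = y"
  shows "x * y = y * x"
proof -
  have "2 *\<^sub>R (x * y) = 2 *\<^sub>R (y * x)"
    using Loc_graded_commute[OF assms(2,1,3)] assms(4) by (simp add: scaleR_2 algebra_simps)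
  then show ?thesis by (metis real_vector.scale_cancel_left zero_neq_numeral)
qed

lemma Loc_odd_anticommute:
  assumes "x \<in> Loc X" "y \<in> Loc Y" "X \<inter> Y = {}" "\<Theta> x = - x" "\<Theta> y = - y"
  shows "x * y = - (y * x)"
proof -
  have "2 *\<^sub>R (x * y) = 2 *\<^sub>R (- (y * x))"
    using Loc_graded_commute[OF assms(2,1,3)] assms(4,5) by (simp add: scaleR_2 algebra_simps)
  then show ?thesis by (metis real_vector.scale_cancel_left zero_neq_numeral)
qed

lemma \<Theta>_modes: "\<Theta> (mode_annihilator d a k) = - mode_annihilator d a k"
  unfolding mode_annihilator_eq by (rule \<Theta>_simps(5)[OF lmode_ops])

lemma \<Theta>_word: "\<Theta> (modes.word xs) = (- 1) ^ length xs *\<^sub>C modes.word xs"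
  by (induction xs) (simp_all add: \<Theta>_simps \<Theta>_modes star_minus scaleC_minus_left scaleC_minus_right mult_scaleC_right)

lemma \<Theta>_vac: "\<Theta> (modes.vac n) = modes.vac n"
  by (induction n) (simp_all add: modes.vac_Suc modes.num_def \<Theta>_simps \<Theta>_modes star_minus)

lemma \<Theta>_unit:
  assumes "finite S" "finite T"
  shows "\<Theta> (modes.unit n S T) = (- 1) ^ (card S + card T) *\<^sub>C modes.unit n S T"
  unfolding modes.unit_def \<Theta>_simps(2,4) \<Theta>_word \<Theta>_vac
  by (simp add: star_scaleC mult_scaleC_left mult_scaleC_right scaleC_scaleC power_add mult.commute)

lemma word_Loc: "set xs \<subseteq> {..<d * N} \<Longrightarrow> modes.word xs \<in> Loc {0..<int N}"
proof (induction xs)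
  case (Cons k xs)
  then have "mode_annihilator d a k \<in> Loc {0..<int N}"
    unfolding mode_annihilator_eq Loc_def by (intro star_subalgebra.gen imageI lmode_ops') auto
  moreover have "modes.word xs \<in> Loc {0..<int N}" using Cons by simp
  ultimately show ?case
    unfolding Loc_def modes.word_simps by (intro star_subalgebra.mult star_subalgebra.star)
qed (simp add: Loc_def star_subalgebra.unit)

lemma vac_Loc: "n \<le> d * N \<Longrightarrow> modes.vac n \<in> Loc {0..<int N}"
proof (induction n)
  case (Suc n)
  then have "mode_annihilator d a n \<in> Loc {0..<int N}"
    unfolding mode_annihilator_eq Loc_def by (intro star_subalgebra.gen imageI lmode_ops') auto
  moreover have "modes.vac n \<in> Loc {0..<int N}" using Suc by simp
  ultimately show ?case
    unfolding Loc_def modes.vac_Suc modes.num_def by (intro star_subalgebra.mult star_subalgebra.star)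
qed (simp add: Loc_def star_subalgebra.unit)

lemma unit_Loc:
  assumes "S \<subseteq> {..<d * N}" "T \<subseteq> {..<d * N}"
  shows "modes.unit (d * N) S T \<in> Loc {0..<int N}"
proof -
  have "finite S" "finite T" using assms finite_subset by blast+
  then show ?thesis
    using assms word_Loc[of "sorted_list_of_set S" N] word_Loc[of "sorted_list_of_set T" N] vac_Loc[of "d * N" N]
    unfolding modes.unit_def Loc_def by (intro star_subalgebra.mult star_subalgebra.star) simp_all
qed

end

section \<open>Clustering of pure translation invariant states\<close>

lemma tendsto_0_approx:
  fixes f :: "'i \<Rightarrow> complex"
  assumes "\<And>e. e > 0 \<Longrightarrow> \<exists>g. (g \<longlongrightarrow> 0) F \<and> (\<forall>N. cmod (f N) \<le> cmod (g N) + e)"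
  shows "(f \<longlongrightarrow> 0) F"
proof (rule tendstoI)
  fix e :: real assume e: "e > 0"
  obtain g where g: "(g \<longlongrightarrow> 0) F" "\<And>N. cmod (f N) \<le> cmod (g N) + e / 2"
    using assms[of "e / 2"] e by auto
  have "\<forall>\<^sub>F N in F. dist (g N) 0 < e / 2" by (rule tendstoD[OF g(1)]) (use e in simp)
  then show "\<forall>\<^sub>F N in F. dist (f N) 0 < e"
  proof eventually_elim
    case (elim N)
    then show ?case using g(2)[of N] by simp
  qed
qed

lemma compact_complex_box: "compact ((\<lambda>p. Complex (fst p) (snd p)) ` ({- K..K} \<times> {- K..K}))"
proof (rule compact_continuous_image)
  show "continuous_on ({- K..K} \<times> {- K..K}) (\<lambda>p. Complex (fst p) (snd p))"
    unfolding Complex_eq by (intro continuous_intros)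
qed (intro compact_Times compact_Icc)

text \<open>Compactness of a product of boxes. A filter takes the place of a subsequence, because
  convergence is wanted simultaneously at all \<open>x\<close>, of which there may be uncountably
  many.\<close>

lemma cluster_functional:
  fixes \<phi> :: "'i \<Rightarrow> 'a \<Rightarrow> complex"
  assumes F: "F \<noteq> bot" and bnd: "\<And>i x. cmod (\<phi> i x) \<le> K x"
  obtains G l where "G \<noteq> bot" "G \<le> F" "\<And>x. ((\<lambda>i. \<phi> i x) \<longlongrightarrow> l x) G"
proof -
  let ?box = "\<lambda>K. (\<lambda>p. Complex (fst p) (snd p)) ` ({- K..K} \<times> {- K..K})"
  let ?K = "PiE UNIV (\<lambda>x. ?box (K x))"
  have "compactin (product_topology (\<lambda>_. euclidean) UNIV) ?K"
    unfolding compactin_PiE by (simp only: compactin_euclidean_iff compact_complex_box) simp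
  then have "compact ?K" by (simp add: euclidean_product_topology)
  moreover have "\<phi> i x \<in> ?box (K x)" for i x
    by (rule image_eqI[of _ _ "(Re (\<phi> i x), Im (\<phi> i x))"])
      (use bnd[of i x] abs_Re_le_cmod[of "\<phi> i x"] abs_Im_le_cmod[of "\<phi> i x"] in auto)
  then have "\<forall>\<^sub>F f in filtermap \<phi> F. f \<in> ?K"
    by (simp only: eventually_filtermap PiE_UNIV_domain) simp
  moreover have "filtermap \<phi> F \<noteq> bot" using F by (simp add: filtermap_bot_iff)
  ultimately obtain l where l: "inf (nhds l) (filtermap \<phi> F) \<noteq> bot"
    unfolding compact_filter[of ?K] by blast
  \<comment> \<open>\<open>F\<close> refined by the preimages of the neighbourhoods of the cluster
    point.\<close>
  define G where "G = inf F (filtercomap \<phi> (nhds l))"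
  have "G \<noteq> bot"
  proof
    assume "G = bot"
    then obtain P Q where P: "eventually P F" and Q: "eventually Q (nhds l)" and PQ: "\<And>i. P i \<Longrightarrow> Q (\<phi> i) \<Longrightarrow> False"
      unfolding G_def trivial_limit_def eventually_inf eventually_filtercomap by blast
    have "eventually (\<lambda>y. \<not> Q y) (filtermap \<phi> F)"
      unfolding eventually_filtermap using P by (rule eventually_mono) (use PQ in blast)
    then have "inf (nhds l) (filtermap \<phi> F) = bot"
      unfolding trivial_limit_def eventually_inf using Q by blast
    then show False using l by simp
  qed
  moreover have "((\<lambda>i. \<phi> i x) \<longlongrightarrow> l x) G" for x
  proof -
    have "(\<phi> \<longlongrightarrow> l) G"
      unfolding G_def filterlim_def
      by (metis filtermap_filtercomap filtermap_mono inf.cobounded2 order.trans)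
    note lim = this
    show ?thesis
    proof (rule topological_tendstoI)
      fix S assume S: "open S" "l x \<in> S"
      have "open ((\<lambda>f :: 'a \<Rightarrow> complex. f x) -` S)" using S(1) by (rule open_vimage) simp
      from topological_tendstoD[OF lim this] S(2) show "\<forall>\<^sub>F i in G. \<phi> i x \<in> S" by simp
    qed
  qed
  ultimately show thesis by (intro that[of G l]) (simp_all add: G_def)
qed

lemma pure_state_dominates:
  fixes \<omega> \<phi> :: "'a::cstar_algebra \<Rightarrow> complex"
  assumes pure: "is_pure \<omega>"
    and \<phi>: "\<And>x y. \<phi> (x + y) = \<phi> x + \<phi> y" "\<And>c x. \<phi> (c *\<^sub>C x) = c * \<phi> x"
    and pos: "\<And>x. Im (\<phi> (star x * x)) = 0" "\<And>x. 0 \<le> Re (\<phi> (star x * x))"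
      "\<And>x. Re (\<phi> (star x * x)) \<le> K * Re (\<omega> (star x * x))"
  shows "\<phi> x = \<phi> 1 * \<omega> x"
proof -
  have st: "is_state \<omega>" using pure by (simp add: is_pure_def)
  then have \<omega>: "\<And>x y. \<omega> (x + y) = \<omega> x + \<omega> y" "\<And>c x. \<omega> (c *\<^sub>C x) = c * \<omega> x" "\<omega> 1 = 1"
    "\<And>x. Im (\<omega> (star x * x)) = 0" "\<And>x. 0 \<le> Re (\<omega> (star x * x))"
    by (auto simp: is_state_def less_eq_complex_def)
  \<comment> \<open>The maximum makes the constant positive, so that it can be divided by.\<close>
  define C where "C = max K 1"
  have C: "C > 0" by (simp add: C_def)
  have le: "Re (\<phi> (star x * x)) \<le> C * Re (\<omega> (star x * x))" for x
    by (rule order.trans[OF pos(3)]) (simp add: C_def mult_right_mono \<omega>)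
  define r where "r = Re (\<phi> 1) / C"
  have r: "0 \<le> r" "r \<le> 1" using pos(2)[of 1] le[of 1] C \<omega>(3) by (simp_all add: r_def)
  have \<phi>1: "\<phi> 1 = complex_of_real (C * r)"
    using pos(1)[of 1] C by (simp add: r_def complex_eq_iff)
  \<comment> \<open>\<open>\<omega>\<close> is the sum of \<open>(\<phi> / C + \<omega>) / 3\<close>
    and \<open>(2 * \<omega> - \<phi> / C) / 3\<close>; normalised, these are the states
    \<open>\<psi>\<close> and \<open>\<chi>\<close>. The extra share of \<open>\<omega>\<close>
    keeps the weight \<open>t\<close> between 1/3 and 2/3, so the extreme cases
    \<open>\<phi> = 0\<close> and \<open>\<phi> = C * \<omega>\<close> need no separate
    treatment.\<close>
  define \<psi> where "\<psi> x = (\<phi> x / C + \<omega> x) / (1 + complex_of_real r)" for x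
  define \<chi> where "\<chi> x = (2 * \<omega> x - \<phi> x / C) / (2 - complex_of_real r)" for x
  define t where "t = (1 + r) / 3"
  have nz: "1 + complex_of_real r \<noteq> 0" "2 - complex_of_real r \<noteq> 0"
    using r by (auto simp: complex_eq_iff)
  have eqs: "1 + complex_of_real r = complex_of_real (1 + r)" "2 - complex_of_real r = complex_of_real (2 - r)"
    by simp_all
  have "is_state \<psi>" unfolding is_state_def
  proof (intro conjI allI)
    fix x y c
    show "\<psi> (x + y) = \<psi> x + \<psi> y" "\<psi> (c *\<^sub>C x) = c * \<psi> x"
      by (simp_all add: \<psi>_def \<phi> \<omega> add_divide_distrib algebra_simps)
    show "\<psi> 1 = 1" using nz C by (simp add: \<psi>_def \<omega> \<phi>1 field_simps)
    show "0 \<le> \<psi> (star x * x)" unfolding \<psi>_def eqs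
      using r C pos(1,2)[of x] \<omega>(4,5)[of x] by (simp add: less_eq_complex_def)
  qed
  moreover have "is_state \<chi>" unfolding is_state_def
  proof (intro conjI allI)
    fix x y c
    show "\<chi> (x + y) = \<chi> x + \<chi> y" "\<chi> (c *\<^sub>C x) = c * \<chi> x"
      by (simp_all add: \<chi>_def \<phi> \<omega> add_divide_distrib diff_divide_distrib algebra_simps)
    show "\<chi> 1 = 1" using nz C by (simp add: \<chi>_def \<omega> \<phi>1 field_simps)
    have "Re (\<phi> (star x * x)) / C \<le> Re (\<omega> (star x * x))"
      using le[of x] C by (simp add: field_simps)
    then have "0 \<le> 2 * Re (\<omega> (star x * x)) - Re (\<phi> (star x * x)) / C" using \<omega>(5)[of x] by linarith
    then show "0 \<le> \<chi> (star x * x)" unfolding \<chi>_def eqs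
      using r C pos(1)[of x] \<omega>(4)[of x] by (simp add: less_eq_complex_def)
  qed
  moreover have "0 < t" "t < 1" using r by (auto simp: t_def)
  moreover have "\<omega> x = complex_of_real t * \<psi> x + complex_of_real (1 - t) * \<chi> x" for x
  proof -
    have canc: "a / 3 * (b / a) = b / 3" if "a \<noteq> 0" for a b :: complex using that by simp
    have t: "complex_of_real t = (1 + complex_of_real r) / 3"
      by (simp add: t_def)
    have "complex_of_real (1 - t) = (2 - complex_of_real r) / 3"
      by (simp add: t field_simps)
    then have "complex_of_real (1 - t) * \<chi> x = (2 * \<omega> x - \<phi> x / C) / 3"
      using canc[OF nz(2)] by (simp only: \<chi>_def)
    moreover have "complex_of_real t * \<psi> x = (\<phi> x / C + \<omega> x) / 3"
      using canc[OF nz(1)] by (simp only: \<psi>_def t)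
    ultimately have "complex_of_real t * \<psi> x + complex_of_real (1 - t) * \<chi> x
        = (\<phi> x / C + \<omega> x) / 3 + (2 * \<omega> x - \<phi> x / C) / 3" by (simp only:)
    then show ?thesis by (simp add: field_simps)
  qed
  ultimately have "\<psi> = \<omega>" using pure unfolding is_pure_def by blast
  then have "\<psi> x = \<omega> x" by simp
  then have "\<phi> x / C + \<omega> x = \<omega> x * (1 + complex_of_real r)"
    using nz by (simp add: \<psi>_def divide_eq_eq)
  then show ?thesis using C by (simp add: \<phi>1 field_simps)
qed

locale chain = car_parity d a \<Theta> + gns \<omega> \<pi>0 \<Omega>
  for d and a :: "one_particle \<Rightarrow> 'a::cstar_algebra" and \<Theta> \<omega> and \<pi>0 :: "'a \<Rightarrow> 'h::complex_hilbert \<Rightarrow> 'h" and \<Omega> +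
  fixes \<sigma> :: "nat \<Rightarrow> 'a \<Rightarrow> 'a"
  assumes pure: "is_pure \<omega>"
    and shift: "\<And>N. is_bogoliubov d a 0 (shift (int N)) (\<sigma> N)"
    and shift_invariant: "\<And>N A. \<omega> (\<sigma> N A) = \<omega> A"
    and parity_invariant: "\<And>A. \<omega> (\<Theta> A) = \<omega> A"
begin

lemma \<sigma>_simps: "\<sigma> N (x + y) = \<sigma> N x + \<sigma> N y" "\<sigma> N (x * y) = \<sigma> N x * \<sigma> N y" "\<sigma> N (c *\<^sub>C x) = c *\<^sub>C \<sigma> N x"
  "\<sigma> N (star x) = star (\<sigma> N x)" "\<sigma> N 1 = 1" "\<sigma> N (- x) = - \<sigma> N x" "\<sigma> N (x - y) = \<sigma> N x - \<sigma> N y"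
proof -
  have b: "surj (\<sigma> N)" using shift[of N] by (simp add: is_bogoliubov_def bij_def)
  show *: "\<sigma> N (x + y) = \<sigma> N x + \<sigma> N y" "\<sigma> N (x * y) = \<sigma> N x * \<sigma> N y" "\<sigma> N (c *\<^sub>C x) = c *\<^sub>C \<sigma> N x"
    "\<sigma> N (star x) = star (\<sigma> N x)" for x y c
    using shift[of N] by (auto simp: is_bogoliubov_def)
  obtain z where z: "\<sigma> N z = 1" using b by (metis surjD)
  show "\<sigma> N 1 = 1" using *(2)[of 1 z] z by simp
  show m: "\<sigma> N (- x) = - \<sigma> N x" for x using *(3)[of "- 1" x] by simp
  show "\<sigma> N (x - y) = \<sigma> N x - \<sigma> N y" using *(1)[of x "- y"] m by simp
qed

lemma \<sigma>_a: "f \<in> ops d X \<Longrightarrow> \<sigma> N (a f) = a (shift (int N) f)"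
  using shift[of N] ops_UNIV[of f X] by (auto simp: is_bogoliubov_def)

lemma \<sigma>_Loc:
  assumes "x \<in> Loc X"
  shows "\<sigma> N x \<in> Loc ((+) (int N) ` X)" "\<Theta> (\<sigma> N x) = \<sigma> N (\<Theta> x)"
proof -
  let ?S = "star_subalgebra (a ` ops d ((+) (int N) ` X))"
  have "\<sigma> N x \<in> ?S \<and> \<Theta> (\<sigma> N x) = \<sigma> N (\<Theta> x)" using assms unfolding Loc_def
  proof induction
    case (gen x)
    then obtain f where f: "f \<in> ops d X" "x = a f" by blast
    then show ?case using ops_shift[OF f(1), of "int N"]
      by (auto simp: \<sigma>_a[OF f(1)] \<Theta>_simps \<sigma>_simps intro: star_subalgebra.gen)
  next
    case unit
    show ?case by (simp add: \<sigma>_simps \<Theta>_simps star_subalgebra.unit)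
  next
    case (add x y)
    then show ?case by (simp add: \<sigma>_simps \<Theta>_simps star_subalgebra.add)
  next
    case (scale x c)
    then show ?case by (simp add: \<sigma>_simps \<Theta>_simps star_subalgebra.scale)
  next
    case (mult x y)
    then show ?case by (simp add: \<sigma>_simps \<Theta>_simps star_subalgebra.mult)
  next
    case (star x)
    then show ?case by (simp add: \<sigma>_simps \<Theta>_simps star_subalgebra.star)
  qed
  then show "\<sigma> N x \<in> Loc ((+) (int N) ` X)" "\<Theta> (\<sigma> N x) = \<sigma> N (\<Theta> x)" by (simp_all add: Loc_def)
qed

lemma norm_\<Omega>: "norm \<Omega> = 1"
proof -
  have "\<omega> 1 = 1" using pure by (simp add: is_pure_def is_state_def)
  then have "(norm \<Omega>)\<^sup>2 = 1" by (simp add: state_eq rep_simps cinner_self flip: of_real_power)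
  then show ?thesis using norm_ge_zero[of \<Omega>] by (auto simp: power2_eq_1_iff)
qed

lemma norm_\<Omega>_vec: "norm (ap (\<pi> A) \<Omega>) \<le> norm A"
  using norm_rep_le[of A \<Omega>] by (simp add: norm_\<Omega>)

lemma norm_\<sigma>_vec: "norm (ap (\<pi> (\<sigma> N A)) \<Omega>) = norm (ap (\<pi> A) \<Omega>)"
proof -
  have "cinner (ap (\<pi> (\<sigma> N A)) \<Omega>) (ap (\<pi> (\<sigma> N A)) \<Omega>) = cinner (ap (\<pi> A) \<Omega>) (ap (\<pi> A) \<Omega>)"
    unfolding cinner_rep by (simp add: shift_invariant flip: \<sigma>_simps)
  then show ?thesis by (simp add: cinner_self flip: of_real_power)
qed

lemma state_mult_le: "cmod (\<omega> (x * y)) \<le> norm x * norm (ap (\<pi> y) \<Omega>)"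
proof -
  have "\<omega> (x * y) = cinner (ap (\<pi> (star x)) \<Omega>) (ap (\<pi> y) \<Omega>)" by (simp add: cinner_rep star_star)
  also have "cmod \<dots> \<le> norm (ap (\<pi> (star x)) \<Omega>) * norm (ap (\<pi> y) \<Omega>)" by (rule cinner_Cauchy_Schwarz)
  also have "\<dots> \<le> norm x * norm (ap (\<pi> y) \<Omega>)"
    using norm_\<Omega>_vec[of "star x"] by (simp add: norm_star mult_right_mono)
  finally show ?thesis .
qed

text \<open>The translation is implemented by a unitary, so the bound involves \<open>norm A\<close>
  and is uniform in \<open>N\<close>.\<close>

lemma norm_\<sigma>_rep: "norm (ap (\<pi> (\<sigma> N A)) x) \<le> norm A * norm x"
proof -
  obtain V where V: "semiunitary 0 V" "\<And>A x. V (ap (\<pi> A) x) = ap (\<pi> (\<sigma> N A)) (V x)"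
    using implementer[OF shift[of N]] shift_invariant by (metis cj_simps(9))
  interpret V: semiunitary_map 0 V by standard (rule V(1))
  have "norm (ap (\<pi> (\<sigma> N A)) (V (inv_into UNIV V x))) = norm (ap (\<pi> A) (inv_into UNIV V x))"
    by (simp add: V(2)[symmetric] V.norm)
  also have "\<dots> \<le> norm A * norm (V (inv_into UNIV V x))" by (simp add: norm_rep_le V.norm)
  finally show ?thesis by (simp add: V.inv_right)
qed

lemma eventually_disjoint:
  assumes "finite X" "finite Y"
  shows "\<forall>\<^sub>F N in sequentially. X \<inter> (+) (int N) ` Y = {}"
proof -
  obtain m where m: "\<And>x. x \<in> X \<union> Y \<Longrightarrow> \<bar>x\<bar> \<le> m"
    using assms finite_imp_Sup_less[of "abs ` (X \<union> Y)"] bdd_above_finite[of "abs ` (X \<union> Y)"]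
    by (auto simp: bdd_above_def)
  show ?thesis unfolding eventually_sequentially
  proof (intro exI allI impI)
    fix N assume N: "nat (2 * m + 1) \<le> N"
    show "X \<inter> (+) (int N) ` Y = {}"
    proof (rule ccontr)
      assume "X \<inter> (+) (int N) ` Y \<noteq> {}"
      then obtain y where "y \<in> Y" "int N + y \<in> X" by auto
      then have "\<bar>y\<bar> \<le> m" "\<bar>int N + y\<bar> \<le> m" using m by auto
      then show False using N by linarith
    qed
  qed
qed

text \<open>A cluster point of the functionals
  \<open>x \<mapsto> \<omega> (x * \<sigma> N (star y * y))\<close> is positive and dominated by a
  multiple of \<open>\<omega>\<close>; purity makes it a multiple of \<open>\<omega>\<close>, and
  its value at 1 fixes the factor. Hence there is only one possible limit. Squares are needed to
  have positivity.\<close>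

lemma clustering_square:
  assumes y: "y \<in> Loc Y" "finite Y" "\<Theta> y = y"
  shows "(\<lambda>N. \<omega> (x * \<sigma> N (star y * y))) \<longlonglongrightarrow> \<omega> x * \<omega> (star y * y)"
proof (rule ccontr)
  assume nlim: "\<not> ?thesis"
  let ?B = "star y * y"
  let ?\<phi> = "\<lambda>N x. \<omega> (x * \<sigma> N ?B)"
  from nlim obtain e where e: "e > 0" "\<exists>\<^sub>F N in sequentially. \<not> dist (?\<phi> N x) (\<omega> x * \<omega> ?B) < e"
    unfolding tendsto_iff frequently_def by auto
  \<comment> \<open>Along \<open>F\<close> the distance to the claimed limit stays at least
    \<open>e\<close>; the cluster functional taken along \<open>F\<close> will contradict
    this.\<close>
  define F where "F = inf sequentially (principal {N. \<not> dist (?\<phi> N x) (\<omega> x * \<omega> ?B) < e})"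
  have "F \<noteq> bot"
    using e(2) by (simp add: F_def trivial_limit_def eventually_inf_principal frequently_def)
  moreover have bnd: "cmod (?\<phi> N x) \<le> norm x * norm ?B" for N x
    using state_mult_le[of x "\<sigma> N ?B"] mult_left_mono[OF norm_\<Omega>_vec[of ?B], of "norm x"]
    unfolding norm_\<sigma>_vec by simp
  ultimately obtain G \<phi> where G: "G \<noteq> bot" "G \<le> F" and \<phi>: "\<And>x. ((\<lambda>N. ?\<phi> N x) \<longlongrightarrow> \<phi> x) G"
    using cluster_functional[of F ?\<phi> "\<lambda>x. norm x * norm ?B"] by blast
  have Gseq: "eventually P G" if "eventually P sequentially" for P
    using that G(2) unfolding F_def by (metis filter_leD inf.cobounded1 order.trans)
  note uniq = tendsto_unique[OF G(1)]
  have add: "\<phi> (x + z) = \<phi> x + \<phi> z" for x z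
    by (rule uniq[OF \<phi>]) (use tendsto_add[OF \<phi>[of x] \<phi>[of z]] in \<open>simp add: distrib_right state_linear\<close>)
  have scale: "\<phi> (c *\<^sub>C x) = c * \<phi> x" for c x
    by (rule uniq[OF \<phi>]) (use tendsto_mult_left[OF \<phi>[of x], of c] in \<open>simp add: mult_scaleC_left state_linear\<close>)
  have \<phi>bnd: "cmod (\<phi> x) \<le> norm x * norm ?B" for x
    using tendsto_upperbound[OF tendsto_norm[OF \<phi>] _ G(1)] bnd by simp
  have "\<phi> (r *\<^sub>R x) = r *\<^sub>R \<phi> x" for r x
    using scale[of "complex_of_real r" x] by (simp add: scaleC_of_real scaleR_conv_of_real[of r "\<phi> x"])
  then have bl: "bounded_linear \<phi>"
    by (intro bounded_linear_intro[where K = "norm ?B"] add \<phi>bnd)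
  have bl\<omega>: "bounded_linear \<omega>"
  proof (rule bounded_linear_intro[where K = 1])
    show "norm (\<omega> x) \<le> norm x * 1" for x using state_mult_le[of x 1] by (simp add: rep_simps norm_\<Omega>)
    show "\<omega> (r *\<^sub>R x) = r *\<^sub>R \<omega> x" for r x
      using state_linear(2)[of "complex_of_real r" x] by (simp add: scaleC_of_real scaleR_conv_of_real[of r "\<omega> x"])
  qed (rule state_linear)
  let ?C = "(norm y)\<^sup>2"
  \<comment> \<open>As soon as the supports are disjoint, the even element
    \<open>\<sigma> N y\<close> commutes with \<open>x\<close>, and the value at
    \<open>star x * x\<close> is the squared norm of \<open>\<pi> (\<sigma> N y)\<close> applied to
    \<open>\<pi> x \<Omega>\<close>.\<close>
  have posN: "\<forall>\<^sub>F N in sequentially. ?\<phi> N (star x * x) \<in> {z. Im z = 0 \<and> 0 \<le> Re z \<and> Re z \<le> ?C * Re (\<omega> (star x * x))}"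
    if x: "x \<in> locals" for x
  proof -
    obtain X where X: "finite X" "x \<in> Loc X" using x by (auto simp: locals_def)
    show ?thesis using eventually_disjoint[OF X(1) y(2)]
    proof eventually_elim
      case (elim N)
      define s where "s = \<sigma> N y"
      have s: "s \<in> Loc ((+) (int N) ` Y)" "\<Theta> s = s"
        using \<sigma>_Loc[OF y(1), of N] y(3) by (simp_all add: s_def)
      have ss: "star s \<in> Loc ((+) (int N) ` Y)" "\<Theta> (star s) = star s"
        using s by (simp_all add: Loc_def star_subalgebra.star \<Theta>_simps)
      have xs: "x * s = s * x" "x * star s = star s * x"
        using Loc_even_commute[OF X(2) s(1) elim s(2)] Loc_even_commute[OF X(2) ss(1) elim ss(2)] by auto
      have "star (x * star s) = star (star s * x)" by (simp only: xs)
      then have xs': "s * star x = star x * s" by (simp add: star_mult star_star)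
      have "star x * x * (star s * s) = star (x * s) * (x * s)"
      proof -
        have "star (x * s) * (x * s) = star s * star x * (x * s)" by (simp add: star_mult)
        also have "star s * star x = star x * star s"
          using arg_cong[OF xs(1), of star] by (simp add: star_mult)
        also have "star x * star s * (x * s) = star x * (star s * x) * s" by (simp add: mult.assoc)
        also have "\<dots> = star x * x * (star s * s)" unfolding xs(2)[symmetric] by (simp add: mult.assoc)
        finally show ?thesis by simp
      qed
      then have "?\<phi> N (star x * x) = cinner (ap (\<pi> (s * x)) \<Omega>) (ap (\<pi> (s * x)) \<Omega>)"
        by (simp add: cinner_rep \<sigma>_simps s_def[symmetric] xs(1))
      also have "\<dots> = complex_of_real ((norm (ap (\<pi> s) (ap (\<pi> x) \<Omega>)))\<^sup>2)"
        by (simp add: cinner_self rep_simps ap_simps)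
      finally have eq: "?\<phi> N (star x * x) = complex_of_real ((norm (ap (\<pi> s) (ap (\<pi> x) \<Omega>)))\<^sup>2)" .
      have "(norm (ap (\<pi> s) (ap (\<pi> x) \<Omega>)))\<^sup>2 \<le> (norm y * norm (ap (\<pi> x) \<Omega>))\<^sup>2"
        unfolding s_def by (rule power_mono[OF norm_\<sigma>_rep]) simp
      also have "\<dots> = ?C * Re (\<omega> (star x * x))"
        by (simp add: cinner_rep[symmetric] cinner_self power_mult_distrib)
      finally show ?case by (simp add: eq)
    qed
  qed
  have cl: "closed {z. Im z = 0 \<and> 0 \<le> Re z \<and> Re z \<le> K}" for K
    by (intro closed_Collect_conj closed_Collect_eq closed_Collect_le continuous_intros)
  let ?Q = "{x. Im (\<phi> (star x * x)) = 0 \<and> 0 \<le> Re (\<phi> (star x * x)) \<and> Re (\<phi> (star x * x)) \<le> ?C * Re (\<omega> (star x * x))}"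
  have "locals \<subseteq> ?Q"
  proof
    fix x assume "x \<in> locals"
    from Lim_in_closed_set[OF cl Gseq[OF posN[OF this]] G(1) \<phi>] show "x \<in> ?Q" by simp
  qed
  moreover have "closed ?Q"
    by (intro closed_Collect_conj closed_Collect_eq closed_Collect_le continuous_intros
        bounded_linear.continuous_on[OF bl] bounded_linear.continuous_on[OF bl\<omega>]
        bounded_linear.continuous_on[OF bounded_linear_star])
  ultimately have "closure locals \<subseteq> ?Q" by (rule closure_minimal)
  then have Q: "\<And>x. x \<in> ?Q" using locals_dense by blast
  have "\<phi> x = \<phi> 1 * \<omega> x"
    by (rule pure_state_dominates[OF pure add scale, where K = ?C]) (use Q in auto)
  moreover have "\<phi> 1 = \<omega> ?B"
    by (rule uniq[OF \<phi>]) (simp add: shift_invariant)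
  ultimately have "((\<lambda>N. ?\<phi> N x) \<longlongrightarrow> \<omega> x * \<omega> ?B) G" using \<phi>[of x] by (simp add: mult.commute)
  then have "\<forall>\<^sub>F N in G. dist (?\<phi> N x) (\<omega> x * \<omega> ?B) < e" using e(1) by (rule tendstoD)
  moreover have "\<forall>\<^sub>F N in F. \<not> dist (?\<phi> N x) (\<omega> x * \<omega> ?B) < e"
    by (simp add: F_def eventually_inf_principal)
  then have "\<forall>\<^sub>F N in G. \<not> dist (?\<phi> N x) (\<omega> x * \<omega> ?B) < e" using G(2) by (rule filter_leD[rotated])
  ultimately have "\<forall>\<^sub>F N in G. False" by eventually_elim simp
  then show False using G(1) by (simp add: trivial_limit_def)
qed

lemma clustering_even:
  assumes y: "y \<in> Loc Y" "finite Y" "\<Theta> y = y"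
  shows "(\<lambda>N. \<omega> (x * \<sigma> N y)) \<longlonglongrightarrow> \<omega> x * \<omega> y"
proof -
  define q where "q c = star (y + c *\<^sub>C 1) * (y + c *\<^sub>C 1)" for c
  have q: "(\<lambda>N. \<omega> (x * \<sigma> N (q c))) \<longlonglongrightarrow> \<omega> x * \<omega> (q c)" for c
    unfolding q_def
  proof (rule clustering_square[OF _ y(2)])
    show "y + c *\<^sub>C 1 \<in> Loc Y"
      using y(1) unfolding Loc_def by (intro star_subalgebra.add star_subalgebra.scale star_subalgebra.unit)
    show "\<Theta> (y + c *\<^sub>C 1) = y + c *\<^sub>C 1" by (simp add: \<Theta>_simps y)
  qed
  have qe: "q c = star y * y + c *\<^sub>C star y + cnj c *\<^sub>C y + (cnj c * c) *\<^sub>C 1" for c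
    by (simp add: q_def star_add star_scaleC algebra_simps mult_scaleC_left mult_scaleC_right scaleC_scaleC scaleC_add_right)
  \<comment> \<open>Polarisation of \<open>y\<close> against 1 over the fourth roots of unity; it
    expresses \<open>y\<close> by the squares \<open>q c\<close>.\<close>
  have pol: "y = (1/4) *\<^sub>C (q 1 + \<i> *\<^sub>C q \<i> - q (-1) - \<i> *\<^sub>C q (- \<i>))"
  proof -
    have "q 1 + \<i> *\<^sub>C q \<i> - q (-1) - \<i> *\<^sub>C q (- \<i>) = 4 *\<^sub>C y"
      by (simp add: qe scaleC_add_right scaleC_diff_right scaleC_minus_right scaleC_minus_left scaleC_scaleC algebra_simps)
        (use scaleC_add_left[of 1 1 y] scaleC_add_left[of 2 1 y] scaleC_add_left[of 3 1 y] in \<open>simp add: add_ac\<close>)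
    then show ?thesis by (simp add: scaleC_scaleC)
  qed
  have lin: "\<omega> (z * \<sigma> N y) = (1/4) * (\<omega> (z * \<sigma> N (q 1)) + \<i> * \<omega> (z * \<sigma> N (q \<i>)) - \<omega> (z * \<sigma> N (q (-1))) - \<i> * \<omega> (z * \<sigma> N (q (- \<i>))))" for z N
    by (subst pol) (simp only: \<sigma>_simps distrib_left right_diff_distrib mult_scaleC_right state_linear)
  have lin': "\<omega> y = (1/4) * (\<omega> (q 1) + \<i> * \<omega> (q \<i>) - \<omega> (q (-1)) - \<i> * \<omega> (q (- \<i>)))"
    by (subst pol) (simp only: state_linear)
  have "(\<lambda>N. (1/4) * (\<omega> (x * \<sigma> N (q 1)) + \<i> * \<omega> (x * \<sigma> N (q \<i>)) - \<omega> (x * \<sigma> N (q (-1))) - \<i> * \<omega> (x * \<sigma> N (q (- \<i>)))))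
    \<longlonglongrightarrow> (1/4) * (\<omega> x * \<omega> (q 1) + \<i> * (\<omega> x * \<omega> (q \<i>)) - \<omega> x * \<omega> (q (-1)) - \<i> * (\<omega> x * \<omega> (q (- \<i>))))"
    by (intro tendsto_intros q)
  then show ?thesis unfolding lin lin' by (simp add: algebra_simps)
qed

text \<open>
  Distant translates \<open>b k\<close> of an odd element have vanishing anticommutators, so they satisfy a Bessel inequality
  for the form \<open>\<omega> (S\<^sup>* S + S S\<^sup>*)\<close>.
\<close>

lemma clustering_odd:
  assumes y: "y \<in> Loc Y" "finite Y" "\<Theta> y = - y"
  shows "(\<lambda>N. \<omega> (x * \<sigma> N y)) \<longlonglongrightarrow> 0"
proof -
  have "\<forall>\<^sub>F N in sequentially. Y \<inter> (+) (int N) ` Y = {}" by (rule eventually_disjoint[OF y(2,2)])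
  then obtain L0 where L0: "\<And>N. N \<ge> L0 \<Longrightarrow> Y \<inter> (+) (int N) ` Y = {}" by (auto simp: eventually_sequentially)
  \<comment> \<open>A spacing beyond which translates of \<open>Y\<close> are disjoint;
    \<open>Suc\<close> makes it positive, so that it can serve as a modulus.\<close>
  define L where "L = Suc L0"
  have disj: "(+) (int M) ` Y \<inter> (+) (int N) ` Y = {}" if "M + L \<le> N" for M N
  proof (rule ccontr)
    assume "\<not> ?thesis"
    then obtain u v where uv: "u \<in> Y" "v \<in> Y" "int M + u = int N + v" by auto
    then have "u = int (N - M) + v" using that by (simp add: of_nat_diff)
    then have "u \<in> Y \<inter> (+) (int (N - M)) ` Y" using uv by auto
    moreover have "Y \<inter> (+) (int (N - M)) ` Y = {}" using that by (intro L0) (simp add: L_def)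
    ultimately show False by blast
  qed
  define c0 where "c0 = Re (\<omega> (star y * y + y * star y))"
  have anti: "star (\<sigma> M y) * \<sigma> N y + \<sigma> N y * star (\<sigma> M y) = 0" if "M + L \<le> N \<or> N + L \<le> M" for M N
  proof -
    have d: "(+) (int M) ` Y \<inter> (+) (int N) ` Y = {}" using disj[of M N] disj[of N M] that by auto
    have "star (\<sigma> M y) * \<sigma> N y = - (\<sigma> N y * star (\<sigma> M y))"
      by (rule Loc_odd_anticommute[OF _ _ d])
        (use \<sigma>_Loc[OF y(1)] in \<open>auto simp: y(3) \<Theta>_simps \<sigma>_simps star_minus Loc_def star_subalgebra.star\<close>)
    then show ?thesis by simp
  qed
  have bessel: "(\<Sum>N\<in>I. (cmod (\<omega> (x * \<sigma> N y)))\<^sup>2) \<le> (norm x)\<^sup>2 * c0"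
    if I: "finite I" "\<And>M N. M \<in> I \<Longrightarrow> N \<in> I \<Longrightarrow> M \<noteq> N \<Longrightarrow> M + L \<le> N \<or> N + L \<le> M" for I
  proof -
    define s where "s N = \<omega> (x * \<sigma> N y)" for N
    define S where "S = (\<Sum>N\<in>I. cnj (s N) *\<^sub>C \<sigma> N y)"
    define \<Sigma> where "\<Sigma> = (\<Sum>N\<in>I. (cmod (s N))\<^sup>2)"
    have \<omega>sum: "\<omega> (\<Sum>i\<in>J. h i) = (\<Sum>i\<in>J. \<omega> (h i))" for h and J :: "nat set"
      by (simp add: state_eq rep_sum ap_bop_sum cinner_sum_right)
    have "\<omega> (x * S) = (\<Sum>N\<in>I. cnj (s N) * s N)"
      by (simp add: S_def sum_distrib_left \<omega>sum mult_scaleC_right state_linear s_def)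
    also have "\<dots> = complex_of_real \<Sigma>"
      unfolding \<Sigma>_def of_real_sum by (rule sum.cong) (simp_all add: complex_norm_square mult.commute del: of_real_power)
    finally have xS: "\<omega> (x * S) = complex_of_real \<Sigma>" .
    have \<Sigma>0: "\<Sigma> \<ge> 0" by (simp add: \<Sigma>_def sum_nonneg)
    \<comment> \<open>The off-diagonal terms are anticommutators of distant translates and vanish;
      on the diagonal translation invariance leaves \<open>c0\<close>.\<close>
    have SS: "Re (\<omega> (star S * S + S * star S)) = \<Sigma> * c0"
    proof -
      have "star S * S + S * star S = (\<Sum>M\<in>I. \<Sum>N\<in>I. (s M * cnj (s N)) *\<^sub>C (star (\<sigma> M y) * \<sigma> N y))
          + (\<Sum>N\<in>I. \<Sum>M\<in>I. (s M * cnj (s N)) *\<^sub>C (\<sigma> N y * star (\<sigma> M y)))"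
        by (simp add: S_def star_sum star_scaleC sum_product mult_scaleC_left mult_scaleC_right scaleC_scaleC mult.commute)
      also have "\<dots> = (\<Sum>M\<in>I. \<Sum>N\<in>I. (s M * cnj (s N)) *\<^sub>C (star (\<sigma> M y) * \<sigma> N y + \<sigma> N y * star (\<sigma> M y)))"
        by (subst (2) sum.swap) (simp add: sum.distrib scaleC_add_right)
      also have "\<dots> = (\<Sum>M\<in>I. \<Sum>N\<in>I. if N = M then (s M * cnj (s M)) *\<^sub>C \<sigma> M (star y * y + y * star y) else 0)"
        by (intro sum.cong refl) (use I(2) anti in \<open>auto simp: \<sigma>_simps\<close>)
      also have "\<dots> = (\<Sum>M\<in>I. (s M * cnj (s M)) *\<^sub>C \<sigma> M (star y * y + y * star y))"
        using I(1) by simp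
      finally have "\<omega> (star S * S + S * star S) = (\<Sum>M\<in>I. complex_of_real ((cmod (s M))\<^sup>2)) * \<omega> (star y * y + y * star y)"
        by (simp only: \<omega>sum state_linear(2) shift_invariant sum_distrib_right complex_norm_square)
      then show ?thesis by (simp add: \<Sigma>_def c0_def flip: of_real_sum of_real_power)
    qed
    have "\<Sigma> \<le> norm x * norm (ap (\<pi> S) \<Omega>)"
      using state_mult_le[of x S] \<Sigma>0 by (simp add: xS)
    then have "\<Sigma>\<^sup>2 \<le> (norm x)\<^sup>2 * (norm (ap (\<pi> S) \<Omega>))\<^sup>2"
      using \<Sigma>0 by (metis power_mono power_mult_distrib)
    moreover have "(norm (ap (\<pi> S) \<Omega>))\<^sup>2 \<le> \<Sigma> * c0"
    proof -
      have n: "(norm (ap (\<pi> z) \<Omega>))\<^sup>2 = Re (\<omega> (star z * z))" for z by (simp add: cinner_rep[symmetric] cinner_self)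
      have "0 \<le> Re (\<omega> (S * star S))" using n[of "star S"] by (metis star_star zero_le_power2)
      then show ?thesis using SS by (simp add: n state_linear)
    qed
    from mult_left_mono[OF this, of "(norm x)\<^sup>2"] have "(norm x)\<^sup>2 * (norm (ap (\<pi> S) \<Omega>))\<^sup>2 \<le> (norm x)\<^sup>2 * c0 * \<Sigma>"
      by (simp add: mult_ac)
    ultimately have "\<Sigma> * \<Sigma> \<le> (norm x)\<^sup>2 * c0 * \<Sigma>" by (simp add: power2_eq_square)
    moreover have "0 \<le> (norm x)\<^sup>2 * c0"
    proof -
      have "0 \<le> Re (\<omega> (star y * y))" "0 \<le> Re (\<omega> (y * star y))"
        using cinner_rep[of y y] cinner_rep[of "star y" "star y"] by (simp_all add: cinner_self star_star flip: of_real_power) (metis Re_complex_of_real zero_le_power2)+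
      then show ?thesis by (simp add: c0_def state_linear)
    qed
    ultimately have "\<Sigma> \<le> (norm x)\<^sup>2 * c0" using \<Sigma>0 by (cases "\<Sigma> = 0") (auto simp: mult_le_cancel_right)
    then show ?thesis by (simp add: \<Sigma>_def s_def)
  qed
  show ?thesis
  proof (rule tendstoI)
    fix e :: real assume e: "e > 0"
    let ?bad = "{N. e \<le> cmod (\<omega> (x * \<sigma> N y))}"
    \<comment> \<open>Distinct elements of one residue class are at least \<open>L\<close> apart, so
      the Bessel inequality limits how many of them can be bad; there are only \<open>L\<close>
      classes.\<close>
    have "finite {N \<in> ?bad. N mod L = r}" for r
    proof (rule ccontr)
      assume inf: "infinite {N \<in> ?bad. N mod L = r}"
      obtain n :: nat where n: "(norm x)\<^sup>2 * c0 < real n * e\<^sup>2"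
        using reals_Archimedean3[of "e\<^sup>2"] e by auto
      obtain I where I: "I \<subseteq> {N \<in> ?bad. N mod L = r}" "card I = n" "finite I"
        using infinite_arbitrarily_large[OF inf, of n] by auto
      have "M + L \<le> N \<or> N + L \<le> M" if MN: "M \<in> I" "N \<in> I" "M \<noteq> N" for M N
      proof -
        have *: "M + L \<le> N" if "M < N" "M mod L = N mod L" for M N
        proof -
          have "L dvd N - M" using that by (metis mod_eq_dvd_iff_nat less_imp_le)
          then show ?thesis using that by (auto dest!: dvd_imp_le)
        qed
        have "M mod L = N mod L" using I(1) MN by auto
        then show ?thesis using *[of M N] *[of N M] MN(3) by (cases "M < N") auto
      qed
      from bessel[OF I(3) this] have "(\<Sum>N\<in>I. (cmod (\<omega> (x * \<sigma> N y)))\<^sup>2) \<le> (norm x)\<^sup>2 * c0" by simp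
      moreover have "real n * e\<^sup>2 \<le> (\<Sum>N\<in>I. (cmod (\<omega> (x * \<sigma> N y)))\<^sup>2)"
        using sum_bounded_below[of I "e\<^sup>2" "\<lambda>N. (cmod (\<omega> (x * \<sigma> N y)))\<^sup>2"] I e
        by (auto simp: power_mono)
      ultimately show False using n by linarith
    qed
    then have "finite (\<Union>r<L. {N \<in> ?bad. N mod L = r})" by simp
    moreover have "?bad \<subseteq> (\<Union>r<L. {N \<in> ?bad. N mod L = r})" by (auto simp: L_def)
    ultimately have "finite ?bad" by (rule rev_finite_subset)
    then show "\<forall>\<^sub>F N in sequentially. dist (\<omega> (x * \<sigma> N y)) 0 < e"
      by (simp add: eventually_cofinite not_less flip: cofinite_eq_sequentially)
  qed
qed

text \<open>Even and odd parts separately; parity invariance makes \<open>\<omega>\<close> vanish on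
  the odd part, in agreement with its limit 0.\<close>

lemma clustering:
  assumes "y \<in> locals"
  shows "(\<lambda>N. \<omega> (x * \<sigma> N y)) \<longlonglongrightarrow> \<omega> x * \<omega> y"
proof -
  obtain Y where Y: "finite Y" "y \<in> Loc Y" using assms by (auto simp: locals_def)
  define e where "e = (1/2) *\<^sub>C (y + \<Theta> y)"
  define f where "f = (1/2) *\<^sub>C (y - \<Theta> y)"
  have \<Theta>y: "\<Theta> y \<in> Loc Y" "\<Theta> (\<Theta> y) = y" using \<Theta>_Loc[OF Y(2)] by auto
  have e: "e \<in> Loc Y" "\<Theta> e = e"
    using Y(2) \<Theta>y by (simp_all add: e_def \<Theta>_simps add.commute Loc_def star_subalgebra.scale star_subalgebra.add)
  have f: "f \<in> Loc Y" "\<Theta> f = - f"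
    using Y(2) \<Theta>y star_subalgebra_diff[of y _ "\<Theta> y"]
    by (simp_all add: f_def \<Theta>_simps Loc_def star_subalgebra.scale flip: scaleC_minus_right)
  have y: "y = e + f"
    by (simp add: e_def f_def scaleC_add_right scaleC_diff_right flip: scaleC_add_left)
  have "\<omega> f = 0" using parity_invariant[of f] by (simp add: f state_linear)
  then show ?thesis
    using tendsto_add[OF clustering_even[OF e(1) Y(1) e(2), of x] clustering_odd[OF f(1) Y(1) f(2), of x]]
    by (simp add: y \<sigma>_simps distrib_left state_linear)
qed

text \<open>Clustering as weak convergence of the translations to the projection onto
  \<open>\<Omega>\<close>. Both vectors are replaced by vectors from the dense set of local ones,
  with errors uniform in \<open>N\<close> because the \<open>V N\<close> are isometric.\<close>

lemma weak_mixing: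
  assumes V: "\<And>N. semiunitary 0 (V N)" "\<And>N A. V N (ap (\<pi> A) \<Omega>) = ap (\<pi> (\<sigma> N A)) \<Omega>"
  shows "(\<lambda>N. cinner \<eta> (V N \<zeta>)) \<longlonglongrightarrow> cinner \<eta> \<Omega> * cinner \<Omega> \<zeta>"
proof -
  have sV: "semiunitary_map 0 (V N)" for N by standard (rule V(1))
  let ?f = "\<lambda>\<eta> \<zeta> N. cinner \<eta> (V N \<zeta>) - cinner \<eta> \<Omega> * cinner \<Omega> \<zeta>"
  have fbnd: "cmod (?f \<eta> \<zeta> N) \<le> 2 * (norm \<eta> * norm \<zeta>)" for \<eta> \<zeta> N
  proof -
    have "cmod (cinner \<eta> (V N \<zeta>)) \<le> norm \<eta> * norm \<zeta>"
      using cinner_Cauchy_Schwarz[of \<eta> "V N \<zeta>"] by (simp add: semiunitary_map.norm[OF sV])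
    moreover have "cmod (cinner \<eta> \<Omega>) \<le> norm \<eta>" "cmod (cinner \<Omega> \<zeta>) \<le> norm \<zeta>"
      using cinner_Cauchy_Schwarz[of \<eta> \<Omega>] cinner_Cauchy_Schwarz[of \<Omega> \<zeta>] by (simp_all add: norm_\<Omega>)
    then have "cmod (cinner \<eta> \<Omega> * cinner \<Omega> \<zeta>) \<le> norm \<eta> * norm \<zeta>" by (simp add: norm_mult mult_mono)
    ultimately show ?thesis using norm_triangle_ineq4[of "cinner \<eta> (V N \<zeta>)" "cinner \<eta> \<Omega> * cinner \<Omega> \<zeta>"] by linarith
  qed
  have fdiff: "?f \<eta> \<zeta> N = ?f \<eta>' \<zeta>' N + ?f \<eta>' (\<zeta> - \<zeta>') N + ?f (\<eta> - \<eta>') \<zeta> N" for \<eta> \<eta>' \<zeta> \<zeta>' N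
    by (simp add: cinner_diff_left cinner_diff_right semiunitary_map.diff[OF sV] algebra_simps)
  have dense: "\<exists>B\<in>locals. norm (\<xi> - ap (\<pi> B) \<Omega>) < e" if e: "e > 0" for \<xi> e
  proof -
    have "\<xi> \<in> closure (range (\<lambda>A. ap (\<pi> A) \<Omega>))" by (simp add: cyclic)
    then have "\<exists>v\<in>range (\<lambda>A. ap (\<pi> A) \<Omega>). dist v \<xi> < e / 2"
      unfolding closure_approachable using half_gt_zero[OF e] by blast
    then obtain A where A: "norm (ap (\<pi> A) \<Omega> - \<xi>) < e / 2" by (auto simp: dist_norm)
    have "A \<in> closure locals" by (simp add: locals_dense)
    then have "\<exists>B\<in>locals. dist B A < e / 2" unfolding closure_approachable using half_gt_zero[OF e] by blast
    then obtain B where B: "B \<in> locals" "norm (B - A) < e / 2" by (auto simp: dist_norm)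
    have "norm (ap (\<pi> B) \<Omega> - ap (\<pi> A) \<Omega>) < e / 2"
      using norm_\<Omega>_vec[of "B - A"] B(2) by (simp add: rep_simps ap_simps)
    then have "norm (\<xi> - ap (\<pi> B) \<Omega>) < e"
      using A norm_triangle_ineq4[of "ap (\<pi> A) \<Omega> - ap (\<pi> B) \<Omega>" "ap (\<pi> A) \<Omega> - \<xi>"]
      by (simp add: norm_minus_commute[of "ap (\<pi> B) \<Omega>"])
    then show ?thesis using B(1) by blast
  qed
  have tri: "cmod z \<le> cmod a + e" if "z = a + b + c" "cmod b \<le> e / 2" "cmod c \<le> e / 2" for z a b c and e :: real
    using that norm_triangle_ineq[of "a + b" c] norm_triangle_ineq[of a b] by simp
  have aux: "2 * (n * (e / (4 * (n + 1)))) \<le> e / 2" if "n \<ge> 0" "e > 0" for n e :: real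
  proof -
    have "4 + n * 4 > 0" using that by simp
    then show ?thesis using that by (simp add: field_simps)
  qed
  have "?f \<eta> \<zeta> \<longlonglongrightarrow> 0"
  proof (rule tendsto_0_approx)
    fix e :: real assume e: "e > 0"
    define d1 where "d1 = e / (4 * (norm \<zeta> + 1))"
    have d1: "d1 > 0" using e norm_ge_zero[of \<zeta>] by (simp add: d1_def add_nonneg_pos)
    obtain x where x: "norm (\<eta> - ap (\<pi> x) \<Omega>) < d1" using dense[OF d1] by blast
    define \<eta>' where "\<eta>' = ap (\<pi> x) \<Omega>"
    \<comment> \<open>The second approximation is made after the first, with a tolerance adapted to
      the vector \<open>\<eta>'\<close> that has replaced \<open>\<eta>\<close>.\<close>
    define d2 where "d2 = e / (4 * (norm \<eta>' + 1))"
    have d2: "d2 > 0" using e norm_ge_zero[of \<eta>'] by (simp add: d2_def add_nonneg_pos)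
    obtain y where y: "y \<in> locals" "norm (\<zeta> - ap (\<pi> y) \<Omega>) < d2" using dense[OF d2] by blast
    define \<zeta>' where "\<zeta>' = ap (\<pi> y) \<Omega>"
    have "?f \<eta>' \<zeta>' = (\<lambda>N. \<omega> (star x * \<sigma> N y) - \<omega> (star x) * \<omega> y)"
      using cinner_rep[of x 1] cinner_rep[of 1 y]
      by (simp add: \<eta>'_def \<zeta>'_def V(2) cinner_rep rep_simps)
    then have lim: "?f \<eta>' \<zeta>' \<longlonglongrightarrow> 0" using clustering[OF y(1), of "star x"] by (simp add: LIM_zero)
    have "cmod (?f \<eta> \<zeta> N) \<le> cmod (?f \<eta>' \<zeta>' N) + e" for N
    proof -
      have "cmod (?f \<eta>' (\<zeta> - \<zeta>') N) \<le> 2 * (norm \<eta>' * d2)"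
        using fbnd[where \<eta> = \<eta>' and \<zeta> = "\<zeta> - \<zeta>'" and N = N] mult_left_mono[OF less_imp_le[OF y(2)] norm_ge_zero[of \<eta>']]
        by (fold \<zeta>'_def) linarith
      also have "\<dots> \<le> e / 2" unfolding d2_def by (rule aux[OF norm_ge_zero e])
      finally have 1: "cmod (?f \<eta>' (\<zeta> - \<zeta>') N) \<le> e / 2" .
      have "cmod (?f (\<eta> - \<eta>') \<zeta> N) \<le> 2 * (d1 * norm \<zeta>)"
        using fbnd[where \<eta> = "\<eta> - \<eta>'" and \<zeta> = \<zeta> and N = N] mult_right_mono[of "norm (\<eta> - \<eta>')" d1 "norm \<zeta>"] x
        by (fold \<eta>'_def) (simp add: mult_ac)
      also have "\<dots> = 2 * (norm \<zeta> * d1)" by simp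
      also have "\<dots> \<le> e / 2" unfolding d1_def by (rule aux[OF norm_ge_zero e])
      finally have 2: "cmod (?f (\<eta> - \<eta>') \<zeta> N) \<le> e / 2" .
      show ?thesis
        by (rule tri[OF fdiff 1 2])
    qed
    then show "\<exists>g. g \<longlonglongrightarrow> 0 \<and> (\<forall>N. cmod (?f \<eta> \<zeta> N) \<le> cmod (g N) + e)" using lim by blast
  qed
  then show ?thesis by (simp add: LIM_zero_iff)
qed

end

section \<open>Projections\<close>

text \<open>The real projection theorem suffices: a complex subspace contains \<open>\<i> z\<close>
  together with \<open>z\<close>, so real orthogonality to it is complex orthogonality.\<close>

lemma closed_subspace_projection:
  fixes S :: "'h::complex_hilbert set"
  assumes S: "closed S" "0 \<in> S" "\<And>x y. x \<in> S \<Longrightarrow> y \<in> S \<Longrightarrow> x + y \<in> S" "\<And>c x. x \<in> S \<Longrightarrow> c *\<^sub>C x \<in> S"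
  obtains p where "p * p = p" "adj p = p" "\<And>x. ap p x = x \<longleftrightarrow> x \<in> S"
proof -
  have scR: "r *\<^sub>R x \<in> S" if "x \<in> S" for r x
    using S(4)[OF that, of "of_real r"] by (simp add: scaleC_of_real)
  have sub: "real_vector.subspace S" using S scR by (simp add: real_vector.subspace_def)
  have Sd: "x - y \<in> S" if "x \<in> S" "y \<in> S" for x y using S(3)[OF that(1) S(4)[OF that(2), of "- 1"]] by simp
  have "\<exists>y\<in>S. \<forall>z\<in>S. cinner z (x - y) = 0" for x
  proof -
    obtain y where y: "y \<in> S" "\<And>z. z \<in> S \<Longrightarrow> inner (x - y) z = 0"
      using orthogonal_projection_exists[OF sub S(1), of x] by blast
    have "cinner z (x - y) = 0" if z: "z \<in> S" for z
    proof -
      have "Re (cinner z (x - y)) = 0" using y(2)[OF z] by (simp add: Re_cinner inner_commute)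
      moreover have "Re (cinner (\<i> *\<^sub>C z) (x - y)) = 0"
        using y(2)[OF S(4)[OF z, of \<i>]] by (simp add: Re_cinner inner_commute)
      ultimately show ?thesis by (simp add: cinner_scaleC_left complex_eq_iff)
    qed
    then show ?thesis using y(1) by blast
  qed
  then obtain f where f: "\<And>x. f x \<in> S" "\<And>x z. z \<in> S \<Longrightarrow> cinner z (x - f x) = 0" by metis
  have uniq: "f x = y" if y: "y \<in> S" "\<And>z. z \<in> S \<Longrightarrow> cinner z (x - y) = 0" for x y
  proof -
    have "cinner (f x - y) (x - y) - cinner (f x - y) (x - f x) = 0"
      using y(2) f(2) Sd[OF f(1) y(1)] by simp
    then have "cinner (f x - y) (f x - y) = 0" by (simp add: cinner_diff_right)
    then show ?thesis by simp
  qed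
  have fid: "f x = x" if "x \<in> S" for x by (rule uniq) (use that in auto)
  have bc: "bounded_clinear f"
  proof (rule bounded_clinear_intro[where K = 1])
    fix x y c
    show "f (x + y) = f x + f y"
    proof (rule uniq)
      fix z assume z: "z \<in> S"
      have "x + y - (f x + f y) = (x - f x) + (y - f y)" by simp
      then show "cinner z (x + y - (f x + f y)) = 0" using f(2)[OF z] by (simp only: cinner_add_right) simp
    qed (simp add: S f)
    show "f (c *\<^sub>C x) = c *\<^sub>C f x"
      by (rule uniq) (use S f in \<open>simp_all add: cinner_scaleC_right flip: scaleC_diff_right\<close>)
    have "cinner (f x) x = cinner (f x) (f x)" using f(2)[OF f(1)[of x], of x] by (simp add: cinner_diff_right)
    then have "complex_of_real ((norm (f x))\<^sup>2) = cinner (f x) x" by (simp add: cinner_self)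
    then have "(norm (f x))\<^sup>2 = cmod (cinner (f x) x)" by (metis norm_of_real abs_power2)
    then have "norm (f x) * norm (f x) \<le> norm (f x) * norm x"
      using cinner_Cauchy_Schwarz[of "f x" x] by (simp add: power2_eq_square)
    then show "norm (f x) \<le> norm x * 1" by (cases "norm (f x) = 0") (auto simp: mult_le_cancel_left)
  qed
  define p where "p = Bop f"
  have p: "ap p x = f x" for x by (simp add: p_def ap_Bop[OF bc])
  have "p * p = p" by (rule bop_eqI) (simp add: ap_mult p fid f)
  moreover have "adj p = p"
  proof (rule adj_eqI)
    fix x y
    have "cinner (f x) (y - f y) = 0" "cinner (f y) (x - f x) = 0" using f by auto
    then have "cinner (f x) y = cinner (f x) (f y)" "cinner x (f y) = cinner (f x) (f y)"
      by (simp_all add: cinner_diff_right) (metis cinner_commute)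
    then show "cinner (ap p x) y = cinner x (ap p y)" by (simp add: p)
  qed
  moreover have "ap p x = x \<longleftrightarrow> x \<in> S" for x using fid f(1) by (metis p)
  ultimately show thesis by (rule that)
qed

text \<open>For a unit vector \<open>\<zeta>\<close> in the range of \<open>q\<close>, compressing
  \<open>rank1 \<zeta> \<zeta>\<close> by \<open>q\<close> changes nothing, while minimality makes
  the result a multiple of \<open>q\<close>; evaluation at \<open>\<zeta>\<close> shows that the
  factor is 1.\<close>

lemma projection_eq_rank1:
  fixes q :: "'h::complex_hilbert bop"
  assumes q: "q * q = q" "adj q = q" "q \<noteq> 0" and min: "\<And>x. \<exists>c. q * x * q = c *\<^sub>C q"
  obtains \<zeta> where "cinner \<zeta> \<zeta> = 1" "q = rank1 \<zeta> \<zeta>"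
proof -
  obtain z where z: "ap q z \<noteq> 0" using q(3) by (metis ap_zero bop_eqI)
  define \<zeta> where "\<zeta> = (1 / complex_of_real (norm (ap q z))) *\<^sub>C ap q z"
  have \<zeta>: "cinner \<zeta> \<zeta> = 1" unfolding \<zeta>_def by (rule cinner_normalized[OF z])
  have q\<zeta>: "ap q \<zeta> = \<zeta>" by (simp add: \<zeta>_def ap_linear flip: ap_mult) (simp add: q)
  obtain c where c: "q * rank1 \<zeta> \<zeta> * q = c *\<^sub>C q" using min by blast
  have "q * rank1 \<zeta> \<zeta> * q = rank1 \<zeta> \<zeta>" by (simp add: rank1_mult q q\<zeta>)
  then have e: "rank1 \<zeta> \<zeta> = c *\<^sub>C q" using c by simp
  have "\<zeta> = c *\<^sub>C \<zeta>" using arg_cong[OF e, of "\<lambda>t. ap t \<zeta>"] by (simp add: ap_rank1 \<zeta> ap_scaleC q\<zeta>)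
  then have "cinner \<zeta> \<zeta> = c * cinner \<zeta> \<zeta>" by (metis cinner_scaleC_right)
  then have "c = 1" by (simp add: \<zeta>)
  then show thesis using that[OF \<zeta>] e by simp
qed

lemma comm_mult:
  fixes a b z :: "'a::semigroup_mult"
  assumes "a * z = z * a" "b * z = z * b"
  shows "(a * b) * z = z * (a * b)"
proof -
  have "(a * b) * z = a * (b * z)" by (rule mult.assoc)
  also have "\<dots> = (a * z) * b" unfolding assms(2) by (rule mult.assoc[symmetric])
  also have "\<dots> = z * (a * b)" unfolding assms(1) by (rule mult.assoc)
  finally show ?thesis .
qed

lemma idem_mult:
  fixes a b :: "'a::semigroup_mult"
  assumes "a * b = b * a" "a * a = a" "b * b = b"
  shows "(a * b) * (a * b) = a * b"
proof -
  have "(a * b) * (a * b) = a * (b * a) * b" by (simp add: mult.assoc)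
  also have "\<dots> = (a * a) * (b * b)" unfolding assms(1)[symmetric] by (simp add: mult.assoc)
  finally show ?thesis by (simp add: assms)
qed

definition comm :: "'h::complex_hilbert bop set \<Rightarrow> 'h bop set"
  where "comm S = {T. \<forall>s\<in>S. T * s = s * T}"

section \<open>The half-chain algebra and its shift endomorphism\<close>

text \<open>The content of the index on the level of operators: \<open>\<Phi>\<close> maps
  \<open>M\<close> onto all operators of the index space, \<open>\<Gamma>\<close> is the grading
  there, \<open>V N\<close> and \<open>\<Gamma>h\<close> implement translation by \<open>N\<close>
  sites and parity on the GNS space. \<open>V_funpow\<close> makes the translations a
  semigroup.\<close>

locale half_chain = chain d a \<Theta> \<omega> \<pi>0 \<Omega> \<sigma>
  for d and a :: "one_particle \<Rightarrow> 'a::cstar_algebra" and \<Theta> \<omega>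
    and \<pi>0 :: "'a \<Rightarrow> 'h::complex_hilbert \<Rightarrow> 'h" and \<Omega> \<sigma> +
  fixes V :: "nat \<Rightarrow> 'h \<Rightarrow> 'h" and \<Gamma>h :: "'h \<Rightarrow> 'h"
    and \<Phi> :: "'h bop \<Rightarrow> 'l::complex_hilbert bop" and \<Gamma> :: "'l bop" and M
  assumes V: "\<And>N. semiunitary 0 (V N)" "\<And>N A. V N (ap (rep A) \<Omega>) = ap (rep (\<sigma> N A)) \<Omega>"
      "\<And>N A x. V N (ap (rep A) x) = ap (rep (\<sigma> N A)) (V N x)"
    and V_funpow: "V N = V 1 ^^ N"
    and \<Gamma>h: "semiunitary 0 \<Gamma>h" "\<And>A. \<Gamma>h (ap (rep A) \<Omega>) = ap (rep (\<Theta> A)) \<Omega>"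
      "\<And>A x. \<Gamma>h (ap (rep A) x) = ap (rep (\<Theta> A)) (\<Gamma>h x)"
    and M_eq: "M = comm (comm (rep ` right_algebra d a))"
    and \<Phi>_bij: "bij_betw \<Phi> M UNIV"
    and \<Phi>_hom: "\<And>S T. S \<in> M \<Longrightarrow> T \<in> M \<Longrightarrow> \<Phi> (S + T) = \<Phi> S + \<Phi> T"
      "\<And>S T. S \<in> M \<Longrightarrow> T \<in> M \<Longrightarrow> \<Phi> (S * T) = \<Phi> S * \<Phi> T"
      "\<And>c T. T \<in> M \<Longrightarrow> \<Phi> (c *\<^sub>C T) = c *\<^sub>C \<Phi> T" "\<And>T. T \<in> M \<Longrightarrow> \<Phi> (adj T) = adj (\<Phi> T)"
    and \<Gamma>: "adj \<Gamma> = \<Gamma>" "\<Gamma> * \<Gamma> = 1"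
    and \<Phi>_parity: "\<And>T. T \<in> M \<Longrightarrow> \<Phi> (semiunitary_map.conj_by \<Gamma>h T) = \<Gamma> * \<Phi> T * \<Gamma>"
begin

sublocale V: semiunitary_map 0 "V N" for N by standard (rule V(1))
sublocale \<Gamma>h: semiunitary_map 0 \<Gamma>h by standard (rule \<Gamma>h(1))

lemma V_conj_rep: "V.conj_by N (\<pi> A) = \<pi> (\<sigma> N A)"
  by (rule bop_eqI) (simp add: V.ap_conj_by V(3) V.inv_right)

lemma \<Gamma>h_conj_rep: "\<Gamma>h.conj_by (\<pi> A) = \<pi> (\<Theta> A)"
  by (rule bop_eqI) (simp add: \<Gamma>h.ap_conj_by \<Gamma>h(3) \<Gamma>h.inv_right)

lemma V_\<Omega>: "V N \<Omega> = \<Omega>"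
  using V(2)[of N 1] by (simp add: rep_simps \<sigma>_simps)

lemma \<Gamma>h_\<Omega>: "\<Gamma>h \<Omega> = \<Omega>"
  using \<Gamma>h(2)[of 1] by (simp add: rep_simps \<Theta>_simps)

text \<open>The commutant of the half chain, described by generators so that membership can be
  tested on them. That it commutes with the whole norm closure is due to the continuity of
  \<open>\<pi>\<close>.\<close>

definition M' :: "'h bop set"
  where "M' = {Y. \<forall>f\<in>ops d {0..}. Y * \<pi> (a f) = \<pi> (a f) * Y \<and> Y * adj (\<pi> (a f)) = adj (\<pi> (a f)) * Y}"

lemma M'_adj: "Y \<in> M' \<Longrightarrow> adj Y \<in> M'"
proof -
  assume Y: "Y \<in> M'"
  show ?thesis unfolding M'_def
  proof (intro CollectI ballI conjI)
    fix f assume f: "f \<in> ops d {0..}"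
    from Y f have "Y * \<pi> (a f) = \<pi> (a f) * Y" "Y * adj (\<pi> (a f)) = adj (\<pi> (a f)) * Y" by (auto simp: M'_def)
    from this[THEN arg_cong[where f = adj]]
    show "adj Y * \<pi> (a f) = \<pi> (a f) * adj Y" "adj Y * adj (\<pi> (a f)) = adj (\<pi> (a f)) * adj Y" by simp_all
  qed
qed

lemma M'_closed: "1 \<in> M'" "0 \<in> M'" "X \<in> M' \<Longrightarrow> Y \<in> M' \<Longrightarrow> X * Y \<in> M'" "X \<in> M' \<Longrightarrow> Y \<in> M' \<Longrightarrow> X + Y \<in> M'"
  "X \<in> M' \<Longrightarrow> c *\<^sub>C X \<in> M'"
proof -
  show "1 \<in> M'" "0 \<in> M'" by (auto simp: M'_def)
  show "X \<in> M' \<Longrightarrow> Y \<in> M' \<Longrightarrow> X * Y \<in> M'" unfolding M'_def by (auto intro: comm_mult)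
  show "X \<in> M' \<Longrightarrow> Y \<in> M' \<Longrightarrow> X + Y \<in> M'" "X \<in> M' \<Longrightarrow> c *\<^sub>C X \<in> M'"
    by (auto simp: M'_def distrib_left distrib_right)
qed

lemma M'_eq: "M' = comm (\<pi> ` right_algebra d a)"
proof
  show "comm (\<pi> ` right_algebra d a) \<subseteq> M'"
  proof
    fix Y assume Y: "Y \<in> comm (\<pi> ` right_algebra d a)"
    have "a f \<in> right_algebra d a \<and> star (a f) \<in> right_algebra d a" if "f \<in> ops d {0..}" for f
    proof -
      have "a f \<in> star_subalgebra (a ` ops d {0..})" using that by (intro star_subalgebra.gen imageI)
      then show ?thesis unfolding local_algebra_def
        using closure_subset star_subalgebra.star by blast
    qed
    then show "Y \<in> M'" using Y by (auto simp: M'_def comm_def simp flip: rep_simps)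
  qed
  show "M' \<subseteq> comm (\<pi> ` right_algebra d a)"
  proof
    fix Y assume Y: "Y \<in> M'"
    let ?Q = "\<lambda>x. Y * \<pi> x = \<pi> x * Y"
    have m: "?Q (x * y)" if "?Q x" "?Q y" for x y
      using comm_mult[of "\<pi> x" Y "\<pi> y"] that by (simp add: rep_simps)
    have "?Q x \<and> ?Q (star x)" if "x \<in> star_subalgebra (a ` ops d {0..})" for x
      using that
    proof induction
      case (gen x)
      then show ?case using Y by (auto simp: M'_def rep_simps)
    next
      case unit
      show ?case by (simp add: rep_simps)
    next
      case (add x y)
      then show ?case by (simp add: rep_simps star_add distrib_left distrib_right)
    next
      case (scale x c)
      then show ?case by (simp add: rep_simps star_scaleC)
    next
      case (mult x y)
      then show ?case unfolding star_mult using m by blast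
    next
      case (star x)
      then show ?case unfolding star_star by blast
    qed
    then have "star_subalgebra (a ` ops d {0..}) \<subseteq> {x. \<forall>v. ap Y (ap (\<pi> x) v) = ap (\<pi> x) (ap Y v)}"
      by (auto simp flip: ap_mult)
    moreover have "closed {x. \<forall>v. ap Y (ap (\<pi> x) v) = ap (\<pi> x) (ap Y v)}"
      by (intro closed_Collect_all closed_Collect_eq continuous_on_ap
          bounded_linear.continuous_on[OF bounded_linear_rep] continuous_intros)
    ultimately have "right_algebra d a \<subseteq> {x. \<forall>v. ap Y (ap (\<pi> x) v) = ap (\<pi> x) (ap Y v)}"
      unfolding local_algebra_def by (rule closure_minimal)
    then show "Y \<in> comm (\<pi> ` right_algebra d a)"
      by (auto simp: comm_def intro!: bop_eqI simp: ap_mult)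
  qed
qed

lemma M_comm: "M = comm M'"
  by (simp add: M_eq M'_eq)

lemma M_M'_commute: "T \<in> M \<Longrightarrow> Y \<in> M' \<Longrightarrow> T * Y = Y * T"
  by (auto simp: M_comm comm_def)

lemma M_closed: "1 \<in> M" "0 \<in> M" "X \<in> M \<Longrightarrow> Y \<in> M \<Longrightarrow> X * Y \<in> M" "X \<in> M \<Longrightarrow> Y \<in> M \<Longrightarrow> X + Y \<in> M"
  "X \<in> M \<Longrightarrow> c *\<^sub>C X \<in> M" "X \<in> M \<Longrightarrow> adj X \<in> M"
proof -
  show "1 \<in> M" "0 \<in> M" by (auto simp: M_comm comm_def)
  show "X \<in> M \<Longrightarrow> Y \<in> M \<Longrightarrow> X * Y \<in> M" unfolding M_comm comm_def by (auto intro: comm_mult)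
  show "X \<in> M \<Longrightarrow> Y \<in> M \<Longrightarrow> X + Y \<in> M" "X \<in> M \<Longrightarrow> c *\<^sub>C X \<in> M"
    by (auto simp: M_comm comm_def distrib_left distrib_right)
  show "adj X \<in> M" if X: "X \<in> M"
    unfolding M_comm comm_def
  proof (intro CollectI ballI)
    fix Y assume "Y \<in> M'"
    then have "X * adj Y = adj Y * X" by (rule M_M'_commute[OF X M'_adj])
    from arg_cong[OF this, of adj] show "adj X * Y = Y * adj X" by simp
  qed
qed

lemma M_sum: "(\<And>i. i \<in> I \<Longrightarrow> f i \<in> M) \<Longrightarrow> (\<Sum>i\<in>I. f i) \<in> M"
  by (induction I rule: infinite_finite_induct) (auto simp: M_closed)

lemma rep_right_M: "x \<in> right_algebra d a \<Longrightarrow> \<pi> x \<in> M"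
  unfolding M_eq comm_def by auto

lemma rep_a_M: "f \<in> ops d {0..} \<Longrightarrow> \<pi> (a f) \<in> M"
  by (auto simp: M_comm comm_def M'_def)

lemma rep_Loc_M: "x \<in> Loc X \<Longrightarrow> X \<subseteq> {0..} \<Longrightarrow> \<pi> x \<in> M"
  by (rule rep_right_M) (use Loc_mono[of X "{0..}"] closure_subset in \<open>auto simp: local_algebra_def Loc_def\<close>)

definition \<Psi> :: "'l bop \<Rightarrow> 'h bop"
  where "\<Psi> = inv_into M \<Phi>"

lemma \<Psi>_M: "\<Psi> x \<in> M" and \<Phi>_\<Psi>: "\<Phi> (\<Psi> x) = x" and \<Psi>_\<Phi>: "T \<in> M \<Longrightarrow> \<Psi> (\<Phi> T) = T"
  using \<Phi>_bij unfolding \<Psi>_def bij_betw_def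
  by (metis inv_into_into UNIV_I, metis f_inv_into_f UNIV_I, simp)

lemma \<Phi>_inj: "S \<in> M \<Longrightarrow> T \<in> M \<Longrightarrow> \<Phi> S = \<Phi> T \<Longrightarrow> S = T"
  by (metis \<Psi>_\<Phi>)

lemma \<Psi>_eqI: "T \<in> M \<Longrightarrow> \<Phi> T = x \<Longrightarrow> \<Psi> x = T"
  using \<Psi>_\<Phi> by blast

lemma \<Phi>_one: "\<Phi> 1 = 1"
proof -
  have "\<Phi> 1 * \<Phi> (\<Psi> 1) = \<Phi> (1 * \<Psi> 1)" by (simp only: \<Phi>_hom(2)[OF M_closed(1) \<Psi>_M])
  then show ?thesis by (simp add: \<Phi>_\<Psi>)
qed

lemma \<Psi>_star_hom: "star_hom \<Psi>"
  unfolding star_hom_def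
  by (intro conjI allI; rule \<Psi>_eqI; simp add: M_closed \<Psi>_M \<Phi>_hom \<Phi>_\<Psi> \<Phi>_one)

lemmas \<Psi>_simps = star_homD[OF \<Psi>_star_hom]

lemma \<Phi>_sum: "finite I \<Longrightarrow> (\<And>i. i \<in> I \<Longrightarrow> f i \<in> M) \<Longrightarrow> \<Phi> (\<Sum>i\<in>I. f i) = (\<Sum>i\<in>I. \<Phi> (f i))"
proof (induction I rule: finite_induct)
  case empty
  have "\<Phi> 0 = 0" using \<Phi>_hom(3)[OF M_closed(2), of 0] by simp
  then show ?case by simp
next
  case (insert x F)
  then show ?case by (simp add: \<Phi>_hom(1) M_sum)
qed

text \<open>Conjugated back by the translation, \<open>Y\<close> commutes with the generators of the
  half chain and so lies in \<open>M'\<close>. Thus commuting with translated generators already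
  means commuting with the translate of the weak closure.\<close>

lemma shifted_commute:
  assumes Y: "\<And>f. f \<in> ops d {0..} \<Longrightarrow> Y * \<pi> (a (shift (int N) f)) = \<pi> (a (shift (int N) f)) * Y"
      "\<And>f. f \<in> ops d {0..} \<Longrightarrow> Y * adj (\<pi> (a (shift (int N) f))) = adj (\<pi> (a (shift (int N) f))) * Y"
    and T: "T \<in> M"
  shows "Y * V.conj_by N T = V.conj_by N T * Y"
proof -
  interpret W: semiunitary_map 0 "inv_into UNIV (V N)" by standard (rule V.inv_semiunitary)
  define X where "X = W.conj_by Y"
  have XY: "V.conj_by N X = Y"
    by (rule bop_eqI) (simp add: X_def V.ap_conj_by W.ap_conj_by V.inv_right V.surj V.inj bij_def inv_inv_eq)
  have "X * z = z * X" if "Y * V.conj_by N z = V.conj_by N z * Y" for z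
    using that V.conj_by_inj[of N "X * z" "z * X"] by (simp add: V.conj_by_simps XY)
  then have "X \<in> M'" unfolding M'_def
    using Y by (auto simp: V.conj_by_simps V_conj_rep \<sigma>_a)
  then have "T * X = X * T" by (rule M_M'_commute[OF T])
  from arg_cong[OF this, of "V.conj_by N"] show ?thesis by (simp add: V.conj_by_simps XY)
qed

lemma shift_ops: "f \<in> ops d {0..} \<Longrightarrow> shift (int N) f \<in> ops d {int N..}"
  using ops_shift[of f d "{0..}" "int N"] ops_mono[of "(+) (int N) ` {0..}" "{int N..}" d] by auto

lemma shift_ops0: "f \<in> ops d {0..} \<Longrightarrow> shift (int N) f \<in> ops d {0..}"
  using shift_ops[of f N] ops_mono[of "{int N..}" "{0..}" d] by auto

lemma conj_M: "T \<in> M \<Longrightarrow> V.conj_by N T \<in> M"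
  unfolding M_comm[unfolded comm_def]
  using shifted_commute[of _ N T] shift_ops0[of _ N] by (auto simp: M'_def M_comm[unfolded comm_def])

text \<open>Dual to \<open>conj_M\<close>: translation shrinks \<open>M\<close>, hence it enlarges
  \<open>M'\<close>.\<close>

lemma V_conj_M': "Y \<in> M' \<Longrightarrow> \<exists>X\<in>M'. V.conj_by N X = Y"
proof -
  assume Y: "Y \<in> M'"
  interpret W: semiunitary_map 0 "inv_into UNIV (V N)" by standard (rule V.inv_semiunitary)
  define X where "X = W.conj_by Y"
  have XY: "V.conj_by N X = Y"
    by (rule bop_eqI) (simp add: X_def V.ap_conj_by W.ap_conj_by V.inv_right V.surj V.inj bij_def inv_inv_eq)
  have "X * z = z * X" if "Y * V.conj_by N z = V.conj_by N z * Y" for z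
    using that V.conj_by_inj[of N "X * z" "z * X"] by (simp add: V.conj_by_simps XY)
  then have "X \<in> M'" unfolding M'_def
    using Y shift_ops0[of _ N] by (auto simp: V.conj_by_simps V_conj_rep \<sigma>_a M'_def)
  with XY show ?thesis by blast
qed

text \<open>An endomorphism of the operators on the index space, because forward translations map
  \<open>M\<close> into itself.\<close>

definition \<gamma> :: "nat \<Rightarrow> 'l bop \<Rightarrow> 'l bop"
  where "\<gamma> N x = \<Phi> (V.conj_by N (\<Psi> x))"

lemma \<gamma>_star_hom: "star_hom (\<gamma> N)"
  unfolding star_hom_def \<gamma>_def
  by (simp add: \<Psi>_simps V.conj_by_simps \<Phi>_hom conj_M \<Psi>_M \<Phi>_one)

lemmas \<gamma>_simps = star_homD[OF \<gamma>_star_hom]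

lemma \<Psi>_\<gamma>: "\<Psi> (\<gamma> N x) = V.conj_by N (\<Psi> x)"
  unfolding \<gamma>_def by (rule \<Psi>_\<Phi>) (rule conj_M[OF \<Psi>_M])

lemma \<gamma>_Suc: "\<gamma> (Suc N) x = \<gamma> 1 (\<gamma> N x)"
proof -
  have "V (Suc N) = V 1 \<circ> V N" using V_funpow[of "Suc N"] V_funpow[of N] by simp
  then have VS: "V (Suc N) y = V 1 (V N y)" for y by simp
  have "V.conj_by (Suc N) T = V.conj_by 1 (V.conj_by N T)" for T
  proof (rule bop_eqI)
    fix x
    obtain y where x: "x = V (Suc N) y" using V.surj[of "Suc N"] by blast
    show "ap (V.conj_by (Suc N) T) x = ap (V.conj_by 1 (V.conj_by N T)) x"
      unfolding x V.ap_conj_by_V unfolding VS V.ap_conj_by_V ..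
  qed
  then show ?thesis by (simp add: \<gamma>_def \<Psi>_\<Phi> conj_M \<Psi>_M)
qed

lemma \<gamma>_0: "\<gamma> 0 x = x"
proof -
  have "V.conj_by 0 T = T" for T
    by (rule bop_eqI) (use V.ap_conj_by_V[of 0 T] V_funpow[of 0] in simp)
  then show ?thesis by (simp add: \<gamma>_def \<Phi>_\<Psi>)
qed

text \<open>A parity operator lying inside \<open>M\<close>; this is what the first index entry 0
  provides.\<close>

definition \<Gamma>M :: "'h bop" where "\<Gamma>M = \<Psi> \<Gamma>"

lemma \<Gamma>M: "\<Gamma>M \<in> M" "\<Gamma>M * \<Gamma>M = 1" "adj \<Gamma>M = \<Gamma>M"
  using \<Psi>_simps(2)[of \<Gamma> \<Gamma>] \<Psi>_simps(4)[of \<Gamma>] \<Gamma> by (simp_all add: \<Gamma>M_def \<Psi>_M \<Psi>_simps)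

lemma \<Gamma>M_cancel: "\<Gamma>M * (\<Gamma>M * x) = x" by (simp add: \<Gamma>M flip: mult.assoc)

lemma M'_\<Gamma>h: "Y \<in> M' \<Longrightarrow> \<exists>X\<in>M'. \<Gamma>h.conj_by X = Y"
proof -
  assume Y: "Y \<in> M'"
  interpret W: semiunitary_map 0 "inv_into UNIV \<Gamma>h" by standard (rule \<Gamma>h.inv_semiunitary)
  define X where "X = W.conj_by Y"
  have XY: "\<Gamma>h.conj_by X = Y"
    by (rule bop_eqI) (simp add: X_def \<Gamma>h.ap_conj_by W.ap_conj_by \<Gamma>h.inv_right \<Gamma>h.surj \<Gamma>h.inj bij_def inv_inv_eq)
  have "X * z = z * X" if "Y * \<Gamma>h.conj_by z = \<Gamma>h.conj_by z * Y" for z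
    using that \<Gamma>h.conj_by_inj[of "X * z" "z * X"] by (simp add: \<Gamma>h.conj_by_simps XY)
  then have "X \<in> M'" unfolding M'_def
    using Y by (auto simp: \<Gamma>h.conj_by_simps \<Gamma>h_conj_rep M'_def \<Theta>_simps(5) rep_simps)
  with XY show ?thesis by blast
qed

lemma \<Gamma>h_conj_M: "T \<in> M \<Longrightarrow> \<Gamma>h.conj_by T \<in> M"
  unfolding M_comm comm_def
proof (intro CollectI ballI)
  fix Y assume T: "T \<in> {T. \<forall>s\<in>M'. T * s = s * T}" and Y: "Y \<in> M'"
  obtain X where X: "X \<in> M'" "\<Gamma>h.conj_by X = Y" using M'_\<Gamma>h[OF Y] by blast
  then have "T * X = X * T" using T by blast
  from arg_cong[OF this, of \<Gamma>h.conj_by] show "\<Gamma>h.conj_by T * Y = Y * \<Gamma>h.conj_by T"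
    by (simp add: \<Gamma>h.conj_by_simps X)
qed

lemma \<Gamma>M_conj: "T \<in> M \<Longrightarrow> \<Gamma>M * T * \<Gamma>M = \<Gamma>h.conj_by T"
  by (rule \<Phi>_inj) (simp_all add: M_closed \<Gamma>M \<Gamma>h_conj_M \<Phi>_hom \<Phi>_parity, simp add: \<Gamma>M_def \<Phi>_\<Psi>)

lemma \<Gamma>M_rep: "\<pi> x \<in> M \<Longrightarrow> \<Gamma>M * \<pi> x = \<pi> (\<Theta> x) * \<Gamma>M"
  using \<Gamma>M_conj[of "\<pi> x"] \<Gamma>h_conj_rep[of x] by (metis \<Gamma>M(2) mult.assoc mult_1_right)

section \<open>Matrix units of a block and their commutation with the translated algebra\<close>

definition E :: "nat \<Rightarrow> nat set \<Rightarrow> nat set \<Rightarrow> 'h bop"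
  where "E N S T = \<pi> (modes.unit (d * N) S T)"

abbreviation sets :: "nat \<Rightarrow> nat set set" where "sets N \<equiv> Pow {..<d * N}"

lemma E_M: "S \<in> sets N \<Longrightarrow> T \<in> sets N \<Longrightarrow> E N S T \<in> M"
  unfolding E_def by (rule rep_Loc_M[OF unit_Loc]) auto

lemma E_mult:
  assumes "S \<in> sets N" "T \<in> sets N"
  shows "E N R T * E N S Q = (if S = T then E N R Q else 0)"
  using assms by (simp add: E_def modes.unit_mult rep_simps flip: rep_simps(2))

lemma E_sum: "(\<Sum>S\<in>sets N. E N S S) = 1"
  by (simp add: E_def modes.sum_unit rep_simps flip: rep_sum)

lemma E_adj: "adj (E N S T) = E N T S"
  by (simp add: E_def modes.star_unit flip: rep_simps)

definition sg :: "nat set \<Rightarrow> nat set \<Rightarrow> complex"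
  where "sg S T = (- 1) ^ (card S + card T)"

lemma E_parity: "S \<in> sets N \<Longrightarrow> T \<in> sets N \<Longrightarrow> \<Gamma>M * E N S T = sg S T *\<^sub>C (E N S T * \<Gamma>M)"
  using \<Gamma>M_rep[of "modes.unit (d * N) S T"] E_M[of S N T] finite_subset[of S "{..<d * N}"] finite_subset[of T "{..<d * N}"]
  by (simp add: E_def \<Theta>_unit rep_simps sg_def)

lemma E_shift_commute:
  assumes "S \<in> sets N" "T \<in> sets N" and f: "f \<in> ops d {0..}"
  shows "E N S T * \<pi> (a (shift (int N) f)) = sg S T *\<^sub>C (\<pi> (a (shift (int N) f)) * E N S T)"
    "E N S T * adj (\<pi> (a (shift (int N) f))) = sg S T *\<^sub>C (adj (\<pi> (a (shift (int N) f))) * E N S T)"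
proof -
  have fin: "finite S" "finite T" using assms finite_subset by blast+
  have L: "modes.unit (d * N) S T \<in> Loc {0..<int N}" using assms by (intro unit_Loc) auto
  have dis: "{0..<int N} \<inter> {int N..} = {}" by auto
  from Loc_a_commute[OF L shift_ops[OF f] dis]
  show "E N S T * \<pi> (a (shift (int N) f)) = sg S T *\<^sub>C (\<pi> (a (shift (int N) f)) * E N S T)"
    "E N S T * adj (\<pi> (a (shift (int N) f))) = sg S T *\<^sub>C (adj (\<pi> (a (shift (int N) f))) * E N S T)"
    unfolding E_def by (simp_all add: \<Theta>_unit[OF fin] mult_scaleC_right rep_simps sg_def flip: rep_simps(2,3,4))
qed

text \<open>The parity operator of the half chain starting at \<open>N\<close>. It anticommutes with
  the generators there, so its product with an odd matrix unit of \<open>[0, N - 1]\<close> commutes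
  with them.\<close>

definition GN :: "nat \<Rightarrow> 'h bop" where "GN N = V.conj_by N \<Gamma>M"

lemma GN: "GN N \<in> M" "GN N * GN N = 1" "adj (GN N) = GN N"
  by (simp_all add: GN_def conj_M \<Gamma>M flip: V.conj_by_simps) (simp add: V.conj_by_simps)

lemma GN_shift:
  assumes f: "f \<in> ops d {0..}"
  shows "GN N * \<pi> (a (shift (int N) f)) = - (\<pi> (a (shift (int N) f)) * GN N)"
    "GN N * adj (\<pi> (a (shift (int N) f))) = - (adj (\<pi> (a (shift (int N) f))) * GN N)"
proof -
  have "\<Gamma>M * \<pi> (a f) = - (\<pi> (a f) * \<Gamma>M)" "\<Gamma>M * \<pi> (star (a f)) = - (\<pi> (star (a f)) * \<Gamma>M)"
    using \<Gamma>M_rep[OF rep_a_M[OF f]] \<Gamma>M_rep[of "star (a f)"] M_closed(6)[OF rep_a_M[OF f]]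
    by (simp_all add: \<Theta>_simps(4) \<Theta>_simps(5)[OF f] star_minus rep_simps)
  from this[THEN arg_cong[where f = "V.conj_by N"]]
  show "GN N * \<pi> (a (shift (int N) f)) = - (\<pi> (a (shift (int N) f)) * GN N)"
    "GN N * adj (\<pi> (a (shift (int N) f))) = - (adj (\<pi> (a (shift (int N) f))) * GN N)"
    by (simp_all add: V.conj_by_simps GN_def V_conj_rep \<sigma>_simps \<sigma>_a[OF f] rep_simps)
qed

lemma odd_GN_commute:
  assumes ST: "S \<in> sets N" "T \<in> sets N" and "sg S T = - 1" and X: "X \<in> M"
  shows "E N S T * GN N * V.conj_by N X = V.conj_by N X * (E N S T * GN N)"
  by (rule shifted_commute[OF _ _ X])
    (simp_all add: mult.assoc GN_shift E_shift_commute[OF ST] assms(3) flip: mult.assoc[of "E N S T"])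

lemma even_commute:
  assumes ST: "S \<in> sets N" "T \<in> sets N" and "sg S T = 1" and X: "X \<in> M"
  shows "E N S T * V.conj_by N X = V.conj_by N X * E N S T"
  by (rule shifted_commute[OF _ _ X]) (simp_all add: E_shift_commute[OF ST] assms(3))

lemma sg_cases: "sg S T = 1 \<or> sg S T = - 1"
  by (simp add: sg_def minus_one_power_iff)

text \<open>For an odd unit, the product with \<open>GN N\<close> commutes with the translate of all
  of \<open>M\<close>, in particular with \<open>GN N\<close>, the translate of
  \<open>\<Gamma>M\<close>. One factor then cancels, as \<open>GN N\<close> squares to 1.\<close>

lemma E_GN_commute:
  assumes ST: "S \<in> sets N" "T \<in> sets N"
  shows "E N S T * GN N = GN N * E N S T"
  using sg_cases[of S T]
proof
  assume "sg S T = 1"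
  then show ?thesis using even_commute[OF ST _ \<Gamma>M(1)] by (simp add: GN_def)
next
  assume "sg S T = - 1"
  then have "E N S T * GN N * GN N = GN N * (E N S T * GN N)"
    using odd_GN_commute[OF ST _ \<Gamma>M(1)] by (simp add: GN_def)
  then have "E N S T = GN N * (E N S T * GN N)" by (simp add: mult.assoc GN)
  then have "GN N * E N S T = GN N * GN N * (E N S T * GN N)" by (metis mult.assoc)
  then show ?thesis by (simp add: GN)
qed

text \<open>Insert \<open>GN N\<close> twice: one copy makes the odd unit commute, the other joins
  it on the far side, so that the translated element is conjugated by the parity.\<close>

lemma E_conj_twist:
  assumes ST: "S \<in> sets N" "T \<in> sets N" and X: "X \<in> M" and odd: "sg S T = - 1"
  shows "E N S T * V.conj_by N X = V.conj_by N (\<Gamma>M * X * \<Gamma>M) * E N S T"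
proof -
  have "E N S T * V.conj_by N X = E N S T * GN N * V.conj_by N (\<Gamma>M * X)"
    by (simp add: GN_def V.conj_by_simps mult.assoc) (simp add: \<Gamma>M flip: mult.assoc V.conj_by_simps)
  also have "\<dots> = V.conj_by N (\<Gamma>M * X) * (E N S T * GN N)"
    by (rule odd_GN_commute[OF ST odd]) (simp add: M_closed \<Gamma>M X)
  also have "\<dots> = V.conj_by N (\<Gamma>M * X) * GN N * E N S T" by (simp add: E_GN_commute[OF ST] mult.assoc)
  finally show ?thesis by (simp add: GN_def V.conj_by_simps mult.assoc)
qed

text \<open>Twisted by \<open>GN N\<close>, the matrix units of \<open>[0, N - 1]\<close> commute with the algebra of \<open>[N, \<infinity>)\<close>.\<close>

definition F :: "nat \<Rightarrow> nat set \<Rightarrow> nat set \<Rightarrow> 'h bop"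
  where "F N S T = (if sg S T = 1 then E N S T else E N S T * GN N)"

lemma F_M: "S \<in> sets N \<Longrightarrow> T \<in> sets N \<Longrightarrow> F N S T \<in> M"
  by (simp add: F_def E_M GN M_closed)

lemma F_conj_commute: "S \<in> sets N \<Longrightarrow> T \<in> sets N \<Longrightarrow> X \<in> M \<Longrightarrow> F N S T * V.conj_by N X = V.conj_by N X * F N S T"
  using even_commute odd_GN_commute sg_cases[of S T] by (auto simp: F_def)

lemma F_mult:
  assumes "S \<in> sets N" "T \<in> sets N" "R \<in> sets N" "Q \<in> sets N"
  shows "F N R T * F N S Q = (if S = T then F N R Q else 0)"
proof -
  have sgm: "sg R Q = sg R T * sg T Q"
    by (simp add: sg_def power_add flip: power_mult_distrib)
  have c: "GN N * E N S Q = E N S Q * GN N" using E_GN_commute assms by metis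
  define g1 g2 where "g1 = (if sg R T = 1 then 1 else GN N)" and "g2 = (if sg S Q = 1 then 1 else GN N)"
  have c1: "g1 * E N S Q = E N S Q * g1" by (simp add: g1_def c)
  have "F N R T * F N S Q = E N R T * (g1 * E N S Q) * g2"
    by (simp add: F_def g1_def g2_def mult.assoc)
  also have "\<dots> = E N R T * E N S Q * g1 * g2" unfolding c1 by (simp add: mult.assoc)
  also have "\<dots> = (if S = T then F N R Q else 0)"
  proof (cases "S = T")
    case True
    show ?thesis using sg_cases[of R T] sg_cases[of T Q] assms
      by (elim disjE) (simp_all add: True E_mult F_def sgm g1_def g2_def mult.assoc GN)
  qed (use assms in \<open>simp add: E_mult\<close>)
  finally show ?thesis .
qed

lemma F_diag: "F N S S = E N S S"
  by (simp add: F_def sg_def flip: mult_2)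

lemma F_sum: "(\<Sum>S\<in>sets N. F N S S) = 1"
  by (simp add: F_diag E_sum)

lemma E_eq_F: "S \<in> sets N \<Longrightarrow> T \<in> sets N \<Longrightarrow> E N S T = (if sg S T = 1 then F N S T else F N S T * GN N)"
  by (simp add: F_def mult.assoc GN)

lemma finite_sets: "finite (sets N)" by simp

text \<open>Block matrix units and translated generators together generate the half chain, by
  \<open>ops_split\<close> and \<open>modes.s_as_units\<close>.\<close>

lemma in_M'I:
  assumes E: "\<And>S T. S \<in> sets N \<Longrightarrow> T \<in> sets N \<Longrightarrow> Y * E N S T = E N S T * Y"
    and s: "\<And>f. f \<in> ops d {0..} \<Longrightarrow> Y * \<pi> (a (shift (int N) f)) = \<pi> (a (shift (int N) f)) * Y"
      "\<And>f. f \<in> ops d {0..} \<Longrightarrow> Y * adj (\<pi> (a (shift (int N) f))) = adj (\<pi> (a (shift (int N) f))) * Y"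
  shows "Y \<in> M'"
proof -
  let ?A = "\<lambda>k. \<pi> (mode_annihilator d a k)"
  have sum_comm: "Y * (\<Sum>i\<in>I. f i) = (\<Sum>i\<in>I. f i) * Y" if "\<And>i. i \<in> I \<Longrightarrow> Y * f i = f i * Y" for I and f :: "'i \<Rightarrow> 'h bop"
    using that by (simp add: sum_distrib_left sum_distrib_right)
  have k: "Y * adj (?A k) = adj (?A k) * Y" "Y * ?A k = ?A k * Y" if k: "k < d * N" for k
  proof -
    let ?I = "{S. S \<subseteq> {..<d * N} \<and> k \<notin> S}"
    let ?g = "\<lambda>S. (- 1) ^ card {j \<in> S. j < k} :: complex"
    have 1: "adj (?A k) = (\<Sum>S\<in>?I. ?g S *\<^sub>C E N (insert k S) S)"
      unfolding rep_simps(4)[symmetric] modes.s_as_units[OF k] rep_sum rep_simps E_def ..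
    have 2: "?A k = (\<Sum>S\<in>?I. cnj (?g S) *\<^sub>C E N S (insert k S))"
      using arg_cong[OF 1, of adj] by (simp add: adj_sum E_adj)
    show "Y * adj (?A k) = adj (?A k) * Y" unfolding 1 by (rule sum_comm) (use k E in auto)
    show "Y * ?A k = ?A k * Y" unfolding 2 by (rule sum_comm) (use k E in auto)
  qed
  show ?thesis unfolding M'_def
  proof (intro CollectI ballI conjI)
    fix f assume f: "f \<in> ops d {0..}"
    obtain g where g: "g \<in> ops d {0..}" "a f = a (mode_part (d * N) f) + a (shift (int N) g)" using ops_split[OF f] .
    have "Y * \<pi> (a (mode_part (d * N) f)) = \<pi> (a (mode_part (d * N) f)) * Y"
      unfolding a_mode_part rep_sum rep_simps by (rule sum_comm) (simp add: k)
    then show "Y * \<pi> (a f) = \<pi> (a f) * Y" using s(1)[OF g(1)] by (simp add: g(2) rep_simps distrib_left distrib_right)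
    have "Y * adj (\<pi> (a (mode_part (d * N) f))) = adj (\<pi> (a (mode_part (d * N) f))) * Y"
      unfolding a_mode_part rep_sum rep_simps adj_sum adj_simps by (rule sum_comm) (simp add: k)
    then show "Y * adj (\<pi> (a f)) = adj (\<pi> (a f)) * Y"
      using s(2)[OF g(1)] by (simp add: g(2) rep_simps distrib_left distrib_right)
  qed
qed

text \<open>
  \<open>M\<close> is the tensor product of the algebra generated by the \<open>F N S T\<close> and of the algebra of \<open>[N, \<infinity>)\<close>.
\<close>

lemma corner:
  assumes T: "T \<in> M"
  shows "\<exists>X\<in>M. E N {} {} * T * E N {} {} = E N {} {} * V.conj_by N X"
proof -
  have e: "{} \<in> sets N" by simp
  note Fm = F_mult[of _ N]
  \<comment> \<open>The corner of \<open>T\<close> repeated along the diagonal: in the tensor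
    picture, the identity of the block tensored with the corner.\<close>
  define Z where "Z = (\<Sum>S\<in>sets N. F N S {} * T * F N {} S)"
  have ZF: "Z * F N S R = F N S R * Z" if SR: "S \<in> sets N" "R \<in> sets N" for S R
  proof -
    have "Z * F N S R = (\<Sum>Q\<in>sets N. if Q = S then F N S {} * T * F N {} R else 0)"
      unfolding Z_def sum_distrib_right
      by (rule sum.cong[OF refl]) (use SR in \<open>simp add: mult.assoc Fm\<close>)
    also have "\<dots> = (\<Sum>Q\<in>sets N. if Q = R then F N S {} * T * F N {} R else 0)"
      using SR by simp
    also have "\<dots> = F N S R * Z"
      unfolding Z_def sum_distrib_left
      by (rule sum.cong[OF refl]) (use SR in \<open>simp add: Fm flip: mult.assoc\<close>)
    finally show ?thesis .
  qed
  interpret W: semiunitary_map 0 "inv_into UNIV (V N)" by standard (rule V.inv_semiunitary)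
  define X where "X = W.conj_by Z"
  have XZ: "V.conj_by N X = Z"
    by (rule bop_eqI) (simp add: X_def V.ap_conj_by W.ap_conj_by V.inv_right V.surj V.inj bij_def inv_inv_eq)
  have "X \<in> M" unfolding M_comm comm_def
  proof (intro CollectI ballI)
    fix Y assume Y: "Y \<in> M'"
    define Y1 where "Y1 = V.conj_by N Y"
    have Y1c: "Y1 * V.conj_by N R = V.conj_by N R * Y1" if "R \<in> M" for R
      using M_M'_commute[OF that Y] by (simp add: Y1_def flip: V.conj_by_simps)
    \<comment> \<open>Matrix coefficients of \<open>Y1\<close> with respect to the units
      \<open>F\<close>. Each of them commutes with the block and with the translated algebra, so it
      lies in \<open>M'\<close>. Hence \<open>Y1\<close> is built from units \<open>F\<close>, which
      commute with \<open>Z\<close> by construction, and elements of \<open>M'\<close>, which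
      commute with \<open>Z\<close> because \<open>Z\<close> lies in \<open>M\<close>.\<close>
    define YY where "YY S R = (\<Sum>Q\<in>sets N. F N Q S * Y1 * F N R Q)" for S R
    have YYF: "YY S R * F N A B = F N A B * YY S R"
      if "S \<in> sets N" "R \<in> sets N" "A \<in> sets N" "B \<in> sets N" for S R A B
    proof -
      have "YY S R * F N A B = (\<Sum>Q\<in>sets N. if Q = A then F N A S * Y1 * F N R B else 0)"
        unfolding YY_def sum_distrib_right
        by (rule sum.cong[OF refl]) (use that in \<open>simp add: mult.assoc Fm\<close>)
      also have "\<dots> = (\<Sum>Q\<in>sets N. if Q = B then F N A S * Y1 * F N R B else 0)"
        using that by simp
      also have "\<dots> = F N A B * YY S R"
        unfolding YY_def sum_distrib_left
        by (rule sum.cong[OF refl]) (use that in \<open>simp add: Fm flip: mult.assoc\<close>)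
      finally show ?thesis .
    qed
    have YYc: "YY S R * V.conj_by N B = V.conj_by N B * YY S R"
      if srb: "S \<in> sets N" "R \<in> sets N" "B \<in> M" for S R B
    proof -
      have "F N Q S * Y1 * F N R Q * V.conj_by N B = V.conj_by N B * (F N Q S * Y1 * F N R Q)" if Q: "Q \<in> sets N" for Q
        using Q srb by (intro comm_mult F_conj_commute Y1c)
      then show ?thesis unfolding YY_def sum_distrib_left sum_distrib_right by (intro sum.cong refl)
    qed
    have YYM': "YY S R \<in> M'" if SR: "S \<in> sets N" "R \<in> sets N" for S R
    proof (rule in_M'I[of N])
      fix A B assume AB: "A \<in> sets N" "B \<in> sets N"
      have "YY S R * GN N = GN N * YY S R" using YYc[OF SR \<Gamma>M(1)] by (simp add: GN_def)
      then have "YY S R * (F N A B * GN N) = F N A B * GN N * YY S R"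
        using comm_mult[of "F N A B" "YY S R" "GN N"] YYF[OF SR AB] by simp
      then show "YY S R * E N A B = E N A B * YY S R" using YYF[OF SR AB] E_eq_F[OF AB] by simp
    next
      fix f assume f: "f \<in> ops d {0..}"
      show "YY S R * \<pi> (a (shift (int N) f)) = \<pi> (a (shift (int N) f)) * YY S R"
        using YYc[OF SR rep_a_M[OF f]] by (simp add: V_conj_rep \<sigma>_a[OF f])
      show "YY S R * adj (\<pi> (a (shift (int N) f))) = adj (\<pi> (a (shift (int N) f))) * YY S R"
        using YYc[OF SR M_closed(6)[OF rep_a_M[OF f]]] by (simp add: V.conj_by_simps V_conj_rep \<sigma>_a[OF f])
    qed
    have "Y1 = (\<Sum>S\<in>sets N. \<Sum>R\<in>sets N. F N S S * Y1 * F N R R)"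
      unfolding sum_distrib_left[symmetric] sum_distrib_right[symmetric] F_sum by simp
    also have "\<dots> = (\<Sum>S\<in>sets N. \<Sum>R\<in>sets N. F N S R * YY S R)"
    proof (intro sum.cong refl)
      fix S R assume SR: "S \<in> sets N" "R \<in> sets N"
      have "F N S R * YY S R = (\<Sum>Q\<in>sets N. if Q = R then F N S S * Y1 * F N R R else 0)"
        unfolding YY_def sum_distrib_left
        by (rule sum.cong[OF refl]) (use SR in \<open>simp add: Fm flip: mult.assoc\<close>)
      then show "F N S S * Y1 * F N R R = F N S R * YY S R" using SR by simp
    qed
    finally have Y1: "Y1 = (\<Sum>S\<in>sets N. \<Sum>R\<in>sets N. F N S R * YY S R)" .
    have Z_M: "Z \<in> M" unfolding Z_def by (intro M_sum M_closed F_M T e)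
    have "Z * Y1 = Y1 * Z"
    proof -
      have "Z * (F N S R * YY S R) = F N S R * YY S R * Z" if SR: "S \<in> sets N" "R \<in> sets N" for S R
        using comm_mult[of "F N S R" Z "YY S R"] ZF[OF SR] M_M'_commute[OF Z_M YYM'[OF SR]] by simp
      then show ?thesis unfolding Y1 sum_distrib_left sum_distrib_right by (intro sum.cong refl)
    qed
    then show "X * Y = Y * X"
      using V.conj_by_inj[of N "X * Y" "Y * X"] by (simp add: V.conj_by_simps XZ Y1_def)
  qed
  moreover have "E N {} {} * T * E N {} {} = E N {} {} * Z"
  proof -
    have "F N {} {} * Z = (\<Sum>Q\<in>sets N. if Q = {} then F N {} {} * T * F N {} {} else 0)"
      unfolding Z_def sum_distrib_left
      by (rule sum.cong[OF refl]) (simp add: Fm flip: mult.assoc)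
    then show ?thesis by (simp add: F_diag)
  qed
  ultimately show ?thesis using XZ by metis
qed

section \<open>Matrix units and translation on the index space\<close>

definition EK :: "nat \<Rightarrow> nat set \<Rightarrow> nat set \<Rightarrow> 'l bop"
  where "EK N S T = \<Phi> (E N S T)"

lemma EK_mult: "S \<in> sets N \<Longrightarrow> T \<in> sets N \<Longrightarrow> R \<in> sets N \<Longrightarrow> Q \<in> sets N \<Longrightarrow>
    EK N R T * EK N S Q = (if S = T then EK N R Q else 0)"
  using \<Phi>_hom(2)[OF E_M[of R N T] E_M[of S N Q]] \<Phi>_hom(3)[OF M_closed(2), of 0] by (cases "S = T") (simp_all add: EK_def E_mult)

lemma EK_sum: "(\<Sum>S\<in>sets N. EK N S S) = 1"
  using \<Phi>_sum[OF finite_sets, of N "\<lambda>S. E N S S"] by (simp add: E_M EK_def E_sum \<Phi>_one)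

lemma EK_adj: "S \<in> sets N \<Longrightarrow> T \<in> sets N \<Longrightarrow> adj (EK N S T) = EK N T S"
  using \<Phi>_hom(4)[OF E_M[of S N T]] by (simp add: EK_def E_adj)

lemma \<Psi>_EK: "S \<in> sets N \<Longrightarrow> T \<in> sets N \<Longrightarrow> \<Psi> (EK N S T) = E N S T"
  by (simp add: EK_def \<Psi>_\<Phi> E_M)

lemma \<Psi>_inj: "\<Psi> x = \<Psi> y \<longleftrightarrow> x = y"
  by (metis \<Phi>_\<Psi>)

lemma EK_\<gamma>_even:
  assumes ST: "S \<in> sets N" "T \<in> sets N" and "sg S T = 1"
  shows "EK N S T * \<gamma> N x = \<gamma> N x * EK N S T"
proof -
  have "\<Psi> (EK N S T * \<gamma> N x) = \<Psi> (\<gamma> N x * EK N S T)"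
    by (simp add: \<Psi>_simps \<Psi>_EK[OF ST] \<Psi>_\<gamma> even_commute[OF ST assms(3) \<Psi>_M])
  then show ?thesis by (simp add: \<Psi>_inj)
qed

lemma EK_\<gamma>_odd:
  assumes ST: "S \<in> sets N" "T \<in> sets N" and "sg S T = - 1"
  shows "EK N S T * \<gamma> N x = \<gamma> N (\<Gamma> * x * \<Gamma>) * EK N S T"
proof -
  have "\<Psi> (EK N S T * \<gamma> N x) = \<Psi> (\<gamma> N (\<Gamma> * x * \<Gamma>) * EK N S T)"
    using E_conj_twist[OF ST \<Psi>_M assms(3)] by (simp add: \<Psi>_simps \<Psi>_EK[OF ST] \<Psi>_\<gamma> flip: \<Gamma>M_def)
  then show ?thesis by (simp add: \<Psi>_inj)
qed

lemma EK_\<gamma>_even_arg: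
  assumes ST: "S \<in> sets N" "T \<in> sets N" and "\<Gamma> * x * \<Gamma> = x"
  shows "EK N S T * \<gamma> N x = \<gamma> N x * EK N S T"
  using EK_\<gamma>_even[OF ST, of x] EK_\<gamma>_odd[OF ST, of x] sg_cases[of S T] assms(3) by auto

lemma EK_parity: "S \<in> sets N \<Longrightarrow> T \<in> sets N \<Longrightarrow> \<Gamma> * EK N S T * \<Gamma> = sg S T *\<^sub>C EK N S T"
proof -
  assume ST: "S \<in> sets N" "T \<in> sets N"
  have "\<Psi> (\<Gamma> * EK N S T * \<Gamma>) = \<Psi> (sg S T *\<^sub>C EK N S T)"
    unfolding \<Psi>_simps \<Psi>_EK[OF ST] \<Gamma>M_def[symmetric] E_parity[OF ST] by (simp add: mult.assoc \<Gamma>M)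
  then show ?thesis by (simp add: \<Psi>_inj)
qed

lemma sg_empty: "sg {} {} = 1" by (simp add: sg_def)

text \<open>By \<open>corner\<close>, compressing any operator by \<open>EK N {} {}\<close> gives
  \<open>EK N {} {}\<close> times an element in the image of \<open>\<gamma> N\<close>; the image of
  the rank-one projection then reduces that element to a scalar. So the product of the two commuting
  projections is minimal.\<close>

lemma minimal_projection:
  assumes \<xi>: "cinner \<xi> \<xi> = 1"
  obtains \<zeta> where "cinner \<zeta> \<zeta> = 1" "EK N {} {} * \<gamma> N (rank1 \<xi> \<xi>) = rank1 \<zeta> \<zeta>"
proof -
  let ?e = "rank1 \<xi> \<xi>" and ?E = "EK N {} {}"
  define q where "q = ?E * \<gamma> N ?e"
  have e: "{} \<in> sets N" by simp
  have ee: "?e * ?e = ?e" by (simp add: rank1_rank1 \<xi>)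
  note c = EK_\<gamma>_even[OF e e sg_empty]
  have EE: "?E * ?E = ?E" by (simp add: EK_mult)
  have q1: "q * q = q"
    unfolding q_def by (rule idem_mult[OF c EE]) (simp add: ee flip: \<gamma>_simps(2))
  have q2: "adj q = q"
    by (simp add: q_def EK_adj c flip: \<gamma>_simps(4))
  have q3: "q \<noteq> 0"
  proof
    assume q0: "q = 0"
    \<comment> \<open>Summed over \<open>S\<close>, these conjugates restore the translate of the
      rank-one projection, so \<open>q = 0\<close> would force that translate to vanish.\<close>
    have F0: "F N S {} * (E N {} {} * V.conj_by N (\<Psi> ?e)) * F N {} S = E N S S * V.conj_by N (\<Psi> ?e)" if S: "S \<in> sets N" for S
    proof -
      have "F N S {} * (E N {} {} * V.conj_by N (\<Psi> ?e)) * F N {} S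
          = F N S {} * F N {} {} * (F N {} S * V.conj_by N (\<Psi> ?e))"
        by (simp add: F_diag mult.assoc F_conj_commute[OF e S \<Psi>_M])
      also have "\<dots> = F N S {} * F N {} {} * F N {} S * V.conj_by N (\<Psi> ?e)" by (simp only: mult.assoc)
      also have "F N S {} * F N {} {} * F N {} S = E N S S" using S by (simp add: F_mult flip: F_diag)
      finally show ?thesis .
    qed
    have "\<Psi> q = E N {} {} * V.conj_by N (\<Psi> ?e)" by (simp add: q_def \<Psi>_simps \<Psi>_EK \<Psi>_\<gamma>)
    then have "E N {} {} * V.conj_by N (\<Psi> ?e) = 0" using q0 by (simp add: \<Psi>_simps)
    then have "(\<Sum>S\<in>sets N. E N S S * V.conj_by N (\<Psi> ?e)) = 0" using F0 by (simp add: sum.neutral)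
    then have "V.conj_by N (\<Psi> ?e) = 0" by (simp add: E_sum flip: sum_distrib_right)
    then have "\<Psi> ?e = \<Psi> 0" using V.conj_by_inj[of N "\<Psi> ?e" 0] by (simp add: V.conj_by_simps \<Psi>_simps)
    then have "?e = 0" by (simp add: \<Psi>_inj)
    then have "ap ?e \<xi> = 0" by simp
    then show False using \<xi> by (simp add: ap_rank1)
  qed
  have q4: "\<exists>k. q * x * q = k *\<^sub>C q" for x
  proof -
    obtain X where X: "X \<in> M" "E N {} {} * \<Psi> x * E N {} {} = E N {} {} * V.conj_by N X"
      using corner[OF \<Psi>_M] by blast
    have "\<Psi> (?E * x * ?E) = \<Psi> (?E * \<gamma> N (\<Phi> X))"
      using X by (simp add: \<Psi>_simps \<Psi>_EK \<Psi>_\<gamma> \<Psi>_\<Phi>)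
    then have ExE: "?E * x * ?E = ?E * \<gamma> N (\<Phi> X)" by (simp add: \<Psi>_inj)
    have "?e * \<Phi> X * ?e = cinner \<xi> (ap (\<Phi> X) \<xi>) *\<^sub>C ?e" by (simp add: rank1_mult rank1_rank1 ap_rank1 rank1_linear cinner_adj')
    then have eXe: "\<gamma> N ?e * \<gamma> N (\<Phi> X) * \<gamma> N ?e = cinner \<xi> (ap (\<Phi> X) \<xi>) *\<^sub>C \<gamma> N ?e"
      by (simp flip: \<gamma>_simps)
    have "q * x * q = \<gamma> N ?e * (?E * x * ?E) * \<gamma> N ?e"
      unfolding q_def by (subst (1) c) (simp add: mult.assoc)
    also have "\<dots> = (\<gamma> N ?e * ?E) * \<gamma> N (\<Phi> X) * \<gamma> N ?e" unfolding ExE by (simp add: mult.assoc)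
    also have "\<dots> = ?E * (\<gamma> N ?e * \<gamma> N (\<Phi> X) * \<gamma> N ?e)" unfolding c[symmetric] by (simp add: mult.assoc)
    finally show ?thesis by (auto simp: eXe q_def)
  qed
  show thesis using projection_eq_rank1[OF q1 q2 q3 q4] that by (metis q_def)
qed

end

section \<open>The support projection\<close>

context half_chain
begin

text \<open>The range of the support projection of \<open>\<omega>\<close> in \<open>M\<close>,
  reached from \<open>\<Omega>\<close> by the commutant.\<close>

definition S where "S = closure ((\<lambda>Y. ap Y \<Omega>) ` M')"

lemma S_ap: "Y \<in> M' \<Longrightarrow> ap Y \<Omega> \<in> S"
  unfolding S_def by (rule subsetD[OF closure_subset]) simp

lemma S_induct:
  assumes "v \<in> S" "closed Q" "\<And>Y. Y \<in> M' \<Longrightarrow> ap Y \<Omega> \<in> Q"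
  shows "v \<in> Q"
proof -
  have "(\<lambda>Y. ap Y \<Omega>) ` M' \<subseteq> Q" using assms(3) by (rule image_subsetI)
  from closure_minimal[OF this assms(2)] show ?thesis using assms(1) by (auto simp: S_def)
qed

lemma S_closed: "closed S" by (simp add: S_def)

lemma closed_ap_S: "closed {v. ap T v \<in> S}"
  using closed_vimage[OF S_closed continuous_on_ap[OF continuous_on_id, where T = T]]
  unfolding vimage_def id_apply .

lemma S_invariant:
  assumes "v \<in> S" "Y \<in> M'"
  shows "ap Y v \<in> S"
proof -
  have "v \<in> {v. ap Y v \<in> S}"
    by (rule S_induct[OF assms(1) closed_ap_S]) (simp add: S_ap M'_closed assms(2) flip: ap_mult)
  then show ?thesis by simp
qed

lemma S_scale: "v \<in> S \<Longrightarrow> c *\<^sub>C v \<in> S"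
  using S_invariant[of v "c *\<^sub>C 1"] M'_closed by (simp add: ap_simps)

lemma S_add:
  assumes "v \<in> S" "w \<in> S"
  shows "v + w \<in> S"
proof -
  have cl: "closed {v. v + w \<in> S}" for w
    using closed_vimage[OF S_closed, of "\<lambda>v. v + w"] unfolding vimage_def by (simp add: continuous_intros)
  have 1: "ap Y \<Omega> + w \<in> S" if Y: "Y \<in> M'" for Y
  proof -
    have "w \<in> {w. w + ap Y \<Omega> \<in> S}"
      by (rule S_induct[OF assms(2) cl]) (simp add: S_ap M'_closed Y flip: ap_add)
    then show ?thesis by (simp add: add.commute)
  qed
  have "v \<in> {v. v + w \<in> S}" by (rule S_induct[OF assms(1) cl]) (simp add: 1)
  then show ?thesis by simp
qed

lemma \<Omega>_S: "\<Omega> \<in> S" using S_ap[OF M'_closed(1)] by simp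

definition p where "p = (SOME p. p * p = p \<and> adj p = p \<and> (\<forall>x. ap p x = x \<longleftrightarrow> x \<in> S))"

lemma p: "p * p = p" "adj p = p" "ap p x = x \<longleftrightarrow> x \<in> S"
proof -
  have "\<exists>p. p * p = p \<and> adj p = p \<and> (\<forall>x. ap p x = x \<longleftrightarrow> x \<in> S)"
  proof -
    have "0 \<in> S" using S_ap[OF M'_closed(2)] by simp
    from closed_subspace_projection[OF S_closed this S_add S_scale] show ?thesis by blast
  qed
  from someI_ex[OF this] show "p * p = p" "adj p = p" "ap p x = x \<longleftrightarrow> x \<in> S"
    unfolding p_def[symmetric] by auto
qed

lemma p_in_S: "ap p x \<in> S"
  using p(3)[of "ap p x"] by (simp add: p(1) flip: ap_mult)

text \<open>\<open>S\<close> is invariant under \<open>M'\<close>, which is closed under adjoints,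
  so \<open>p\<close> commutes with \<open>M'\<close>.\<close>

lemma p_M: "p \<in> M"
  unfolding M_comm comm_def
proof (intro CollectI ballI)
  fix Y assume Y: "Y \<in> M'"
  have *: "p * Z * p = Z * p" if "Z \<in> M'" for Z
    by (rule bop_eqI) (use p(3) S_invariant[OF p_in_S that] in \<open>simp add: ap_mult\<close>)
  have "p * Y * p = p * Y" using arg_cong[OF *[OF M'_adj[OF Y]], of adj] by (simp add: p mult.assoc)
  then show "p * Y = Y * p" using *[OF Y] by simp
qed

lemma p_\<Omega>: "ap p \<Omega> = \<Omega>" using p(3) \<Omega>_S by blast

text \<open>\<open>T\<close> commutes with \<open>M'\<close>, so with \<open>\<Omega>\<close> it
  kills a dense subset of the range of \<open>p\<close>. This is faithfulness of the state on the
  support.\<close>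

lemma vanish_on_support:
  assumes T: "T \<in> M" "ap T \<Omega> = 0"
  shows "T * p = 0"
proof (rule bop_eqI)
  fix x
  have "ap p x \<in> {v. ap T v = 0}"
  proof (rule S_induct[OF p_in_S])
    show "closed {v. ap T v = 0}" by (intro closed_Collect_eq continuous_on_ap continuous_intros)
    fix Y assume "Y \<in> M'"
    then have "ap T (ap Y \<Omega>) = ap Y (ap T \<Omega>)" using M_M'_commute[OF T(1)] by (metis ap_mult)
    then show "ap Y \<Omega> \<in> {v. ap T v = 0}" by (simp add: T ap_linear)
  qed
  then show "ap (T * p) x = ap 0 x" by (simp add: ap_mult)
qed

text \<open>Every element of \<open>M'\<close> is the translate of an element of \<open>M'\<close>,
  and \<open>\<Omega>\<close> is fixed, so \<open>S\<close> is contained in its translate. The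
  resulting inequality between \<open>p\<close> and its translate is what allows the later
  compressions.\<close>

lemma conj_p_p: "V.conj_by N p * p = p"
proof (rule bop_eqI)
  fix x
  have "ap p x \<in> {v. ap (V.conj_by N p) v = v}"
  proof (rule S_induct[OF p_in_S])
    show "closed {v. ap (V.conj_by N p) v = v}" by (intro closed_Collect_eq continuous_on_ap continuous_intros)
    fix Y assume "Y \<in> M'"
    then obtain X where X: "X \<in> M'" "V.conj_by N X = Y" using V_conj_M' by blast
    have "ap Y \<Omega> = V N (ap X \<Omega>)" using V.ap_conj_by_V[of N X \<Omega>] by (simp add: X V_\<Omega>)
    moreover have "ap p (ap X \<Omega>) = ap X \<Omega>" using p(3) S_ap[OF X(1)] by blast
    ultimately show "ap Y \<Omega> \<in> {v. ap (V.conj_by N p) v = v}" by (simp add: V.ap_conj_by_V)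
  qed
  then show "ap (V.conj_by N p * p) x = ap p x" by (simp add: ap_mult)
qed

text \<open>One inequality suffices, because applying the parity a second time returns
  \<open>p\<close> and reverses it.\<close>

lemma \<Gamma>h_conj_p: "\<Gamma>h.conj_by p = p"
proof -
  let ?q = "\<Gamma>h.conj_by p"
  have qp: "?q * p = p"
  proof (rule bop_eqI)
    fix x
    have "ap p x \<in> {v. ap ?q v = v}"
    proof (rule S_induct[OF p_in_S])
      show "closed {v. ap ?q v = v}" by (intro closed_Collect_eq continuous_on_ap continuous_intros)
      fix Y assume "Y \<in> M'"
      then obtain X where X: "X \<in> M'" "\<Gamma>h.conj_by X = Y" using M'_\<Gamma>h by blast
      have "ap Y \<Omega> = \<Gamma>h (ap X \<Omega>)" using \<Gamma>h.ap_conj_by_V[of X \<Omega>] by (simp add: X \<Gamma>h_\<Omega>)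
      moreover have "ap p (ap X \<Omega>) = ap X \<Omega>" using p(3) S_ap[OF X(1)] by blast
      ultimately show "ap Y \<Omega> \<in> {v. ap ?q v = v}" by (simp add: \<Gamma>h.ap_conj_by_V)
    qed
    then show "ap (?q * p) x = ap p x" by (simp add: ap_mult)
  qed
  have q: "?q = \<Gamma>M * p * \<Gamma>M" by (simp add: \<Gamma>M_conj p_M)
  have qq: "\<Gamma>h.conj_by ?q = p"
  proof -
    have "\<Gamma>h.conj_by ?q = \<Gamma>M * ?q * \<Gamma>M" by (simp add: \<Gamma>M_conj \<Gamma>h_conj_M p_M)
    then show ?thesis unfolding q by (simp add: mult.assoc \<Gamma>M \<Gamma>M_cancel)
  qed
  have "p * ?q = ?q" using arg_cong[OF qp, of "\<Gamma>h.conj_by"] by (simp add: \<Gamma>h.conj_by_simps qq)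
  moreover have "p * ?q = p" using arg_cong[OF qp, of adj] by (simp add: p flip: \<Gamma>h.conj_by_simps)
  ultimately show ?thesis by simp
qed

definition P where "P = \<Phi> p"

lemma \<Psi>_P: "\<Psi> P = p" by (simp add: P_def \<Psi>_\<Phi> p_M)

lemma P: "P * P = P" "adj P = P" "\<gamma> N P * P = P" "P * \<gamma> N P = P" "\<Gamma> * P * \<Gamma> = P"
proof -
  show PP: "P * P = P" "adj P = P" using \<Phi>_hom(2)[OF p_M p_M] \<Phi>_hom(4)[OF p_M] by (simp_all add: P_def p)
  have "\<Psi> (\<gamma> N P * P) = \<Psi> P" by (simp add: \<Psi>_simps \<Psi>_\<gamma> \<Psi>_P conj_p_p)
  then show gP: "\<gamma> N P * P = P" by (simp add: \<Psi>_inj)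
  show "P * \<gamma> N P = P" using arg_cong[OF gP, of adj] by (simp add: PP flip: \<gamma>_simps(4))
  show "\<Gamma> * P * \<Gamma> = P" using \<Phi>_parity[OF p_M] by (simp add: P_def \<Gamma>h_conj_p)
qed

lemma P_\<Gamma>: "P * \<Gamma> = \<Gamma> * P"
  using arg_cong[OF P(5), of "\<lambda>x. x * \<Gamma>"] by (simp add: mult.assoc \<Gamma>)

text \<open>The state \<open>\<omega>\<close> on the half chain, carried over to the index
  space.\<close>

definition psi where "psi x = cinner \<Omega> (ap (\<Psi> x) \<Omega>)"

lemma psi_linear: "psi (x + y) = psi x + psi y" "psi (c *\<^sub>C x) = c * psi x" "psi 0 = 0" "psi (- x) = - psi x"
  "psi (x - y) = psi x - psi y"
  by (simp_all add: psi_def \<Psi>_simps ap_simps cinner_add_right cinner_scaleC_right cinner_minus_right cinner_diff_right)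

lemma psi_sum: "psi (\<Sum>i\<in>I. f i) = (\<Sum>i\<in>I. psi (f i))"
  by (induction I rule: infinite_finite_induct) (simp_all add: psi_linear)

lemma psi_star: "psi (adj x * x) = complex_of_real ((norm (ap (\<Psi> x) \<Omega>))\<^sup>2)"
  by (simp add: psi_def \<Psi>_simps ap_simps cinner_adj[symmetric] cinner_self)

lemma psi_P: "psi (P * x) = psi x" "psi (x * P) = psi x"
  using cinner_adj[of p \<Omega>] by (simp_all add: psi_def \<Psi>_simps \<Psi>_P ap_simps p_\<Omega> p)

lemma psi_one: "psi 1 = 1"
  by (simp add: psi_def \<Psi>_simps cinner_self norm_\<Omega>)

lemma psi_faithful: "psi (adj x * x) = 0 \<Longrightarrow> x * P = 0"
proof -
  assume "psi (adj x * x) = 0"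
  then have "\<Psi> x * p = 0" by (intro vanish_on_support \<Psi>_M) (simp add: psi_star)
  then have "\<Psi> (x * P) = \<Psi> 0" by (simp add: \<Psi>_simps \<Psi>_P)
  then show ?thesis by (simp add: \<Psi>_inj)
qed

lemma psi_\<Gamma>: "psi (\<Gamma> * x * \<Gamma>) = psi x"
proof -
  have "\<Psi> (\<Gamma> * x * \<Gamma>) = \<Gamma>h.conj_by (\<Psi> x)" by (simp add: \<Psi>_simps \<Gamma>M_conj[OF \<Psi>_M] flip: \<Gamma>M_def)
  then have "ap (\<Psi> (\<Gamma> * x * \<Gamma>)) \<Omega> = \<Gamma>h (ap (\<Psi> x) \<Omega>)" using \<Gamma>h.ap_conj_by_V[of "\<Psi> x" \<Omega>] by (simp add: \<Gamma>h_\<Omega>)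
  then show ?thesis using \<Gamma>h.cinner[of \<Omega> "ap (\<Psi> x) \<Omega>"] by (simp add: psi_def \<Gamma>h_\<Omega>)
qed

lemma psi_odd: "\<Gamma> * x * \<Gamma> = - x \<Longrightarrow> psi x = 0"
  using psi_\<Gamma>[of x] by (simp add: psi_linear)

section \<open>Mixing and finite rank of the support\<close>

text \<open>On a vector \<open>Y \<Omega>\<close> with \<open>Y\<close> in \<open>M'\<close> the
  translate of \<open>X\<close> can be moved past \<open>Y\<close> to \<open>\<Omega>\<close>, where
  it acts as the translation of \<open>X \<Omega>\<close>; weak mixing applies. The general vector
  follows by a bound uniform in \<open>N\<close>.\<close>

lemma mixing_S:
  assumes \<zeta>: "\<zeta> \<in> S" and X: "X \<in> M"
  shows "(\<lambda>N. cinner \<eta> (ap (V.conj_by N X) \<zeta>)) \<longlonglongrightarrow> cinner \<eta> \<zeta> * cinner \<Omega> (ap X \<Omega>)"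
proof -
  let ?w = "cinner \<Omega> (ap X \<Omega>)"
  let ?f = "\<lambda>\<zeta> N. cinner \<eta> (ap (V.conj_by N X) \<zeta>) - cinner \<eta> \<zeta> * ?w"
  obtain K where K: "K > 0" "\<And>x. norm (ap X x) \<le> norm x * K" using ap_bounded by blast
  have VX: "norm (ap (V.conj_by N X) x) \<le> norm x * K" for N x
  proof -
    obtain y where "x = V N y" using V.surj by blast
    then show ?thesis by (simp add: V.ap_conj_by_V V.norm K)
  qed
  define C where "C = norm \<eta> * (K + cmod ?w) + 1"
  have C: "C > 0" using K by (simp add: C_def add_nonneg_pos)
  have bnd: "cmod (?f \<zeta> N) \<le> C * norm \<zeta>" for \<zeta> N
  proof -
    have "cmod (?f \<zeta> N) \<le> cmod (cinner \<eta> (ap (V.conj_by N X) \<zeta>)) + cmod (cinner \<eta> \<zeta>) * cmod ?w"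
      using norm_triangle_ineq4[of "cinner \<eta> (ap (V.conj_by N X) \<zeta>)" "cinner \<eta> \<zeta> * ?w"] by (simp add: norm_mult)
    also have "\<dots> \<le> norm \<eta> * (norm \<zeta> * K) + norm \<eta> * norm \<zeta> * cmod ?w"
      by (intro add_mono order.trans[OF cinner_Cauchy_Schwarz] mult_left_mono mult_right_mono VX) (simp_all add: cinner_Cauchy_Schwarz)
    also have "\<dots> \<le> C * norm \<zeta>" by (simp add: C_def algebra_simps)
    finally show ?thesis .
  qed
  have "?f \<zeta> \<longlonglongrightarrow> 0"
  proof (rule tendsto_0_approx)
    fix e :: real assume e: "e > 0"
    have "e / C > 0" using e C by simp
    then obtain v where "v \<in> (\<lambda>Y. ap Y \<Omega>) ` M'" "dist v \<zeta> < e / C"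
      using \<zeta> unfolding S_def closure_approachable by blast
    then obtain Y where Y: "Y \<in> M'" "norm (\<zeta> - ap Y \<Omega>) < e / C" by (auto simp: dist_norm norm_minus_commute)
    have eq: "cinner \<eta> (ap (V.conj_by N X) (ap Y \<Omega>)) = cinner (ap (adj Y) \<eta>) (V N (ap X \<Omega>))" for N
    proof -
      have "ap (V.conj_by N X) (ap Y \<Omega>) = ap Y (ap (V.conj_by N X) \<Omega>)"
        using M_M'_commute[OF conj_M[OF X] Y(1)] by (metis ap_mult)
      also have "ap (V.conj_by N X) \<Omega> = V N (ap X \<Omega>)" by (metis V.ap_conj_by_V V_\<Omega>)
      finally show ?thesis by (simp add: cinner_adj')
    qed
    have "(\<lambda>N. cinner (ap (adj Y) \<eta>) (V N (ap X \<Omega>))) \<longlonglongrightarrow> cinner (ap (adj Y) \<eta>) \<Omega> * ?w"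
      by (rule weak_mixing) (rule V)+
    then have lim: "?f (ap Y \<Omega>) \<longlonglongrightarrow> 0" by (simp add: eq cinner_adj' LIM_zero)
    have "cmod (?f \<zeta> N) \<le> cmod (?f (ap Y \<Omega>) N) + e" for N
    proof -
      have "?f \<zeta> N = ?f (ap Y \<Omega>) N + ?f (\<zeta> - ap Y \<Omega>) N" by (simp add: ap_linear cinner_diff_right algebra_simps)
      moreover have "cmod (?f (\<zeta> - ap Y \<Omega>) N) \<le> e"
        using bnd[where \<zeta> = "\<zeta> - ap Y \<Omega>" and N = N] mult_left_mono[OF less_imp_le[OF Y(2)], of C] C by simp
      moreover have "cmod (u + v) \<le> cmod u + e" if "cmod v \<le> e" for u v
        using norm_triangle_ineq[of u v] that by simp
      ultimately show ?thesis by metis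
    qed
    then show "\<exists>g. g \<longlonglongrightarrow> 0 \<and> (\<forall>N. cmod (?f \<zeta> N) \<le> cmod (g N) + e)" using lim by blast
  qed
  then show ?thesis by (simp add: LIM_zero_iff)
qed

lemma psi_rank1_pos:
  assumes \<xi>: "ap P \<xi> = \<xi>" "cinner \<xi> \<xi> = 1"
  shows "Re (psi (rank1 \<xi> \<xi>)) > 0" "Im (psi (rank1 \<xi> \<xi>)) = 0"
proof -
  let ?e = "rank1 \<xi> \<xi>"
  have e: "adj ?e * ?e = ?e" by (simp add: rank1_rank1 \<xi>)
  have "psi ?e \<noteq> 0"
  proof
    assume "psi ?e = 0"
    then have "?e * P = 0" using psi_faithful[of ?e] e by simp
    then have "ap (?e * P) \<xi> = 0" by simp
    then show False using \<xi> by (auto simp: ap_mult ap_rank1)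
  qed
  then show "Re (psi ?e) > 0" "Im (psi ?e) = 0"
    using psi_star[of ?e] unfolding e by (simp_all add: zero_less_power2)
qed

text \<open>For \<open>y\<close> in the range of \<open>P\<close> the vector
  \<open>y + \<Gamma> y\<close> is even; if it is 0, then \<open>y\<close> is odd already. Either
  way the rank-one projection is even, so that its images under \<open>\<gamma>\<close> commute with
  all block matrix units.\<close>

lemma exists_unit_vector: "\<exists>\<xi>. ap P \<xi> = \<xi> \<and> cinner \<xi> \<xi> = 1 \<and> \<Gamma> * rank1 \<xi> \<xi> * \<Gamma> = rank1 \<xi> \<xi>"
proof -
  have "P \<noteq> 0"
  proof
    assume "P = 0"
    then have "p = 0" using \<Psi>_P by (simp add: \<Psi>_simps)
    then have "\<Omega> = 0" using p_\<Omega> by simp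
    then show False using norm_\<Omega> by simp
  qed
  then obtain z where z: "ap P z \<noteq> 0" by (metis ap_zero bop_eqI)
  define y where "y = ap P z"
  have y: "y \<noteq> 0" "ap P y = y" using z P(1) by (auto simp: y_def simp flip: ap_mult)
  have P\<Gamma>: "ap P (ap \<Gamma> v) = ap \<Gamma> (ap P v)" for v using P_\<Gamma> by (metis ap_mult)
  have \<Gamma>\<Gamma>: "ap \<Gamma> (ap \<Gamma> v) = v" for v using \<Gamma>(2) by (metis ap_mult ap_one)
  obtain w \<epsilon> where w: "w \<noteq> 0" "ap P w = w" "ap \<Gamma> w = \<epsilon> *\<^sub>C w" "\<epsilon> * cnj \<epsilon> = 1"
  proof (cases "y + ap \<Gamma> y = 0")
    case False
    then show thesis using that[of "y + ap \<Gamma> y" 1] y by (simp add: ap_linear P\<Gamma> \<Gamma>\<Gamma> add.commute)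
  next
    case True
    then have "ap \<Gamma> y = - y" by (metis add.commute eq_neg_iff_add_eq_0)
    then show thesis using that[of y "- 1"] y by simp
  qed
  define \<xi> where "\<xi> = (1 / complex_of_real (norm w)) *\<^sub>C w"
  have "cinner \<xi> \<xi> = 1" unfolding \<xi>_def by (rule cinner_normalized[OF w(1)])
  moreover have "ap P \<xi> = \<xi>" by (simp add: \<xi>_def ap_linear w)
  moreover have "ap \<Gamma> \<xi> = \<epsilon> *\<^sub>C \<xi>" by (simp add: \<xi>_def ap_linear w scaleC_scaleC mult.commute)
  then have "\<Gamma> * rank1 \<xi> \<xi> * \<Gamma> = rank1 \<xi> \<xi>"
    using w(4) by (simp add: rank1_mult \<Gamma> rank1_linear scaleC_scaleC)
  ultimately show ?thesis by blast
qed

text \<open>The GNS vector \<open>\<Psi> (rank1 \<eta> \<xi>) \<Omega>\<close> stands in for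
  \<open>\<eta>\<close>: matrix elements between such vectors are those on the index space times
  \<open>k\<close>, the expectation of \<open>rank1 \<xi> \<xi>\<close>. For \<open>\<zeta>\<close>
  in the range of \<open>P\<close> the stand-in lies in \<open>S\<close>, so \<open>mixing_S\<close>
  applies, and \<open>k\<close> can be divided out because \<open>\<xi>\<close> lies in the
  support.\<close>

lemma mixing:
  assumes \<zeta>: "ap P \<zeta> = \<zeta>"
  shows "(\<lambda>N. cinner \<eta> (ap (\<gamma> N x) \<zeta>)) \<longlonglongrightarrow> cinner \<eta> \<zeta> * psi x"
proof -
  obtain \<xi> where \<xi>: "ap P \<xi> = \<xi>" "cinner \<xi> \<xi> = 1" using exists_unit_vector by blast
  define k where "k = psi (rank1 \<xi> \<xi>)"
  have k: "k \<noteq> 0" using psi_rank1_pos[OF \<xi>] by (auto simp: k_def)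
  let ?g = "\<lambda>\<eta>. \<Psi> (rank1 \<eta> \<xi>)"
  have "p * ?g \<zeta> = ?g \<zeta>" by (simp add: \<zeta> rank1_mult flip: \<Psi>_P \<Psi>_simps(2))
  then have gS: "ap (?g \<zeta>) \<Omega> \<in> S" using p(3) by (metis ap_mult)
  have eq: "cinner (ap (?g \<eta>) \<Omega>) (ap (V.conj_by N (\<Psi> x)) (ap (?g \<zeta>) \<Omega>)) = cinner \<eta> (ap (\<gamma> N x) \<zeta>) * k" for N
  proof -
    have "cinner (ap (?g \<eta>) \<Omega>) (ap (V.conj_by N (\<Psi> x)) (ap (?g \<zeta>) \<Omega>)) = psi (rank1 \<xi> \<eta> * \<gamma> N x * rank1 \<zeta> \<xi>)"
      by (simp add: psi_def \<Psi>_simps \<Psi>_\<gamma> ap_mult cinner_adj flip: \<Psi>_simps(4))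
    also have "rank1 \<xi> \<eta> * \<gamma> N x * rank1 \<zeta> \<xi> = cinner \<eta> (ap (\<gamma> N x) \<zeta>) *\<^sub>C rank1 \<xi> \<xi>"
      by (simp add: mult.assoc rank1_mult(1) ap_mult ap_rank1 rank1_linear)
    finally show ?thesis by (simp add: psi_linear k_def)
  qed
  have eq2: "cinner (ap (?g \<eta>) \<Omega>) (ap (?g \<zeta>) \<Omega>) = cinner \<eta> \<zeta> * k"
    using psi_linear(2)[of "cinner \<eta> \<zeta>" "rank1 \<xi> \<xi>"]
    by (simp add: k_def psi_def cinner_adj rank1_rank1 flip: \<Psi>_simps(2,4) ap_mult)
  from mixing_S[OF gS \<Psi>_M, of "ap (?g \<eta>) \<Omega>" x]
  have "(\<lambda>N. cinner \<eta> (ap (\<gamma> N x) \<zeta>) * k) \<longlonglongrightarrow> cinner \<eta> \<zeta> * k * psi x"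
    by (simp add: eq eq2 psi_def)
  from tendsto_divide[OF this tendsto_const[of k] k] show ?thesis using k by simp
qed

text \<open>
  \<open>rank_hyp R\<close> says that the local density matrices have rank at most \<open>R\<close>: the column vectors of any
  \<open>b\<close> that factors through such a matrix are linearly dependent.
\<close>

definition rank_hyp :: "nat \<Rightarrow> bool"
  where "rank_hyp R \<longleftrightarrow> (\<forall>N\<ge>1. \<forall>r>R. \<forall>b :: nat \<Rightarrow> nat set \<Rightarrow> complex.
    (\<forall>c. (\<Sum>A\<in>sets N. \<Sum>B\<in>sets N. cnj (c A) * c B * \<omega> (modes.unit (d * N) B A)) = 0 \<longrightarrow>
        (\<forall>i<r. (\<Sum>A\<in>sets N. c A * b i A) = 0)) \<longrightarrow>
    (\<exists>y. (\<exists>i<r. y i \<noteq> 0) \<and> (\<forall>A\<in>sets N. (\<Sum>i<r. cnj (y i) * b i A) = 0)))"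

definition onb :: "nat \<Rightarrow> (nat \<Rightarrow> 'l) \<Rightarrow> bool"
  where "onb r \<xi> \<longleftrightarrow> (\<forall>i<r. ap P (\<xi> i) = \<xi> i \<and> (\<forall>j<r. cinner (\<xi> i) (\<xi> j) = (if i = j then 1 else 0)))"

lemma onb_le_rank:
  assumes R: "rank_hyp R" and \<xi>: "onb r \<xi>"
  shows "r \<le> R"
proof (rule ccontr)
  assume "\<not> r \<le> R"
  then have r: "r > R" by simp
  obtain \<xi>' where \<xi>': "ap P \<xi>' = \<xi>'" "cinner \<xi>' \<xi>' = 1" "\<Gamma> * rank1 \<xi>' \<xi>' * \<Gamma> = rank1 \<xi>' \<xi>'"
    using exists_unit_vector by blast
  define e where "e = rank1 \<xi>' \<xi>'"
  define \<kappa> where "\<kappa> = Re (psi e)"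
  have \<kappa>: "\<kappa> > 0" "psi e = complex_of_real \<kappa>" using psi_rank1_pos[OF \<xi>'(1,2)] by (auto simp: \<kappa>_def e_def complex_eq_iff)
  define G where "G N i j = cinner (\<xi> i) (ap (\<gamma> N e) (\<xi> j))" for N i j
  \<comment> \<open>Small enough to make the Gram matrix diagonally dominant: deviations from
    \<open>\<kappa>\<close> times the identity add up to at most \<open>\<kappa> / 2\<close> along a
    column.\<close>
  define \<delta> where "\<delta> = \<kappa> / (2 * real r)"
  have \<delta>: "\<delta> > 0" using \<kappa> r by (simp add: \<delta>_def)
  have "\<forall>\<^sub>F N in sequentially. cmod (G N i j - (if i = j then \<kappa> else 0)) < \<delta>" if ij: "i < r" "j < r" for i j
  proof -
    have "ap P (\<xi> j) = \<xi> j" using \<xi> ij by (simp add: onb_def)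
    from mixing[OF this, of "\<xi> i" e] have "(\<lambda>N. G N i j) \<longlonglongrightarrow> (if i = j then \<kappa> else 0)"
      using \<xi> ij by (auto simp: G_def onb_def \<kappa>)
    then show ?thesis using tendstoD[OF _ \<delta>] by (fastforce simp: dist_norm)
  qed
  then have "\<forall>\<^sub>F N in sequentially. \<forall>i\<in>{..<r}. \<forall>j\<in>{..<r}. cmod (G N i j - (if i = j then \<kappa> else 0)) < \<delta>"
    by (intro eventually_ball_finite ballI) auto
  then have "\<forall>\<^sub>F N in sequentially. N \<ge> 1 \<and> (\<forall>i\<in>{..<r}. \<forall>j\<in>{..<r}. cmod (G N i j - (if i = j then \<kappa> else 0)) < \<delta>)"
    using eventually_ge_at_top[of "1::nat"] by eventually_elim simp
  then obtain N where N: "N \<ge> 1" "\<And>i j. i < r \<Longrightarrow> j < r \<Longrightarrow> cmod (G N i j - (if i = j then \<kappa> else 0)) < \<delta>"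
    using eventually_happens'[OF sequentially_bot] by fastforce
  obtain \<zeta> where \<zeta>: "EK N {} {} * \<gamma> N e = rank1 \<zeta> \<zeta>" using minimal_projection[OF \<xi>'(2)] e_def by metis
  define b where "b i A = cinner (\<xi> i) (ap (EK N A {}) \<zeta>)" for i A
  \<comment> \<open>Since \<open>e\<close> is even, \<open>\<gamma> N e\<close> commutes with the
    block units and splits into rank-one operators on the vectors
    \<open>EK N A {} \<zeta>\<close>.\<close>
  have Gb: "G N i j = (\<Sum>A\<in>sets N. b i A * cnj (b j A))" for i j
  proof -
    have em: "{} \<in> sets N" by simp
    have "\<gamma> N e = (\<Sum>A\<in>sets N. EK N A A * \<gamma> N e)" by (simp add: EK_sum flip: sum_distrib_right)
    also have "\<dots> = (\<Sum>A\<in>sets N. rank1 (ap (EK N A {}) \<zeta>) (ap (EK N A {}) \<zeta>))"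
    proof (rule sum.cong[OF refl])
      fix A assume A: "A \<in> sets N"
      have "rank1 (ap (EK N A {}) \<zeta>) (ap (EK N A {}) \<zeta>) = EK N A {} * rank1 \<zeta> \<zeta> * adj (EK N A {})"
        by (simp add: rank1_mult)
      also have "\<dots> = EK N A {} * (\<gamma> N e * EK N {} {}) * EK N {} A"
        using EK_\<gamma>_even[OF em em sg_empty, of e] by (simp add: \<zeta> EK_adj[OF A em])
      also have "\<dots> = EK N A {} * (EK N {} A * \<gamma> N e)"
        using EK_\<gamma>_even_arg[OF em A, of e] \<xi>'(3) EK_mult[OF em em em A] by (simp add: e_def mult.assoc)
      also have "\<dots> = EK N A A * \<gamma> N e" using A by (simp add: EK_mult flip: mult.assoc)
      finally show "EK N A A * \<gamma> N e = rank1 (ap (EK N A {}) \<zeta>) (ap (EK N A {}) \<zeta>)" by simp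
    qed
    finally have "G N i j = (\<Sum>A\<in>sets N. cinner (\<xi> i) (cinner (ap (EK N A {}) \<zeta>) (\<xi> j) *\<^sub>C ap (EK N A {}) \<zeta>))"
      by (simp add: G_def ap_bop_sum cinner_sum_right ap_rank1)
    then show ?thesis by (simp add: b_def cinner_scaleC_right mult.commute flip: cinner_commute)
  qed
  \<comment> \<open>A null vector \<open>c\<close> of the density form gives an element
    \<open>Ec\<close> whose adjoint kills \<open>\<Omega>\<close>; hence \<open>P\<close>
    annihilates its image from the left, and the vectors \<open>\<xi> i\<close> do not see it. This
    is the factorisation required by \<open>rank_hyp\<close>.\<close>
  have "(\<Sum>A\<in>sets N. c A * b i A) = 0"
    if c: "(\<Sum>A\<in>sets N. \<Sum>B\<in>sets N. cnj (c A) * c B * \<omega> (modes.unit (d * N) B A)) = 0" and i: "i < r" for c i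
  proof -
    define Ec where "Ec = (\<Sum>A\<in>sets N. c A *\<^sub>C E N A {})"
    have EcM: "Ec \<in> M" unfolding Ec_def by (intro M_sum M_closed E_M) auto
    have "Ec * adj Ec = (\<Sum>B\<in>sets N. \<Sum>A\<in>sets N. (c B * cnj (c A)) *\<^sub>C (E N B {} * E N {} A))"
      by (simp add: Ec_def adj_sum E_adj sum_product scaleC_scaleC mult.commute)
    also have "\<dots> = (\<Sum>B\<in>sets N. \<Sum>A\<in>sets N. (c B * cnj (c A)) *\<^sub>C E N B A)"
      by (intro sum.cong refl) (simp add: E_mult)
    finally have "cinner \<Omega> (ap (Ec * adj Ec) \<Omega>) = (\<Sum>B\<in>sets N. \<Sum>A\<in>sets N. c B * cnj (c A) * \<omega> (modes.unit (d * N) B A))"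
      by (simp add: ap_bop_sum cinner_sum_right ap_scaleC cinner_scaleC_right E_def state_eq)
    also have "\<dots> = 0" by (subst sum.swap) (use c in \<open>simp add: mult.commute\<close>)
    finally have "cinner (ap (adj Ec) \<Omega>) (ap (adj Ec) \<Omega>) = 0" by (simp add: ap_mult cinner_adj')
    then have "adj Ec * p = 0" by (intro vanish_on_support M_closed EcM) simp
    from arg_cong[OF this, of adj] have "p * Ec = 0" by (simp add: p)
    then have "\<Phi> (p * Ec) = 0" using \<Phi>_\<Psi>[of 0] by (simp add: \<Psi>_simps)
    moreover have "\<Phi> Ec = (\<Sum>A\<in>sets N. c A *\<^sub>C EK N A {})"
      unfolding Ec_def by (subst \<Phi>_sum) (auto simp: M_closed E_M \<Phi>_hom EK_def)
    ultimately have PE: "P * (\<Sum>A\<in>sets N. c A *\<^sub>C EK N A {}) = 0" by (simp add: \<Phi>_hom p_M EcM P_def)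
    have "(\<Sum>A\<in>sets N. c A * b i A) = cinner (\<xi> i) (ap (\<Sum>A\<in>sets N. c A *\<^sub>C EK N A {}) \<zeta>)"
      by (simp add: b_def ap_bop_sum ap_scaleC cinner_sum_right cinner_scaleC_right)
    also have "\<dots> = cinner (ap P (\<xi> i)) (ap (\<Sum>A\<in>sets N. c A *\<^sub>C EK N A {}) \<zeta>)"
      using \<xi> i by (simp add: onb_def)
    also have "\<dots> = cinner (\<xi> i) (ap (P * (\<Sum>A\<in>sets N. c A *\<^sub>C EK N A {})) \<zeta>)"
      by (simp add: cinner_adj P ap_mult)
    finally show ?thesis by (simp add: PE)
  qed
  then obtain y where y: "\<exists>i<r. y i \<noteq> 0" "\<And>A. A \<in> sets N \<Longrightarrow> (\<Sum>i<r. cnj (y i) * b i A) = 0"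
    using R[unfolded rank_hyp_def, rule_format, OF N(1) r, of b] by blast
  have yG: "(\<Sum>i<r. cnj (y i) * G N i j) = 0" for j
  proof -
    have "(\<Sum>i<r. cnj (y i) * G N i j) = (\<Sum>A\<in>sets N. (\<Sum>i<r. cnj (y i) * b i A) * cnj (b j A))"
      unfolding Gb sum_distrib_left sum_distrib_right by (subst sum.swap) (simp add: mult.assoc)
    then show ?thesis using y(2) by simp
  qed
  \<comment> \<open>The relation \<open>yG\<close> in the column \<open>j\<close> of a largest
    coefficient contradicts diagonal dominance.\<close>
  define ym where "ym = Max ((\<lambda>i. cmod (y i)) ` {..<r})"
  have fin: "finite ((\<lambda>i. cmod (y i)) ` {..<r})" "(\<lambda>i. cmod (y i)) ` {..<r} \<noteq> {}" using r by auto
  obtain j where j: "j < r" "cmod (y j) = ym" using Max_in[OF fin] by (auto simp: ym_def)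
  have le: "cmod (y i) \<le> ym" if "i < r" for i using fin that by (simp add: ym_def)
  have ym: "ym > 0" using y(1) le by (meson le_less_trans norm_le_zero_iff not_le order_trans)
  have "cnj (y j) * \<kappa> = - (\<Sum>i<r. cnj (y i) * (G N i j - (if i = j then \<kappa> else 0)))"
  proof -
    have "(\<Sum>i<r. cnj (y i) * (if i = j then complex_of_real \<kappa> else 0)) = (\<Sum>i<r. if i = j then cnj (y j) * \<kappa> else 0)"
      by (rule sum.cong) auto
    moreover have "(\<Sum>i<r. cnj (y i) * (G N i j - (if i = j then \<kappa> else 0)))
        = (\<Sum>i<r. cnj (y i) * G N i j) - (\<Sum>i<r. cnj (y i) * (if i = j then complex_of_real \<kappa> else 0))"
      unfolding sum_subtractf[symmetric] by (rule sum.cong) (auto simp: right_diff_distrib)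
    ultimately show ?thesis using yG[of j] j(1) by simp
  qed
  then have "cmod (cnj (y j) * \<kappa>) = cmod (\<Sum>i<r. cnj (y i) * (G N i j - (if i = j then \<kappa> else 0)))" by simp
  also have "\<dots> \<le> (\<Sum>i<r. ym * \<delta>)"
  proof (rule sum_norm_le)
    fix i assume "i \<in> {..<r}"
    then have i: "i < r" by simp
    show "cmod (cnj (y i) * (G N i j - (if i = j then \<kappa> else 0))) \<le> ym * \<delta>"
      unfolding norm_mult complex_mod_cnj
      by (rule mult_mono[OF le[OF i] less_imp_le[OF N(2)[OF i j(1)]]]) (use ym in auto)
  qed
  also have "\<dots> = ym * (\<kappa> / 2)" using r by (simp add: \<delta>_def)
  finally have "ym * \<kappa> \<le> ym * (\<kappa> / 2)" using \<kappa>(1) j(2) by (simp add: norm_mult)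
  then show False using ym \<kappa>(1) by (simp add: mult_le_cancel_left)
qed

text \<open>The bound on the length of orthonormal systems yields one of maximal length; it spans,
  since a remainder vector could be normalised and added.\<close>

lemma exists_onb:
  assumes R: "rank_hyp R"
  obtains m \<xi> where "m \<ge> 1" "onb m \<xi>" "P = (\<Sum>i<m. rank1 (\<xi> i) (\<xi> i))"
proof -
  define m where "m = (GREATEST r. \<exists>\<xi>. onb r \<xi>)"
  obtain \<xi>1 where "ap P \<xi>1 = \<xi>1" "cinner \<xi>1 \<xi>1 = 1" using exists_unit_vector by blast
  then have ex1: "\<exists>\<xi>. onb 1 \<xi>" by (intro exI[of _ "\<lambda>_. \<xi>1"]) (simp add: onb_def)
  have bd: "\<And>r. \<exists>\<xi>. onb r \<xi> \<Longrightarrow> r \<le> R" using onb_le_rank[OF R] by blast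
  have "\<exists>\<xi>. onb m \<xi>" unfolding m_def by (rule GreatestI_nat[where P = "\<lambda>r. \<exists>\<xi>. onb r \<xi>", OF ex1 bd])
  then obtain \<xi> where \<xi>: "onb m \<xi>" by blast
  have max: "\<not> onb (Suc m) \<xi>'" for \<xi>'
    using Greatest_le_nat[of "\<lambda>r. \<exists>\<xi>. onb r \<xi>" "Suc m" R] bd by (auto simp: m_def)
  have m1: "m \<ge> 1" unfolding m_def by (rule Greatest_le_nat[where P = "\<lambda>r. \<exists>\<xi>. onb r \<xi>", OF ex1 bd])
  have span: "v = (\<Sum>i<m. cinner (\<xi> i) v *\<^sub>C \<xi> i)" if v: "ap P v = v" for v
  proof (rule ccontr)
    define w where "w = v - (\<Sum>i<m. cinner (\<xi> i) v *\<^sub>C \<xi> i)"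
    assume "v \<noteq> (\<Sum>i<m. cinner (\<xi> i) v *\<^sub>C \<xi> i)"
    then have w: "w \<noteq> 0" by (simp add: w_def)
    have Pw: "ap P w = w" using \<xi> v by (simp add: w_def ap_linear ap_sum onb_def)
    have orth: "cinner (\<xi> j) w = 0" if j: "j < m" for j
    proof -
      have "(\<Sum>i<m. cinner (\<xi> i) v * cinner (\<xi> j) (\<xi> i)) = (\<Sum>i<m. if i = j then cinner (\<xi> i) v else 0)"
        by (rule sum.cong[OF refl]) (use \<xi> j in \<open>auto simp: onb_def\<close>)
      then show ?thesis using j by (simp add: w_def cinner_diff_right cinner_sum_right cinner_scaleC_right)
    qed
    define n where "n = (1 / complex_of_real (norm w)) *\<^sub>C w"
    have n: "cinner n n = 1" "ap P n = n" unfolding n_def by (rule cinner_normalized[OF w]) (simp add: ap_linear Pw)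
    have on: "cinner (\<xi> j) n = 0" "cinner n (\<xi> j) = 0" if "j < m" for j
      using orth[OF that] cinner_commute[of n "\<xi> j"] by (simp_all add: n_def cinner_scaleC_right)
    have "onb (Suc m) (\<lambda>i. if i < m then \<xi> i else n)"
      using \<xi> n on by (auto simp: onb_def less_Suc_eq)
    then show False using max by blast
  qed
  have "P = (\<Sum>i<m. rank1 (\<xi> i) (\<xi> i))"
  proof (rule bop_eqI)
    fix x
    have Px: "ap P (ap P x) = ap P x" by (simp add: P flip: ap_mult)
    have "cinner (\<xi> i) (ap P x) = cinner (\<xi> i) x" if "i < m" for i
    proof -
      have "cinner (ap P (\<xi> i)) x = cinner (\<xi> i) (ap P x)" by (simp add: cinner_adj P)
      then show ?thesis using \<xi> that by (simp add: onb_def)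
    qed
    then show "ap P x = ap (\<Sum>i<m. rank1 (\<xi> i) (\<xi> i)) x"
      using span[OF Px] by (simp add: ap_bop_sum ap_rank1)
  qed
  with m1 \<xi> show thesis by (rule that)
qed

end

declare One_nat_def [simp del]

section \<open>The matrices \<open>v\<close> and the density matrix\<close>

lemma mat_adjoint_index:
  "A \<in> carrier_mat m m \<Longrightarrow> i < m \<Longrightarrow> j < m \<Longrightarrow> mat_adjoint A $$ (i, j) = cnj (A $$ (j, i))"
  unfolding mat_adjoint_def by (simp add: mat_of_rows_def)

lemma mat_adjoint_carrier: "A \<in> carrier_mat m m \<Longrightarrow> mat_adjoint A \<in> carrier_mat m m"
  unfolding mat_adjoint_def by (intro carrier_matI) simp_all

lemma vec_l2norm_le:
  assumes "x \<in> carrier_vec m"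
  shows "vec_l2norm x \<le> (\<Sum>i<m. cmod (vec_index x i))"
proof -
  have "Re (x \<bullet>c x) = (\<Sum>i<m. (cmod (vec_index x i))\<^sup>2)"
    using assms unfolding scalar_prod_def lessThan_atLeast0 cmod_power2
    by (auto simp: power2_eq_square intro!: sum.cong)
  then show ?thesis unfolding vec_l2norm_def
    using L2_set_le_sum[of "{..<m}" "\<lambda>i. cmod (vec_index x i)"] by (simp add: L2_set_def)
qed

lemma cmod_index_le_l2norm:
  assumes "x \<in> carrier_vec m" "i < m"
  shows "cmod (vec_index x i) \<le> vec_l2norm x"
proof -
  have "Re (x \<bullet>c x) = (\<Sum>i<m. (cmod (vec_index x i))\<^sup>2)"
    using assms unfolding scalar_prod_def lessThan_atLeast0 cmod_power2
    by (auto simp: power2_eq_square intro!: sum.cong)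
  moreover have "(cmod (vec_index x i))\<^sup>2 \<le> (\<Sum>i<m. (cmod (vec_index x i))\<^sup>2)"
    using assms(2) by (intro member_le_sum) auto
  ultimately show ?thesis unfolding vec_l2norm_def by (intro real_le_rsqrt) simp
qed

text \<open>The norm is a supremum of reals, so its use requires a nonempty bounded set. The bound
  by the sum of the entries turns entrywise convergence into norm convergence.\<close>

lemma mat_opnorm_bounds:
  assumes A: "A \<in> carrier_mat m m"
  shows "0 \<le> mat_opnorm A" "mat_opnorm A \<le> (\<Sum>i<m. \<Sum>j<m. cmod (A $$ (i, j)))"
proof -
  let ?X = "{vec_l2norm (A *\<^sub>v x) | x. x \<in> carrier_vec (dim_col A) \<and> vec_l2norm x \<le> 1}"
  let ?K = "\<Sum>i<m. \<Sum>j<m. cmod (A $$ (i, j))"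
  have le: "z \<le> ?K" if z: "z \<in> ?X" for z
  proof -
    obtain x where x: "z = vec_l2norm (A *\<^sub>v x)" "x \<in> carrier_vec m" "vec_l2norm x \<le> 1" using z A by auto
    have "z \<le> (\<Sum>i<m. cmod (vec_index (A *\<^sub>v x) i))" unfolding x(1) by (rule vec_l2norm_le) (use A x in auto)
    also have "\<dots> \<le> ?K"
    proof (rule sum_mono)
      fix i assume i: "i \<in> {..<m}"
      have "vec_index (A *\<^sub>v x) i = (\<Sum>j<m. A $$ (i, j) * vec_index x j)"
        using A x i by (auto simp: scalar_prod_def lessThan_atLeast0 intro!: sum.cong)
      then have "cmod (vec_index (A *\<^sub>v x) i) \<le> (\<Sum>j<m. cmod (A $$ (i, j) * vec_index x j))"
        by (simp add: norm_sum)
      also have "\<dots> \<le> (\<Sum>j<m. cmod (A $$ (i, j)))"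
      proof (rule sum_mono)
        fix j assume "j \<in> {..<m}"
        then have "cmod (vec_index x j) \<le> 1" using cmod_index_le_l2norm[OF x(2), of j] x(3) by auto
        then show "cmod (A $$ (i, j) * vec_index x j) \<le> cmod (A $$ (i, j))"
          by (simp add: norm_mult mult_left_le)
      qed
      finally show "cmod (vec_index (A *\<^sub>v x) i) \<le> (\<Sum>j<m. cmod (A $$ (i, j)))" .
    qed
    finally show ?thesis .
  qed
  have z: "vec_l2norm (0\<^sub>v m) = 0" by (simp add: vec_l2norm_def)
  have Az: "A *\<^sub>v 0\<^sub>v m = 0\<^sub>v m" using A by (intro eq_vecI) auto
  have 0: "0 \<in> ?X" using A z Az by (auto intro!: exI[of _ "0\<^sub>v m"])
  show "0 \<le> mat_opnorm A" unfolding mat_opnorm_def by (rule cSup_upper[OF 0]) (use le in \<open>auto simp: bdd_above_def\<close>)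
  show "mat_opnorm A \<le> ?K" unfolding mat_opnorm_def using 0 le by (intro cSup_least) auto
qed

context half_chain
begin

text \<open>The parity of the block \<open>[0, N - 1]\<close>, counting particles modulo 2.\<close>

definition G0 where "G0 N = (\<Sum>A\<in>sets N. (- 1) ^ card A *\<^sub>C EK N A A)"

lemma G0_EK: "A \<in> sets N \<Longrightarrow> B \<in> sets N \<Longrightarrow> G0 N * EK N A B = (- 1) ^ card A *\<^sub>C EK N A B"
  "A \<in> sets N \<Longrightarrow> B \<in> sets N \<Longrightarrow> EK N A B * G0 N = (- 1) ^ card B *\<^sub>C EK N A B"
proof -
  assume AB: "A \<in> sets N" "B \<in> sets N"
  have "G0 N * EK N A B = (\<Sum>C\<in>sets N. if C = A then (- 1) ^ card A *\<^sub>C EK N A B else 0)"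
    unfolding G0_def sum_distrib_right by (rule sum.cong[OF refl]) (use AB in \<open>simp add: EK_mult\<close>)
  then show "G0 N * EK N A B = (- 1) ^ card A *\<^sub>C EK N A B" using AB by simp
  have "EK N A B * G0 N = (\<Sum>C\<in>sets N. if C = B then (- 1) ^ card B *\<^sub>C EK N A B else 0)"
    unfolding G0_def sum_distrib_left by (rule sum.cong[OF refl]) (use AB in \<open>simp add: EK_mult\<close>)
  then show "EK N A B * G0 N = (- 1) ^ card B *\<^sub>C EK N A B" using AB by simp
qed

lemma G0_sq: "G0 N * G0 N = 1"
proof -
  have "G0 N * G0 N = (\<Sum>A\<in>sets N. (- 1) ^ card A *\<^sub>C (G0 N * EK N A A))"
    by (subst (2) G0_def) (simp add: sum_distrib_left)
  also have "\<dots> = (\<Sum>A\<in>sets N. EK N A A)"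
    by (rule sum.cong[OF refl]) (simp add: G0_EK scaleC_scaleC flip: power_add mult_2)
  finally show ?thesis by (simp add: EK_sum)
qed

lemma G0_\<gamma>: "G0 N * \<gamma> N x = \<gamma> N x * G0 N"
  unfolding G0_def sum_distrib_left sum_distrib_right
  by (rule sum.cong[OF refl]) (simp add: EK_\<gamma>_even sg_def flip: mult_2)

lemma \<Psi>_G0: "\<Psi> (G0 N) = (\<Sum>A\<in>sets N. (- 1) ^ card A *\<^sub>C E N A A)"
  unfolding G0_def star_hom_sum[OF \<Psi>_star_hom] by (rule sum.cong[OF refl]) (simp add: \<Psi>_simps \<Psi>_EK)

text \<open>Two anticommuting factors compensate each other; in the application they are the
  parities \<open>GN N\<close> and \<open>\<Gamma>M\<close>.\<close>

lemma anticommute_three: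
  fixes A b c x :: "'x::ring"
  assumes "A * x = x * A" "b * x = - (x * b)" "c * x = - (x * c)"
  shows "(A * b * c) * x = x * (A * b * c)"
proof -
  have "(A * b * c) * x = A * b * (c * x)" by (simp add: mult.assoc)
  also have "\<dots> = - (A * (b * x) * c)" by (simp add: assms(3) mult.assoc)
  also have "\<dots> = (A * x) * b * c" by (simp add: assms(2) mult.assoc)
  finally show ?thesis by (simp add: assms(1) mult.assoc)
qed

text \<open>
  \<open>G0 N * \<gamma> N \<Gamma>\<close> and \<open>\<Gamma>\<close> both implement the parity, so they agree up to a sign; for \<open>N = 1\<close> this sign is \<open>(-1)\<close> to the
  power \<open>\<sigma>\<^sub>0\<close>.
\<close>

lemma exists_sign: "\<exists>s. (s = 1 \<or> s = - 1) \<and> G0 N * \<gamma> N \<Gamma> = s *\<^sub>C \<Gamma>"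
proof -
  \<comment> \<open>Parity of the block, of the half chain beyond it and of the whole half chain:
    the product lies in \<open>M\<close> and commutes with all its generators, so it is a
    scalar.\<close>
  define Z where "Z = \<Psi> (G0 N) * GN N * \<Gamma>M"
  have ZM: "Z \<in> M" by (simp add: Z_def M_closed \<Psi>_M GN \<Gamma>M)
  have G0E: "\<Psi> (G0 N) * E N A B = (- 1) ^ card A *\<^sub>C E N A B" "E N A B * \<Psi> (G0 N) = (- 1) ^ card B *\<^sub>C E N A B"
    if "A \<in> sets N" "B \<in> sets N" for A B
    using G0_EK[of A N B] that \<Psi>_simps(2)[of "G0 N" "EK N A B"] \<Psi>_simps(2)[of "EK N A B" "G0 N"]
    by (simp_all add: \<Psi>_EK \<Psi>_simps(3))
  have sh: "\<Psi> (G0 N) * \<pi> (a (shift (int N) f)) = \<pi> (a (shift (int N) f)) * \<Psi> (G0 N)"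
    "\<Psi> (G0 N) * adj (\<pi> (a (shift (int N) f))) = adj (\<pi> (a (shift (int N) f))) * \<Psi> (G0 N)" if f: "f \<in> ops d {0..}" for f
  proof -
    have s1: "sg A A = 1" for A by (simp add: sg_def flip: mult_2)
    show "\<Psi> (G0 N) * \<pi> (a (shift (int N) f)) = \<pi> (a (shift (int N) f)) * \<Psi> (G0 N)"
      "\<Psi> (G0 N) * adj (\<pi> (a (shift (int N) f))) = adj (\<pi> (a (shift (int N) f))) * \<Psi> (G0 N)"
      unfolding \<Psi>_G0 sum_distrib_left sum_distrib_right
      by (rule sum.cong[OF refl]; use E_shift_commute[of _ N _ f] f in \<open>simp add: s1\<close>)+
  qed
  have "Z \<in> M'"
  proof (rule in_M'I[of N])
    fix A B assume AB: "A \<in> sets N" "B \<in> sets N"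
    have "Z * E N A B = sg A B *\<^sub>C (\<Psi> (G0 N) * (GN N * E N A B) * \<Gamma>M)"
      by (simp add: Z_def mult.assoc E_parity[OF AB])
    also have "\<dots> = sg A B *\<^sub>C (\<Psi> (G0 N) * E N A B * (GN N * \<Gamma>M))"
      by (simp only: E_GN_commute[OF AB, symmetric] mult.assoc)
    also have "\<dots> = (sg A B * (- 1) ^ card A) *\<^sub>C (E N A B * (GN N * \<Gamma>M))"
      by (simp only: G0E[OF AB] scaleC_scaleC bop_scaleC_mult)
    also have "sg A B * (- 1) ^ card A = (- 1) ^ card B"
      by (simp add: sg_def power_add mult.assoc mult.commute[of "(- 1) ^ card B"])
    also have "(- 1) ^ card B *\<^sub>C (E N A B * (GN N * \<Gamma>M)) = E N A B * Z"
      using G0E(2)[OF AB] by (simp add: Z_def mult.assoc[symmetric])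
    finally show "Z * E N A B = E N A B * Z" .
  next
    fix f assume f: "f \<in> ops d {0..}"
    note f1 = shift_ops0[OF f, of N]
    have g: "\<Gamma>M * \<pi> (a (shift (int N) f)) = - (\<pi> (a (shift (int N) f)) * \<Gamma>M)"
      "\<Gamma>M * adj (\<pi> (a (shift (int N) f))) = - (adj (\<pi> (a (shift (int N) f))) * \<Gamma>M)"
      using \<Gamma>M_rep[OF rep_a_M[OF f1]] \<Gamma>M_rep[of "star (a (shift (int N) f))"] M_closed(6)[OF rep_a_M[OF f1]]
      by (simp_all add: \<Theta>_simps(4) \<Theta>_simps(5)[OF f1] star_minus rep_simps)
    show "Z * \<pi> (a (shift (int N) f)) = \<pi> (a (shift (int N) f)) * Z"
      unfolding Z_def by (rule anticommute_three[OF sh(1)[OF f] GN_shift(1)[OF f] g(1)])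
    show "Z * adj (\<pi> (a (shift (int N) f))) = adj (\<pi> (a (shift (int N) f))) * Z"
      unfolding Z_def by (rule anticommute_three[OF sh(2)[OF f] GN_shift(2)[OF f] g(2)])
  qed
  then have "\<Psi> (\<Phi> Z * x) = \<Psi> (x * \<Phi> Z)" for x
    using M_M'_commute[OF \<Psi>_M, of Z x] by (simp add: \<Psi>_simps \<Psi>_\<Phi> ZM)
  then have "\<exists>s. \<Phi> Z = s *\<^sub>C 1" by (intro commutes_with_rank1_scalar) (simp add: \<Psi>_inj)
  moreover have "\<Phi> Z = G0 N * \<gamma> N \<Gamma> * \<Gamma>"
  proof -
    have "\<Psi> (G0 N * \<gamma> N \<Gamma> * \<Gamma>) = Z" by (simp add: Z_def \<Psi>_simps \<Psi>_\<gamma> GN_def flip: \<Gamma>M_def)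
    then show ?thesis by (metis \<Phi>_\<Psi>)
  qed
  ultimately obtain s where s: "G0 N * \<gamma> N \<Gamma> * \<Gamma> = s *\<^sub>C 1" by auto
  have s1: "G0 N * \<gamma> N \<Gamma> = s *\<^sub>C \<Gamma>" using arg_cong[OF s, of "\<lambda>z. z * \<Gamma>"] by (simp add: mult.assoc \<Gamma>)
  \<comment> \<open>The block parity and \<open>\<gamma> N \<Gamma>\<close> commute and square to 1,
    hence so does the scalar.\<close>
  have "(s * s) *\<^sub>C (1 :: 'l bop) = (s *\<^sub>C \<Gamma>) * (s *\<^sub>C \<Gamma>)" by (simp add: \<Gamma> scaleC_scaleC)
  also have "\<dots> = (\<gamma> N \<Gamma> * G0 N) * (G0 N * \<gamma> N \<Gamma>)" by (simp only: s1[symmetric]) (simp only: G0_\<gamma>)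
  also have "\<dots> = \<gamma> N \<Gamma> * (G0 N * G0 N) * \<gamma> N \<Gamma>" by (simp only: mult.assoc)
  also have "\<dots> = 1" by (simp add: G0_sq \<gamma>_simps(2)[symmetric] \<Gamma> \<gamma>_simps(5))
  finally have "((s - 1) * (s + 1)) *\<^sub>C (1 :: 'l bop) = 0"
    by (simp add: algebra_simps scaleC_diff_left)
  moreover have "(1 :: 'l bop) \<noteq> 0"
  proof
    assume "(1 :: 'l bop) = 0"
    then have "psi 1 = 0" by (simp add: psi_linear)
    then show False by (simp add: psi_one)
  qed
  ultimately have "s = 1 \<or> s = - 1" by (simp add: eq_neg_iff_add_eq_0)
  with s1 show ?thesis by blast
qed

text \<open>The general intertwiner for \<open>\<gamma> 1\<close>, with its vector
  \<open>\<zeta>\<close> taken from the range of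
  \<open>EK 1 {} {} * \<gamma> 1 (rank1 \<xi> \<xi>)\<close>. That this projection is
  \<open>rank1 \<zeta> \<zeta>\<close> yields the identity on rank-one operators.\<close>

lemma exists_B0:
  fixes \<xi> :: 'l
  assumes \<xi>: "cinner \<xi> \<xi> = 1"
  obtains B0 where "adj B0 * B0 = 1" "\<And>x. \<gamma> 1 x * B0 = B0 * x"
    "\<And>x y. rank1 (ap B0 x) (ap B0 y) = EK 1 {} {} * \<gamma> 1 (rank1 x y)" "EK 1 {} {} * B0 = B0"
proof -
  let ?e = "rank1 \<xi> \<xi>" and ?E = "EK 1 {} {}"
  have em: "{} \<in> sets 1" by simp
  obtain \<zeta> where \<zeta>: "cinner \<zeta> \<zeta> = 1" "?E * \<gamma> 1 ?e = rank1 \<zeta> \<zeta>" using minimal_projection[OF \<xi>, of 1] .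
  note c = EK_\<gamma>_even[OF em em sg_empty]
  have ee: "?e * ?e = ?e" by (simp add: rank1_rank1 \<xi>)
  have z: "ap (?E * \<gamma> 1 ?e) \<zeta> = \<zeta>" unfolding \<zeta>(2) by (simp add: ap_rank1 \<zeta>)
  have "\<gamma> 1 ?e * (?E * \<gamma> 1 ?e) = ?E * \<gamma> 1 ?e" by (simp add: c mult.assoc[symmetric]) (simp add: mult.assoc ee flip: \<gamma>_simps(2))
  then have ge: "ap (\<gamma> 1 ?e) \<zeta> = \<zeta>" using z by (metis ap_mult)
  have "?E * (?E * \<gamma> 1 ?e) = ?E * \<gamma> 1 ?e" by (simp add: EK_mult flip: mult.assoc)
  then have Ee: "ap ?E \<zeta> = \<zeta>" using z by (metis ap_mult)
  obtain t where t: "\<And>\<eta>. ap t \<eta> = ap (\<gamma> 1 (rank1 \<eta> \<xi>)) \<zeta>" "adj t * t = 1" "\<And>x. \<gamma> 1 x * t = t * x"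
    by (rule star_hom_intertwiner[OF \<gamma>_star_hom \<xi> \<zeta>(1) ge]) rule
  have "rank1 (ap t x) (ap t y) = ?E * \<gamma> 1 (rank1 x y)" for x y
  proof -
    have "rank1 (ap t x) (ap t y) = \<gamma> 1 (rank1 x \<xi>) * rank1 \<zeta> \<zeta> * adj (\<gamma> 1 (rank1 y \<xi>))"
      by (simp add: rank1_mult t)
    also have "\<dots> = (\<gamma> 1 (rank1 x \<xi>) * ?E) * (\<gamma> 1 ?e * \<gamma> 1 (rank1 \<xi> y))"
      by (simp add: \<zeta>(2)[symmetric] mult.assoc flip: \<gamma>_simps(4))
    also have "\<dots> = ?E * (\<gamma> 1 (rank1 x \<xi>) * \<gamma> 1 (rank1 \<xi> y))"
      by (simp add: c[symmetric] mult.assoc rank1_rank1 \<xi> flip: \<gamma>_simps(2))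
    finally show ?thesis by (simp add: rank1_rank1 \<xi> flip: \<gamma>_simps(2))
  qed
  note r1 = this
  have "?E * t = t"
    by (rule bop_eqI) (simp add: ap_mult t(1), simp add: c Ee flip: ap_mult, simp add: ap_mult Ee)
  then show thesis by (rule that[OF t(2,3) r1])
qed

end

locale mps = half_chain d a \<Theta> \<omega> \<pi>0 \<Omega> \<sigma> V \<Gamma>h \<Phi> \<Gamma> M
  for d and a :: "one_particle \<Rightarrow> 'a::cstar_algebra" and \<Theta> \<omega>
    and \<pi>0 :: "'a \<Rightarrow> 'h::complex_hilbert \<Rightarrow> 'h" and \<Omega> \<sigma> V \<Gamma>h
    and \<Phi> :: "'h bop \<Rightarrow> 'l::complex_hilbert bop" and \<Gamma> M +
  fixes m :: nat and \<xi> :: "nat \<Rightarrow> 'l" and B0 :: "'l bop" and s :: complex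
  assumes m1: "m \<ge> 1" and onb: "onb m \<xi>" and P_sum: "P = (\<Sum>i<m. rank1 (\<xi> i) (\<xi> i))"
    and B0: "adj B0 * B0 = 1" "\<And>x. \<gamma> 1 x * B0 = B0 * x"
      "\<And>x y. rank1 (ap B0 x) (ap B0 y) = EK 1 {} {} * \<gamma> 1 (rank1 x y)" "EK 1 {} {} * B0 = B0"
    and s: "s = 1 \<or> s = - 1" "G0 1 * \<gamma> 1 \<Gamma> = s *\<^sub>C \<Gamma>"
begin

lemma P_\<xi>: "i < m \<Longrightarrow> ap P (\<xi> i) = \<xi> i"
  and cinner_\<xi>: "i < m \<Longrightarrow> j < m \<Longrightarrow> cinner (\<xi> i) (\<xi> j) = (if i = j then 1 else 0)"
  using onb by (auto simp: onb_def)

section \<open>Matrices of compressions to the range of \<open>P\<close>, and the density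
  matrix\<close>

definition mt :: "'l bop \<Rightarrow> complex mat"
  where "mt T = Matrix.mat m m (\<lambda>(i, j). cinner (\<xi> i) (ap T (\<xi> j)))"

lemma mt_carrier [simp]: "mt T \<in> carrier_mat m m" "dim_row (mt T) = m" "dim_col (mt T) = m"
  by (simp_all add: mt_def)

lemma mt_index: "i < m \<Longrightarrow> j < m \<Longrightarrow> mt T $$ (i, j) = cinner (\<xi> i) (ap T (\<xi> j))"
  by (simp add: mt_def)

lemma mt_P: "mt (P * T) = mt T" "mt (T * P) = mt T"
proof -
  have "cinner (\<xi> i) (ap P x) = cinner (\<xi> i) x" if "i < m" for i x
    using cinner_adj[of P "\<xi> i" x] that by (simp add: P_\<xi> P)
  then show "mt (P * T) = mt T" "mt (T * P) = mt T" by (auto intro!: eq_matI simp: mt_index ap_mult P_\<xi>)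
qed

lemma mt_linear: "mt (X + T) = mt X + mt T" "mt (c *\<^sub>C T) = c \<cdot>\<^sub>m mt T"
  by (auto intro!: eq_matI simp: mt_index ap_simps cinner_add_right cinner_scaleC_right)

lemma mt_sum: "mt (\<Sum>i\<in>I. f i) = mat_sum m I (\<lambda>i. mt (f i))"
  unfolding mat_sum_def by (auto intro!: eq_matI simp: mt_index ap_bop_sum cinner_sum_right)

lemma mt_adj: "mt (adj T) = mat_adjoint (mt T)"
proof (rule eq_matI)
  fix i j assume "i < dim_row (mat_adjoint (mt T))" "j < dim_col (mat_adjoint (mt T))"
  then have "i < m" "j < m" using mat_adjoint_carrier[OF mt_carrier(1), of T] by auto
  then show "mt (adj T) $$ (i, j) = mat_adjoint (mt T) $$ (i, j)"
    by (simp add: mt_index mat_adjoint_index[OF mt_carrier(1)] cinner_adj[symmetric])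
      (metis cinner_adj cinner_commute)
qed (use mat_adjoint_carrier[OF mt_carrier(1), of T] in auto)

text \<open>Compression is multiplicative only up to the \<open>P\<close> in between; for operators
  commuting with \<open>P\<close> this factor disappears.\<close>

lemma mt_mult: "mt X * mt T = mt (X * P * T)"
proof (rule eq_matI)
  fix i j assume "i < dim_row (mt (X * P * T))" "j < dim_col (mt (X * P * T))"
  then have ij: "i < m" "j < m" by auto
  have "(mt X * mt T) $$ (i, j) = (\<Sum>k<m. cinner (\<xi> i) (ap X (\<xi> k)) * cinner (\<xi> k) (ap T (\<xi> j)))"
    using ij by (simp add: scalar_prod_def mt_index lessThan_atLeast0)
  also have "\<dots> = cinner (\<xi> i) (ap X (ap P (ap T (\<xi> j))))"
    by (simp add: P_sum ap_bop_sum ap_rank1 ap_sum ap_linear cinner_sum_right cinner_scaleC_right mult.commute)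
  finally show "(mt X * mt T) $$ (i, j) = mt (X * P * T) $$ (i, j)" using ij by (simp add: mt_index ap_mult)
qed auto

lemma mt_mult_P: "P * X = X * P \<Longrightarrow> mt X * mt T = mt (X * T)"
proof -
  assume c: "P * X = X * P"
  have "mt X * mt T = mt (P * (X * T))" by (simp add: mt_mult c[symmetric] mult.assoc)
  then show ?thesis by (simp add: mt_P)
qed

lemma mt_one: "mt 1 = 1\<^sub>m m"
  by (auto intro!: eq_matI simp: mt_index cinner_\<xi>)

lemma mt_eq_iff: "mt X = mt T \<longleftrightarrow> P * X * P = P * T * P"
proof
  assume eq: "mt X = mt T"
  have e: "P * R * P = (\<Sum>i<m. \<Sum>j<m. mt R $$ (i, j) *\<^sub>C rank1 (\<xi> i) (\<xi> j))" for R
  proof -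
    have "P * R * P = (\<Sum>i<m. \<Sum>j<m. rank1 (\<xi> i) (\<xi> i) * R * rank1 (\<xi> j) (\<xi> j))"
      by (simp only: P_sum sum_distrib_left sum_distrib_right) (rule sum.swap)
    also have "\<dots> = (\<Sum>i<m. \<Sum>j<m. mt R $$ (i, j) *\<^sub>C rank1 (\<xi> i) (\<xi> j))"
      by (intro sum.cong refl) (simp add: rank1_mult ap_rank1 rank1_linear mt_index cinner_adj' ap_mult mult.assoc)
    finally show ?thesis .
  qed
  show "P * X * P = P * T * P" unfolding e eq ..
next
  assume "P * X * P = P * T * P"
  then have "mt (P * X * P) = mt (P * T * P)" by simp
  then show "mt X = mt T" by (simp add: mt_P)
qed

definition opr :: "complex mat \<Rightarrow> 'l bop"
  where "opr x = (\<Sum>i<m. \<Sum>j<m. x $$ (i, j) *\<^sub>C rank1 (\<xi> i) (\<xi> j))"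

lemma mt_opr: "x \<in> carrier_mat m m \<Longrightarrow> mt (opr x) = x"
proof (rule eq_matI)
  fix k l assume x: "x \<in> carrier_mat m m" and "k < dim_row x" "l < dim_col x"
  then have kl: "k < m" "l < m" by auto
  have "mt (opr x) $$ (k, l) = (\<Sum>i<m. \<Sum>j<m. x $$ (i, j) * (cinner (\<xi> j) (\<xi> l) * cinner (\<xi> k) (\<xi> i)))"
    using kl by (simp add: mt_index opr_def ap_bop_sum ap_scaleC ap_rank1 cinner_sum_right cinner_scaleC_right)
  also have "\<dots> = (\<Sum>i<m. \<Sum>j<m. if j = l then (if i = k then x $$ (k, l) else 0) else 0)"
    by (intro sum.cong refl) (use kl in \<open>auto simp: cinner_\<xi>\<close>)
  also have "\<dots> = x $$ (k, l)" using kl by simp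
  finally show "mt (opr x) $$ (k, l) = x $$ (k, l)" .
qed auto

lemma opr_P: "P * opr x = opr x" "opr x * P = opr x"
  by (simp_all add: opr_def sum_distrib_left sum_distrib_right rank1_mult P_\<xi> P)

lemma opr_mt: "opr (mt T) = P * T * P"
  using mt_eq_iff[of "opr (mt T)" T] by (simp add: mt_opr opr_P)

text \<open>The indices of the rank-one operators are exchanged, so that the trace against
  \<open>Dop\<close> reproduces \<open>psi\<close>.\<close>

definition Dop :: "'l bop"
  where "Dop = (\<Sum>i<m. \<Sum>j<m. psi (rank1 (\<xi> j) (\<xi> i)) *\<^sub>C rank1 (\<xi> i) (\<xi> j))"

lemma cinner_Dop:
  assumes "ap P \<eta> = \<eta>" "ap P \<zeta> = \<zeta>"
  shows "cinner \<eta> (ap Dop \<zeta>) = psi (rank1 \<zeta> \<eta>)"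
proof -
  have ex: "v = (\<Sum>i<m. cinner (\<xi> i) v *\<^sub>C \<xi> i)" if "ap P v = v" for v
    using that by (simp add: P_sum ap_bop_sum ap_rank1)
  have "psi (rank1 \<zeta> \<eta>) = (\<Sum>j<m. \<Sum>i<m. cinner (\<xi> j) \<zeta> * (cnj (cinner (\<xi> i) \<eta>) * psi (rank1 (\<xi> j) (\<xi> i))))"
    by (subst ex[OF assms(1)], subst ex[OF assms(2)])
      (simp add: rank1_sum_left rank1_sum_right rank1_linear psi_sum psi_linear sum_distrib_left mult_ac, rule sum.swap)
  also have "\<dots> = (\<Sum>i<m. \<Sum>j<m. cinner (\<xi> j) \<zeta> * (cnj (cinner (\<xi> i) \<eta>) * psi (rank1 (\<xi> j) (\<xi> i))))"
    by (rule sum.swap)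
  also have "\<dots> = cinner \<eta> (ap Dop \<zeta>)"
    by (simp add: Dop_def ap_bop_sum ap_scaleC ap_rank1 cinner_sum_right cinner_scaleC_right mult_ac flip: cinner_commute)
  finally show ?thesis by simp
qed

lemma trace_Dop: "mat_trace (mt Dop * mt T) = psi T"
proof -
  have "mat_trace (mt Dop * mt T) = (\<Sum>i<m. \<Sum>j<m. psi (rank1 (\<xi> j) (\<xi> i)) * cinner (\<xi> j) (ap T (\<xi> i)))"
    by (simp add: mat_trace_def scalar_prod_def mt_index cinner_Dop P_\<xi> lessThan_atLeast0)
  also have "\<dots> = psi (\<Sum>j<m. \<Sum>i<m. rank1 (\<xi> j) (\<xi> j) * T * rank1 (\<xi> i) (\<xi> i))"
    by (subst sum.swap)
      (simp add: psi_sum rank1_mult ap_rank1 rank1_linear psi_linear cinner_adj' mult.commute mult.assoc)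
  also have "(\<Sum>j<m. \<Sum>i<m. rank1 (\<xi> j) (\<xi> j) * T * rank1 (\<xi> i) (\<xi> i)) = P * T * P"
    by (simp only: P_sum sum_distrib_left sum_distrib_right) (rule sum.swap)
  finally show ?thesis by (simp add: psi_P)
qed

lemma density: "density_matrix m (mt Dop)"
proof -
  have pos: "Im (psi (rank1 v v)) = 0 \<and> Re (psi (rank1 v v)) \<ge> 0" for v
  proof (cases "v = 0")
    case False
    \<comment> \<open>Normalising one of its two vectors writes \<open>rank1 v v\<close> in the form
      \<open>adj A * A\<close>, on which \<open>psi\<close> is nonnegative.\<close>
    define k where "k = 1 / complex_of_real (norm v)"
    have "psi (rank1 v v) = psi (adj (rank1 (k *\<^sub>C v) v) * rank1 (k *\<^sub>C v) v)"
      using cinner_normalized[OF False] by (simp add: rank1_rank1 psi_linear k_def)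
    then show ?thesis using psi_star[of "rank1 (k *\<^sub>C v) v"] by simp
  qed (simp add: rank1_linear psi_linear)
  have adjD: "adj Dop = Dop"
  proof -
    have "psi (rank1 x y) = cnj (psi (rank1 y x))" for x y
    proof -
      have "psi (adj T) = cnj (psi T)" for T
        by (simp add: psi_def \<Psi>_simps cinner_adj[symmetric] flip: cinner_commute)
      from this[of "rank1 y x"] show ?thesis by simp
    qed
    then have pc: "cnj (psi (rank1 x y)) = psi (rank1 y x)" for x y by metis
    show ?thesis unfolding Dop_def adj_sum adj_simps adj_rank1 pc by (rule sum.swap)
  qed
  have "0 \<le> (mt Dop *\<^sub>v x) \<bullet>c x" if x: "x \<in> carrier_vec m" for x
  proof -
    define v where "v = (\<Sum>i<m. vec_index x i *\<^sub>C \<xi> i)"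
    have Pv: "ap P v = v" by (simp add: v_def ap_sum ap_linear P_\<xi>)
    have "(mt Dop *\<^sub>v x) \<bullet>c x = (\<Sum>i<m. (\<Sum>j<m. cinner (\<xi> i) (ap Dop (\<xi> j)) * vec_index x j) * cnj (vec_index x i))"
      using x by (auto simp: scalar_prod_def mt_index lessThan_atLeast0 intro!: sum.cong)
    also have "\<dots> = cinner v (ap Dop v)"
      by (simp add: v_def ap_sum ap_linear cinner_sum_left cinner_sum_right cinner_scaleC_left cinner_scaleC_right
          sum_distrib_left sum_distrib_right mult_ac) (rule sum.swap)
    also have "\<dots> = psi (rank1 v v)" by (rule cinner_Dop[OF Pv Pv])
    finally show ?thesis using pos[of v] by (simp add: less_eq_complex_def)
  qed
  moreover have "mat_trace (mt Dop) = 1"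
    using trace_Dop[of 1] by (simp add: mt_one right_mult_one_mat[OF mt_carrier(1)] psi_one)
  ultimately show ?thesis by (simp add: density_matrix_def adjD flip: mt_adj)
qed

lemma faithful: "faithful_matrix m (mt Dop)"
  unfolding faithful_matrix_def
proof (intro ballI impI)
  fix x assume x: "x \<in> carrier_mat m m" and 0: "mat_trace (mt Dop * (mat_adjoint x * x)) = 0"
  have eq: "mat_adjoint x * x = mt (adj (opr x) * opr x)"
    using mt_mult[of "adj (opr x)" "opr x"] by (simp add: mt_adj mt_opr[OF x] mult.assoc opr_P)
  have "opr x * P = 0" by (rule psi_faithful) (use 0 in \<open>simp add: eq trace_Dop\<close>)
  then have "opr x = 0" by (simp add: opr_P)
  then have "x = mt 0" using mt_opr[OF x] by simp
  then show "x = 0\<^sub>m m m" by (auto intro!: eq_matI simp: mt_index)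
qed

lemma mt_\<Gamma>_conj: "Ad_mat (mt \<Gamma>) (mt T) = mt (\<Gamma> * T * \<Gamma>)"
proof -
  have "Ad_mat (mt \<Gamma>) (mt T) = mt (\<Gamma> * T) * mt \<Gamma>" by (simp add: Ad_mat_def mt_mult_P P_\<Gamma> \<Gamma> flip: mt_adj)
  also have "\<dots> = mt (\<Gamma> * T * (P * \<Gamma>))" by (simp add: mt_mult mult.assoc)
  also have "\<dots> = mt (\<Gamma> * T * \<Gamma> * P)" by (simp add: P_\<Gamma> mult.assoc)
  finally show ?thesis by (simp add: mt_P)
qed

lemma \<theta>_unitary: "self_adjoint_unitary m (mt \<Gamma>)"
  by (simp add: self_adjoint_unitary_def mt_mult_P P_\<Gamma> \<Gamma> mt_one flip: mt_adj)

lemma \<Gamma>_Dop: "Ad_mat (mt \<Gamma>) (mt Dop) = mt Dop"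
proof -
  have P\<Gamma>: "ap P (ap \<Gamma> v) = ap \<Gamma> (ap P v)" for v using P_\<Gamma> by (metis ap_mult)
  have "mt (\<Gamma> * Dop * \<Gamma>) $$ (i, j) = mt Dop $$ (i, j)" if ij: "i < m" "j < m" for i j
  proof -
    have "mt (\<Gamma> * Dop * \<Gamma>) $$ (i, j) = cinner (ap \<Gamma> (\<xi> i)) (ap Dop (ap \<Gamma> (\<xi> j)))"
      using ij by (simp add: mt_index ap_mult cinner_adj[of \<Gamma>] \<Gamma>)
    also have "\<dots> = psi (rank1 (ap \<Gamma> (\<xi> j)) (ap \<Gamma> (\<xi> i)))" by (rule cinner_Dop) (use ij in \<open>simp_all add: P\<Gamma> P_\<xi>\<close>)
    also have "rank1 (ap \<Gamma> (\<xi> j)) (ap \<Gamma> (\<xi> i)) = \<Gamma> * rank1 (\<xi> j) (\<xi> i) * \<Gamma>" by (simp add: rank1_mult \<Gamma>)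
    also have "psi \<dots> = mt Dop $$ (i, j)" using ij by (simp add: psi_\<Gamma> mt_index cinner_Dop P_\<xi>)
    finally show ?thesis .
  qed
  then show ?thesis by (simp add: mt_\<Gamma>_conj) (auto intro!: eq_matI)
qed

section \<open>The operators behind \<open>v\<close> and the transfer map\<close>

definition Bop' :: "nat set \<Rightarrow> 'l bop" where "Bop' \<mu> = EK 1 \<mu> {} * B0"
definition v :: "nat set \<Rightarrow> complex mat" where "v \<mu> = mt (Bop' \<mu>)"

lemma em: "{} \<in> sets 1" by simp

lemma \<Gamma>_sq_cancel: "\<Gamma> * (\<Gamma> * x) = x" by (simp add: \<Gamma> flip: mult.assoc)

lemma s_sq: "s * s = 1" using s(1) by auto

lemma \<gamma>_\<Gamma>: "\<gamma> 1 \<Gamma> = s *\<^sub>C (G0 1 * \<Gamma>)" "G0 1 = s *\<^sub>C (\<Gamma> * \<gamma> 1 \<Gamma>)" "\<Gamma> * G0 1 = G0 1 * \<Gamma>"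
proof -
  show 1: "\<gamma> 1 \<Gamma> = s *\<^sub>C (G0 1 * \<Gamma>)" using arg_cong[OF s(2), of "\<lambda>x. G0 1 * x"] by (simp add: G0_sq flip: mult.assoc)
  have "\<Gamma> * G0 1 = G0 1 * \<Gamma>"
  proof -
    have "\<Gamma> * EK 1 A A = EK 1 A A * \<Gamma>" if A: "A \<in> sets 1" for A
      using arg_cong[OF EK_parity[OF A A], of "\<lambda>x. x * \<Gamma>"] by (simp add: mult.assoc \<Gamma> sg_def flip: mult_2)
    then show ?thesis unfolding G0_def sum_distrib_left sum_distrib_right by (intro sum.cong refl) simp
  qed
  then show 2: "\<Gamma> * G0 1 = G0 1 * \<Gamma>" .
  have "\<Gamma> * \<gamma> 1 \<Gamma> = s *\<^sub>C G0 1" by (simp add: 1 \<Gamma>_sq_cancel flip: 2)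
  then show "G0 1 = s *\<^sub>C (\<Gamma> * \<gamma> 1 \<Gamma>)" by (simp add: scaleC_scaleC s_sq)
qed

text \<open>\<open>B0 * \<Gamma>\<close> is \<open>\<gamma> 1 \<Gamma> * B0\<close>, and
  \<open>\<Gamma> * \<gamma> 1 \<Gamma>\<close> is \<open>s\<close> times the block parity, which
  equals 1 on the range of \<open>EK 1 {} {}\<close>. This is where the sign in the parity of the
  matrices comes from.\<close>

lemma \<Gamma>_B0: "\<Gamma> * B0 * \<Gamma> = s *\<^sub>C B0"
proof -
  have "\<Gamma> * B0 * \<Gamma> = \<Gamma> * \<gamma> 1 \<Gamma> * B0" by (simp add: mult.assoc B0(2))
  also have "\<dots> = s *\<^sub>C (G0 1 * B0)" using \<gamma>_\<Gamma>(2) by (simp add: scaleC_scaleC s_sq flip: bop_scaleC_mult(1))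
  also have "G0 1 * B0 = G0 1 * EK 1 {} {} * B0" by (simp add: mult.assoc B0(4))
  also have "\<dots> = B0" by (simp add: G0_EK[OF em em] B0(4))
  finally show ?thesis .
qed

lemma \<Gamma>_B: "\<mu> \<in> sets 1 \<Longrightarrow> \<Gamma> * Bop' \<mu> * \<Gamma> = ((- 1) ^ card \<mu> * s) *\<^sub>C Bop' \<mu>"
proof -
  assume \<mu>: "\<mu> \<in> sets 1"
  have "\<Gamma> * Bop' \<mu> * \<Gamma> = (\<Gamma> * EK 1 \<mu> {} * \<Gamma>) * (\<Gamma> * B0 * \<Gamma>)"
    by (simp add: Bop'_def mult.assoc \<Gamma>_sq_cancel)
  then show ?thesis by (simp add: EK_parity[OF \<mu> em] \<Gamma>_B0 scaleC_scaleC Bop'_def sg_def mult.commute[of s])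
qed

definition L :: "nat set \<Rightarrow> nat set \<Rightarrow> 'l bop \<Rightarrow> 'l bop"
  where "L \<mu> \<nu> x = EK 1 \<mu> {} * \<gamma> 1 x * EK 1 {} \<nu>"

text \<open>Immediate for rank-one operators and extended by finite sums, so that no continuity of
  \<open>\<gamma> 1\<close> enters.\<close>

lemma B_opr:
  assumes \<mu>: "\<mu> \<in> sets 1" and \<nu>: "\<nu> \<in> sets 1"
  shows "Bop' \<mu> * opr x * adj (Bop' \<nu>) = L \<mu> \<nu> (opr x)"
proof -
  have "Bop' \<mu> * rank1 y z * adj (Bop' \<nu>) = L \<mu> \<nu> (rank1 y z)" for y z
  proof -
    have "Bop' \<mu> * rank1 y z * adj (Bop' \<nu>) = EK 1 \<mu> {} * rank1 (ap B0 y) (ap B0 z) * adj (EK 1 \<nu> {})"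
      by (simp add: Bop'_def rank1_mult ap_mult)
    then show ?thesis by (simp add: B0(3) EK_adj[OF \<nu> em] L_def EK_mult[OF em em \<mu> em] flip: mult.assoc)
  qed
  note r = this
  show ?thesis
    unfolding opr_def L_def star_hom_sum[OF \<gamma>_star_hom] sum_distrib_left sum_distrib_right
    by (intro sum.cong refl) (use r in \<open>simp add: \<gamma>_simps(3) L_def mult.assoc\<close>)
qed

text \<open>\<open>P\<close> is even, so \<open>\<gamma> 1 P\<close> commutes with the matrix units
  and reaches the outer \<open>P\<close>, which absorbs it. Replacing \<open>x\<close> by the finite
  rank operator \<open>P * x * P\<close> is therefore harmless.\<close>

lemma P_L_P:
  assumes \<mu>: "\<mu> \<in> sets 1" and \<nu>: "\<nu> \<in> sets 1"
  shows "P * L \<mu> \<nu> x * P = P * L \<mu> \<nu> (P * x * P) * P"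
proof -
  have c1: "EK 1 \<mu> {} * \<gamma> 1 P = \<gamma> 1 P * EK 1 \<mu> {}" by (rule EK_\<gamma>_even_arg[OF \<mu> em P(5)])
  have c2: "EK 1 {} \<nu> * \<gamma> 1 P = \<gamma> 1 P * EK 1 {} \<nu>" by (rule EK_\<gamma>_even_arg[OF em \<nu> P(5)])
  have "P * L \<mu> \<nu> (P * x * P) * P = P * (EK 1 \<mu> {} * \<gamma> 1 P) * \<gamma> 1 x * (\<gamma> 1 P * EK 1 {} \<nu>) * P"
    by (simp add: L_def \<gamma>_simps(2) mult.assoc)
  also have "\<dots> = (P * \<gamma> 1 P) * EK 1 \<mu> {} * \<gamma> 1 x * EK 1 {} \<nu> * (\<gamma> 1 P * P)"
    by (simp only: c1 c2[symmetric] mult.assoc)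
  also have "\<dots> = P * L \<mu> \<nu> x * P" by (simp only: P(3,4) L_def mult.assoc)
  finally show ?thesis by simp
qed

lemma mt_L:
  assumes \<mu>: "\<mu> \<in> sets 1" and \<nu>: "\<nu> \<in> sets 1"
  shows "mt (L \<mu> \<nu> x) = v \<mu> * mt x * mat_adjoint (v \<nu>)"
proof -
  have "v \<mu> * mt x * mat_adjoint (v \<nu>) = mt (Bop' \<mu> * (P * x * P) * adj (Bop' \<nu>))"
    by (simp add: v_def mt_mult mult.assoc flip: mt_adj)
  also have "\<dots> = mt (L \<mu> \<nu> (P * x * P))" using B_opr[OF assms, of "mt x"] by (simp add: opr_mt)
  also have "\<dots> = mt (L \<mu> \<nu> x)" using P_L_P[OF assms, of x] by (simp add: mt_eq_iff)
  finally show ?thesis by simp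
qed

definition gt :: "'l bop \<Rightarrow> 'l bop"
  where "gt x = (\<Sum>\<mu>\<in>sets 1. L \<mu> \<mu> x)"

lemma transfer_mt: "transfer_map m d v (mt x) = mt (gt x)"
  unfolding transfer_map_def gt_def mt_sum mat_sum_def by (auto simp: mt_L)

lemma transfer_power: "(transfer_map m d v ^^ N) (mt x) = mt ((gt ^^ N) x)"
  by (induction N) (simp_all add: transfer_mt)

lemma gt_even: "\<Gamma> * x * \<Gamma> = x \<Longrightarrow> gt x = \<gamma> 1 x"
proof -
  assume x: "\<Gamma> * x * \<Gamma> = x"
  have "L \<mu> \<mu> x = EK 1 \<mu> \<mu> * \<gamma> 1 x" if \<mu>: "\<mu> \<in> sets 1" for \<mu>
    by (simp add: L_def mult.assoc EK_\<gamma>_even_arg[OF em \<mu> x, symmetric])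
      (simp add: EK_mult[OF em em \<mu> \<mu>] flip: mult.assoc)
  then have "gt x = (\<Sum>\<mu>\<in>sets 1. EK 1 \<mu> \<mu>) * \<gamma> 1 x" by (simp add: gt_def flip: sum_distrib_right)
  then show ?thesis by (simp only: EK_sum mult_1_left)
qed

text \<open>Moving \<open>EK 1 {} \<mu>\<close> past \<open>\<gamma> 1\<close> of an odd operator
  costs a sign for each particle, so the resolution of the identity of the site becomes its parity
  \<open>G0 1\<close>, and that is \<open>s\<close> times
  \<open>\<Gamma> * \<gamma> 1 \<Gamma>\<close>.\<close>

lemma gt_odd: "\<Gamma> * x * \<Gamma> = - x \<Longrightarrow> gt x = s *\<^sub>C (\<Gamma> * \<gamma> 1 (\<Gamma> * x))"
proof -
  assume x: "\<Gamma> * x * \<Gamma> = - x"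
  have "L \<mu> \<mu> x = ((- 1) ^ card \<mu> *\<^sub>C EK 1 \<mu> \<mu>) * \<gamma> 1 x" if \<mu>: "\<mu> \<in> sets 1" for \<mu>
  proof -
    have c: "\<gamma> 1 x * EK 1 {} \<mu> = (- 1) ^ card \<mu> *\<^sub>C (EK 1 {} \<mu> * \<gamma> 1 x)"
      using EK_\<gamma>_even[OF em \<mu>, of x] EK_\<gamma>_odd[OF em \<mu>, of x] sg_cases[of "{}" \<mu>] x
      by (auto simp: sg_def \<gamma>_simps(7))
    have "L \<mu> \<mu> x = (- 1) ^ card \<mu> *\<^sub>C (EK 1 \<mu> {} * EK 1 {} \<mu> * \<gamma> 1 x)"
      by (simp add: L_def mult.assoc c)
    then show ?thesis by (simp add: EK_mult[OF em em \<mu> \<mu>])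
  qed
  then have "gt x = G0 1 * \<gamma> 1 x" by (simp add: gt_def G0_def sum_distrib_right)
  also have "\<dots> = s *\<^sub>C (\<Gamma> * (\<gamma> 1 \<Gamma> * \<gamma> 1 x))" by (subst \<gamma>_\<Gamma>(2)) (simp add: mult.assoc)
  finally show ?thesis by (simp add: \<gamma>_simps(2))
qed

text \<open>\<open>\<Gamma>\<close> and \<open>\<gamma> 1 \<Gamma>\<close> differ by the block
  parity, which commutes with the image of \<open>\<gamma> 1\<close>; iterate.\<close>

lemma \<gamma>_parity: "\<Gamma> * \<gamma> N x * \<Gamma> = \<gamma> N (\<Gamma> * x * \<Gamma>)"
proof (induction N)
  case 0
  then show ?case by (simp add: \<gamma>_0)
next
  case (Suc N)
  have one: "\<Gamma> * \<gamma> 1 y * \<Gamma> = \<gamma> 1 (\<Gamma> * y * \<Gamma>)" for y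
  proof -
    have "\<gamma> 1 (\<Gamma> * y * \<Gamma>) = (s *\<^sub>C (\<Gamma> * G0 1)) * \<gamma> 1 y * (s *\<^sub>C (G0 1 * \<Gamma>))"
      by (simp add: \<gamma>_simps(2) \<gamma>_\<Gamma>(1) \<gamma>_\<Gamma>(3))
    also have "\<dots> = \<Gamma> * (G0 1 * \<gamma> 1 y) * G0 1 * \<Gamma>" by (simp add: scaleC_scaleC s_sq mult.assoc)
    also have "\<dots> = \<Gamma> * \<gamma> 1 y * (G0 1 * G0 1) * \<Gamma>" by (simp only: G0_\<gamma> mult.assoc)
    finally show ?thesis by (simp add: G0_sq)
  qed
  show ?case unfolding \<gamma>_Suc one Suc ..
qed

lemma gt_power_even: "\<Gamma> * x * \<Gamma> = x \<Longrightarrow> (gt ^^ N) x = \<gamma> N x"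
proof (induction N)
  case (Suc N)
  then have "\<Gamma> * \<gamma> N x * \<Gamma> = \<gamma> N x" by (simp add: \<gamma>_parity)
  then show ?case using Suc by (simp add: gt_even \<gamma>_Suc)
qed (simp add: \<gamma>_0)

lemma gt_scale: "gt (c *\<^sub>C x) = c *\<^sub>C gt x"
  by (simp add: gt_def L_def \<gamma>_simps(3) scaleC_sum_right)

lemma gt_add: "gt (x + y) = gt x + gt y"
  by (simp add: gt_def L_def \<gamma>_simps(1) sum.distrib distrib_left distrib_right)

lemma gt_power_odd: "\<Gamma> * x * \<Gamma> = - x \<Longrightarrow> (gt ^^ N) x = s ^ N *\<^sub>C (\<Gamma> * \<gamma> N (\<Gamma> * x))"
proof (induction N)
  case 0
  then show ?case by (simp add: \<gamma>_0 \<Gamma>_sq_cancel)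
next
  case (Suc N)
  define z where "z = \<Gamma> * \<gamma> N (\<Gamma> * x)"
  have gx: "\<Gamma> * (\<Gamma> * x) * \<Gamma> = - (\<Gamma> * x)" using Suc.prems by (simp add: mult.assoc)
  have "\<Gamma> * z * \<Gamma> = \<Gamma> * (\<Gamma> * \<gamma> N (\<Gamma> * x) * \<Gamma>)" by (simp add: z_def mult.assoc)
  also have "\<dots> = - z" unfolding \<gamma>_parity gx by (simp add: z_def \<gamma>_simps(7))
  finally have "gt z = s *\<^sub>C (\<Gamma> * \<gamma> 1 (\<Gamma> * z))" by (rule gt_odd)
  then have "gt z = s *\<^sub>C (\<Gamma> * \<gamma> (Suc N) (\<Gamma> * x))" by (simp add: z_def \<Gamma>_sq_cancel \<gamma>_Suc)
  then show ?case using Suc by (simp add: gt_scale scaleC_scaleC mult.commute flip: z_def)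
qed

lemma gt_power_add: "(gt ^^ N) (x + y) = (gt ^^ N) x + (gt ^^ N) y"
  by (induction N) (simp_all add: gt_add)

text \<open>On the even part the iterates are those of \<open>\<gamma>\<close>, and mixing gives the
  expectation. On the odd part \<open>\<Gamma> * xo\<close> is odd again and has expectation 0,
  while the factor \<open>s ^ N\<close> has modulus 1.\<close>

lemma gt_limit:
  assumes ij: "i < m" "j < m"
  shows "(\<lambda>N. cinner (\<xi> i) (ap ((gt ^^ N) x) (\<xi> j))) \<longlonglongrightarrow> (if i = j then psi x else 0)"
proof -
  define xe where "xe = (1/2) *\<^sub>C (x + \<Gamma> * x * \<Gamma>)"
  define xo where "xo = (1/2) *\<^sub>C (x - \<Gamma> * x * \<Gamma>)"
  have xe: "\<Gamma> * xe * \<Gamma> = xe" by (simp add: xe_def distrib_left distrib_right mult.assoc \<Gamma> \<Gamma>_sq_cancel add.commute)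
  have xo: "\<Gamma> * xo * \<Gamma> = - xo"
    by (simp add: xo_def right_diff_distrib left_diff_distrib mult.assoc \<Gamma> \<Gamma>_sq_cancel flip: scaleC_minus_right)
  have x: "x = xe + xo" by (simp add: xe_def xo_def scaleC_add_right scaleC_diff_right flip: scaleC_add_left)
  have gx: "\<Gamma> * (\<Gamma> * xo) * \<Gamma> = - (\<Gamma> * xo)" using xo by (simp add: mult.assoc)
  have "(\<lambda>N. cinner (ap \<Gamma> (\<xi> i)) (ap (\<gamma> N (\<Gamma> * xo)) (\<xi> j))) \<longlonglongrightarrow> 0"
    using mixing[OF P_\<xi>[OF ij(2)], of "ap \<Gamma> (\<xi> i)" "\<Gamma> * xo"] psi_odd[OF gx] by simp
  then have "(\<lambda>N. s ^ N * cinner (ap \<Gamma> (\<xi> i)) (ap (\<gamma> N (\<Gamma> * xo)) (\<xi> j))) \<longlonglongrightarrow> 0"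
    by (rule tendsto_0_le[where K = 1]) (use s in \<open>auto simp: norm_mult norm_power\<close>)
  moreover have "s ^ N * cinner (ap \<Gamma> (\<xi> i)) (ap (\<gamma> N (\<Gamma> * xo)) (\<xi> j)) = cinner (\<xi> i) (ap ((gt ^^ N) xo) (\<xi> j))" for N
    by (simp add: gt_power_odd[OF xo] ap_scaleC ap_mult cinner_scaleC_right cinner_adj[of \<Gamma>] \<Gamma>)
  ultimately have lo: "(\<lambda>N. cinner (\<xi> i) (ap ((gt ^^ N) xo) (\<xi> j))) \<longlonglongrightarrow> 0" by simp
  have le: "(\<lambda>N. cinner (\<xi> i) (ap ((gt ^^ N) xe) (\<xi> j))) \<longlonglongrightarrow> (if i = j then psi xe else 0)"
    using mixing[OF P_\<xi>[OF ij(2)], of "\<xi> i" xe] ij by (auto simp: gt_power_even[OF xe] cinner_\<xi>)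
  have "psi x = psi xe" using psi_odd[OF xo] by (simp add: x psi_linear)
  moreover have "cinner (\<xi> i) (ap ((gt ^^ N) x) (\<xi> j)) =
      cinner (\<xi> i) (ap ((gt ^^ N) xe) (\<xi> j)) + cinner (\<xi> i) (ap ((gt ^^ N) xo) (\<xi> j))" for N
    by (subst x) (simp add: gt_power_add ap_simps cinner_add_right)
  ultimately show ?thesis using tendsto_add[OF le lo] by (simp only: add_0_right)
qed

lemma transfer_limit:
  assumes x: "x \<in> carrier_mat m m"
  shows "(\<lambda>N. mat_opnorm ((transfer_map m d v ^^ N) x - mat_trace (mt Dop * x) \<cdot>\<^sub>m 1\<^sub>m m)) \<longlonglongrightarrow> 0"
proof -
  define A where "A N = (transfer_map m d v ^^ N) x - mat_trace (mt Dop * x) \<cdot>\<^sub>m 1\<^sub>m m" for N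
  have T: "(transfer_map m d v ^^ N) x = mt ((gt ^^ N) (opr x))" for N
    using transfer_power[of N "opr x"] by (simp add: mt_opr[OF x])
  have tr: "mat_trace (mt Dop * x) = psi (opr x)" using trace_Dop[of "opr x"] by (simp add: mt_opr[OF x])
  have A: "A N \<in> carrier_mat m m" for N unfolding A_def T by (intro minus_carrier_mat smult_carrier_mat one_carrier_mat)
  have Aij: "A N $$ (i, j) = cinner (\<xi> i) (ap ((gt ^^ N) (opr x)) (\<xi> j)) - (if i = j then psi (opr x) else 0)"
    if "i < m" "j < m" for N i j
    using that by (simp add: A_def T tr mt_index)
  have "(\<lambda>N. \<Sum>i<m. \<Sum>j<m. cmod (A N $$ (i, j))) \<longlonglongrightarrow> (\<Sum>i<m. \<Sum>j<m. 0)"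
  proof (intro tendsto_sum)
    fix i j assume "i \<in> {..<m}" "j \<in> {..<m}"
    then have ij: "i < m" "j < m" by auto
    show "(\<lambda>N. cmod (A N $$ (i, j))) \<longlonglongrightarrow> 0"
      unfolding Aij[OF ij] by (intro tendsto_norm_zero LIM_zero gt_limit ij)
  qed
  then have lim: "(\<lambda>N. \<Sum>i<m. \<Sum>j<m. cmod (A N $$ (i, j))) \<longlonglongrightarrow> 0" by simp
  show ?thesis unfolding A_def[symmetric]
    by (rule tendsto_sandwich[OF _ _ tendsto_const lim]) (use mat_opnorm_bounds[OF A] in auto)
qed

lemma Ad_\<theta>_v: "\<mu> \<in> sets 1 \<Longrightarrow> Ad_mat (mt \<Gamma>) (v \<mu>) = (- 1) ^ (par \<mu> + (if s = 1 then 0 else 1)) \<cdot>\<^sub>m v \<mu>"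
proof -
  assume \<mu>: "\<mu> \<in> sets 1"
  have "(- 1 :: complex) ^ card \<mu> = (- 1) ^ par \<mu>" by (simp add: par_def minus_one_power_iff even_iff_mod_2_eq_zero)
  then have "(- 1) ^ card \<mu> * s = (- 1) ^ (par \<mu> + (if s = 1 then 0 else 1))" using s(1) by (auto simp: power_add)
  then show ?thesis by (simp add: v_def mt_\<Gamma>_conj \<Gamma>_B[OF \<mu>] mt_linear)
qed

section \<open>Correlation functions\<close>

fun corr :: "(nat set \<times> nat set) list \<Rightarrow> 'a" where
  "corr [] = 1"
| "corr ((\<mu>, \<nu>) # xs) = modes.unit (d * 1) \<mu> \<nu> * \<sigma> 1 (corr xs)"

text \<open>The product in \<open>corr\<close> with every unit split in two, the left half in front
  of the remaining sites and the right half behind them.\<close>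

fun nested :: "(nat set \<times> nat set) list \<Rightarrow> 'l bop" where
  "nested [] = 1"
| "nested ((\<mu>, \<nu>) # xs) = L \<mu> \<nu> (nested xs)"

definition wt :: "(nat set \<times> nat set) list \<Rightarrow> nat"
  where "wt xs = (\<Sum>(\<mu>, \<nu>)\<leftarrow>xs. par \<mu> + par \<nu>)"

text \<open>The sign for carrying the right half of each unit past all later sites;
  \<open>wt xs\<close> is the parity of what it passes.\<close>

fun sgn_exp :: "(nat set \<times> nat set) list \<Rightarrow> nat" where
  "sgn_exp [] = 0"
| "sgn_exp ((\<mu>, \<nu>) # xs) = par \<nu> * wt xs + sgn_exp xs"

lemma minus_one_par: "(- 1 :: complex) ^ card A = (- 1) ^ par A"
  by (simp add: par_def minus_one_power_iff even_iff_mod_2_eq_zero)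

lemma L_scale: "L \<mu> \<nu> (c *\<^sub>C x) = c *\<^sub>C L \<mu> \<nu> x"
  by (simp add: L_def \<gamma>_simps(3))

lemma nested_parity: "set xs \<subseteq> sets 1 \<times> sets 1 \<Longrightarrow> \<Gamma> * nested xs * \<Gamma> = (- 1) ^ wt xs *\<^sub>C nested xs"
proof (induction xs rule: nested.induct)
  case (2 \<mu> \<nu> xs)
  then have \<mu>: "\<mu> \<in> sets 1" "\<nu> \<in> sets 1" by auto
  have "\<Gamma> * L \<mu> \<nu> y * \<Gamma> = (\<Gamma> * EK 1 \<mu> {} * \<Gamma>) * (\<Gamma> * \<gamma> 1 y * \<Gamma>) * (\<Gamma> * EK 1 {} \<nu> * \<Gamma>)" for y
    by (simp add: L_def mult.assoc \<Gamma>_sq_cancel)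
  then have Lp: "\<Gamma> * L \<mu> \<nu> y * \<Gamma> = ((- 1) ^ par \<mu> * (- 1) ^ par \<nu>) *\<^sub>C L \<mu> \<nu> (\<Gamma> * y * \<Gamma>)" for y
    unfolding EK_parity[OF \<mu>(1) em] EK_parity[OF em \<mu>(2)] \<gamma>_parity
    by (simp add: sg_def minus_one_par scaleC_scaleC L_def mult.commute)
  show ?case using 2 by (simp add: Lp L_scale scaleC_scaleC wt_def power_add)
qed (simp add: \<Gamma> wt_def)

lemma corr_Cons: "\<pi> (corr ((\<mu>, \<nu>) # xs)) = E 1 \<mu> \<nu> * V.conj_by 1 (\<pi> (corr xs))"
  by (simp add: rep_simps E_def V_conj_rep)

lemma corr_M: "set xs \<subseteq> sets 1 \<times> sets 1 \<Longrightarrow> \<pi> (corr xs) \<in> M"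
proof (induction xs rule: corr.induct)
  case (2 \<mu> \<nu> xs)
  then have \<mu>: "\<mu> \<in> sets 1" "\<nu> \<in> sets 1" and xs: "\<pi> (corr xs) \<in> M" by auto
  show ?case unfolding corr_Cons by (intro M_closed E_M \<mu> conj_M xs)
qed (simp add: rep_simps M_closed)

lemma corr_nested: "set xs \<subseteq> sets 1 \<times> sets 1 \<Longrightarrow> \<Phi> (\<pi> (corr xs)) = (- 1) ^ sgn_exp xs *\<^sub>C nested xs"
proof (induction xs rule: corr.induct)
  case 1
  show ?case by (simp add: rep_simps \<Phi>_one)
next
  case (2 \<mu> \<nu> xs)
  then have \<mu>: "\<mu> \<in> sets 1" "\<nu> \<in> sets 1" and xs: "set xs \<subseteq> sets 1 \<times> sets 1" by auto
  have par: "\<Gamma> * nested xs * \<Gamma> = (- 1) ^ wt xs *\<^sub>C nested xs" by (rule nested_parity[OF xs])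
  \<comment> \<open>Only an odd right half notices the parity of the operator it passes.\<close>
  have c: "\<gamma> 1 (nested xs) * EK 1 {} \<nu> = (- 1) ^ (par \<nu> * wt xs) *\<^sub>C (EK 1 {} \<nu> * \<gamma> 1 (nested xs))"
  proof (cases "sg {} \<nu> = 1")
    case True
    then have "par \<nu> = 0" by (simp add: sg_def minus_one_par par_def minus_one_power_iff split: if_splits)
    then show ?thesis using EK_\<gamma>_even[OF em \<mu>(2) True] by simp
  next
    case False
    then have p1: "par \<nu> = 1" by (simp add: sg_def minus_one_par par_def minus_one_power_iff odd_iff_mod_2_eq_one split: if_splits)
    have "EK 1 {} \<nu> * \<gamma> 1 (nested xs) = (- 1) ^ wt xs *\<^sub>C (\<gamma> 1 (nested xs) * EK 1 {} \<nu>)"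
      using EK_\<gamma>_odd[OF em \<mu>(2), of "nested xs"] sg_cases[of "{}" \<nu>] False by (simp add: par \<gamma>_simps(3))
    then show ?thesis by (simp add: p1 scaleC_scaleC flip: power_add mult_2)
  qed
  have "\<Phi> (\<pi> (corr ((\<mu>, \<nu>) # xs))) = \<Phi> (E 1 \<mu> \<nu> * V.conj_by 1 (\<pi> (corr xs)))"
    by (simp only: corr_Cons)
  also have "\<dots> = EK 1 \<mu> \<nu> * \<gamma> 1 (\<Phi> (\<pi> (corr xs)))"
    using \<Phi>_hom(2)[OF E_M[OF \<mu>] conj_M[OF corr_M[OF xs]]] by (simp add: EK_def \<gamma>_def \<Psi>_\<Phi> corr_M[OF xs])
  also have "\<dots> = (- 1) ^ sgn_exp xs *\<^sub>C (EK 1 \<mu> {} * (EK 1 {} \<nu> * \<gamma> 1 (nested xs)))"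
    using 2 xs by (simp add: \<gamma>_simps(3) EK_mult \<mu> flip: mult.assoc)
  also have "EK 1 {} \<nu> * \<gamma> 1 (nested xs) = (- 1) ^ (par \<nu> * wt xs) *\<^sub>C (\<gamma> 1 (nested xs) * EK 1 {} \<nu>)"
    unfolding c by (simp add: scaleC_scaleC flip: power_add mult_2)
  finally show ?case by (simp add: scaleC_scaleC L_def power_add mult.commute mult.assoc)
qed

lemma mat_prod_snoc:
  assumes "\<forall>x\<in>set xs. x \<in> carrier_mat m m" "B \<in> carrier_mat m m"
  shows "mat_prod m xs \<in> carrier_mat m m" "mat_prod m (xs @ [B]) = mat_prod m xs * B"
  using assms
proof (induction xs)
  case (Cons A xs)
  {
    case 1
    then show ?case using Cons by (auto simp: mat_prod_def)
  next
    case 2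
    then show ?case
      using Cons assoc_mult_mat[of A m m "mat_prod m xs" m B m] by (auto simp: mat_prod_def)
  }
qed (auto simp: mat_prod_def)

lemma mt_nested:
  assumes "set xs \<subseteq> sets 1 \<times> sets 1"
  shows "mt (nested xs) = mat_prod m (map (\<lambda>x. v (fst x)) xs @ map (\<lambda>x. mat_adjoint (v (snd x))) (rev xs))"
  using assms
proof (induction xs rule: nested.induct)
  case 1
  show ?case by (simp add: mat_prod_def mt_one)
next
  case (2 \<mu> \<nu> xs)
  let ?ys = "map (\<lambda>x. v (fst x)) xs @ map (\<lambda>x. mat_adjoint (v (snd x))) (rev xs)"
  have vc: "v A \<in> carrier_mat m m" "mat_adjoint (v A) \<in> carrier_mat m m" for A
    by (simp_all add: v_def mat_adjoint_carrier)
  have ys: "\<forall>x\<in>set (v \<mu> # ?ys). x \<in> carrier_mat m m" using vc by auto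
  have "mt (nested ((\<mu>, \<nu>) # xs)) = v \<mu> * mat_prod m ?ys * mat_adjoint (v \<nu>)"
    using 2 by (simp add: mt_L)
  also have "\<dots> = mat_prod m ((v \<mu> # ?ys) @ [mat_adjoint (v \<nu>)])"
    unfolding mat_prod_snoc(2)[OF ys vc(2)] by (simp add: mat_prod_def)
  finally show ?case by simp
qed

text \<open>The recursion splits off the first site, whereas the outer sum of the final exponent
  grows with the last one; appending a site connects the two.\<close>

lemma sgn_exp_snoc: "sgn_exp (xs @ [(\<mu>, \<nu>)]) = sgn_exp xs + (par \<mu> + par \<nu>) * (\<Sum>x\<leftarrow>xs. par (snd x))"
  by (induction xs rule: sgn_exp.induct) (simp_all add: wt_def algebra_simps)

lemma sgn_exp_eq: "sgn_exp (map (\<lambda>k. (\<mu> k, \<nu> k)) [0..<Suc l]) = (\<Sum>k=1..l. (par (\<mu> k) + par (\<nu> k)) * (\<Sum>j<k. par (\<nu> j)))"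
proof (induction l)
  case (Suc l)
  have "(\<Sum>x\<leftarrow>map (\<lambda>k. (\<mu> k, \<nu> k)) [0..<Suc l]. par (snd x)) = (\<Sum>j<Suc l. par (\<nu> j))"
    by (simp add: o_def interv_sum_list_conv_sum_set_nat lessThan_atLeast0 del: upt_Suc)
  then show ?case
    using Suc sgn_exp_snoc[of "map (\<lambda>k. (\<mu> k, \<nu> k)) [0..<Suc l]" "\<mu> (Suc l)" "\<nu> (Suc l)"]
    by (simp del: sum.lessThan_Suc)
qed (simp add: wt_def)

lemma corr_formula:
  assumes "\<And>k. k \<le> l \<Longrightarrow> \<mu> k \<in> sets 1 \<and> \<nu> k \<in> sets 1"
  shows "\<omega> (corr (map (\<lambda>k. (\<mu> k, \<nu> k)) [0..<Suc l])) =
    (- 1) ^ (\<Sum>k=1..l. (par (\<mu> k) + par (\<nu> k)) * (\<Sum>j<k. par (\<nu> j))) *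
    mat_trace (mt Dop * mat_prod m (map (\<lambda>k. v (\<mu> k)) [0..<Suc l] @ map (\<lambda>k. mat_adjoint (v (\<nu> k))) (rev [0..<Suc l])))"
proof -
  let ?xs = "map (\<lambda>k. (\<mu> k, \<nu> k)) [0..<Suc l]"
  have xs: "set ?xs \<subseteq> sets 1 \<times> sets 1" using assms by (auto simp del: upt_Suc simp: less_Suc_eq_le subset_eq)
  have "\<omega> (corr ?xs) = psi (\<Phi> (\<pi> (corr ?xs)))" by (simp only: state_eq psi_def \<Psi>_\<Phi>[OF corr_M[OF xs]])
  also have "\<dots> = (- 1) ^ sgn_exp ?xs * mat_trace (mt Dop * mt (nested ?xs))"
    unfolding corr_nested[OF xs] by (simp only: psi_linear trace_Dop)
  finally show ?thesis unfolding mt_nested[OF xs] sgn_exp_eq by (simp add: o_def rev_map del: upt_Suc)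
qed

end

section \<open>On-site symmetries\<close>

lemma (in semiunitary_map) continuous_on_map: "continuous_on UNIV V"
  unfolding continuous_on_iff dist_norm diff[symmetric] norm by blast

locale car_onsite = car d a for d and a :: "one_particle \<Rightarrow> 'a::cstar_algebra" +
  fixes t :: bit and U :: "complex Matrix.vec \<Rightarrow> complex Matrix.vec" and \<alpha> :: "'a \<Rightarrow> 'a"
  assumes U: "semiunitary_on (carrier_vec d) (\<cdot>\<^sub>v) (\<lambda>x y. y \<bullet>c x) t U"
    and \<alpha>: "is_bogoliubov d a t (onsite U) \<alpha>"
begin

lemma U_carrier: "x \<in> carrier_vec d \<Longrightarrow> U x \<in> carrier_vec d"
  and U_surj: "y \<in> carrier_vec d \<Longrightarrow> \<exists>x\<in>carrier_vec d. U x = y"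
  and U_inner: "x \<in> carrier_vec d \<Longrightarrow> y \<in> carrier_vec d \<Longrightarrow> U y \<bullet>c U x = cj t (y \<bullet>c x)"
  and U_scale: "x \<in> carrier_vec d \<Longrightarrow> U (c \<cdot>\<^sub>v x) = cj t c \<cdot>\<^sub>v U x"
proof -
  have u: "U ` carrier_vec d = carrier_vec d"
    "\<forall>x\<in>carrier_vec d. \<forall>y\<in>carrier_vec d. U (x + y) = U x + U y \<and> U y \<bullet>c U x = cj t (y \<bullet>c x)"
    "\<forall>c. \<forall>x\<in>carrier_vec d. U (c \<cdot>\<^sub>v x) = cj t c \<cdot>\<^sub>v U x"
    using U unfolding semiunitary_on_def by blast+
  show "x \<in> carrier_vec d \<Longrightarrow> U x \<in> carrier_vec d" "y \<in> carrier_vec d \<Longrightarrow> \<exists>x\<in>carrier_vec d. U x = y"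
    using u(1) by blast (use u(1) in \<open>metis imageE\<close>)
  show "x \<in> carrier_vec d \<Longrightarrow> y \<in> carrier_vec d \<Longrightarrow> U y \<bullet>c U x = cj t (y \<bullet>c x)"
    "x \<in> carrier_vec d \<Longrightarrow> U (c \<cdot>\<^sub>v x) = cj t c \<cdot>\<^sub>v U x"
    using u(2,3) by blast+
qed

lemma U_zero: "U (0\<^sub>v d) = 0\<^sub>v d"
proof -
  have "U (0 \<cdot>\<^sub>v 0\<^sub>v d) = 0 \<cdot>\<^sub>v U (0\<^sub>v d)" using U_scale[of "0\<^sub>v d" 0] by simp
  moreover have "0 \<cdot>\<^sub>v x = 0\<^sub>v d" if "x \<in> carrier_vec d" for x :: "complex Matrix.vec"
    using that by (intro eq_vecI) auto
  ultimately show ?thesis using U_carrier[of "0\<^sub>v d"] by simp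
qed

lemma U_norm: "x \<in> carrier_vec d \<Longrightarrow> Re (U x \<bullet>c U x) = Re (x \<bullet>c x)"
  by (simp add: U_inner cj_def)

lemma onsite_ops: "f \<in> ops d X \<Longrightarrow> onsite U f \<in> ops d X"
  unfolding one_particle_space_def onsite_def by (auto simp: U_carrier U_zero U_norm)

lemma onsite_ops_surj:
  assumes f: "f \<in> ops d X"
  obtains g where "g \<in> ops d X" "onsite U g = f"
proof -
  \<comment> \<open>The value 0 is fixed where \<open>f\<close> vanishes, so that the preimage keeps
    the support of \<open>f\<close>.\<close>
  define g where "g x = (if f x = 0\<^sub>v d then 0\<^sub>v d else SOME y. y \<in> carrier_vec d \<and> U y = f x)" for x
  have g: "g x \<in> carrier_vec d \<and> U (g x) = f x" for x
  proof (cases "f x = 0\<^sub>v d")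
    case False
    have "\<exists>y. y \<in> carrier_vec d \<and> U y = f x" using U_surj[OF ops_carrier[OF f]] by blast
    from someI_ex[OF this] show ?thesis using False by (simp add: g_def)
  qed (simp add: g_def U_zero)
  have "Re (g x \<bullet>c g x) = Re (f x \<bullet>c f x)" for x using U_norm[of "g x"] g[of x] by simp
  then have "g \<in> ops d X" using f g unfolding one_particle_space_def by (auto simp: g_def)
  moreover have "onsite U g = f" using g by (simp add: onsite_def fun_eq_iff)
  ultimately show thesis by (rule that)
qed

lemma \<alpha>_simps: "\<alpha> (x + y) = \<alpha> x + \<alpha> y" "\<alpha> (x * y) = \<alpha> x * \<alpha> y" "\<alpha> (c *\<^sub>C x) = cj t c *\<^sub>C \<alpha> x"
  "\<alpha> (star x) = star (\<alpha> x)" "\<alpha> 1 = 1" "\<alpha> 0 = 0"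
proof -
  have b: "surj \<alpha>" using \<alpha> by (simp add: is_bogoliubov_def bij_def)
  show *: "\<alpha> (x + y) = \<alpha> x + \<alpha> y" "\<alpha> (x * y) = \<alpha> x * \<alpha> y" "\<alpha> (c *\<^sub>C x) = cj t c *\<^sub>C \<alpha> x"
    "\<alpha> (star x) = star (\<alpha> x)" for x y c
    using \<alpha> by (simp_all add: is_bogoliubov_def)
  obtain y where "\<alpha> y = 1" using b by (metis surjD)
  then show "\<alpha> 1 = 1" using *(2)[of 1 y] by simp
  show "\<alpha> 0 = 0" using *(1)[of 0 0] by simp
qed

lemma \<alpha>_a: "f \<in> ops d X \<Longrightarrow> \<alpha> (a f) = a (onsite U f)"
  using \<alpha> ops_UNIV[of f X] by (auto simp: is_bogoliubov_def)

definition site0 :: "complex Matrix.vec \<Rightarrow> one_particle"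
  where "site0 f = (\<lambda>x. if x = 0 then f else 0\<^sub>v d)"

lemma site0_ops: "f \<in> carrier_vec d \<Longrightarrow> site0 f \<in> ops d {0}"
  by (rule ops_finite) (auto simp: site0_def)

lemma onsite_site0: "onsite U (site0 f) = site0 (U f)"
  by (auto simp: onsite_def site0_def U_zero)

lemma a_site0:
  assumes f: "f \<in> carrier_vec d"
  shows "a (site0 f) = (\<Sum>k<d. cnj (vec_index f k) *\<^sub>C mode_annihilator d a k)"
proof -
  have "mode_part d (site0 f) = site0 f"
  proof
    fix x
    show "mode_part d (site0 f) x = site0 f x"
    proof (cases "x = 0")
      case True
      then show ?thesis using f by (auto simp: mode_part_def site0_def)
    next
      case False
      have "\<not> nat x * d + i < d" if x: "0 \<le> x" for i
      proof -
        have "1 \<le> nat x" using x False by linarith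
        from mult_le_mono1[OF this, of d] show ?thesis by (simp only: mult_1)
      qed
      then show ?thesis using False by (auto simp: mode_part_def site0_def intro!: eq_vecI)
    qed
  qed
  then show ?thesis using a_mode_part[of d "site0 f"] by (simp add: site0_def)
qed

lemma mode_eq_site0: "k < d \<Longrightarrow> mode_annihilator d a k = a (site0 (unit_vec d k))"
  by (simp add: mode_annihilator_eq lmode_def site0_def cong: if_cong)

lemma \<alpha>_mode: "k < d \<Longrightarrow> \<alpha> (mode_annihilator d a k) = a (site0 (U (unit_vec d k)))"
  by (simp add: mode_eq_site0 \<alpha>_a[OF site0_ops] onsite_site0)

lemma num_prod_fix:
  "(\<And>k. k \<in> set ks \<Longrightarrow> h k * z = z) \<Longrightarrow> prod_list (map h ks) * z = (z :: 'a)"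
  by (induction ks) (simp_all add: mult.assoc)

text \<open>
  Both projections are annihilated by all annihilation operators of the site \<open>0\<close>, so each of them is dominated by the
  other.
\<close>

lemma \<alpha>_vac: "\<alpha> (modes.vac d) = modes.vac d"
proof -
  let ?q = "\<alpha> (modes.vac d)" and ?v = "modes.vac d"
  have bv: "a (site0 f) * ?v = 0" if "f \<in> carrier_vec d" for f
    by (simp add: a_site0[OF that] sum_distrib_right mult_scaleC_left modes.c_vac)
  have "mode_annihilator d a k * ?q = 0" if k: "k < d" for k
  proof -
    obtain f where f: "f \<in> carrier_vec d" "U f = unit_vec d k" using U_surj[of "unit_vec d k"] by auto
    have "\<alpha> (a (site0 f) * ?v) = mode_annihilator d a k * ?q"
      by (simp only: \<alpha>_simps \<alpha>_a[OF site0_ops[OF f(1)]] onsite_site0 f mode_eq_site0[OF k])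
    then show ?thesis by (simp add: bv[OF f(1)] \<alpha>_simps)
  qed
  then have "modes.num k * ?q = ?q" if "k < d" for k
    using that by (simp add: modes.num_def modes.cs'[of k k] left_diff_distrib mult.assoc)
  then have vq: "?v * ?q = ?q" unfolding modes.vac_def[of d] by (intro num_prod_fix) auto
  have "\<alpha> (modes.num k) * ?v = ?v" if k: "k < d" for k
  proof -
    have "\<alpha> (modes.num k) = 1 - star (\<alpha> (mode_annihilator d a k)) * \<alpha> (mode_annihilator d a k)"
    proof -
      have "modes.num k + star (mode_annihilator d a k) * mode_annihilator d a k = 1"
        using modes.cs[of k k] by (simp add: modes.num_def)
      from arg_cong[OF this, of \<alpha>] show ?thesis by (simp add: \<alpha>_simps eq_diff_eq)
    qed
    then show ?thesis using bv[of "U (unit_vec d k)"] U_carrier[of "unit_vec d k"]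
      by (simp add: \<alpha>_mode[OF k] left_diff_distrib mult.assoc)
  qed
  moreover have "\<alpha> (prod_list (map modes.num ks)) = prod_list (map (\<lambda>k. \<alpha> (modes.num k)) ks)" for ks
    by (induction ks) (simp_all add: \<alpha>_simps)
  moreover from this have "?q = prod_list (map (\<lambda>k. \<alpha> (modes.num k)) [0..<d])" by (simp add: modes.vac_def)
  ultimately have "?q * ?v = ?v" using num_prod_fix[of "[0..<d]" "\<lambda>k. \<alpha> (modes.num k)" ?v] by simp
  moreover have "?q * ?v = ?q"
    using arg_cong[OF vq, of star] by (simp add: star_mult modes.star_vac flip: \<alpha>_simps(4))
  ultimately show ?thesis by simp
qed

text \<open>Fock space as the left ideal generated by the vacuum projection, on which creators act
  by left multiplication.\<close>

definition fock_op :: "(nat set \<Rightarrow> complex) \<Rightarrow> 'a"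
  where "fock_op \<phi> = (\<Sum>A\<in>Pow {..<d}. \<phi> A *\<^sub>C modes.unit d A {})"

text \<open>A creator inserts a mode with the sign of the smaller modes; indexing by the set after
  the insertion gives the formula for \<open>fock_create\<close>.\<close>

lemma fock_create_op:
  assumes f: "f \<in> carrier_vec d"
  shows "star (a (site0 f)) * fock_op \<phi> = fock_op (fock_create f \<phi>)"
proof -
  let ?sg = "\<lambda>A k. (- 1) ^ card {j\<in>A. j < k} :: complex"
  let ?t = "\<lambda>k A. if k \<in> A then (?sg A k * vec_index f k * \<phi> (A - {k})) *\<^sub>C modes.unit d A {} else 0"
  have "star (a (site0 f)) * fock_op \<phi> =
      (\<Sum>k<d. \<Sum>A\<in>Pow {..<d}. (vec_index f k * \<phi> A) *\<^sub>C (star (mode_annihilator d a k) * modes.unit d A {}))"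
    by (simp add: a_site0[OF f] fock_op_def star_sum star_scaleC sum_distrib_left sum_distrib_right
        mult_scaleC_left mult_scaleC_right scaleC_scaleC scaleC_sum_right mult.commute) (rule sum.swap)
  also have "\<dots> = (\<Sum>k<d. \<Sum>A\<in>Pow {..<d}. ?t k A)"
  proof (rule sum.cong[OF refl])
    fix k assume k: "k \<in> {..<d}"
    have "(\<Sum>A\<in>Pow {..<d}. (vec_index f k * \<phi> A) *\<^sub>C (star (mode_annihilator d a k) * modes.unit d A {})) =
        (\<Sum>A\<in>{A\<in>Pow {..<d}. k \<notin> A}. (?sg A k * vec_index f k * \<phi> A) *\<^sub>C modes.unit d (insert k A) {})"
    proof (rule sum.mono_neutral_cong_right)
      fix A assume "A \<in> {A\<in>Pow {..<d}. k \<notin> A}"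
      then show "(vec_index f k * \<phi> A) *\<^sub>C (star (mode_annihilator d a k) * modes.unit d A {}) =
          (?sg A k * vec_index f k * \<phi> A) *\<^sub>C modes.unit d (insert k A) {}"
        using finite_subset[of A "{..<d}"] by (simp add: modes.s_unit scaleC_scaleC mult_ac)
    qed (use finite_subset[of _ "{..<d}"] in \<open>auto simp: modes.s_unit\<close>)
    also have "\<dots> = (\<Sum>A\<in>{A\<in>Pow {..<d}. k \<in> A}. (?sg A k * vec_index f k * \<phi> (A - {k})) *\<^sub>C modes.unit d A {})"
    proof (rule sum.reindex_bij_witness[where i = "\<lambda>A. A - {k}" and j = "insert k"])
      fix A assume A: "A \<in> {A\<in>Pow {..<d}. k \<notin> A}"
      have "{j \<in> insert k A. j < k} = {j\<in>A. j < k}" by auto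
      then show "(?sg (insert k A) k * vec_index f k * \<phi> (insert k A - {k})) *\<^sub>C modes.unit d (insert k A) {} =
          (?sg A k * vec_index f k * \<phi> A) *\<^sub>C modes.unit d (insert k A) {}" using A by simp
    qed (use k in auto)
    also have "\<dots> = (\<Sum>A\<in>Pow {..<d}. ?t k A)"
      by (rule sum.mono_neutral_cong_left) auto
    finally show "(\<Sum>A\<in>Pow {..<d}. (vec_index f k * \<phi> A) *\<^sub>C (star (mode_annihilator d a k) * modes.unit d A {})) =
        (\<Sum>A\<in>Pow {..<d}. ?t k A)" .
  qed
  also have "(\<Sum>k<d. \<Sum>A\<in>Pow {..<d}. ?t k A) = (\<Sum>A\<in>Pow {..<d}. \<Sum>k<d. ?t k A)" by (rule sum.swap)
  also have "\<dots> = fock_op (fock_create f \<phi>)"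
    unfolding fock_op_def fock_create_def scaleC_sum_left
  proof (rule sum.cong[OF refl])
    fix A assume "A \<in> Pow {..<d}"
    then show "(\<Sum>k<d. ?t k A) =
        (\<Sum>k\<in>A. (?sg A k * vec_index f k * \<phi> (A - {k})) *\<^sub>C modes.unit d A {})"
      by (intro sum.mono_neutral_cong_right) auto
  qed
  finally show ?thesis .
qed

lemma \<alpha>_word_vac:
  assumes "set ks \<subseteq> {..<d}"
  shows "\<alpha> (modes.word ks) * modes.vac d = fock_op (foldr (\<lambda>i. fock_create (U (unit_vec d i))) ks (fock_basis {}))"
  using assms
proof (induction ks)
  case Nil
  have "fock_op (fock_basis {}) = (\<Sum>A\<in>Pow {..<d}. if A = {} then modes.unit d {} {} else 0)"
    unfolding fock_op_def fock_basis_def by (rule sum.cong) auto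
  then show ?case by (simp add: \<alpha>_simps modes.unit_def)
next
  case (Cons k ks)
  then have "\<alpha> (modes.word (k # ks)) * modes.vac d =
      star (a (site0 (U (unit_vec d k)))) * fock_op (foldr (\<lambda>i. fock_create (U (unit_vec d i))) ks (fock_basis {}))"
    by (simp add: \<alpha>_simps \<alpha>_mode mult.assoc)
  then show ?case using fock_create_op[OF U_carrier[of "unit_vec d k"]] by simp
qed

lemma fock_inner_basis: "\<mu> \<subseteq> {..<d} \<Longrightarrow> fock_inner d (fock_basis \<mu>) x = x \<mu>"
proof -
  assume \<mu>: "\<mu> \<subseteq> {..<d}"
  have "fock_inner d (fock_basis \<mu>) x = (\<Sum>A\<in>Pow {..<d}. if A = \<mu> then x A else 0)"
    unfolding fock_inner_def fock_basis_def by (rule sum.cong) auto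
  then show ?thesis using \<mu> by simp
qed

abbreviation U_coeff :: "nat set \<Rightarrow> nat set \<Rightarrow> complex"
  where "U_coeff \<mu> \<nu> \<equiv> fock_inner d (fock_basis \<mu>) (second_quant d t U (fock_basis \<nu>))"

text \<open>\<open>\<alpha>\<close> fixes the vacuum projection and sends the creator of a basis
  vector to that of its image under \<open>U\<close>, so the coefficients are those of the second
  quantisation.\<close>

lemma \<alpha>_unit:
  assumes \<nu>: "\<nu> \<subseteq> {..<d}"
  shows "\<alpha> (modes.unit d \<nu> {}) = (\<Sum>\<mu>\<in>Pow {..<d}. U_coeff \<mu> \<nu> *\<^sub>C modes.unit d \<mu> {})"
proof -
  let ?h = "foldr (\<lambda>i. fock_create (U (unit_vec d i))) (sorted_list_of_set \<nu>) (fock_basis {})"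
  have "second_quant d t U (fock_basis \<nu>) \<rho> = ?h \<rho>" for \<rho>
  proof -
    have "second_quant d t U (fock_basis \<nu>) \<rho> = (\<Sum>A\<in>Pow {..<d}. if A = \<nu> then ?h \<rho> else 0)"
      unfolding second_quant_def fock_basis_def by (rule sum.cong) auto
    then show ?thesis using \<nu> by simp
  qed
  then have "fock_op ?h = (\<Sum>\<mu>\<in>Pow {..<d}. U_coeff \<mu> \<nu> *\<^sub>C modes.unit d \<mu> {})"
    unfolding fock_op_def by (intro sum.cong refl) (simp add: fock_inner_basis)
  moreover have "\<alpha> (modes.unit d \<nu> {}) = \<alpha> (modes.wordset \<nu>) * modes.vac d"
    by (simp add: modes.unit_def \<alpha>_simps \<alpha>_vac)
  ultimately show ?thesis using \<alpha>_word_vac[of "sorted_list_of_set \<nu>"] \<nu> finite_subset[OF \<nu>] by simp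
qed

end

text \<open>One group element: \<open>t\<close> is its linearity bit, \<open>uh\<close> implements
  it on the GNS space and \<open>W\<close> on the index space. The two are linked on the half-chain
  C*-algebra only.\<close>

locale symmetric_mps = mps d a \<Theta> \<omega> \<pi>0 \<Omega> \<sigma> V \<Gamma>h \<Phi> \<Gamma> M m \<xi> B0 s + car_onsite d a t U \<alpha>
  for d and a :: "one_particle \<Rightarrow> 'a::cstar_algebra" and \<Theta> \<omega>
    and \<pi>0 :: "'a \<Rightarrow> 'h::complex_hilbert \<Rightarrow> 'h" and \<Omega> \<sigma> V \<Gamma>h
    and \<Phi> :: "'h bop \<Rightarrow> 'l::complex_hilbert bop" and \<Gamma> M m \<xi> B0 s t U \<alpha> +
  fixes uh :: "'h \<Rightarrow> 'h" and W :: "'l \<Rightarrow> 'l"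
  assumes uh: "semiunitary t uh" "\<And>A. uh (ap (rep A) \<Omega>) = ap (rep (\<alpha> A)) \<Omega>"
      "\<And>A x. uh (ap (rep A) x) = ap (rep (\<alpha> A)) (uh x)"
    and W: "semiunitary t W"
    and W_rep: "\<And>A. A \<in> right_algebra d a \<Longrightarrow> \<Phi> (rep (\<alpha> A)) = semiunitary_map.conj_by W (\<Phi> (rep A))"
begin

sublocale uh: semiunitary_map t uh by standard (rule uh(1))
sublocale W: semiunitary_map t W by standard (rule W)
sublocale Wi: semiunitary_map t "inv_into UNIV W" by standard (rule W.inv_semiunitary)

lemma uh_conj_rep: "uh.conj_by (\<pi> A) = \<pi> (\<alpha> A)"
  by (rule bop_eqI) (simp add: uh.ap_conj_by uh(3) uh.inv_right)

lemma uh_\<Omega>: "uh \<Omega> = \<Omega>"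
  using uh(2)[of 1] by (simp add: rep_simps \<alpha>_simps)

lemma W_Wi_conj: "W.conj_by (Wi.conj_by x) = x" "Wi.conj_by (W.conj_by x) = x"
proof -
  have i: "inv_into UNIV (inv_into UNIV W) = W" using W.surj W.inj by (simp add: inv_inv_eq bij_def)
  show "W.conj_by (Wi.conj_by x) = x" "Wi.conj_by (W.conj_by x) = x"
    by (rule bop_eqI, simp add: W.ap_conj_by Wi.ap_conj_by i W.inv_right W.inv_left)+
qed

lemma uh_conj_M': "X \<in> M' \<Longrightarrow> uh.conj_by X \<in> M'"
proof -
  assume X: "X \<in> M'"
  have "uh.conj_by X * \<pi> (a f) = \<pi> (a f) * uh.conj_by X \<and> uh.conj_by X * adj (\<pi> (a f)) = adj (\<pi> (a f)) * uh.conj_by X"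
    if f: "f \<in> ops d {0..}" for f
  proof -
    obtain g where g: "g \<in> ops d {0..}" "onsite U g = f" by (rule onsite_ops_surj[OF f])
    have "uh.conj_by (\<pi> (a g)) = \<pi> (a f)" by (simp add: uh_conj_rep \<alpha>_a[OF g(1)] g(2))
    moreover have "X * \<pi> (a g) = \<pi> (a g) * X" "X * adj (\<pi> (a g)) = adj (\<pi> (a g)) * X"
      using X g(1) by (auto simp: M'_def)
    ultimately show ?thesis by (metis uh.conj_by_simps(2,4))
  qed
  then show ?thesis by (auto simp: M'_def)
qed

lemma M'_uh: "Y \<in> M' \<Longrightarrow> \<exists>X\<in>M'. uh.conj_by X = Y"
proof -
  assume Y: "Y \<in> M'"
  interpret i: semiunitary_map t "inv_into UNIV uh" by standard (rule uh.inv_semiunitary)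
  define X where "X = i.conj_by Y"
  have XY: "uh.conj_by X = Y"
    by (rule bop_eqI) (simp add: X_def uh.ap_conj_by i.ap_conj_by uh.inv_right uh.surj uh.inj bij_def inv_inv_eq)
  have "X * z = z * X" if "Y * uh.conj_by z = uh.conj_by z * Y" for z
    using that uh.conj_by_inj[of "X * z" "z * X"] by (simp add: uh.conj_by_simps XY)
  then have "X \<in> M'" unfolding M'_def
    using Y onsite_ops by (auto simp: uh.conj_by_simps uh_conj_rep M'_def \<alpha>_a[where X = "{0..}"])
  with XY show ?thesis by blast
qed

lemma uh_conj_M: "T \<in> M \<Longrightarrow> uh.conj_by T \<in> M"
  unfolding M_comm comm_def
proof (intro CollectI ballI)
  fix Y assume T: "T \<in> {T. \<forall>s\<in>M'. T * s = s * T}" and Y: "Y \<in> M'"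
  obtain X where X: "X \<in> M'" "uh.conj_by X = Y" using M'_uh[OF Y] by blast
  then have "T * X = X * T" using T by blast
  from arg_cong[OF this, of uh.conj_by] show "uh.conj_by T * Y = Y * uh.conj_by T"
    by (simp add: uh.conj_by_simps X)
qed

text \<open>
  Both sides extend the symmetry from the half-chain \<open>C\<^sup>*\<close>-algebra to its weak closure; instead of normality, the proof uses that
  automorphisms of \<open>\<B>(\<K>)\<close> are spatial and that the half-chain algebra acts irreducibly.
\<close>

lemma W_conj: "T \<in> M \<Longrightarrow> \<Phi> (uh.conj_by T) = W.conj_by (\<Phi> T)"
proof -
  assume T: "T \<in> M"
  define \<rho> where "\<rho> x = \<Phi> (uh.conj_by (\<Psi> (Wi.conj_by x)))" for x
  note \<rho>s = \<rho>_def Wi.conj_by_simps uh.conj_by_simps \<Psi>_simps \<Phi>_hom uh_conj_M \<Psi>_M \<Phi>_one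
  have "star_hom \<rho>" by (simp add: star_hom_def \<rho>s)
  moreover have "inj \<rho>"
  proof (rule injI)
    fix x y assume "\<rho> x = \<rho> y"
    then have "uh.conj_by (\<Psi> (Wi.conj_by x)) = uh.conj_by (\<Psi> (Wi.conj_by y))"
      unfolding \<rho>_def by (rule \<Phi>_inj[OF uh_conj_M[OF \<Psi>_M] uh_conj_M[OF \<Psi>_M]])
    then show "x = y" by (simp add: uh.conj_by_inj \<Psi>_inj Wi.conj_by_inj)
  qed
  moreover have "\<exists>c. x = c *\<^sub>C 1"
    if x: "\<And>y. y \<in> (\<lambda>A. W.conj_by (\<Phi> (\<pi> A))) ` right_algebra d a \<Longrightarrow> x * y = y * x" for x
  proof -
    have "\<Psi> (Wi.conj_by x) * \<pi> A = \<pi> A * \<Psi> (Wi.conj_by x)" if A: "A \<in> right_algebra d a" for A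
    proof -
      have "x * W.conj_by (\<Phi> (\<pi> A)) = W.conj_by (\<Phi> (\<pi> A)) * x" by (rule x) (use A in blast)
      from arg_cong[OF this, of Wi.conj_by]
      have "Wi.conj_by x * \<Phi> (\<pi> A) = \<Phi> (\<pi> A) * Wi.conj_by x" by (simp add: Wi.conj_by_simps W_Wi_conj)
      from arg_cong[OF this, of \<Psi>] show ?thesis by (simp add: \<Psi>_simps \<Psi>_\<Phi> rep_right_M[OF A])
    qed
    then have c: "\<Psi> (Wi.conj_by x) \<in> M'" by (simp add: M'_eq comm_def)
    have "\<Psi> (Wi.conj_by x * y) = \<Psi> (y * Wi.conj_by x)" for y
      using M_M'_commute[OF \<Psi>_M c, of y] by (simp add: \<Psi>_simps)
    then have "\<exists>c. Wi.conj_by x = c *\<^sub>C 1" by (intro commutes_with_rank1_scalar) (simp add: \<Psi>_inj)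
    then obtain c where "Wi.conj_by x = c *\<^sub>C 1" by blast
    from arg_cong[OF this, of W.conj_by] have "x = cj t c *\<^sub>C 1" by (simp add: W_Wi_conj W.conj_by_simps)
    then show ?thesis by blast
  qed
  moreover have "\<rho> y = y" if "y \<in> (\<lambda>A. W.conj_by (\<Phi> (\<pi> A))) ` right_algebra d a" for y
  proof -
    obtain A where A: "A \<in> right_algebra d a" "y = W.conj_by (\<Phi> (\<pi> A))" using \<open>y \<in> _\<close> by blast
    have "\<rho> y = \<Phi> (\<pi> (\<alpha> A))" by (simp add: \<rho>_def A(2) W_Wi_conj \<Psi>_\<Phi> rep_right_M[OF A(1)] uh_conj_rep)
    then show ?thesis by (simp add: A(2) W_rep[OF A(1)])
  qed
  ultimately have "\<rho> x = x" for x by (rule star_automorphism_trivial)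
  from this[of "W.conj_by (\<Phi> T)"] show ?thesis by (simp add: \<rho>_def W_Wi_conj \<Psi>_\<Phi> T)
qed

lemma \<Psi>_W: "\<Psi> (W.conj_by x) = uh.conj_by (\<Psi> x)"
  by (rule \<Psi>_eqI) (simp_all add: uh_conj_M \<Psi>_M W_conj \<Phi>_\<Psi>)

text \<open>Unlike for the parity, both inequalities are proved, since \<open>uh\<close> need not be
  an involution: conjugation by \<open>uh\<close> maps \<open>M'\<close> onto itself, and
  \<open>\<Omega>\<close> is fixed.\<close>

lemma uh_conj_p: "uh.conj_by p = p"
proof -
  let ?q = "uh.conj_by p"
  have "?q * p = p"
  proof (rule bop_eqI)
    fix x
    have "ap p x \<in> {v. ap ?q v = v}"
    proof (rule S_induct[OF p_in_S])
      show "closed {v. ap ?q v = v}" by (intro closed_Collect_eq continuous_on_ap continuous_intros)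
      fix Y assume "Y \<in> M'"
      then obtain X where X: "X \<in> M'" "uh.conj_by X = Y" using M'_uh by blast
      have "ap Y \<Omega> = uh (ap X \<Omega>)" using uh.ap_conj_by_V[of X \<Omega>] by (simp add: X uh_\<Omega>)
      moreover have "ap p (ap X \<Omega>) = ap X \<Omega>" using p(3) S_ap[OF X(1)] by blast
      ultimately show "ap Y \<Omega> \<in> {v. ap ?q v = v}" by (simp add: uh.ap_conj_by_V)
    qed
    then show "ap (?q * p) x = ap p x" by (simp add: ap_mult)
  qed
  from arg_cong[OF this, of adj] have "p * ?q = p" by (simp add: p flip: uh.conj_by_simps)
  moreover have "p * ?q = ?q"
  proof (rule bop_eqI)
    fix x
    have "ap p (inv_into UNIV uh x) \<in> {v. ap p (uh v) = uh v}"
    proof (rule S_induct[OF p_in_S])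
      show "closed {v. ap p (uh v) = uh v}" by (intro closed_Collect_eq continuous_on_ap uh.continuous_on_map)
      fix X assume X: "X \<in> M'"
      have "uh (ap X \<Omega>) = ap (uh.conj_by X) \<Omega>" using uh.ap_conj_by_V[of X \<Omega>] by (simp add: uh_\<Omega>)
      then show "ap X \<Omega> \<in> {v. ap p (uh v) = uh v}" using p(3) S_ap[OF uh_conj_M'[OF X]] by simp
    qed
    then show "ap (p * ?q) x = ap ?q x" by (simp add: ap_mult uh.ap_conj_by)
  qed
  ultimately show ?thesis by simp
qed

lemma W_conj_P: "W.conj_by P = P"
  using W_conj[OF p_M] by (simp add: P_def uh_conj_p)

lemma W_P: "W (ap P x) = ap P (W x)"
  using W.ap_conj_by_V[of P x] by (simp add: W_conj_P)

lemma psi_W: "psi (W.conj_by x) = cj t (psi x)"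
  using uh.cinner[of \<Omega> "ap (\<Psi> x) \<Omega>"] uh.ap_conj_by_V[of "\<Psi> x" \<Omega>] by (simp add: psi_def \<Psi>_W uh_\<Omega>)

lemma \<alpha>_\<sigma>: "A \<in> Loc X \<Longrightarrow> \<alpha> (\<sigma> N A) = \<sigma> N (\<alpha> A)"
  unfolding Loc_def
proof (induction rule: star_subalgebra.induct)
  case (gen x)
  then obtain f where f: "x = a f" "f \<in> ops d X" by blast
  have "onsite U (shift (int N) f) = shift (int N) (onsite U f)" by (simp add: onsite_def shift_def)
  then show ?case by (simp add: f(1) \<sigma>_a[OF f(2)] \<alpha>_a[OF f(2)] \<sigma>_a[OF onsite_ops[OF f(2)]] \<alpha>_a[OF ops_shift[OF f(2)]])
qed (simp_all add: \<alpha>_simps \<sigma>_simps)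

text \<open>True on vectors from \<open>Loc UNIV\<close>, then extended by continuity of
  \<open>\<pi>\<close> to the whole algebra and by cyclicity to the whole space.\<close>

lemma uh_V: "uh (V N x) = V N (uh x)"
proof -
  have cont: "continuous_on UNIV (\<lambda>x. uh (V N x))" "continuous_on UNIV (\<lambda>x. V N (uh x))"
    by (rule continuous_on_compose2[OF uh.continuous_on_map V.continuous_on_map subset_UNIV]
        continuous_on_compose2[OF V.continuous_on_map uh.continuous_on_map subset_UNIV])+
  have cl: "closed {x. uh (V N x) = V N (uh x)}" by (intro closed_Collect_eq cont)
  have "closed ((\<lambda>A. ap (\<pi> A) \<Omega>) -` {x. uh (V N x) = V N (uh x)})"
    by (intro closed_vimage cl bounded_linear.continuous_on[OF bounded_linear_rep] continuous_intros)
  moreover have "Loc UNIV \<subseteq> (\<lambda>A. ap (\<pi> A) \<Omega>) -` {x. uh (V N x) = V N (uh x)}"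
    by (auto simp: V(2) uh(2) \<alpha>_\<sigma>)
  ultimately have "closure (Loc UNIV) \<subseteq> (\<lambda>A. ap (\<pi> A) \<Omega>) -` {x. uh (V N x) = V N (uh x)}"
    by (intro closure_minimal)
  then have "range (\<lambda>A. ap (\<pi> A) \<Omega>) \<subseteq> {x. uh (V N x) = V N (uh x)}" using total by (auto simp: Loc_def)
  from closure_minimal[OF this cl] show ?thesis using cyclic by auto
qed

lemma \<gamma>_W: "\<gamma> N (W.conj_by x) = W.conj_by (\<gamma> N x)"
proof -
  have inv: "inv_into UNIV (V N) (inv_into UNIV uh x) = inv_into UNIV uh (inv_into UNIV (V N) x)" for x
    by (metis uh_V V.inv_left V.inv_right uh.inv_left uh.inv_right)
  have "V.conj_by N (uh.conj_by T) = uh.conj_by (V.conj_by N T)" for T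
    by (rule bop_eqI) (simp add: V.ap_conj_by uh.ap_conj_by uh_V inv)
  then show ?thesis by (simp add: \<gamma>_def \<Psi>_W W_conj conj_M \<Psi>_M)
qed

lemma EK_W:
  assumes \<nu>: "\<nu> \<in> sets 1"
  shows "W.conj_by (EK 1 \<nu> {}) = (\<Sum>\<mu>\<in>sets 1. U_coeff \<mu> \<nu> *\<^sub>C EK 1 \<mu> {})"
proof -
  have "W.conj_by (EK 1 \<nu> {}) = \<Phi> (\<pi> (\<alpha> (modes.unit d \<nu> {})))"
    using W_conj[OF E_M[OF \<nu> em]] by (simp add: EK_def E_def uh_conj_rep)
  also have "\<dots> = \<Phi> (\<Sum>\<mu>\<in>sets 1. U_coeff \<mu> \<nu> *\<^sub>C E 1 \<mu> {})"
    using \<nu> by (simp add: \<alpha>_unit rep_sum rep_simps E_def)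
  also have "\<dots> = (\<Sum>\<mu>\<in>sets 1. U_coeff \<mu> \<nu> *\<^sub>C EK 1 \<mu> {})"
    by (subst \<Phi>_sum) (auto simp: EK_def \<Phi>_hom E_M M_closed)
  finally show ?thesis .
qed

lemma EK_W_vac: "W.conj_by (EK 1 {} {}) = EK 1 {} {}"
proof -
  have "\<alpha> (modes.unit d {} {}) = modes.unit d {} {}" by (simp add: modes.unit_def \<alpha>_vac)
  then show ?thesis using W_conj[OF E_M[OF em em]] by (simp add: EK_def E_def uh_conj_rep)
qed

text \<open>Conjugation by \<open>W\<close> fixes \<open>EK 1 {} {}\<close> and commutes with
  \<open>\<gamma> 1\<close>, so both isometries send rank-one operators to the same rank-one
  operators; this determines an isometry up to a phase.\<close>

lemma B0_W: "\<exists>c. cmod c = 1 \<and> W.conj_by B0 = c *\<^sub>C B0"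
proof -
  let ?C = "W.conj_by B0"
  have C: "ap ?C x = W (ap B0 (inv_into UNIV W x))" for x by (rule W.ap_conj_by)
  have "rank1 (ap ?C x) (ap ?C y) = rank1 (ap B0 x) (ap B0 y)" for x y
  proof -
    let ?x = "inv_into UNIV W x" and ?y = "inv_into UNIV W y"
    have "rank1 (ap ?C x) (ap ?C y) = W.conj_by (EK 1 {} {} * \<gamma> 1 (rank1 ?x ?y))"
      by (simp only: C W.conj_by_simps(6)[symmetric] B0(3))
    also have "\<dots> = EK 1 {} {} * \<gamma> 1 (W.conj_by (rank1 ?x ?y))" by (simp only: W.conj_by_simps(2) EK_W_vac \<gamma>_W)
    also have "\<dots> = rank1 (ap B0 x) (ap B0 y)" by (simp only: W.conj_by_simps(6) W.inv_right B0(3))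
    finally show ?thesis .
  qed
  note eq = this
  have iso: "cinner (ap B0 x) (ap B0 y) = cinner x y" for x y
    using cinner_adj[of B0 x "ap B0 y"] by (simp add: B0(1) flip: ap_mult)
  have C1: "adj ?C * ?C = 1" using arg_cong[OF B0(1), of W.conj_by] by (simp add: W.conj_by_simps)
  have iso': "cinner (ap ?C x) (ap ?C y) = cinner x y" for x y
    using cinner_adj[of ?C x "ap ?C y"] by (simp add: C1 flip: ap_mult)
  let ?\<xi> = "\<xi> 0"
  have \<xi>0: "cinner ?\<xi> ?\<xi> = 1" using cinner_\<xi>[of 0 0] m1 by simp
  define c where "c = cinner (ap B0 ?\<xi>) (ap ?C ?\<xi>)"
  have Cc: "ap ?C x = c *\<^sub>C ap B0 x" for x
    using arg_cong[OF eq[of x ?\<xi>], of "\<lambda>T. ap T (ap ?C ?\<xi>)"] by (simp add: ap_rank1 iso' \<xi>0 c_def)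
  have "c * cnj c = 1" using iso'[of ?\<xi> ?\<xi>] by (simp add: Cc cinner_scaleC_left cinner_scaleC_right iso \<xi>0)
  then have "(cmod c)\<^sup>2 = 1" by (metis complex_norm_square of_real_eq_1_iff)
  then have "cmod c = 1" using norm_ge_zero[of c] by (auto simp: power2_eq_1_iff)
  moreover have "?C = c *\<^sub>C B0" by (rule bop_eqI) (simp add: Cc ap_scaleC)
  ultimately show ?thesis by blast
qed

lemma B_W:
  "\<exists>c. cmod c = 1 \<and> (\<forall>\<nu>\<in>sets 1. (\<Sum>\<mu>\<in>sets 1. U_coeff \<mu> \<nu> *\<^sub>C Bop' \<mu>) = c *\<^sub>C W.conj_by (Bop' \<nu>))"
proof -
  obtain c where c: "cmod c = 1" "W.conj_by B0 = c *\<^sub>C B0" using B0_W by blast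
  have cc: "cnj c * c = 1" using c(1) complex_norm_square[of c] by (simp add: mult.commute[of "cnj c"])
  \<comment> \<open>The sum is the side to be solved for, hence the inverse \<open>cnj c\<close> of
    the phase of \<open>B0\<close>.\<close>
  have "(\<Sum>\<mu>\<in>sets 1. U_coeff \<mu> \<nu> *\<^sub>C Bop' \<mu>) = cnj c *\<^sub>C W.conj_by (Bop' \<nu>)" if \<nu>: "\<nu> \<in> sets 1" for \<nu>
  proof -
    have "W.conj_by (Bop' \<nu>) = c *\<^sub>C (\<Sum>\<mu>\<in>sets 1. U_coeff \<mu> \<nu> *\<^sub>C Bop' \<mu>)"
      unfolding Bop'_def W.conj_by_simps(2) c(2) EK_W[OF \<nu>] by (simp add: sum_distrib_right)
    then show ?thesis by (simp only: scaleC_scaleC cc scaleC_one)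
  qed
  moreover have "cmod (cnj c) = 1" using c(1) by simp
  ultimately show ?thesis by blast
qed

end

context mps
begin

text \<open>Coordinates on the range of \<open>P\<close> with respect to \<open>\<xi>\<close>.\<close>

definition lift :: "complex Matrix.vec \<Rightarrow> 'l"
  where "lift x = (\<Sum>i<m. vec_index x i *\<^sub>C \<xi> i)"

definition co :: "'l \<Rightarrow> complex Matrix.vec"
  where "co y = Matrix.vec m (\<lambda>i. cinner (\<xi> i) y)"

definition wm :: "('l \<Rightarrow> 'l) \<Rightarrow> complex Matrix.vec \<Rightarrow> complex Matrix.vec"
  where "wm R x = co (R (lift x))"

lemma co_carrier [simp]: "co y \<in> carrier_vec m" "dim_vec (co y) = m"
  by (simp_all add: co_def)

lemma lift_co: "lift (co y) = ap P y"
  by (simp add: lift_def co_def P_sum ap_bop_sum ap_rank1)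

lemma P_lift: "ap P (lift x) = lift x"
  by (simp add: lift_def ap_sum ap_linear P_\<xi>)

lemma co_lift: "x \<in> carrier_vec m \<Longrightarrow> co (lift x) = x"
  by (rule eq_vecI) (auto simp: co_def lift_def cinner_sum_right cinner_scaleC_right cinner_\<xi> if_distrib cong: if_cong)

lemma co_P: "co (ap P y) = co y"
proof -
  have "cinner (\<xi> i) (ap P y) = cinner (\<xi> i) y" if "i < m" for i
    using cinner_adj[of P "\<xi> i" y] that by (simp add: P_\<xi> P)
  then show ?thesis by (intro eq_vecI) (auto simp: co_def)
qed

lemma lift_add: "x \<in> carrier_vec m \<Longrightarrow> y \<in> carrier_vec m \<Longrightarrow> lift (x + y) = lift x + lift y"
  by (simp add: lift_def scaleC_add_left sum.distrib)

lemma lift_scale: "x \<in> carrier_vec m \<Longrightarrow> lift (c \<cdot>\<^sub>v x) = c *\<^sub>C lift x"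
  by (simp add: lift_def scaleC_sum_right scaleC_scaleC)

lemma co_add: "co (x + y) = co x + co y"
  by (rule eq_vecI) (auto simp: co_def cinner_add_right)

lemma co_scale: "co (c *\<^sub>C x) = c \<cdot>\<^sub>v co x"
  by (rule eq_vecI) (auto simp: co_def cinner_scaleC_right)

lemma cinner_lift: "x \<in> carrier_vec m \<Longrightarrow> cinner y (lift x) = x \<bullet>c co y"
  by (simp add: lift_def co_def cinner_sum_right cinner_scaleC_right scalar_prod_def lessThan_atLeast0
      flip: cinner_commute)

lemma lift_unit: "j < m \<Longrightarrow> lift (unit_vec m j) = \<xi> j"
proof -
  assume j: "j < m"
  have "lift (unit_vec m j) = (\<Sum>i<m. if i = j then \<xi> i else 0)"
    unfolding lift_def by (rule sum.cong) (auto simp: unit_vec_def)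
  then show ?thesis using j by simp
qed

lemma mt_co: "mt T *\<^sub>v co y = co (ap T (ap P y))"
proof (rule eq_vecI)
  fix i assume "i < dim_vec (co (ap T (ap P y)))"
  then have i: "i < m" by simp
  have "ap T (ap P y) = (\<Sum>j<m. cinner (\<xi> j) y *\<^sub>C ap T (\<xi> j))"
    by (simp add: P_sum ap_bop_sum ap_rank1 ap_sum ap_linear)
  then show "vec_index (mt T *\<^sub>v co y) i = vec_index (co (ap T (ap P y))) i"
    using i by (simp add: co_def scalar_prod_def mt_index cinner_sum_right cinner_scaleC_right lessThan_atLeast0 mult.commute)
qed simp

text \<open>Because \<open>R\<close> commutes with \<open>P\<close>, \<open>lift\<close> intertwines
  \<open>wm R\<close> with \<open>R\<close>, and the inverse of \<open>wm R\<close> on the carrier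
  comes from the inverse of \<open>R\<close>.\<close>

lemma
  assumes R: "semiunitary t R" and RP: "\<And>x. R (ap P x) = ap P (R x)"
  shows wm_semiunitary: "semiunitary_on (carrier_vec m) (\<cdot>\<^sub>v) (\<lambda>x y. y \<bullet>c x) t (wm R)"
    and wm_compose: "wm R' (wm R x) = co (R' (R (lift x)))"
    and semi_adjoint_wm: "x \<in> carrier_vec m \<Longrightarrow> semi_adjoint m (wm R) x = wm (inv_into UNIV R) x"
    and Ad_semi_wm: "Ad_semi m (wm R) (mt T) = mt (semiunitary_map.conj_by R T)"
proof -
  interpret R: semiunitary_map t R by standard (rule R)
  have lw: "lift (wm R x) = R (lift x)" for x by (simp add: wm_def lift_co P_lift flip: RP)
  have RP': "inv_into UNIV R (ap P x) = ap P (inv_into UNIV R x)" for x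
    using RP[of "inv_into UNIV R x"] by (metis R.inv_left R.inv_right)
  have lwi: "lift (wm (inv_into UNIV R) x) = inv_into UNIV R (lift x)" for x
    by (simp add: wm_def lift_co P_lift flip: RP')
  have wwi: "wm R (wm (inv_into UNIV R) x) = x" if "x \<in> carrier_vec m" for x
    unfolding wm_def[of R] lwi using that by (simp add: R.inv_right co_lift)
  have wiw: "wm (inv_into UNIV R) (wm R x) = x" if "x \<in> carrier_vec m" for x
    unfolding wm_def[of "inv_into UNIV R"] lw using that by (simp add: R.inv_left co_lift)
  have wc: "wm Y x \<in> carrier_vec m" for Y x by (simp add: wm_def)
  show su: "semiunitary_on (carrier_vec m) (\<cdot>\<^sub>v) (\<lambda>x y. y \<bullet>c x) t (wm R)"
    unfolding semiunitary_on_def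
  proof (intro conjI ballI allI)
    show "wm R ` carrier_vec m = carrier_vec m"
    proof
      show "carrier_vec m \<subseteq> wm R ` carrier_vec m"
      proof
        fix x :: "complex Matrix.vec" assume "x \<in> carrier_vec m"
        then show "x \<in> wm R ` carrier_vec m" by (intro rev_image_eqI[OF wc]) (rule wwi[symmetric])
      qed
    qed (auto simp: wc)
    fix x y :: "complex Matrix.vec" assume x: "x \<in> carrier_vec m" and y: "y \<in> carrier_vec m"
    show "wm R (x + y) = wm R x + wm R y" using x y by (simp add: wm_def lift_add R.add co_add)
    have "wm R y \<bullet>c wm R x = cinner (lift (wm R x)) (lift (wm R y))"
      by (simp add: cinner_lift[OF wc] co_lift[OF wc])
    also have "\<dots> = cj t (y \<bullet>c x)" unfolding lw by (simp add: R.cinner cinner_lift[OF y] co_lift[OF x])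
    finally show "wm R y \<bullet>c wm R x = cj t (y \<bullet>c x)" .
  next
    fix c and x :: "complex Matrix.vec" assume x: "x \<in> carrier_vec m"
    show "wm R (c \<cdot>\<^sub>v x) = cj t c \<cdot>\<^sub>v wm R x" using x by (simp add: wm_def lift_scale R.scaleC co_scale)
  qed
  show "wm R' (wm R x) = co (R' (R (lift x)))" by (simp add: wm_def[of R'] lw)
  show sa: "semi_adjoint m (wm R) x = wm (inv_into UNIV R) x" if x: "x \<in> carrier_vec m" for x
  proof -
    have "inj_on (wm R) (carrier_vec m)" by (rule inj_on_inverseI[where g = "wm (inv_into UNIV R)"]) (rule wiw)
    then show ?thesis unfolding semi_adjoint_def by (rule inv_into_f_eq) (simp_all add: wc wwi x)
  qed
  show "Ad_semi m (wm R) (mt T) = mt (R.conj_by T)"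
  proof (rule eq_matI)
    fix i j assume "i < dim_row (mt (R.conj_by T))" "j < dim_col (mt (R.conj_by T))"
    then have ij: "i < m" "j < m" by simp_all
    have "wm R (mt T *\<^sub>v wm (inv_into UNIV R) (unit_vec m j)) = wm R (co (ap T (inv_into UNIV R (\<xi> j))))"
      by (simp add: wm_def[of "inv_into UNIV R"] mt_co lift_unit ij RP'[symmetric] P_\<xi>)
    also have "\<dots> = co (R (ap T (inv_into UNIV R (\<xi> j))))" by (simp add: wm_def lift_co RP co_P)
    finally show "Ad_semi m (wm R) (mt T) $$ (i, j) = mt (R.conj_by T) $$ (i, j)"
      using ij by (simp add: Ad_semi_def sa mt_index R.ap_conj_by co_def)
  qed (simp_all add: Ad_semi_def)
qed

text \<open>\<open>semi_adjoint\<close> of a map and the \<open>wm\<close> of the inverse operator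
  are only compared on vectors of length \<open>m\<close>; conjugation sees no more than
  that.\<close>

lemma Ad_semi_cong:
  assumes eq: "\<And>x. x \<in> carrier_vec m \<Longrightarrow> W1 x = W2 x" and W1: "W1 ` carrier_vec m = carrier_vec m"
    and T: "T \<in> carrier_mat m m"
  shows "Ad_semi m W1 T = Ad_semi m W2 T"
proof -
  have W2: "W2 ` carrier_vec m = carrier_vec m" using W1 eq by (metis (no_types, lifting) image_cong)
  have sa: "semi_adjoint m W1 = semi_adjoint m W2"
    unfolding semi_adjoint_def inv_into_def by (rule ext, rule arg_cong[of _ _ Eps]) (use eq in auto)
  have "semi_adjoint m W2 y \<in> carrier_vec m" if "y \<in> carrier_vec m" for y
    unfolding semi_adjoint_def using that W2 by (intro inv_into_into) simp
  then show ?thesis unfolding Ad_semi_def sa using T by (auto intro!: cong_mat simp: eq)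
qed

end

context symmetric_mps
begin

text \<open>Entries of the density matrix are expectations of rank-one operators, which
  \<open>W\<close> permutes; \<open>cj t\<close> enters twice, from the inner product and from the
  state, and cancels.\<close>

lemma wm_D: "Ad_semi m (semi_adjoint m (wm W)) (mt Dop) = mt Dop"
proof -
  have WiP: "inv_into UNIV W (ap P x) = ap P (inv_into UNIV W x)" for x
    using W_P[of "inv_into UNIV W x"] by (metis W.inv_left W.inv_right)
  have i: "inv_into UNIV (inv_into UNIV W) = W" using W.surj W.inj by (simp add: inv_inv_eq bij_def)
  have "Ad_semi m (wm (inv_into UNIV W)) (mt Dop) = Ad_semi m (semi_adjoint m (wm W)) (mt Dop)"
    using wm_semiunitary[OF Wi.semiunitary WiP]
    by (intro Ad_semi_cong) (simp_all add: semi_adjoint_wm[OF W W_P] semiunitary_on_def)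
  moreover have "Ad_semi m (wm (inv_into UNIV W)) (mt Dop) = mt (Wi.conj_by Dop)"
    by (rule Ad_semi_wm[OF Wi.semiunitary WiP])
  moreover have "mt (Wi.conj_by Dop) = mt Dop"
  proof (rule eq_matI)
    fix k j assume "k < dim_row (mt Dop)" "j < dim_col (mt Dop)"
    then have ij: "k < m" "j < m" by simp_all
    have "mt (Wi.conj_by Dop) $$ (k, j) = cinner (inv_into UNIV W (W (\<xi> k))) (inv_into UNIV W (ap Dop (W (\<xi> j))))"
      using ij by (simp add: mt_index Wi.ap_conj_by i W.inv_left)
    also have "\<dots> = cj t (cinner (W (\<xi> k)) (ap Dop (W (\<xi> j))))" by (rule Wi.cinner)
    also have "\<dots> = cj t (psi (rank1 (W (\<xi> j)) (W (\<xi> k))))"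
      by (subst cinner_Dop) (simp_all add: W_P[symmetric] P_\<xi> ij)
    also have "\<dots> = psi (rank1 (\<xi> j) (\<xi> k))" by (simp add: psi_W flip: W.conj_by_simps(6))
    also have "\<dots> = mt Dop $$ (k, j)" by (simp add: mt_index ij cinner_Dop P_\<xi>)
    finally show "mt (Wi.conj_by Dop) $$ (k, j) = mt Dop $$ (k, j)" .
  qed simp_all
  ultimately show ?thesis by simp
qed

lemma wm_\<Gamma>: "W.conj_by \<Gamma> = c *\<^sub>C \<Gamma> \<Longrightarrow> Ad_semi m (wm W) (mt \<Gamma>) = c \<cdot>\<^sub>m mt \<Gamma>"
  by (simp add: Ad_semi_wm[OF W W_P] mt_linear)

lemma wm_v:
  "\<exists>c. cmod c = 1 \<and> (\<forall>\<nu>\<in>Pow {..<d}.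
    mat_sum m (Pow {..<d}) (\<lambda>\<mu>. U_coeff \<mu> \<nu> \<cdot>\<^sub>m v \<mu>) = c \<cdot>\<^sub>m Ad_semi m (wm W) (v \<nu>))"
proof -
  obtain c where c: "cmod c = 1" "\<And>\<nu>. \<nu> \<in> sets 1 \<Longrightarrow> (\<Sum>\<mu>\<in>sets 1. U_coeff \<mu> \<nu> *\<^sub>C Bop' \<mu>) = c *\<^sub>C W.conj_by (Bop' \<nu>)"
    using B_W by blast
  have "mat_sum m (Pow {..<d}) (\<lambda>\<mu>. U_coeff \<mu> \<nu> \<cdot>\<^sub>m v \<mu>) = c \<cdot>\<^sub>m Ad_semi m (wm W) (v \<nu>)" if \<nu>: "\<nu> \<in> Pow {..<d}" for \<nu>
  proof -
    have "mat_sum m (Pow {..<d}) (\<lambda>\<mu>. U_coeff \<mu> \<nu> \<cdot>\<^sub>m v \<mu>) = mt (\<Sum>\<mu>\<in>sets 1. U_coeff \<mu> \<nu> *\<^sub>C Bop' \<mu>)"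
      by (simp add: mt_sum mt_linear v_def)
    also have "\<dots> = c \<cdot>\<^sub>m mt (W.conj_by (Bop' \<nu>))" by (subst c(2)) (use \<nu> in \<open>simp_all add: mt_linear\<close>)
    finally show ?thesis by (simp add: Ad_semi_wm[OF W W_P] v_def)
  qed
  with c(1) show ?thesis by blast
qed

end

section \<open>The rank condition\<close>

text \<open>The columns of \<open>X\<close> lie in the column space of \<open>Q\<close>, whose
  dimension is smaller than their number \<open>r\<close>.\<close>

lemma (in vec_space) kernel_of_wide_matrix:
  assumes Q: "Q \<in> carrier_mat n n" and X: "X \<in> carrier_mat n r" and QX: "Q * X = X" and r: "rank Q < r"
  obtains y where "y \<in> carrier_vec r" "y \<noteq> 0\<^sub>v r" "X *\<^sub>v y = 0\<^sub>v n"
proof (cases "distinct (cols X)")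
  case False
  \<comment> \<open>Linear dependence is a notion for the set of columns and does not notice
    repetitions; two equal columns give a kernel vector directly.\<close>
  then obtain i j where ij: "i < r" "j < r" "i \<noteq> j" "col X i = col X j"
    using X by (auto simp: distinct_conv_nth)
  have e: "(unit_vec r i - unit_vec r j :: 'a vec) \<in> carrier_vec r" by simp
  have col: "X *\<^sub>v unit_vec r l = col X l" if "l < r" for l
    by (rule eq_vecI) (use X that in simp_all)
  have "X *\<^sub>v (unit_vec r i - unit_vec r j) = X *\<^sub>v unit_vec r i - X *\<^sub>v unit_vec r j"
    by (rule mult_minus_distrib_mat_vec[OF X]) auto
  also have "\<dots> = 0\<^sub>v n" using X ij by (simp add: col)
  finally have "X *\<^sub>v (unit_vec r i - unit_vec r j) = 0\<^sub>v n" .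
  moreover have "vec_index (unit_vec r i - unit_vec r j :: 'a vec) i \<noteq> vec_index (0\<^sub>v r) i"
    using ij by simp
  then have "(unit_vec r i - unit_vec r j :: 'a vec) \<noteq> 0\<^sub>v r" by auto
  ultimately show thesis using e that by blast
next
  case True
  let ?C = "set (cols Q)" and ?U = "set (cols X)"
  have C: "?C \<subseteq> carrier_vec n" using cols_dim[of Q] Q by auto
  have U: "?U \<subseteq> span ?C"
  proof
    fix x assume "x \<in> ?U"
    then obtain i where i: "i < r" "x = col X i" using X by (auto simp: cols_def)
    have "x = Q *\<^sub>v x" using col_mult2[OF Q X i(1)] i(2) QX by simp
    moreover have "x \<in> carrier_vec n" using i X by auto
    ultimately have "x \<in> col_space Q" using col_space_eq[OF Q] Q by (simp, metis)
    then show "x \<in> span ?C" by (simp add: col_space_def)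
  qed
  have card: "card ?U = r" using True X by (simp add: distinct_card)
  have "\<not> lin_indpt ?U"
  proof
    assume "lin_indpt ?U"
    then have li: "LinearCombinations.module.lin_indpt class_ring (span_vs ?C) ?U"
      using span_li_not_depend(2)[OF U] C span_is_submodule by blast
    have vs: "vectorspace class_ring (span_vs ?C)" using span_is_subspace[OF C] subspace_is_vs by blast
    have "card ?U \<le> vectorspace.dim class_ring (span_vs ?C)"
      by (rule vectorspace.li_le_dim(2)[OF vs fin_dim_span_cols[OF Q] _ li]) (use U in simp)
    then show False using r card by (simp add: rank_def)
  qed
  then show thesis using lin_depE[OF X _ True] that by blast
qed

lemma bij_betw_set_decode: "bij_betw set_decode {..<2 ^ n} (Pow {..<n})"
proof -
  have inj: "inj_on set_decode {..<2 ^ n}" by (rule inj_on_inverseI[where g = set_encode]) simp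
  have sub: "set_decode ` {..<2 ^ n} \<subseteq> Pow {..<n}"
  proof safe
    fix x i :: nat assume x: "x < 2 ^ n" and i: "i \<in> set_decode x"
    show "i < n"
    proof (rule ccontr)
      assume "\<not> i < n"
      then have "(2 :: nat) ^ n \<le> 2 ^ i" by (intro power_increasing) auto
      then have "x div 2 ^ i = 0" by (intro div_less order_less_le_trans[OF x])
      then show False using i by (simp add: set_decode_def)
    qed
  qed
  have "card (set_decode ` {..<2 ^ n}) = card (Pow {..<n})" by (simp add: card_image[OF inj] card_Pow)
  then show ?thesis using card_subset_eq[OF _ sub] inj by (simp add: bij_betw_def)
qed

context half_chain
begin

text \<open>Coefficients \<open>b\<close> that vanish against the kernel of the local density lie,
  up to complex conjugation, in the range of its support projection; more than \<open>R\<close> such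
  columns are dependent.\<close>

lemma rank_hypI:
  assumes Q: "\<And>N. N \<ge> 1 \<Longrightarrow> is_support_proj (2 ^ (d * N)) (local_density d a \<omega> N) (Q N)"
    and R: "\<And>N. N \<ge> 1 \<Longrightarrow> vec_space.rank (2 ^ (d * N)) (Q N) \<le> R"
  shows "rank_hyp R"
  unfolding rank_hyp_def
proof (intro allI impI)
  fix N r and b :: "nat \<Rightarrow> nat set \<Rightarrow> complex"
  assume N: "N \<ge> 1" and r: "r > R"
    and hyp: "\<forall>c. (\<Sum>A\<in>sets N. \<Sum>B\<in>sets N. cnj (c A) * c B * \<omega> (modes.unit (d * N) B A)) = 0 \<longrightarrow>
        (\<forall>i<r. (\<Sum>A\<in>sets N. c A * b i A) = 0)"
  define n where "n = (2 :: nat) ^ (d * N)"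
  define \<rho> where "\<rho> = local_density d a \<omega> N"
  define Z where "Z = Q N"
  have Z: "Z \<in> carrier_mat n n" "mat_adjoint Z = Z" "Z * \<rho> = \<rho>"
    using Q[OF N] by (simp_all add: is_support_proj_def is_proj_mat_def n_def \<rho>_def Z_def)
  have \<rho>: "\<rho> \<in> carrier_mat n n" by (simp add: \<rho>_def local_density_def n_def)
  have \<rho>i: "\<rho> $$ (i, j) = \<omega> (modes.unit (d * N) (set_decode j) (set_decode i))" if "i < n" "j < n" for i j
    using that by (simp add: \<rho>_def local_density_def n_def fock_unit_eq)
  have \<rho>c: "cnj (\<rho> $$ (i, j)) = \<rho> $$ (j, i)" if "i < n" "j < n" for i j
    using that by (simp add: \<rho>i modes.star_unit flip: state_star)
  have Zc: "cnj (Z $$ (i, j)) = Z $$ (j, i)" if "i < n" "j < n" for i j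
    using mat_adjoint_index[OF Z(1), of j i] that Z(2) by simp
  have Z\<rho>: "(\<Sum>k<n. \<rho> $$ (i, k) * Z $$ (k, j)) = \<rho> $$ (i, j)" if ij: "i < n" "j < n" for i j
  proof -
    have "\<rho> $$ (j, i) = (\<Sum>k<n. Z $$ (j, k) * \<rho> $$ (k, i))"
      using ij Z(1) \<rho> by (subst Z(3)[symmetric]) (simp add: scalar_prod_def lessThan_atLeast0)
    from arg_cong[OF this, of cnj] show ?thesis
      using ij by (simp add: \<rho>c Zc mult.commute)
  qed
  have dec: "(\<Sum>A\<in>sets N. g A) = (\<Sum>i<n. g (set_decode i))" for g :: "nat set \<Rightarrow> complex"
    using sum.reindex_bij_betw[OF bij_betw_set_decode, of g "d * N"] by (simp add: n_def)
  have bZ: "b i (set_decode k) = (\<Sum>j<n. Z $$ (j, k) * b i (set_decode j))" if k: "k < n" and i: "i < r" for i k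
  proof -
    \<comment> \<open>The column \<open>k\<close> of \<open>1 - Z\<close>. It lies in the kernel of
      the density matrix with the conventions of \<open>hyp\<close>, so pairing it with
      \<open>b i\<close> gives 0.\<close>
    define c where "c A = (if set_encode A = k then 1 else 0) - Z $$ (set_encode A, k)" for A
    have \<rho>c0: "(\<Sum>j<n. c (set_decode j) * \<rho> $$ (l, j)) = 0" if "l < n" for l
    proof -
      have "(\<Sum>j<n. c (set_decode j) * \<rho> $$ (l, j)) =
          (\<Sum>j<n. if j = k then \<rho> $$ (l, j) else 0) - (\<Sum>j<n. \<rho> $$ (l, j) * Z $$ (j, k))"
        unfolding sum_subtractf[symmetric] by (rule sum.cong) (auto simp: c_def algebra_simps)
      then show ?thesis using that k by (simp add: Z\<rho>)
    qed
    have "(\<Sum>A\<in>sets N. \<Sum>B\<in>sets N. cnj (c A) * c B * \<omega> (modes.unit (d * N) B A)) =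
        (\<Sum>l<n. cnj (c (set_decode l)) * (\<Sum>j<n. c (set_decode j) * \<rho> $$ (l, j)))"
      unfolding dec sum_distrib_left by (intro sum.cong refl) (simp add: \<rho>i mult.assoc)
    also have "\<dots> = 0" by (simp add: \<rho>c0)
    finally have "(\<Sum>A\<in>sets N. c A * b i A) = 0" using spec[OF hyp, of c] i by simp
    moreover have "(\<Sum>A\<in>sets N. c A * b i A) =
        (\<Sum>j<n. if j = k then b i (set_decode j) else 0) - (\<Sum>j<n. Z $$ (j, k) * b i (set_decode j))"
      unfolding dec sum_subtractf[symmetric] by (rule sum.cong) (auto simp: c_def algebra_simps)
    ultimately show ?thesis using k by simp
  qed
  define X where "X = Matrix.mat n r (\<lambda>(k, i). cnj (b i (set_decode k)))"
  have X: "X \<in> carrier_mat n r" by (simp add: X_def)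
  have ZX: "Z * X = X"
  proof (rule eq_matI)
    fix k i assume "k < dim_row X" "i < dim_col X"
    then have ki: "k < n" "i < r" by (simp_all add: X_def)
    have "(Z * X) $$ (k, i) = (\<Sum>j<n. Z $$ (k, j) * cnj (b i (set_decode j)))"
      using ki Z(1) by (simp add: X_def scalar_prod_def lessThan_atLeast0)
    also have "\<dots> = cnj (\<Sum>j<n. Z $$ (j, k) * b i (set_decode j))" using ki by (simp add: Zc)
    finally show "(Z * X) $$ (k, i) = X $$ (k, i)" using bZ[OF ki] ki by (simp add: X_def)
  qed (use X Z(1) in auto)
  have rk: "vec_space.rank n Z < r" using R[OF N] r by (simp add: n_def Z_def)
  obtain y where y: "y \<in> carrier_vec r" "y \<noteq> 0\<^sub>v r" "X *\<^sub>v y = 0\<^sub>v n"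
    by (rule vec_space.kernel_of_wide_matrix[OF Z(1) X ZX rk])
  have "\<exists>i<r. vec_index y i \<noteq> 0"
  proof (rule ccontr)
    assume "\<not> ?thesis"
    then have "y = 0\<^sub>v r" using y(1) by (intro eq_vecI) auto
    with y(2) show False by simp
  qed
  moreover have "(\<Sum>i<r. cnj (vec_index y i) * b i A) = 0" if A: "A \<in> sets N" for A
  proof -
    obtain k where k: "k < n" "A = set_decode k"
      using A bij_betw_imp_surj_on[OF bij_betw_set_decode[of "d * N"]] unfolding n_def by (metis imageE lessThan_iff)
    have "(\<Sum>i<r. cnj (b i A) * vec_index y i) = 0"
      using arg_cong[OF y(3), of "\<lambda>x. vec_index x k"] k y(1) by (simp add: X_def scalar_prod_def lessThan_atLeast0)
    from arg_cong[OF this, of cnj] show ?thesis by (simp add: mult.commute)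
  qed
  ultimately show "\<exists>y. (\<exists>i<r. y i \<noteq> 0) \<and> (\<forall>A\<in>sets N. (\<Sum>i<r. cnj (y i) * b i A) = 0)"
    by (intro exI[of _ "vec_index y"] conjI ballI)
qed

end

section \<open>Uniqueness of automorphisms and their implementers\<close>

text \<open>Transfers the commutants of the statement, taken among functions, to the type of
  operators.\<close>

lemma commutant_ap: "commutant (ap ` X) = ap ` comm X"
proof (intro equalityI subsetI)
  fix T assume T: "T \<in> commutant (ap ` X)"
  then have "bounded_clinear T" by (simp add: commutant_def)
  then have 1: "T = ap (Bop T)" by (simp add: ap_Bop)
  have "Bop T * x = x * Bop T" if "x \<in> X" for x
  proof (rule bop_eqI)
    fix y
    have "T \<circ> ap x = ap x \<circ> T" using T \<open>x \<in> X\<close> by (auto simp: commutant_def)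
    from fun_cong[OF this, of y] show "ap (Bop T * x) y = ap (x * Bop T) y" by (simp add: ap_mult flip: 1)
  qed
  then show "T \<in> ap ` comm X" using 1 by (intro image_eqI[where x = "Bop T"]) (simp_all add: comm_def)
next
  fix T assume "T \<in> ap ` comm X"
  then obtain Y where Y: "T = ap Y" "\<forall>x\<in>X. Y * x = x * Y" by (auto simp: comm_def)
  have "ap Y \<circ> ap x = ap x \<circ> ap Y" if "x \<in> X" for x
    using Y(2) that by (auto simp: fun_eq_iff simp flip: ap_mult)
  then show "T \<in> commutant (ap ` X)" by (auto simp: commutant_def Y(1) bounded_clinear_ap)
qed

lemma semiunitary_funpow: "semiunitary 0 V \<Longrightarrow> semiunitary 0 (V ^^ N)"
proof (induction N)
  case 0
  then show ?case by (simp add: semiunitary_on_def)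
next
  case (Suc N)
  then interpret x: semiunitary_map 0 "V ^^ N" by unfold_locales simp
  interpret V: semiunitary_map 0 V by unfold_locales (rule Suc.prems)
  have "range (\<lambda>x. V ((V ^^ N) x)) = UNIV" using comp_surj[OF x.surj V.surj] by (simp add: o_def)
  then show ?case by (simp add: semiunitary_on_def x.add V.add x.cinner V.cinner x.scaleC V.scaleC)
qed

lemma (in gns) semiunitary_unique:
  assumes V: "semiunitary s V" and W: "semiunitary s' W" and eq: "\<And>A. V (ap (rep A) \<Omega>) = W (ap (rep A) \<Omega>)"
  shows "V = W"
proof -
  interpret V: semiunitary_map s V by standard (rule V)
  interpret W: semiunitary_map s' W by standard (rule W)
  have "range (\<lambda>A. ap (\<pi> A) \<Omega>) \<subseteq> {x. V x = W x}" using eq by auto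
  moreover have "closed {x. V x = W x}" by (intro closed_Collect_eq V.continuous_on_map W.continuous_on_map)
  ultimately have "closure (range (\<lambda>A. ap (\<pi> A) \<Omega>)) \<subseteq> {x. V x = W x}" by (rule closure_minimal)
  then show ?thesis by (auto simp: cyclic)
qed

lemma bogoliubov_one: "is_bogoliubov d a s w \<beta> \<Longrightarrow> \<beta> 1 = 1"
proof -
  assume \<beta>: "is_bogoliubov d a s w \<beta>"
  then have "surj \<beta>" by (simp add: is_bogoliubov_def bij_def)
  then obtain y where y: "\<beta> y = 1" by (metis surjD)
  have "\<beta> (1 * y) = \<beta> 1 * \<beta> y" using \<beta> by (simp only: is_bogoliubov_def)
  then show ?thesis by (simp add: y)
qed

text \<open>Local elements are generated by the \<open>a f\<close>. The lemma identifies
  \<open>\<tau> (int k)\<close> with the iterates of \<open>\<tau> 1\<close> on the matrix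
  units.\<close>

lemma (in car) bogoliubov_unique:
  assumes \<beta>: "is_bogoliubov d a s w \<beta>" "is_bogoliubov d a s w \<beta>'" and x: "x \<in> Loc X"
  shows "\<beta> x = \<beta>' x"
  using x unfolding Loc_def
proof (induction rule: star_subalgebra.induct)
  case (gen x)
  then show ?case using \<beta> ops_UNIV by (auto simp: is_bogoliubov_def)
qed (use \<beta> bogoliubov_one[OF \<beta>(1)] bogoliubov_one[OF \<beta>(2)] in \<open>simp_all add: is_bogoliubov_def\<close>)

lemma (in car) bogoliubov_shift_funpow:
  assumes \<beta>: "is_bogoliubov d a 0 (shift 1) \<beta>"
  shows "is_bogoliubov d a 0 (shift (int N)) (\<beta> ^^ N)"
proof (induction N)
  case 0
  show ?case using bij_id by (simp add: is_bogoliubov_def shift_def id_def)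
next
  case (Suc N)
  have "(\<beta> ^^ Suc N) (a f) = a (shift (int (Suc N)) f)" if f: "f \<in> ops d UNIV" for f
  proof -
    have "shift (int N) f \<in> ops d UNIV" using ops_shift[OF f, of "int N"] ops_UNIV by blast
    moreover have "shift 1 (shift (int N) f) = shift (int (Suc N)) f" by (simp add: shift_def diff_diff_eq add.commute)
    ultimately show ?thesis using Suc \<beta> f by (simp add: is_bogoliubov_def)
  qed
  moreover have "bij (\<lambda>x. \<beta> ((\<beta> ^^ N) x))"
    using bij_comp[of "\<beta> ^^ N" \<beta>] Suc \<beta> by (simp add: is_bogoliubov_def o_def)
  ultimately show ?case using Suc \<beta> by (simp add: is_bogoliubov_def)
qed

lemma (in mps) corr_eq_prod:
  "corr (map (\<lambda>k. (\<mu> k, \<nu> k)) [0..<n]) = prod_list (map (\<lambda>k. (\<sigma> 1 ^^ k) (modes.unit (d * 1) (\<mu> k) (\<nu> k))) [0..<n])"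
proof (induction n arbitrary: \<mu> \<nu>)
  case (Suc n)
  have up: "[0..<Suc n] = 0 # map Suc [0..<n]" by (simp add: upt_conv_Cons map_Suc_upt del: upt_Suc)
  have pl: "\<sigma> 1 (prod_list xs) = prod_list (map (\<sigma> 1) xs)" for xs
    by (induction xs) (simp_all add: \<sigma>_simps)
  show ?case unfolding up using Suc[of "\<lambda>k. \<mu> (Suc k)" "\<lambda>k. \<nu> (Suc k)"] by (simp add: o_def pl)
qed simp

lemma Gamma_K_apply: "Gamma_K z = (fst z, - snd z)"
  by (simp add: Gamma_K_def kron2_def pauli_z_def case_prod_unfold scaleC_minus_left)

lemma Gamma_K_bounded: "bounded_clinear Gamma_K"
proof (rule bounded_clinear_intro[where K = 1])
  fix x :: "'k::complex_hilbert \<times> 'k"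
  show "norm (Gamma_K x) \<le> norm x * 1" by (simp add: Gamma_K_apply norm_prod_def)
qed (simp_all add: Gamma_K_apply scaleC_prod_def scaleC_minus_right prod_eq_iff)

lemma Bop_Gamma_K: "adj (Bop Gamma_K) = Bop Gamma_K" "Bop Gamma_K * Bop Gamma_K = 1"
proof -
  show "adj (Bop Gamma_K) = Bop Gamma_K"
    by (rule adj_eqI) (simp add: ap_Bop Gamma_K_bounded Gamma_K_apply cinner_prod_def cinner_minus_left cinner_minus_right)
  show "Bop Gamma_K * Bop Gamma_K = 1"
    by (rule bop_eqI) (simp add: ap_mult ap_Bop Gamma_K_bounded Gamma_K_apply)
qed

theorem theorem6p3:
  fixes d :: nat
    and G :: "('g, 'b) monoid_scheme"
    and p q :: "'g \<Rightarrow> bit"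
    and a :: "one_particle \<Rightarrow> 'a::cstar_algebra"
    and u \<upsilon> :: "'g \<Rightarrow> 'g \<Rightarrow> complex"
    and U :: "'g \<Rightarrow> complex Matrix.vec \<Rightarrow> complex Matrix.vec"
    and \<alpha> :: "'g \<Rightarrow> 'a \<Rightarrow> 'a"
    and \<tau> :: "int \<Rightarrow> 'a \<Rightarrow> 'a"
    and \<Theta> :: "'a \<Rightarrow> 'a"
    and \<omega> :: "'a \<Rightarrow> complex"
    and Q :: "nat \<Rightarrow> complex mat"
  assumes "d \<ge> 1"
    and "group G" and "finite (carrier G)" and "Z2_hom G p"
    and "is_CAR_algebra d a"
    and "proj_rep_Cn d G p u U"
    and "\<And>g. g \<in> carrier G \<Longrightarrow> is_bogoliubov d a (p g) (onsite (U g)) (\<alpha> g)"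
    and "\<And>x. is_bogoliubov d a 0 (shift x) (\<tau> x)"
    and "is_bogoliubov d a 0 flip_sign \<Theta>"
    and "is_pure \<omega>"
    and "is_split TYPE('r::complex_hilbert) d a \<omega>"
    and "translation_invariant \<tau> \<omega>"
    and "symmetry_invariant G p \<alpha> \<omega>"
    and "Z2_hom G q" and "is_cocycle G p \<upsilon>"
    and "has_index TYPE('h::complex_hilbert) TYPE('k::complex_hilbert) d a G p \<Theta> \<alpha> \<omega>
           0 q (cohom_class G p \<upsilon>)"
    and "\<And>N. N \<ge> 1 \<Longrightarrow> is_support_proj (2 ^ (d * N)) (local_density d a \<omega> N) (Q N)"
    and "bdd_above ((\<lambda>N. vec_space.rank (2 ^ (d * N)) (Q N)) ` {1..})"
  shows "\<exists>m D \<theta> v.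
    m \<ge> 1 \<and> density_matrix m D \<and> faithful_matrix m D \<and> self_adjoint_unitary m \<theta> \<and>
    (\<forall>\<mu>\<in>Pow {..<d}. v \<mu> \<in> carrier_mat m m) \<and>
    (\<forall>x\<in>carrier_mat m m.
      (\<lambda>N. mat_opnorm ((transfer_map m d v ^^ N) x - mat_trace (D * x) \<cdot>\<^sub>m 1\<^sub>m m)) \<longlonglongrightarrow> 0) \<and>
    (\<exists>\<sigma>0\<in>{0, 1::nat}. \<forall>\<mu>\<in>Pow {..<d}. Ad_mat \<theta> (v \<mu>) = (- 1) ^ (par \<mu> + \<sigma>0) \<cdot>\<^sub>m v \<mu>) \<and>
    Ad_mat \<theta> D = D \<and>
    (\<forall>l \<mu> \<nu>. (\<forall>k\<le>l. \<mu> k \<in> Pow {..<d} \<and> \<nu> k \<in> Pow {..<d}) \<longrightarrow>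
      \<omega> (prod_list (map (\<lambda>k. site_unit d a \<tau> (int k) (\<mu> k) (\<nu> k)) [0..<Suc l])) =
      (- 1) ^ (\<Sum>k=1..l. (par (\<mu> k) + par (\<nu> k)) * (\<Sum>j<k. par (\<nu> j))) *
      mat_trace (D * mat_prod m (map (\<lambda>k. v (\<mu> k)) [0..<Suc l] @
                                 map (\<lambda>k. mat_adjoint (v (\<nu> k))) (rev [0..<Suc l])))) \<and>
    (\<exists>W w. proj_rep_Cn m G p w W \<and> cohom_class G p w = cohom_class G p \<upsilon> \<and>
      (\<forall>g\<in>carrier G.
        (\<exists>c. cmod c = 1 \<and> (\<forall>\<nu>\<in>Pow {..<d}.
          mat_sum m (Pow {..<d}) (\<lambda>\<mu>. fock_inner d (fock_basis \<mu>)
              (second_quant d (p g) (U g) (fock_basis \<nu>)) \<cdot>\<^sub>m v \<mu>) =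
          c \<cdot>\<^sub>m Ad_semi m (W g) (v \<nu>))) \<and>
        Ad_semi m (semi_adjoint m (W g)) D = D \<and>
        Ad_semi m (W g) \<theta> = sgn_of (q g) \<cdot>\<^sub>m \<theta>))"
  proof -
  note CAR = assms(5) and U = assms(6) and \<alpha> = assms(7) and \<tau> = assms(8) and \<Theta> = assms(9)
  interpret c: car_parity d a \<Theta> by standard (use assms(1) CAR \<Theta> in simp_all)
  obtain \<pi>0 \<Omega> \<Gamma>h \<alpha>h and Mf :: "('h \<Rightarrow> 'h) set" where gns: "is_GNS UNIV \<omega> \<pi>0 \<Omega>"
    and \<Gamma>h: "semiunitary 0 \<Gamma>h" "\<And>A. \<Gamma>h (\<pi>0 A \<Omega>) = \<pi>0 (\<Theta> A) \<Omega>"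
    and Mf: "Mf = commutant (commutant (\<pi>0 ` right_algebra d a))"
    and \<alpha>h: "\<And>g A. g \<in> carrier G \<Longrightarrow> A \<in> right_algebra d a \<Longrightarrow> \<alpha>h g (\<pi>0 A) = \<pi>0 (\<alpha> g A)"
    and ind: "has_Ind TYPE('k) G p Mf (Ad \<Gamma>h) \<alpha>h 0 q (cohom_class G p \<upsilon>)"
    using assms(16) unfolding has_index_def by metis
  obtain V \<upsilon>' \<Phi>f where S: "S_member G p 0 q V" and V: "proj_rep G p \<upsilon>' (V :: 'g \<Rightarrow> 'k \<times> 'k \<Rightarrow> 'k \<times> 'k)"
    and coh: "cohom_class G p \<upsilon> = cohom_class G p \<upsilon>'"
    and \<Phi>f: "star_iso 0 Mf (R_alg 0) \<Phi>f"
    and \<Phi>f_parity: "\<And>T. T \<in> Mf \<Longrightarrow> \<Phi>f (Ad \<Gamma>h T) = Ad Gamma_K (\<Phi>f T)"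
    and \<Phi>f_sym: "\<And>g T. g \<in> carrier G \<Longrightarrow> T \<in> Mf \<Longrightarrow> \<Phi>f (\<alpha>h g T) = Ad (V g) (\<Phi>f T)"
    using ind unfolding has_Ind_def S_cocycle_def by auto
  interpret g: gns \<omega> \<pi>0 \<Omega> by standard (rule gns)

  define \<Gamma> :: "('k \<times> 'k) bop" where "\<Gamma> = Bop Gamma_K"
  have ap_\<Gamma>: "ap \<Gamma> = Gamma_K" by (simp add: \<Gamma>_def ap_Bop Gamma_K_bounded)
  have \<Gamma>: "adj \<Gamma> = \<Gamma>" "\<Gamma> * \<Gamma> = 1" by (simp_all add: \<Gamma>_def Bop_Gamma_K)
  have Ad_Gamma_K: "Ad Gamma_K (ap T) = ap (\<Gamma> * T * \<Gamma>)" for T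
    using ap_adj[of \<Gamma>] by (simp add: Ad_def fun_eq_iff ap_mult ap_\<Gamma> \<Gamma>(1))

  define M where "M = comm (comm (g.rep ` right_algebra d a))"
  have rep: "\<pi>0 A = ap (g.rep A)" for A by (simp add: g.ap_rep)
  have Mf_eq: "Mf = ap ` M"
  proof -
    have "\<pi>0 ` right_algebra d a = ap ` (g.rep ` right_algebra d a)" by (simp add: image_image g.ap_rep)
    then show ?thesis by (simp add: Mf M_def commutant_ap)
  qed
  have inj_ap: "inj_on ap Y" for Y :: "'h bop set" by (rule inj_onI) (metis ap_inject)
  have rep_M: "g.rep A \<in> M" if "A \<in> right_algebra d a" for A
    using that by (auto simp: M_def comm_def)

  define \<Phi> where "\<Phi> T = Bop (\<Phi>f (ap T))" for T
  have bij: "bij_betw \<Phi>f Mf {T. bounded_clinear T}"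
    and hom: "\<And>X Y. X \<in> Mf \<Longrightarrow> Y \<in> Mf \<Longrightarrow> \<Phi>f (\<lambda>x. X x + Y x) = (\<lambda>x. \<Phi>f X x + \<Phi>f Y x)"
      "\<And>X Y. X \<in> Mf \<Longrightarrow> Y \<in> Mf \<Longrightarrow> \<Phi>f (X \<circ> Y) = \<Phi>f X \<circ> \<Phi>f Y"
      "\<And>c X. X \<in> Mf \<Longrightarrow> \<Phi>f (\<lambda>x. c *\<^sub>C X x) = (\<lambda>x. c *\<^sub>C \<Phi>f X x)"
      "\<And>X. X \<in> Mf \<Longrightarrow> \<Phi>f (adjoint X) = adjoint (\<Phi>f X)"
    using \<Phi>f by (simp_all add: star_iso_def R_alg_def)
  have ap_M: "ap T \<in> Mf" if "T \<in> M" for T using that by (simp add: Mf_eq)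
  have ap_\<Phi>: "ap (\<Phi> T) = \<Phi>f (ap T)" if "T \<in> M" for T
    unfolding \<Phi>_def using bij_betwE[OF bij] ap_M[OF that] by (simp add: ap_Bop)
  have M_cl: "X + Y \<in> M" "X * Y \<in> M" "c *\<^sub>C X \<in> M" if XY: "X \<in> M" "Y \<in> M" for X Y c
    using XY by (auto simp: M_def comm_def distrib_left distrib_right intro: comm_mult)

  have \<tau>1: "is_bogoliubov d a 0 (shift 1) (\<tau> 1)" by (rule \<tau>)
  \<comment> \<open>Iterates of \<open>\<tau> 1\<close>, not \<open>\<tau> (int N)\<close>, so that
    the implementing unitaries form a semigroup by construction.\<close>
  define \<sigma> where "\<sigma> N = \<tau> 1 ^^ N" for N
  have \<sigma>: "is_bogoliubov d a 0 (shift (int N)) (\<sigma> N)" for N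
    unfolding \<sigma>_def by (rule c.bogoliubov_shift_funpow[OF \<tau>1])
  have inv1: "\<omega> (\<tau> 1 A) = cj 0 (\<omega> A)" for A using assms(12) by (simp add: translation_invariant_def)
  have \<sigma>_inv: "\<omega> (\<sigma> N A) = \<omega> A" for N A by (induction N) (simp_all add: \<sigma>_def inv1)
  obtain S1 where S1: "semiunitary 0 S1" "\<And>A. S1 (ap (g.rep A) \<Omega>) = ap (g.rep (\<tau> 1 A)) \<Omega>"
    "\<And>A x. S1 (ap (g.rep A) x) = ap (g.rep (\<tau> 1 A)) (S1 x)"
    by (rule g.implementer[OF \<tau>1 inv1]) rule
  have S1\<Omega>: "S1 \<Omega> = \<Omega>" using S1(2)[of 1] bogoliubov_one[OF \<tau>1] by (simp add: g.rep_simps)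
  define Sh where "Sh N = S1 ^^ N" for N
  have Sh: "semiunitary 0 (Sh N)" "Sh N (ap (g.rep A) \<Omega>) = ap (g.rep (\<sigma> N A)) \<Omega>"
    "Sh N (ap (g.rep A) x) = ap (g.rep (\<sigma> N A)) (Sh N x)" for N A x
  proof -
    show "semiunitary 0 (Sh N)" unfolding Sh_def by (rule semiunitary_funpow[OF S1(1)])
    show "Sh N (ap (g.rep A) \<Omega>) = ap (g.rep (\<sigma> N A)) \<Omega>" "Sh N (ap (g.rep A) x) = ap (g.rep (\<sigma> N A)) (Sh N x)"
      by (induction N) (simp_all add: Sh_def \<sigma>_def S1 S1\<Omega>)
  qed
  have \<Gamma>h2: "\<Gamma>h (ap (g.rep A) \<Omega>) = ap (g.rep (\<Theta> A)) \<Omega>" for A by (simp add: g.ap_rep \<Gamma>h(2))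
  interpret \<Gamma>h: semiunitary_map 0 \<Gamma>h by standard (rule \<Gamma>h(1))
  \<comment> \<open>Parity invariance of the state is read off the parity unitary that belongs to
    the index.\<close>
  have "\<Gamma>h \<Omega> = \<Omega>" using \<Gamma>h2[of 1] by (simp add: c.\<Theta>_simps g.rep_simps)
  then have par_inv: "\<omega> (\<Theta> A) = cj 0 (\<omega> A)" for A
    using \<Gamma>h.cinner[of \<Omega> "ap (g.rep A) \<Omega>"] by (simp add: \<Gamma>h2 g.state_eq)
  have \<Gamma>h3: "\<Gamma>h (ap (g.rep A) x) = ap (g.rep (\<Theta> A)) (\<Gamma>h x)" for A x
  proof -
    obtain X where X: "semiunitary 0 X" "\<And>A. X (ap (g.rep A) \<Omega>) = ap (g.rep (\<Theta> A)) \<Omega>"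
      "\<And>A x. X (ap (g.rep A) x) = ap (g.rep (\<Theta> A)) (X x)"
      by (rule g.implementer[OF \<Theta> par_inv]) rule
    \<comment> \<open>\<open>\<Gamma>h\<close> is given only on cyclic vectors; by uniqueness it is
      the implementer, whose commutation with \<open>\<pi>\<close> holds on all vectors.\<close>
    have "\<Gamma>h = X" by (rule g.semiunitary_unique[OF \<Gamma>h(1) X(1)]) (simp add: \<Gamma>h2 X(2))
    then show ?thesis by (simp add: X(3))
  qed

  interpret hc: half_chain d a \<Theta> \<omega> \<pi>0 \<Omega> \<sigma> Sh \<Gamma>h \<Phi> \<Gamma> M
  proof
    show "is_pure \<omega>" by (rule assms(10))
    show "Sh N = Sh 1 ^^ N" for N by (simp add: Sh_def One_nat_def)
    show "bij_betw \<Phi> M UNIV"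
    proof -
      have "bij_betw Bop {T :: 'k \<times> 'k \<Rightarrow> 'k \<times> 'k. bounded_clinear T} UNIV"
        by (rule bij_betwI[where g = ap]) (auto simp: ap_Bop ap_inverse bounded_clinear_ap)
      then have "bij_betw (Bop \<circ> (\<Phi>f \<circ> ap)) M UNIV"
        using inj_ap by (intro bij_betw_trans[OF bij_betw_trans[OF _ bij]]) (simp_all add: bij_betw_def Mf_eq)
      then show ?thesis by (simp add: \<Phi>_def[abs_def] o_def)
    qed
    show "\<Phi> (X + Y) = \<Phi> X + \<Phi> Y" if "X \<in> M" "Y \<in> M" for X Y
    proof (rule bop_eqI)
      fix x
      have "ap (X + Y) = (\<lambda>x. ap X x + ap Y x)" by (simp add: fun_eq_iff ap_add)
      then show "ap (\<Phi> (X + Y)) x = ap (\<Phi> X + \<Phi> Y) x" using that by (simp add: ap_\<Phi> M_cl hom ap_M ap_add)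
    qed
    show "\<Phi> (X * Y) = \<Phi> X * \<Phi> Y" if "X \<in> M" "Y \<in> M" for X Y
    proof (rule bop_eqI)
      fix x
      have "ap (X * Y) = ap X \<circ> ap Y" by (simp add: fun_eq_iff ap_mult)
      then show "ap (\<Phi> (X * Y)) x = ap (\<Phi> X * \<Phi> Y) x" using that by (simp add: ap_\<Phi> M_cl hom ap_M ap_mult)
    qed
    show "\<Phi> (c *\<^sub>C X) = c *\<^sub>C \<Phi> X" if "X \<in> M" for c X
    proof (rule bop_eqI)
      fix x
      have "ap (c *\<^sub>C X) = (\<lambda>x. c *\<^sub>C ap X x)" by (simp add: fun_eq_iff ap_scaleC)
      then show "ap (\<Phi> (c *\<^sub>C X)) x = ap (c *\<^sub>C \<Phi> X) x" using that by (simp add: ap_\<Phi> M_cl hom ap_M ap_scaleC)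
    qed
    show "\<Phi> (adj X) = adj (\<Phi> X)" if "X \<in> M" for X
    proof -
      have "\<Phi> (adj X) = Bop (adjoint (ap (\<Phi> X)))"
        using that by (simp add: \<Phi>_def[of "adj X"] ap_adj hom ap_M ap_\<Phi>)
      then show ?thesis by (simp add: adj_def)
    qed
    show "\<Phi> (\<Gamma>h.conj_by T) = \<Gamma> * \<Phi> T * \<Gamma>" if T: "T \<in> M" for T
    proof -
      have "\<Phi> (\<Gamma>h.conj_by T) = Bop (Ad Gamma_K (ap (\<Phi> T)))"
        by (simp add: \<Phi>_def[of "\<Gamma>h.conj_by T"] \<Phi>f_parity ap_M T ap_\<Phi> flip: \<Gamma>h.Ad_eq)
      then show ?thesis by (simp add: Ad_Gamma_K ap_inverse)
    qed
  qed (use \<sigma> \<sigma>_inv par_inv Sh \<Gamma>h(1) \<Gamma>h2 \<Gamma>h3 \<Gamma> M_def in simp_all)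

  obtain R where R: "\<And>N. N \<ge> 1 \<Longrightarrow> vec_space.rank (2 ^ (d * N)) (Q N) \<le> R"
    using assms(18) by (auto simp: bdd_above_def)
  obtain m \<xi> where m: "m \<ge> 1" "hc.onb m \<xi>" "hc.P = (\<Sum>i<m. rank1 (\<xi> i) (\<xi> i))"
    by (rule hc.exists_onb[OF hc.rank_hypI[OF assms(17) R]]) simp_all
  have "cinner (\<xi> 0) (\<xi> 0) = 1" using m(1,2) by (simp add: hc.onb_def)
  then obtain B0 where B0: "adj B0 * B0 = 1" "\<And>x. hc.\<gamma> 1 x * B0 = B0 * x"
    "\<And>x y. rank1 (ap B0 x) (ap B0 y) = hc.EK 1 {} {} * hc.\<gamma> 1 (rank1 x y)" "hc.EK 1 {} {} * B0 = B0"
    by (rule hc.exists_B0) simp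
  obtain s where s: "s = 1 \<or> s = - 1" "hc.G0 1 * hc.\<gamma> 1 \<Gamma> = s *\<^sub>C \<Gamma>" using hc.exists_sign by blast
  interpret mp: mps d a \<Theta> \<omega> \<pi>0 \<Omega> \<sigma> Sh \<Gamma>h \<Phi> \<Gamma> M m \<xi> B0 s
    by unfold_locales (use m B0 s in simp_all)

  have V_semi: "semiunitary (p g) (V g)" if "g \<in> carrier G" for g using V that by (simp add: proj_rep_on_def)
  have sym: "\<exists>uh. symmetric_mps d a \<Theta> \<omega> \<pi>0 \<Omega> \<sigma> Sh \<Gamma>h \<Phi> \<Gamma> M m \<xi> B0 s (p g) (U g) (\<alpha> g) uh (V g)"
    if g: "g \<in> carrier G" for g
  proof -
    interpret Vg: semiunitary_map "p g" "V g" by standard (rule V_semi[OF g])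
    \<comment> \<open>In the anti-linear case invariance is stated with an adjoint; applied to
      \<open>star A\<close> it becomes complex conjugation of the value.\<close>
    have inv: "\<omega> (\<alpha> g A) = cj (p g) (\<omega> A)" for A
    proof (cases "p g = 0")
      case True
      then show ?thesis using assms(13) g by (simp add: symmetry_invariant_def cj_def)
    next
      case False
      then have "p g = 1" by (cases "p g") simp_all
      then have "\<omega> (\<alpha> g (star (star A))) = \<omega> (star A)" using assms(13) g unfolding symmetry_invariant_def by blast
      then show ?thesis using \<open>p g = 1\<close> by (simp add: star_star g.state_star cj_def)
    qed
    obtain uh where uh: "semiunitary (p g) uh" "\<And>A. uh (ap (g.rep A) \<Omega>) = ap (g.rep (\<alpha> g A)) \<Omega>"
      "\<And>A x. uh (ap (g.rep A) x) = ap (g.rep (\<alpha> g A)) (uh x)"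
      by (rule g.implementer[OF \<alpha>[OF g] inv]) rule
    have "\<Phi> (g.rep (\<alpha> g A)) = Vg.conj_by (\<Phi> (g.rep A))" if A: "A \<in> right_algebra d a" for A
    proof -
      have "\<Phi>f (ap (g.rep (\<alpha> g A))) = Ad (V g) (ap (\<Phi> (g.rep A)))"
        using \<Phi>f_sym[OF g ap_M[OF rep_M[OF A]]] by (simp add: ap_\<Phi>[OF rep_M[OF A]] \<alpha>h[OF g A] flip: rep)
      then show ?thesis by (simp add: \<Phi>_def[of "g.rep (\<alpha> g A)"] Vg.Ad_eq ap_inverse)
    qed
    moreover have "semiunitary_on (carrier_vec d) (\<cdot>\<^sub>v) (\<lambda>x y. y \<bullet>c x) (p g) (U g)"
      using U g by (simp add: proj_rep_on_def)
    ultimately have "symmetric_mps d a \<Theta> \<omega> \<pi>0 \<Omega> \<sigma> Sh \<Gamma>h \<Phi> \<Gamma> M m \<xi> B0 s (p g) (U g) (\<alpha> g) uh (V g)"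
      using \<alpha>[OF g] uh V_semi[OF g] by unfold_locales simp_all
    then show ?thesis by blast
  qed
  have V_P: "V g (ap hc.P x) = ap hc.P (V g x)" if g: "g \<in> carrier G" for g x
  proof -
    obtain uh where "symmetric_mps d a \<Theta> \<omega> \<pi>0 \<Omega> \<sigma> Sh \<Gamma>h \<Phi> \<Gamma> M m \<xi> B0 s (p g) (U g) (\<alpha> g) uh (V g)"
      using sym[OF g] by blast
    then show ?thesis by (rule symmetric_mps.W_P)
  qed
  define W where "W g = mp.wm (V g)" for g

  have corr: "\<omega> (prod_list (map (\<lambda>k. site_unit d a \<tau> (int k) (\<mu> k) (\<nu> k)) [0..<Suc l])) =
      (- 1) ^ (\<Sum>k=1..l. (par (\<mu> k) + par (\<nu> k)) * (\<Sum>j<k. par (\<nu> j))) *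
      mat_trace (mp.mt mp.Dop * mat_prod m (map (\<lambda>k. mp.v (\<mu> k)) [0..<Suc l] @
        map (\<lambda>k. mat_adjoint (mp.v (\<nu> k))) (rev [0..<Suc l])))"
    if \<mu>\<nu>: "\<forall>k\<le>l. \<mu> k \<in> Pow {..<d} \<and> \<nu> k \<in> Pow {..<d}" for l \<mu> \<nu>
  proof -
    have "site_unit d a \<tau> (int k) (\<mu> k) (\<nu> k) = (\<sigma> 1 ^^ k) (c.modes.unit (d * 1) (\<mu> k) (\<nu> k))" if k: "k \<le> l" for k
    proof -
      have "c.modes.unit (d * 1) (\<mu> k) (\<nu> k) \<in> c.Loc {0..<int 1}" by (rule c.unit_Loc) (use \<mu>\<nu> k in auto)
      from c.bogoliubov_unique[OF \<tau>[of "int k"] \<sigma>[of k] this] show ?thesis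
        by (simp add: site_unit_def c.fock_unit_eq \<sigma>_def One_nat_def)
    qed
    then have "map (\<lambda>k. site_unit d a \<tau> (int k) (\<mu> k) (\<nu> k)) [0..<Suc l] =
        map (\<lambda>k. (\<sigma> 1 ^^ k) (c.modes.unit (d * 1) (\<mu> k) (\<nu> k))) [0..<Suc l]"
      by (intro map_cong) auto
    then have "prod_list (map (\<lambda>k. site_unit d a \<tau> (int k) (\<mu> k) (\<nu> k)) [0..<Suc l]) =
        mp.corr (map (\<lambda>k. (\<mu> k, \<nu> k)) [0..<Suc l])"
      by (simp only: mp.corr_eq_prod)
    then show ?thesis using mp.corr_formula[of l \<mu> \<nu>] \<mu>\<nu> by simp
  qed

  \<comment> \<open>\<open>W\<close> restricts \<open>V\<close> to an invariant subspace, so its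
    cocycle is the \<open>\<upsilon>'\<close> of \<open>V\<close>, whose class is that of
    \<open>\<upsilon>\<close> by \<open>coh\<close>.\<close>
  have W_rep: "proj_rep_Cn m G p \<upsilon>' W"
    unfolding proj_rep_on_def
  proof (intro conjI ballI)
    fix g h assume g: "g \<in> carrier G" and h: "h \<in> carrier G"
    show "cmod (\<upsilon>' g h) = 1" using V g h by (simp add: proj_rep_on_def)
    fix x :: "complex Matrix.vec" assume "x \<in> carrier_vec m"
    have "V g (V h y) = \<upsilon>' g h *\<^sub>C V (g \<otimes>\<^bsub>G\<^esub> h) y" for y
      using V g h unfolding proj_rep_on_def by blast
    then show "W g (W h x) = \<upsilon>' g h \<cdot>\<^sub>v W (g \<otimes>\<^bsub>G\<^esub> h) x"
      unfolding W_def mp.wm_compose[OF V_semi[OF h] V_P[OF h]]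
      by (simp add: mp.co_scale mp.wm_def)
  qed (use V in \<open>simp_all add: W_def mp.wm_semiunitary[OF V_semi V_P] proj_rep_on_def\<close>)

  have W_sym: "(\<exists>c. cmod c = 1 \<and> (\<forall>\<nu>\<in>Pow {..<d}.
        mat_sum m (Pow {..<d}) (\<lambda>\<mu>. fock_inner d (fock_basis \<mu>)
          (second_quant d (p g) (U g) (fock_basis \<nu>)) \<cdot>\<^sub>m mp.v \<mu>) = c \<cdot>\<^sub>m Ad_semi m (W g) (mp.v \<nu>))) \<and>
      Ad_semi m (semi_adjoint m (W g)) (mp.mt mp.Dop) = mp.mt mp.Dop \<and>
      Ad_semi m (W g) (mp.mt \<Gamma>) = sgn_of (q g) \<cdot>\<^sub>m mp.mt \<Gamma>"
    if g: "g \<in> carrier G" for g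
  proof -
    obtain uh where "symmetric_mps d a \<Theta> \<omega> \<pi>0 \<Omega> \<sigma> Sh \<Gamma>h \<Phi> \<Gamma> M m \<xi> B0 s (p g) (U g) (\<alpha> g) uh (V g)"
      using sym[OF g] by blast
    then interpret sy: symmetric_mps d a \<Theta> \<omega> \<pi>0 \<Omega> \<sigma> Sh \<Gamma>h \<Phi> \<Gamma> M m \<xi> B0 s "p g" "U g" "\<alpha> g" uh "V g" .
    have "Ad (V g) Gamma_K = (\<lambda>z. sgn_of (q g) *\<^sub>C Gamma_K z)" using S g by (simp add: S_member_def)
    then have "ap (sy.W.conj_by \<Gamma>) = (\<lambda>z. sgn_of (q g) *\<^sub>C ap \<Gamma> z)" by (simp add: ap_\<Gamma> flip: sy.W.Ad_eq)
    then have "sy.W.conj_by \<Gamma> = sgn_of (q g) *\<^sub>C \<Gamma>" by (intro bop_eqI) (simp add: ap_scaleC)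
    from sy.wm_\<Gamma>[OF this] show ?thesis using sy.wm_v sy.wm_D by (simp add: W_def)
  qed

  have "\<exists>\<sigma>0\<in>{0, 1::nat}. \<forall>\<mu>\<in>Pow {..<d}. Ad_mat (mp.mt \<Gamma>) (mp.v \<mu>) = (- 1) ^ (par \<mu> + \<sigma>0) \<cdot>\<^sub>m mp.v \<mu>"
    by (rule bexI[of _ "if s = 1 then 0 else 1"]) (use mp.Ad_\<theta>_v in simp_all)
  moreover have "mp.v \<mu> \<in> carrier_mat m m" for \<mu> by (simp add: mp.v_def)
  ultimately show ?thesis
    using m(1) mp.density mp.faithful mp.\<theta>_unitary mp.transfer_limit mp.\<Gamma>_Dop corr W_rep W_sym coh
    by (intro exI[of _ m] exI[of _ "mp.mt mp.Dop"] exI[of _ "mp.mt \<Gamma>"] exI[of _ mp.v] exI[of _ W] exI[of _ \<upsilon>']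
        conjI allI ballI impI) simp_all
qed

end
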